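(* For every fixed permutation $\pi$ there exist an integer $k_\pi$ and an algorithm which, given any permutation $\sigma$ avoiding $\pi$ as a pattern, computes in time $O(|\sigma|)$ (the hidden constant depending on $\pi$ only) a factorisation of $\sigma$ as a product (composition) of at most $k_\pi$ separable permutations.
   Context: A permutation $\pi\in\mathfrak{S}_n$ is a pattern of $\sigma\in\mathfrak{S}_m$ ($n\le m$) if there is an increasing function $f:[n]\to[m]$ such that for all $i,j\in[n]$, $\pi(i)<\pi(j)$ if and only if $\sigma(f(i))<\sigma(f(j))$. If $\pi$ is not a pattern of $\sigma$, then $\sigma$ avoids $\pi$. $|\sigma|$ denotes the size of $\sigma$. A permutation is separable if it can be obtained from the one-element permutation $1$ by successively applying direct sums (placing two permutation matrices as diagonal blocks of a new permutation matrix) and skew sums (the same with antidiagonal blocks); equivalently, if it avoids both patterns $2413$ and $3142$. The computation model is the RAM model, and a permutation of size $n$ is given as an array containing $[n]=\{1,\dots,n\}$ in permuted order. *)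

theory Defs
  imports "HOL-Combinatorics.Permutations"
begin

text \<open>
  A permutation of size \<open>n\<close> is a function \<open>\<sigma> :: nat \<Rightarrow> nat\<close> with \<open>\<sigma> permutes {1..n}\<close>; in particular
  it is the identity outside \<open>{1..n}\<close>, so products are plain function compositions. The size is
  passed explicitly, since the function does not determine it.
\<close>

definition pattern_of :: "nat \<Rightarrow> (nat \<Rightarrow> nat) \<Rightarrow> nat \<Rightarrow> (nat \<Rightarrow> nat) \<Rightarrow> bool" where
  "pattern_of n \<pi> m \<sigma> \<longleftrightarrow>
     (\<exists>f. strict_mono_on {1..n} f \<and> f ` {1..n} \<subseteq> {1..m} \<and>
          (\<forall>i\<in>{1..n}. \<forall>j\<in>{1..n}. \<pi> i < \<pi> j \<longleftrightarrow> \<sigma> (f i) < \<sigma> (f j)))"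

definition avoids :: "nat \<Rightarrow> (nat \<Rightarrow> nat) \<Rightarrow> nat \<Rightarrow> (nat \<Rightarrow> nat) \<Rightarrow> bool" where
  "avoids m \<sigma> n \<pi> \<longleftrightarrow> \<not> pattern_of n \<pi> m \<sigma>"

definition direct_sum :: "nat \<Rightarrow> (nat \<Rightarrow> nat) \<Rightarrow> nat \<Rightarrow> (nat \<Rightarrow> nat) \<Rightarrow> nat \<Rightarrow> nat" where
  "direct_sum k \<alpha> l \<beta> i =
     (if i \<in> {1..k} then \<alpha> i else if i \<in> {k+1..k+l} then k + \<beta> (i - k) else i)"

definition skew_sum :: "nat \<Rightarrow> (nat \<Rightarrow> nat) \<Rightarrow> nat \<Rightarrow> (nat \<Rightarrow> nat) \<Rightarrow> nat \<Rightarrow> nat" where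
  "skew_sum k \<alpha> l \<beta> i =
     (if i \<in> {1..k} then l + \<alpha> i else if i \<in> {k+1..k+l} then \<beta> (i - k) else i)"

inductive separable :: "nat \<Rightarrow> (nat \<Rightarrow> nat) \<Rightarrow> bool" where
  one: "separable 1 id"
| direct: "separable k \<alpha> \<Longrightarrow> separable l \<beta> \<Longrightarrow> separable (k + l) (direct_sum k \<alpha> l \<beta>)"
| skew: "separable k \<alpha> \<Longrightarrow> separable l \<beta> \<Longrightarrow> separable (k + l) (skew_sum k \<alpha> l \<beta>)"

lemma separable_permutes: "separable n \<tau> \<Longrightarrow> \<tau> permutes {1..n}"
proof (induction rule: separable.induct)
  case one
  show ?case by (rule permutes_id)
next
  case (direct k \<alpha> l \<beta>)
  let ?f = "direct_sum k \<alpha> l \<beta>"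
  have A: "\<alpha> ` {1..k} = {1..k}" "inj_on \<alpha> {1..k}" and B: "\<beta> ` {1..l} = {1..l}" "inj_on \<beta> {1..l}"
    using direct.IH by (auto simp: permutes_image permutes_inj_on)
  have a: "\<alpha> i \<in> {1..k}" if "i \<in> {1..k}" for i using A that by blast
  have b: "\<beta> i \<in> {1..l}" if "i \<in> {1..l}" for i using B that by blast
  have "?f i \<in> {1..k+l}" if "i \<in> {1..k+l}" for i
    using that a[of i] b[of "i - k"] by (auto simp: direct_sum_def Suc_le_eq not_le le_diff_conv add.commute)
  moreover have "inj_on ?f {1..k+l}"
  proof (rule inj_onI)
    fix i j assume ij: "i \<in> {1..k+l}" "j \<in> {1..k+l}" "?f i = ?f j"
    then show "i = j"
      using a[of i] a[of j] b[of "i - k"] b[of "j - k"]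
        inj_onD[OF A(2), of i j] inj_onD[OF B(2), of "i - k" "j - k"]
      by (auto simp: direct_sum_def Suc_le_eq not_le le_diff_conv add.commute split: if_splits)
  qed
  ultimately have "bij_betw ?f {1..k+l} {1..k+l}"
    unfolding bij_betw_def by (intro conjI endo_inj_surj image_subsetI) simp_all
  then show ?case by (rule bij_imp_permutes) (auto simp: direct_sum_def)
next
  case (skew k \<alpha> l \<beta>)
  let ?f = "skew_sum k \<alpha> l \<beta>"
  have A: "\<alpha> ` {1..k} = {1..k}" "inj_on \<alpha> {1..k}" and B: "\<beta> ` {1..l} = {1..l}" "inj_on \<beta> {1..l}"
    using skew.IH by (auto simp: permutes_image permutes_inj_on)
  have a: "\<alpha> i \<in> {1..k}" if "i \<in> {1..k}" for i using A that by blast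
  have b: "\<beta> i \<in> {1..l}" if "i \<in> {1..l}" for i using B that by blast
  have "?f i \<in> {1..k+l}" if "i \<in> {1..k+l}" for i
    using that a[of i] b[of "i - k"] by (auto simp: skew_sum_def Suc_le_eq not_le le_diff_conv add.commute)
  moreover have "inj_on ?f {1..k+l}"
  proof (rule inj_onI)
    fix i j assume ij: "i \<in> {1..k+l}" "j \<in> {1..k+l}" "?f i = ?f j"
    then show "i = j"
      using a[of i] a[of j] b[of "i - k"] b[of "j - k"]
        inj_onD[OF A(2), of i j] inj_onD[OF B(2), of "i - k" "j - k"]
      by (auto simp: skew_sum_def Suc_le_eq not_le le_diff_conv add.commute split: if_splits)
  qed
  ultimately have "bij_betw ?f {1..k+l} {1..k+l}"
    unfolding bij_betw_def by (intro conjI endo_inj_surj image_subsetI) simp_all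
  then show ?case by (rule bij_imp_permutes) (auto simp: skew_sum_def)
qed

text \<open>
  A program is a finite list of instructions acting on registers and on a random access memory,
  both holding natural numbers. Every instruction takes one unit of time. Subtraction is truncated
  at \<open>0\<close> and \<open>x div 0 = 0\<close>. A program halts when its program counter leaves the program.
\<close>

datatype instr =
    Const nat nat
  | Move nat nat
  | Add nat nat nat
  | Sub nat nat nat
  | Mult nat nat nat
  | Div nat nat nat
  | Load nat nat
  | Store nat nat
  | Jump nat
  | JumpLess nat nat nat

record config =
  pc :: nat
  reg :: "nat \<Rightarrow> nat"
  mem :: "nat \<Rightarrow> nat"

definition set_reg :: "nat \<Rightarrow> nat \<Rightarrow> config \<Rightarrow> config" where
  "set_reg r v s = s\<lparr>pc := pc s + 1, reg := (reg s)(r := v)\<rparr>"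

fun exec :: "instr \<Rightarrow> config \<Rightarrow> config" where
  "exec (Const r c) s = set_reg r c s"
| "exec (Move r a) s = set_reg r (reg s a) s"
| "exec (Add r a b) s = set_reg r (reg s a + reg s b) s"
| "exec (Sub r a b) s = set_reg r (reg s a - reg s b) s"
| "exec (Mult r a b) s = set_reg r (reg s a * reg s b) s"
| "exec (Div r a b) s = set_reg r (reg s a div reg s b) s"
| "exec (Load r a) s = set_reg r (mem s (reg s a)) s"
| "exec (Store r a) s = s\<lparr>pc := pc s + 1, mem := (mem s)(reg s r := reg s a)\<rparr>"
| "exec (Jump l) s = s\<lparr>pc := l\<rparr>"
| "exec (JumpLess r a l) s = s\<lparr>pc := (if reg s r < reg s a then l else pc s + 1)\<rparr>"

definition halted :: "instr list \<Rightarrow> config \<Rightarrow> bool" where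
  "halted P s \<longleftrightarrow> pc s \<ge> length P"

definition step :: "instr list \<Rightarrow> config \<Rightarrow> config" where
  "step P s = (if halted P s then s else exec (P ! pc s) s)"

text \<open>
  \<open>runs_to P s T W s'\<close>: started in \<open>s\<close>, the program \<open>P\<close> halts in \<open>s'\<close> after at most \<open>T\<close> steps, and
  no register or memory cell (hence no address in use) ever exceeds \<open>W\<close>. The latter is
  the usual bound on the word length, without which unit cost arithmetic could pack a large
  amount of data into a single cell.
\<close>

definition runs_to :: "instr list \<Rightarrow> config \<Rightarrow> nat \<Rightarrow> nat \<Rightarrow> config \<Rightarrow> bool" where
  "runs_to P s T W s' \<longleftrightarrow>
     (\<exists>t\<le>T. (step P ^^ t) s = s' \<and> halted P s' \<and>
        (\<forall>u\<le>t. \<forall>a. reg ((step P ^^ u) s) a \<le> W \<and> mem ((step P ^^ u) s) a \<le> W))"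

text \<open>
  Input convention: register \<open>0\<close> contains the size \<open>n\<close>, memory cells \<open>1, \<dots>, n\<close> contain the array
  \<open>\<sigma> 1, \<dots>, \<sigma> n\<close>, and everything else is \<open>0\<close>.
\<close>

definition input_config :: "nat \<Rightarrow> (nat \<Rightarrow> nat) \<Rightarrow> config" where
  "input_config n \<sigma> =
     \<lparr>pc = 0, reg = (\<lambda>_. 0)(0 := n), mem = (\<lambda>i. if i \<in> {1..n} then \<sigma> i else 0)\<rparr>"

text \<open>
  Output convention: register \<open>0\<close> contains the number of permutations, whose arrays follow one
  another in memory, starting right after the address contained in register \<open>1\<close>.
\<close>

definition outputs :: "config \<Rightarrow> nat \<Rightarrow> (nat \<Rightarrow> nat) list \<Rightarrow> bool" where
  "outputs s n \<tau>s \<longleftrightarrow>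
     reg s 0 = length \<tau>s \<and>
     (\<forall>j<length \<tau>s. \<forall>i\<in>{1..n}. mem s (reg s 1 + j * n + i) = (\<tau>s ! j) i)"

definition separable_factorisation :: "nat \<Rightarrow> (nat \<Rightarrow> nat) \<Rightarrow> (nat \<Rightarrow> nat) list \<Rightarrow> bool" where
  "separable_factorisation n \<sigma> \<tau>s \<longleftrightarrow>
     \<tau>s \<noteq> [] \<and> (\<forall>\<tau>\<in>set \<tau>s. separable n \<tau>) \<and> \<sigma> = foldr (\<circ>) \<tau>s id"

end

(*
  Let D = 4C, where C is the Marcus-Tardos constant of the forbidden pattern. Starting from the
  permutation matrix of sigma, consecutive columns, and likewise rows, are grouped greedily as long
  as a group meets at most D nonempty cells. By Marcus and Tardos only O(m) cells remain when there
  are m groups, so the number of groups decreases geometrically and everything takes linear time.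
  The history of the groups gives one term for the positions and one for the values. A term builds
  binary trees carrying labels, with at most D labels in use at any node; its leaves, from left to
  right, are in increasing order of position for the one term and of value for the other, and both
  terms build the same tree.

  If at most d labels are in use, one separable permutation of the leaves yields a term for
  the same tree with at most d - 1 labels in use: at a node with several labels, the subterms
  for one label and for the other labels are pulled apart, one to the left and the other, mirrored,
  to the right, which is a caterpillar of direct and skew sums. With at most 2 labels in use, the
  leaf order is an embedding of the tree in the plane, and any two embeddings of a tree differ by a
  separable permutation. So D - 2 steps on both sides and one step in between lead from the
  positions to the values.
*)

theory Submission
  imports Defs "HOL-Library.Nat_Bijection"
begin

text \<open>A label of a column term stands for a nonempty cell of that column, and likewise for
  rows; the tree under it is the history of the cell. The two labels of one cell always carry equal
  trees, and cells are fused by moves made in both terms at once, which is why the two terms build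
  one tree. The factor 4 in D comes from an amortised count: two neighbouring groups together exceed
  D cells, while all columns together contain at most C m, so about m / 2 groups remain. Reducing
  works because, wherever both classes of labels occur, each class has fewer labels than the whole,
  and a subterm in which only one class occurs can be replaced by its own reduction. Linear time is
  the obstacle to carrying this out by plain recursion: the same subterm is needed restricted to
  many different sets of labels. So for every stored subterm a table of constant size is filled,
  with one entry for each possible set of labels and each orientation. Terms share subterms and are
  never written out.\<close>

section \<open>Separable rearrangements of lists\<close>

text \<open>Lists of elements instead of permutations of positions avoid index shifts when blocks
  are composed. The empty case lets a block vanish in such compositions, although
  \<open>separable\<close> has no permutation of size 0.\<close>

inductive sep :: "'a list \<Rightarrow> 'a list \<Rightarrow> bool" where
  sep_Nil: "sep [] []"
| sep_single: "sep [x] [x]"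
| sep_direct: "sep xs ys \<Longrightarrow> sep xs' ys' \<Longrightarrow> sep (xs @ xs') (ys @ ys')"
| sep_skew: "sep xs ys \<Longrightarrow> sep xs' ys' \<Longrightarrow> sep (xs @ xs') (ys' @ ys)"

lemma sep_mset: "sep xs ys \<Longrightarrow> mset xs = mset ys"
  by (induction rule: sep.induct) auto

lemma sep_set: "sep xs ys \<Longrightarrow> set xs = set ys"
  using sep_mset mset_eq_setD by blast

lemma sep_length: "sep xs ys \<Longrightarrow> length xs = length ys"
  using sep_mset mset_eq_length by blast

lemma sep_distinct: "sep xs ys \<Longrightarrow> distinct xs \<longleftrightarrow> distinct ys"
  using sep_mset mset_eq_imp_distinct_iff by blast

lemma sep_sym: "sep xs ys \<Longrightarrow> sep ys xs"
  by (induction rule: sep.induct) (auto intro: sep.intros)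

definition position :: "'a list \<Rightarrow> 'a \<Rightarrow> nat" where
  "position ys x = Suc (length (takeWhile (\<lambda>y. y \<noteq> x) ys))"

lemma position_append1: "x \<in> set ys \<Longrightarrow> position (ys @ zs) x = position ys x"
  unfolding position_def by simp

lemma position_append2: "x \<notin> set ys \<Longrightarrow> position (ys @ zs) x = length ys + position zs x"
proof -
  assume "x \<notin> set ys"
  then have "takeWhile (\<lambda>y. y \<noteq> x) (ys @ zs) = ys @ takeWhile (\<lambda>y. y \<noteq> x) zs"
    by (intro takeWhile_append2) auto
  then show ?thesis by (simp add: position_def)
qed

lemma position_nth:
  assumes "distinct ys" "i < length ys"
  shows "position ys (ys ! i) = Suc i"
proof -
  have "takeWhile (\<lambda>y. y \<noteq> ys ! i) ys = take i ys"
    using assms by (intro takeWhile_eq_take_P_nth) (auto simp: nth_eq_iff_index_eq)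
  then show ?thesis using assms by (simp add: position_def)
qed

lemma length_takeWhile_neq_less: "x \<in> set ys \<Longrightarrow> length (takeWhile (\<lambda>y. y \<noteq> x) ys) < length ys"
  by (induction ys) auto

lemma position_bounds: "x \<in> set ys \<Longrightarrow> position ys x \<in> {1..length ys}"
  using length_takeWhile_neq_less[of x ys] by (auto simp: position_def)

lemma nth_position: "x \<in> set ys \<Longrightarrow> ys ! (position ys x - 1) = x"
  unfolding position_def
  using nth_length_takeWhile[of "\<lambda>y. y \<noteq> x" ys] length_takeWhile_neq_less[of x ys] by auto

text \<open>On rearrangements of one distinct list these permutations telescope: from
  \<open>xs\<close> to \<open>ys\<close> and then from \<open>ys\<close> to \<open>zs\<close> is
  from \<open>xs\<close> to \<open>zs\<close>. This turns a chain of lists into a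
  factorisation.\<close>

definition perm_between :: "'a list \<Rightarrow> 'a list \<Rightarrow> nat \<Rightarrow> nat" where
  "perm_between xs ys i = (if i \<in> {1..length xs} then position ys (xs ! (i - 1)) else i)"

text \<open>Distinctness keeps the blocks apart: an element of \<open>xs\<close> occurs in
  \<open>ys\<close> but not in \<open>ys'\<close>, so the first block is not shifted and the second
  one is shifted by exactly the length of the first.\<close>

lemma perm_between_direct:
  assumes "set xs = set ys" "length xs = length ys" "length xs' = length ys'" "set xs' = set ys'"
    "distinct (xs @ xs')"
  shows "perm_between (xs @ xs') (ys @ ys') =
    direct_sum (length xs) (perm_between xs ys) (length xs') (perm_between xs' ys')"
proof
  fix i
  consider "i \<in> {1..length xs}" | "i \<in> {length xs + 1..length xs + length xs'}"
    | "i = 0 \<or> i > length xs + length xs'" unfolding atLeastAtMost_iff by linarith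
  then show "perm_between (xs @ xs') (ys @ ys') i =
    direct_sum (length xs) (perm_between xs ys) (length xs') (perm_between xs' ys') i"
  proof cases
    case 1
    then have i: "1 \<le> i" "i \<le> length xs" by auto
    then have "i - 1 < length xs" by linarith
    then have "(xs @ xs') ! (i - 1) = xs ! (i - 1)" "xs ! (i - 1) \<in> set xs"
      by (simp_all add: nth_append)
    moreover have "xs ! (i - 1) \<in> set ys" "xs ! (i - 1) \<notin> set ys'"
      using calculation(2) assms(1,4,5) by auto
    ultimately show ?thesis using i assms(3)
      by (simp add: perm_between_def direct_sum_def position_append1 position_append2)
  next
    case 2
    then have i: "length xs + 1 \<le> i" "i \<le> length xs + length xs'" by auto
    then have "i - 1 - length xs < length xs'" "\<not> i - 1 < length xs" "i - 1 - length xs = i - length xs - 1"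
      by linarith+
    then have "(xs @ xs') ! (i - 1) = xs' ! (i - length xs - 1)" "xs' ! (i - length xs - 1) \<in> set xs'"
      by (metis nth_append) (metis \<open>i - 1 - length xs < length xs'\<close> \<open>i - 1 - length xs = i - length xs - 1\<close> nth_mem)
    moreover have "xs' ! (i - length xs - 1) \<in> set ys'" "xs' ! (i - length xs - 1) \<notin> set ys"
      using calculation(2) assms(1,4,5) by auto
    moreover have "i \<notin> {1..length xs}" "i \<in> {1..length xs + length xs'}"
      "i \<in> {length xs + 1..length xs + length xs'}" "i - length xs \<in> {1..length xs'}"
      using i by auto
    ultimately show ?thesis using assms(2)
      unfolding perm_between_def direct_sum_def
      by (simp add: position_append1 position_append2 del: atLeastAtMost_iff)
  next
    case 3
    then show ?thesis by (auto simp: perm_between_def direct_sum_def)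
  qed
qed

lemma perm_between_skew:
  assumes "set xs = set ys" "length xs = length ys" "length xs' = length ys'" "set xs' = set ys'"
    "distinct (xs @ xs')"
  shows "perm_between (xs @ xs') (ys' @ ys) =
    skew_sum (length xs) (perm_between xs ys) (length xs') (perm_between xs' ys')"
proof
  fix i
  consider "i \<in> {1..length xs}" | "i \<in> {length xs + 1..length xs + length xs'}"
    | "i = 0 \<or> i > length xs + length xs'" unfolding atLeastAtMost_iff by linarith
  then show "perm_between (xs @ xs') (ys' @ ys) i =
    skew_sum (length xs) (perm_between xs ys) (length xs') (perm_between xs' ys') i"
  proof cases
    case 1
    then have i: "1 \<le> i" "i \<le> length xs" by auto
    then have "i - 1 < length xs" by linarith
    then have "(xs @ xs') ! (i - 1) = xs ! (i - 1)" "xs ! (i - 1) \<in> set xs"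
      by (simp_all add: nth_append)
    moreover have "xs ! (i - 1) \<in> set ys" "xs ! (i - 1) \<notin> set ys'"
      using calculation(2) assms(1,4,5) by auto
    ultimately show ?thesis using i assms(3)
      by (simp add: perm_between_def skew_sum_def position_append1 position_append2)
  next
    case 2
    then have i: "length xs + 1 \<le> i" "i \<le> length xs + length xs'" by auto
    then have "i - 1 - length xs < length xs'" "\<not> i - 1 < length xs" "i - 1 - length xs = i - length xs - 1"
      by linarith+
    then have "(xs @ xs') ! (i - 1) = xs' ! (i - length xs - 1)" "xs' ! (i - length xs - 1) \<in> set xs'"
      by (metis nth_append) (metis \<open>i - 1 - length xs < length xs'\<close> \<open>i - 1 - length xs = i - length xs - 1\<close> nth_mem)
    moreover have "xs' ! (i - length xs - 1) \<in> set ys'" "xs' ! (i - length xs - 1) \<notin> set ys"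
      using calculation(2) assms(1,4,5) by auto
    moreover have "i \<notin> {1..length xs}" "i \<in> {1..length xs + length xs'}"
      "i \<in> {length xs + 1..length xs + length xs'}" "i - length xs \<in> {1..length xs'}"
      using i by auto
    ultimately show ?thesis using assms(2)
      unfolding perm_between_def skew_sum_def
      by (simp add: position_append1 position_append2 del: atLeastAtMost_iff)
  next
    case 3
    then show ?thesis by (auto simp: perm_between_def skew_sum_def)
  qed
qed

text \<open>Empty blocks, which \<open>sep\<close> admits and \<open>separable\<close> does not, are
  discarded before a sum is formed.\<close>

theorem separable_perm_between:
  "sep xs ys \<Longrightarrow> distinct xs \<Longrightarrow> xs \<noteq> [] \<Longrightarrow> separable (length xs) (perm_between xs ys)"
proof (induction rule: sep.induct)
  case sep_Nil
  then show ?case by simp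
next
  case (sep_single x)
  have "perm_between [x] [x] = id" by (auto simp: perm_between_def position_def fun_eq_iff)
  then have "separable 1 (perm_between [x] [x])" using separable.one by metis
  then show ?case by simp
next
  case (sep_direct xs ys xs' ys')
  note s = sep_set[OF sep_direct.hyps(1)] sep_length[OF sep_direct.hyps(1)]
    sep_length[OF sep_direct.hyps(2)] sep_set[OF sep_direct.hyps(2)]
  show ?case
  proof (cases "xs = [] \<or> xs' = []")
    case True
    then show ?thesis using sep_direct s by auto
  next
    case False
    then show ?thesis using sep_direct perm_between_direct[OF s] separable.direct by auto
  qed
next
  case (sep_skew xs ys xs' ys')
  note s = sep_set[OF sep_skew.hyps(1)] sep_length[OF sep_skew.hyps(1)]
    sep_length[OF sep_skew.hyps(2)] sep_set[OF sep_skew.hyps(2)]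
  show ?case
  proof (cases "xs = [] \<or> xs' = []")
    case True
    then show ?thesis using sep_skew s by auto
  next
    case False
    then show ?thesis using sep_skew perm_between_skew[OF s] separable.skew by auto
  qed
qed

text \<open>The product of the first \<open>j\<close> factors sends \<open>i\<close> to its position
  in \<open>Ls j\<close>. The last list enumerates \<open>inv \<sigma>\<close>, so \<open>i\<close>
  stands there at position \<open>\<sigma> i\<close>. The factors are listed in reverse because the
  last entry of a product acts first.\<close>

lemma separable_factorisation_chain:
  fixes Ls :: "nat \<Rightarrow> nat list"
  assumes perm: "\<sigma> permutes {1..n}" and n: "n \<ge> 1" and k: "k \<ge> 1"
    and L0: "Ls 0 = [1..<Suc n]" and Lk: "Ls k = map (inv \<sigma>) [1..<Suc n]"
    and sep: "\<And>j. j < k \<Longrightarrow> sep (Ls j) (Ls (Suc j))"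
  shows "separable_factorisation n \<sigma> (rev (map (\<lambda>j. perm_between (Ls j) (Ls (Suc j))) [0..<k]))"
proof -
  let ?\<tau> = "\<lambda>j. perm_between (Ls j) (Ls (Suc j))"
  have inv: "set (Ls j) = {1..n} \<and> length (Ls j) = n \<and> distinct (Ls j)" if "j \<le> k" for j
    using that
  proof (induction j)
    case 0
    then show ?case using L0 by (auto simp del: upt_Suc)
  next
    case (Suc j)
    then show ?case using sep[of j] sep_set sep_length sep_distinct by (metis Suc_le_lessD less_imp_le)
  qed
  have comp: "foldr (\<circ>) (rev (map ?\<tau> [0..<j])) id i = (if i \<in> {1..n} then position (Ls j) i else i)"
    if "j \<le> k" for j i
    using that
  proof (induction j)
    case 0
    have "position (Ls 0) i = i" if "i \<in> {1..n}"
    proof -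
      have "Ls 0 ! (i - 1) = i" using that unfolding L0 by (auto simp del: upt_Suc simp: nth_upt)
      then show ?thesis using position_nth[of "Ls 0" "i - 1"] that inv[of 0] by auto
    qed
    then show ?case by auto
  next
    case (Suc j)
    have IH: "foldr (\<circ>) (rev (map ?\<tau> [0..<j])) id i = (if i \<in> {1..n} then position (Ls j) i else i)"
      using Suc.IH Suc.prems Suc_leD by blast
    have e: "foldr (\<circ>) (rev (map ?\<tau> [0..<Suc j])) id i = ?\<tau> j (foldr (\<circ>) (rev (map ?\<tau> [0..<j])) id i)"
      by simp
    have "?\<tau> j (position (Ls j) i) = position (Ls (Suc j)) i" if "i \<in> {1..n}"
    proof -
      have "i \<in> set (Ls j)" using inv[of j] Suc.prems that by simp
      then show ?thesis using position_bounds[of i "Ls j"] nth_position[of i "Ls j"]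
        by (auto simp: perm_between_def)
    qed
    moreover have "?\<tau> j i = i" if "i \<notin> {1..n}"
      using that inv[of j] Suc.prems by (auto simp: perm_between_def)
    ultimately show ?case unfolding e IH by simp
  qed
  have pk: "position (Ls k) i = \<sigma> i" if "i \<in> {1..n}" for i
  proof -
    have s: "\<sigma> i \<in> {1..n}" using that perm by (meson permutes_in_image)
    then have "Ls k ! (\<sigma> i - 1) = i"
      unfolding Lk using perm by (auto simp: nth_upt permutes_inverses simp del: upt_Suc)
    then show ?thesis using position_nth[of "Ls k" "\<sigma> i - 1"] s inv[of k] by auto
  qed
  have "\<sigma> = foldr (\<circ>) (rev (map ?\<tau> [0..<k])) id"
  proof
    fix i
    show "\<sigma> i = foldr (\<circ>) (rev (map ?\<tau> [0..<k])) id i"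
      unfolding comp[OF order_refl] using pk perm by (auto simp: permutes_def)
  qed
  moreover have "separable n (?\<tau> j)" if "j < k" for j
    using separable_perm_between[OF sep[OF that]] inv[of j] that n by fastforce
  ultimately show ?thesis using k by (auto simp: separable_factorisation_def)
qed

section \<open>The Marcus--Tardos theorem\<close>

text \<open>Containment for a 0/1 matrix given by its set of nonempty cells: the chosen columns and
  rows may meet further cells besides those of the pattern.\<close>

definition contains_pattern :: "nat \<Rightarrow> (nat \<Rightarrow> nat) \<Rightarrow> (nat \<times> nat) set \<Rightarrow> bool" where
  "contains_pattern k \<pi> S \<longleftrightarrow> (\<exists>f g. strict_mono_on {1..k} f \<and> strict_mono_on {1..k} g \<and>
     (\<forall>i\<in>{1..k}. (f i, g (\<pi> i)) \<in> S))"

text \<open>Monotone maps reflect strict inequalities, so any choice of preimages of the cells is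
  again increasing in both coordinates. Coarsening therefore cannot create a pattern.\<close>

lemma contains_pattern_quotient:
  fixes u v :: "nat \<Rightarrow> nat"
  assumes "contains_pattern k \<pi> ((\<lambda>(x, y). (u x, v y)) ` S)" "mono u" "mono v" "\<pi> permutes {1..k}"
  shows "contains_pattern k \<pi> S"
proof -
  obtain f g where f: "strict_mono_on {1..k} f" and g: "strict_mono_on {1..k} g"
    and fg: "\<forall>i\<in>{1..k}. (f i, g (\<pi> i)) \<in> (\<lambda>(x, y). (u x, v y)) ` S"
    using assms(1) unfolding contains_pattern_def by blast
  then have "\<forall>i\<in>{1..k}. \<exists>x y. (x, y) \<in> S \<and> u x = f i \<and> v y = g (\<pi> i)" by fastforce
  then obtain x y where xy: "\<And>i. i \<in> {1..k} \<Longrightarrow> (x i, y i) \<in> S \<and> u (x i) = f i \<and> v (y i) = g (\<pi> i)"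
    by metis
  let ?y = "\<lambda>j. y (inv \<pi> j)"
  have p: "inv \<pi> j \<in> {1..k}" "\<pi> (inv \<pi> j) = j" if "j \<in> {1..k}" for j
    using that assms(4) by (metis permutes_inv permutes_in_image) (metis assms(4) permutes_inverses(1))
  have "strict_mono_on {1..k} x"
  proof (rule strict_mono_onI)
    fix r s assume rs: "r \<in> {1..k}" "s \<in> {1..k}" "r < s"
    then have "f r < f s" using f by (simp add: strict_mono_onD)
    then have "u (x r) < u (x s)" using xy rs by simp
    then show "x r < x s" using assms(2) by (metis leD leI monoD)
  qed
  moreover have "strict_mono_on {1..k} ?y"
  proof (rule strict_mono_onI)
    fix r s assume rs: "r \<in> {1..k}" "s \<in> {1..k}" "r < s"
    then have "g r < g s" using g by (simp add: strict_mono_onD)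
    then have "v (?y r) < v (?y s)" using xy p rs by simp
    then show "?y r < ?y s" using assms(3) by (metis leD leI monoD)
  qed
  moreover have "\<forall>i\<in>{1..k}. (x i, ?y (\<pi> i)) \<in> S"
    using xy assms(4) by (auto simp: permutes_inverses)
  ultimately show ?thesis unfolding contains_pattern_def by blast
qed

text \<open>Transposing a matrix inverts the pattern; thus a bound for columns, proved for all
  patterns, also serves for rows.\<close>

lemma contains_pattern_swap:
  assumes "contains_pattern k (inv \<pi>) (prod.swap ` S)" "\<pi> permutes {1..k}"
  shows "contains_pattern k \<pi> S"
proof -
  obtain f g where f: "strict_mono_on {1..k} f" and g: "strict_mono_on {1..k} g"
    and fg: "\<forall>i\<in>{1..k}. (f i, g (inv \<pi> i)) \<in> prod.swap ` S"
    using assms(1) unfolding contains_pattern_def by blast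
  have "(g i, f (\<pi> i)) \<in> S" if "i \<in> {1..k}" for i
  proof -
    have "\<pi> i \<in> {1..k}" using that assms(2) by (meson permutes_in_image)
    then have "(f (\<pi> i), g (inv \<pi> (\<pi> i))) \<in> prod.swap ` S" using fg by blast
    then show ?thesis using assms(2) by (auto simp: permutes_inverses)
  qed
  then show ?thesis unfolding contains_pattern_def using f g by blast
qed

section \<open>Blocks that meet many columns\<close>

lemma div_eq_bounds: "x div b = I \<Longrightarrow> b > 0 \<Longrightarrow> x \<in> {I * b..<I * b + b}" for x b I :: nat
  using div_mult_mod_eq[of x b] mod_less_divisor[of b x] unfolding atLeastLessThan_iff by (simp; linarith)

lemma enumerate_subset:
  fixes T :: "nat set"
  assumes "k \<le> card T"
  obtains h where "strict_mono_on {1..k} h" "h ` {1..k} \<subseteq> T"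
proof (cases "k = 0")
  case True
  then show ?thesis using that[of id] by (auto simp: strict_mono_on_def)
next
  case False
  then have fin: "finite T" using assms card.infinite by fastforce
  let ?xs = "sorted_list_of_set T"
  have l: "length ?xs = card T" by simp
  have "strict_mono_on {1..k} (\<lambda>i. ?xs ! (i - 1))"
  proof (rule strict_mono_onI)
    fix r s assume "r \<in> {1..k}" "s \<in> {1..k}" "r < s"
    then show "?xs ! (r - 1) < ?xs ! (s - 1)"
      using assms l by (intro sorted_wrt_nth_less[OF strict_sorted_list_of_set]) auto
  qed
  moreover have "?xs ! (i - 1) \<in> T" if "i \<in> {1..k}" for i
  proof -
    have "?xs ! (i - 1) \<in> set ?xs" using that assms l by (intro nth_mem) auto
    then show ?thesis using fin by simp
  qed
  ultimately show ?thesis using that by blast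
qed

text \<open>
  Few blocks of one block column meet many columns: each such block has \<open>k\<close> columns among the \<open>b\<close>
  of its block column, and \<open>k\<close> blocks with the same \<open>k\<close> columns contain every pattern of size \<open>k\<close>.
\<close>
lemma wide_blocks_column:
  fixes S :: "(nat \<times> nat) set" and b k :: nat
  assumes perm: "\<pi> permutes {1..k}" and fin: "finite S" and avoid: "\<not> contains_pattern k \<pi> S"
    and b: "b > 0"
  defines "cols \<equiv> \<lambda>I J. {x. x div b = I \<and> (\<exists>y. (x, y) \<in> S \<and> y div b = J)}"
  shows "card {J. k \<le> card (cols I J) \<and> cols I J \<noteq> {}} \<le> k * 2 ^ b"
proof (rule ccontr)
  assume big: "\<not> ?thesis"
  let ?W = "{J. k \<le> card (cols I J) \<and> cols I J \<noteq> {}}"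
  let ?B = "Pow {I * b..<I * b + b}"
  have finW: "finite ?W"
  proof (rule finite_subset)
    show "?W \<subseteq> (\<lambda>(x, y). y div b) ` S" unfolding cols_def by force
  qed (use fin in simp)
  have sub: "cols I J \<in> ?B" for J
    using div_eq_bounds b unfolding cols_def by auto
  \<comment> \<open>Pigeonhole over the \<open>2 ^ b\<close> possible sets of columns: some value of
    \<open>cols I\<close> is taken at least as often as the average, hence by more than
    \<open>k\<close> blocks.\<close>
  have "\<exists>T\<in>?B. card ?W \<le> card (cols I -` {T} \<inter> ?W) * card ?B"
  proof (rule ccontr)
    assume "\<not> ?thesis"
    then have lt: "card (cols I -` {T} \<inter> ?W) * card ?B < card ?W" if "T \<in> ?B" for T using that by (meson not_le)
    have "card ?W = card (\<Union>T\<in>?B. cols I -` {T} \<inter> ?W)"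
      using sub by (intro arg_cong[where f = card]) blast
    also have "\<dots> \<le> (\<Sum>T\<in>?B. card (cols I -` {T} \<inter> ?W))" by (rule card_UN_le) simp
    finally have "card ?B * card ?W \<le> (\<Sum>T\<in>?B. card (cols I -` {T} \<inter> ?W) * card ?B)"
      unfolding sum_distrib_right[symmetric] by (subst mult.commute) (rule mult_le_mono1)
    also have "\<dots> < (\<Sum>T\<in>?B. card ?W)" by (intro sum_strict_mono lt) auto
    finally show False by simp
  qed
  then obtain T where T: "T \<in> ?B" "card ?W \<le> card (cols I -` {T} \<inter> ?W) * card ?B" by blast
  have cB: "card ?B = 2 ^ b" by (simp add: card_Pow)
  have "k * 2 ^ b < card (cols I -` {T} \<inter> ?W) * 2 ^ b" using big T(2) unfolding cB by linarith
  then have many: "k < card (cols I -` {T} \<inter> ?W)" by simp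
  then obtain J0 where J0: "J0 \<in> cols I -` {T} \<inter> ?W"
    using card_gt_0_iff[of "cols I -` {T} \<inter> ?W"] by auto
  then have cT: "k \<le> card T" by auto
  obtain f where f: "strict_mono_on {1..k} f" "f ` {1..k} \<subseteq> T" using enumerate_subset[OF cT] .
  obtain h where h: "strict_mono_on {1..k} h" "h ` {1..k} \<subseteq> cols I -` {T} \<inter> ?W"
    using enumerate_subset[OF less_imp_le[OF many]] .
  have "\<exists>y. (f i, y) \<in> S \<and> y div b = h (\<pi> i)" if "i \<in> {1..k}" for i
  proof -
    have "\<pi> i \<in> {1..k}" using that perm by (meson permutes_in_image)
    then have "cols I (h (\<pi> i)) = T" using h(2) by blast
    then show ?thesis using f(2) that unfolding cols_def by blast
  qed
  then obtain y where y: "\<And>i. i \<in> {1..k} \<Longrightarrow> (f i, y i) \<in> S \<and> y i div b = h (\<pi> i)" by metis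
  have p: "inv \<pi> j \<in> {1..k}" "\<pi> (inv \<pi> j) = j" if "j \<in> {1..k}" for j
    using that perm by (metis permutes_inv permutes_in_image) (metis perm permutes_inverses(1))
  have "strict_mono_on {1..k} (\<lambda>j. y (inv \<pi> j))"
  proof (rule strict_mono_onI)
    fix r s assume rs: "r \<in> {1..k}" "s \<in> {1..k}" "r < s"
    then have "h r < h s" using h(1) by (simp add: strict_mono_onD)
    then have "y (inv \<pi> r) div b < y (inv \<pi> s) div b" using y p rs by simp
    then show "y (inv \<pi> r) < y (inv \<pi> s)" by (metis div_le_mono leD leI)
  qed
  moreover have "\<forall>i\<in>{1..k}. (f i, y (inv \<pi> (\<pi> i))) \<in> S"
    using y perm by (auto simp: permutes_inverses)
  ultimately have "contains_pattern k \<pi> S" unfolding contains_pattern_def using f(1) by blast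
  then show False using avoid by blast
qed

lemma wide_blocks:
  fixes S :: "(nat \<times> nat) set" and b k :: nat
  assumes perm: "\<pi> permutes {1..k}" and avoid: "\<not> contains_pattern k \<pi> S"
    and b: "b > 0" and k: "k > 0" and S: "S \<subseteq> {..<m} \<times> {..<m}"
  shows "card {(I, J). k \<le> card {x. x div b = I \<and> (\<exists>y. (x, y) \<in> S \<and> y div b = J)}}
    \<le> (m div b + 1) * (k * 2 ^ b)"
proof -
  define cols where "cols = (\<lambda>I J. {x. x div b = I \<and> (\<exists>y. (x, y) \<in> S \<and> y div b = J)})"
  have fin: "finite S" using S finite_subset by blast
  have ne: "k \<le> card (cols I J) \<Longrightarrow> cols I J \<noteq> {}" for I J using k by auto
  have "{(I, J). k \<le> card (cols I J)} \<subseteq>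
    (SIGMA I:{..<m div b + 1}. {J. k \<le> card (cols I J) \<and> cols I J \<noteq> {}})"
  proof clarsimp
    fix I J assume kc: "k \<le> card (cols I J)"
    then obtain x y where "x div b = I" "(x, y) \<in> S" using ne unfolding cols_def by blast
    then have "I \<le> m div b" using S by (auto intro!: div_le_mono)
    then show "I < Suc (m div b) \<and> cols I J \<noteq> {}" using ne[OF kc] by simp
  qed
  moreover have finW: "finite {J. k \<le> card (cols I J) \<and> cols I J \<noteq> {}}" for I
  proof (rule finite_subset)
    show "{J. k \<le> card (cols I J) \<and> cols I J \<noteq> {}} \<subseteq> (\<lambda>(x, y). y div b) ` S" unfolding cols_def by force
  qed (use fin in simp)
  ultimately have "card {(I, J). k \<le> card (cols I J)} \<le>
    card (SIGMA I:{..<m div b + 1}. {J. k \<le> card (cols I J) \<and> cols I J \<noteq> {}})"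
    by (intro card_mono) auto
  also have "\<dots> = (\<Sum>I<m div b + 1. card {J. k \<le> card (cols I J) \<and> cols I J \<noteq> {}})"
    using finW by (intro card_SigmaI) auto
  also have "\<dots> \<le> (\<Sum>I<m div b + 1. k * 2 ^ b)"
    unfolding cols_def by (intro sum_mono wide_blocks_column[OF perm fin avoid b])
  finally show ?thesis unfolding cols_def by simp
qed

lemma card_div_eq_le: "b > 0 \<Longrightarrow> (\<And>x. x \<in> A \<Longrightarrow> x div b = I) \<Longrightarrow> finite A \<and> card A \<le> b" for b I :: nat
  using card_mono[of "{I * b..<I * b + b}" A] finite_subset[of A "{I * b..<I * b + b}"] div_eq_bounds
  by fastforce

text \<open>Cut the matrix into blocks of side \<open>b\<close> and recurse on the matrix of
  nonempty blocks. A block with few columns and few rows has at most \<open>k * k\<close> cells; the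
  other blocks may have \<open>b * b\<close>, but \<open>wide_blocks\<close>, applied to the matrix
  and to its transpose, leaves only linearly many of them.\<close>

theorem marcus_tardos:
  assumes perm: "\<pi> permutes {1..k}"
  obtains C where "\<And>m S. S \<subseteq> {..<m} \<times> {..<m} \<Longrightarrow> \<not> contains_pattern k \<pi> S \<Longrightarrow> card S \<le> C * m"
proof (cases "k = 0")
  case True
  then have "contains_pattern k \<pi> S" for S
    unfolding contains_pattern_def by (auto simp: strict_mono_on_def)
  then show ?thesis using that by blast
next
  case False
  \<comment> \<open>\<open>b = 4 * k * k\<close> makes the recursion contract: at most
    \<open>k * k\<close> cells for each of the \<open>C * m'\<close> nonempty blocks, with
    \<open>b * m' \<le> 2 * m\<close>, give half of \<open>C * m\<close>. The constant
    \<open>c\<close> covers the other half, spent on wide and tall blocks, and the summand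
    \<open>b\<close> of \<open>C\<close> the base case \<open>m < b\<close>.\<close>
  define b where "b = 4 * k * k"
  define c where "c = 4 * (k * 2 ^ b) * (b * b)"
  define C where "C = c + b"
  have b4: "b \<ge> 4" using False by (simp add: b_def)
  then have b0: "b > 0" by simp
  have "card S \<le> C * m" if "S \<subseteq> {..<m} \<times> {..<m}" "\<not> contains_pattern k \<pi> S" for m S
    using that
  proof (induction m arbitrary: S rule: less_induct)
    case (less m)
    have finS: "finite S" using less.prems(1) finite_subset by blast
    show ?case
    proof (cases "m < b")
      case True
      have "card S \<le> card ({..<m} \<times> {..<m})" using less.prems(1) by (intro card_mono) auto
      also have "\<dots> \<le> b * m" using True by simp
      finally show ?thesis unfolding C_def by (simp add: add_mult_distrib)
    next
      case False
      \<comment> \<open>The last block may be incomplete; the extra block is paid for by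
        \<open>b \<le> m\<close>.\<close>
      define m' where "m' = m div b + 1"
      have "b * (m div b) \<le> m" by simp
      then have bm': "b * m' \<le> 2 * m" using False unfolding m'_def add_mult_distrib2 by linarith
      moreover have "4 * m' \<le> b * m'" using b4 by simp
      ultimately have m'm: "m' < m" using b4 False by linarith
      define q where "q = (\<lambda>(x, y). (x div b, y div b :: nat))"
      have S': "q ` S \<subseteq> {..<m'} \<times> {..<m'}"
      proof (rule image_subsetI, clarify)
        fix a c assume "(a, c) \<in> S"
        then have "a \<le> m" "c \<le> m" using less.prems(1) by auto
        then have "a div b \<le> m div b" "c div b \<le> m div b" by (simp_all add: div_le_mono)
        then show "q (a, c) \<in> {..<m'} \<times> {..<m'}" by (simp add: q_def m'_def)
      qed
      have "\<not> contains_pattern k \<pi> (q ` S)"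
        using contains_pattern_quotient[of k \<pi> "\<lambda>x. x div b" "\<lambda>x. x div b" S] perm less.prems(2)
        unfolding q_def by (auto simp: mono_def div_le_mono)
      then have IH: "card (q ` S) \<le> C * m'" using less.IH[OF m'm S'] by blast
      define cols where "cols = (\<lambda>I J. {x. x div b = I \<and> (\<exists>y. (x, y) \<in> S \<and> y div b = J)})"
      define rows where "rows = (\<lambda>J I. {y. y div b = J \<and> (\<exists>x. (y, x) \<in> prod.swap ` S \<and> x div b = I)})"
      define W where "W = {(I, J). k \<le> card (cols I J)}"
      define T where "T = {(J, I). k \<le> card (rows J I)}"
      have cW: "card W \<le> m' * (k * 2 ^ b)"
        using wide_blocks[OF perm less.prems(2) b0 _ less.prems(1)] \<open>k \<noteq> 0\<close>
        unfolding W_def cols_def m'_def by simp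
      have avoid': "\<not> contains_pattern k (inv \<pi>) (prod.swap ` S)"
        using contains_pattern_swap perm less.prems(2) by blast
      have cT: "card T \<le> m' * (k * 2 ^ b)"
      proof -
        have sw: "prod.swap ` S \<subseteq> {..<m} \<times> {..<m}" using less.prems(1) by auto
        then show ?thesis
          using wide_blocks[OF permutes_inv[OF perm] avoid' b0 _ sw] \<open>k \<noteq> 0\<close>
          unfolding T_def rows_def m'_def by simp
      qed
      have finq: "finite (q ` S)" using finS by simp
      define big where "big = {B \<in> q ` S. B \<in> W \<or> prod.swap B \<in> T}"
      have fins: "finite {B \<in> q ` S. B \<in> W}" "finite {B \<in> q ` S. prod.swap B \<in> T}" using finq by auto
      have finW: "finite W"
      proof (rule finite_subset)
        show "W \<subseteq> q ` S"
        proof clarify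
          fix I J assume "(I, J) \<in> W"
          then have "k \<le> card (cols I J)" by (simp add: W_def)
          then have "cols I J \<noteq> {}" using \<open>k \<noteq> 0\<close> by auto
          then show "(I, J) \<in> q ` S" unfolding cols_def q_def by force
        qed
      qed (rule finq)
      have finT: "finite T"
      proof (rule finite_subset)
        show "T \<subseteq> prod.swap ` q ` S"
        proof clarify
          fix I J assume "(J, I) \<in> T"
          then have "k \<le> card (rows J I)" by (simp add: T_def)
          then have "rows J I \<noteq> {}" using \<open>k \<noteq> 0\<close> by auto
          then show "(J, I) \<in> prod.swap ` q ` S" unfolding rows_def q_def by force
        qed
      qed (use finq in simp)
      have "B \<in> W \<union> prod.swap ` T" if "B \<in> big" for B
        using that unfolding big_def by (metis (mono_tags, lifting) Un_iff imageI mem_Collect_eq swap_swap)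
      then have "card big \<le> card (W \<union> prod.swap ` T)"
        using finW finT by (intro card_mono) auto
      also have "\<dots> \<le> card W + card T"
        using card_Un_le[of W "prod.swap ` T"] card_image_le[OF finT, of prod.swap] by linarith
      finally have cbig: "card big \<le> 2 * (m' * (k * 2 ^ b))" using cW cT by linarith
      have blk: "card {z \<in> S. q z = B} \<le> k * k + (if B \<in> big then b * b else 0)" if "B \<in> q ` S" for B
      proof -
        obtain I J where B: "B = (I, J)" by force
        have fc: "finite (cols I J) \<and> card (cols I J) \<le> b"
          by (rule card_div_eq_le[OF b0]) (auto simp: cols_def)
        have fr: "finite (rows J I) \<and> card (rows J I) \<le> b"
          by (rule card_div_eq_le[OF b0]) (auto simp: rows_def)
        have "{z \<in> S. q z = B} \<subseteq> cols I J \<times> rows J I"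
          unfolding B cols_def rows_def q_def by force
        then have "card {z \<in> S. q z = B} \<le> card (cols I J \<times> rows J I)"
          using fc fr by (intro card_mono) auto
        then have le: "card {z \<in> S. q z = B} \<le> card (cols I J) * card (rows J I)"
          by (simp add: card_cartesian_product)
        show ?thesis
        proof (cases "B \<in> big")
          case True
          have "card (cols I J) * card (rows J I) \<le> b * b" using fc fr by (intro mult_le_mono) auto
          then show ?thesis using le True by simp
        next
          case False
          then have "card (cols I J) \<le> k" "card (rows J I) \<le> k"
            using that unfolding big_def W_def T_def B by auto
          then have "card (cols I J) * card (rows J I) \<le> k * k" by (intro mult_le_mono)
          then show ?thesis using le by simp
        qed
      qed
      have "card S = card (\<Union>B\<in>q ` S. {z \<in> S. q z = B})" by (rule arg_cong[where f = card]) auto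
      also have "\<dots> \<le> (\<Sum>B\<in>q ` S. card {z \<in> S. q z = B})" by (rule card_UN_le) (rule finq)
      also have "\<dots> \<le> (\<Sum>B\<in>q ` S. k * k + (if B \<in> big then b * b else 0))" by (intro sum_mono blk)
      also have "\<dots> = k * k * card (q ` S) + b * b * card big"
      proof -
        have "{B \<in> q ` S. B \<in> big} = big" unfolding big_def by auto
        then show ?thesis using finq by (simp add: sum.distrib sum.If_cases Int_def)
      qed
      finally have "card S \<le> k * k * (C * m') + b * b * (2 * (m' * (k * 2 ^ b)))"
        using mult_le_mono2[OF IH, of "k * k"] mult_le_mono2[OF cbig, of "b * b"] by linarith
      \<comment> \<open>Doubling gives each of the two contributions a full \<open>C * m\<close> to
        be compared with.\<close>
      then have "2 * card S \<le> C * (2 * k * k * m') + c * m'" unfolding c_def by (simp add: algebra_simps)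
      moreover have "2 * k * k * m' \<le> m" using bm' unfolding b_def by simp
      then have "C * (2 * k * k * m') \<le> C * m" by (rule mult_le_mono2)
      moreover have "c * m' \<le> C * m" using m'm unfolding C_def by (intro mult_le_mono) auto
      ultimately show ?thesis by linarith
    qed
  qed
  then show ?thesis using that by blast
qed

section \<open>Labelled construction terms\<close>

text \<open>
  A term builds labelled trees: \<open>Lf p\<close> is a single leaf with label \<open>0\<close>, \<open>Jn\<close> takes two families with
  different labels together, and \<open>Mv i j\<close> gives label \<open>j\<close> to the tree labelled \<open>i\<close>, making it a sibling
  of the tree that has label \<open>j\<close> already, if any. \<open>ps t\<close> is the family of labelled trees built by \<open>t\<close>, and
  \<open>dm t\<close> is its set of labels (on well-formed terms, \<open>wft\<close>).
\<close>

datatype ttree = TLeaf nat | TNode ttree ttree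

datatype tm = Lf nat | Jn tm tm | Mv nat nat tm

primrec ord :: "tm \<Rightarrow> nat list" where
  "ord (Lf p) = [p]"
| "ord (Jn a b) = ord a @ ord b"
| "ord (Mv i j a) = ord a"

primrec dm :: "tm \<Rightarrow> nat set" where
  "dm (Lf p) = {0}"
| "dm (Jn a b) = dm a \<union> dm b"
| "dm (Mv i j a) = (if i \<in> dm a then insert j (dm a - {i}) else dm a)"

text \<open>The tree that already has label \<open>j\<close> becomes the first child. So two terms
  that make corresponding moves in the same sequence obtain equal trees, not merely isomorphic
  ones.\<close>

definition move :: "nat \<Rightarrow> nat \<Rightarrow> (nat \<rightharpoonup> ttree) \<Rightarrow> (nat \<rightharpoonup> ttree)" where
  "move i j m = m(i := None, j := (case m j of None \<Rightarrow> m i | Some u \<Rightarrow> Some (TNode u (the (m i)))))"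

primrec ps :: "tm \<Rightarrow> (nat \<rightharpoonup> ttree)" where
  "ps (Lf p) = [0 \<mapsto> TLeaf p]"
| "ps (Jn a b) = ps a ++ ps b"
| "ps (Mv i j a) = move i j (ps a)"

primrec wft :: "tm \<Rightarrow> bool" where
  "wft (Lf p) \<longleftrightarrow> True"
| "wft (Jn a b) \<longleftrightarrow> wft a \<and> wft b \<and> dm a \<inter> dm b = {}"
| "wft (Mv i j a) \<longleftrightarrow> wft a \<and> i \<in> dm a \<and> i \<noteq> j"

text \<open>Looking at joins suffices: a leaf has one label, and a move never increases the number
  of labels.\<close>

primrec cx :: "nat \<Rightarrow> tm \<Rightarrow> bool" where
  "cx D (Lf p) \<longleftrightarrow> True"
| "cx D (Jn a b) \<longleftrightarrow> cx D a \<and> cx D b \<and> card (dm a \<union> dm b) \<le> D"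
| "cx D (Mv i j a) \<longleftrightarrow> cx D a"

lemma finite_dm [simp]: "finite (dm t)"
  by (induction t) auto

lemma dom_ps: "wft t \<Longrightarrow> dom (ps t) = dm t"
proof (induction t)
  case (Mv i j a)
  then show ?case by (auto simp: move_def dom_def split: option.splits if_splits)
qed auto

lemma dm_nonempty: "dm t \<noteq> {}"
  by (induction t) auto

lemma ord_nonempty: "ord t \<noteq> []"
  by (induction t) auto

section \<open>Reducing the number of labels by one\<close>

fun jn :: "tm option \<Rightarrow> tm option \<Rightarrow> tm option" where
  "jn None y = y"
| "jn x None = x"
| "jn (Some a) (Some b) = Some (Jn a b)"

text \<open>The inverse image of \<open>K\<close> under the renaming of \<open>i\<close> to
  \<open>j\<close>: restricting after the move amounts to restricting to this set before it.\<close>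

definition pullback :: "nat \<Rightarrow> nat \<Rightarrow> nat set \<Rightarrow> nat set" where
  "pullback i j K = (if j \<in> K then insert i K else K - {i})"

text \<open>The least label is a canonical choice of the class split off. The branch returning
  \<open>t\<close> is a default: for a well-formed term with two labels both parts exist.\<close>

definition split_or :: "tm \<Rightarrow> nat set \<Rightarrow> (bool \<Rightarrow> nat set \<Rightarrow> tm option) \<Rightarrow> tm \<Rightarrow> tm" where
  "split_or t d m t' = (if card d \<ge> 2
     then (case jn (m False {Min d}) (m True (d - {Min d})) of Some A \<Rightarrow> A | None \<Rightarrow> t) else t')"

definition restrict_with :: "tm \<Rightarrow> (bool \<Rightarrow> nat set \<Rightarrow> tm option) \<Rightarrow> nat set \<Rightarrow> bool \<Rightarrow> nat set \<Rightarrow> tm option" where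
  "restrict_with r m d f K = (if d \<subseteq> K then Some r else if d \<inter> K = {} then None else m f K)"

text \<open>
  \<open>red t\<close> is the reduced term, and \<open>mx f K t\<close>, meaningful if \<open>dm t\<close> has labels both in \<open>K\<close> and outside,
  is the restriction of \<open>t\<close> to the labels in \<open>K\<close>, mirrored at joins if \<open>f\<close>, in which maximal
  subterms with all labels in \<open>K\<close> are replaced by their reductions.
\<close>

primrec red_mx :: "tm \<Rightarrow> tm \<times> (bool \<Rightarrow> nat set \<Rightarrow> tm option)" where
  "red_mx (Lf p) = (Lf p, \<lambda>f K. None)"
| "red_mx (Jn a b) =
    (let m = (\<lambda>f K.
       let A = restrict_with (fst (red_mx a)) (snd (red_mx a)) (dm a) f K;
           B = restrict_with (fst (red_mx b)) (snd (red_mx b)) (dm b) f K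
       in if f then jn B A else jn A B)
     in (split_or (Jn a b) (dm (Jn a b)) m (Jn a b), m))"
| "red_mx (Mv i j a) =
    (let m = (\<lambda>f K.
       case snd (red_mx a) f (pullback i j K) of None \<Rightarrow> None
       | Some A \<Rightarrow> Some (if j \<in> K then Mv i j A else A))
     in (split_or (Mv i j a) (dm (Mv i j a)) m (Mv i j (fst (red_mx a))), m))"

definition red :: "tm \<Rightarrow> tm" where "red t = fst (red_mx t)"

definition mx :: "bool \<Rightarrow> nat set \<Rightarrow> tm \<Rightarrow> tm option" where "mx f K t = snd (red_mx t) f K"

definition restr :: "bool \<Rightarrow> nat set \<Rightarrow> tm \<Rightarrow> tm option" where
  "restr f K t = (if dm t \<subseteq> K then Some (red t) else if dm t \<inter> K = {} then None else mx f K t)"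

definition split_red :: "tm \<Rightarrow> tm" where
  "split_red t = (case jn (mx False {Min (dm t)} t) (mx True (dm t - {Min (dm t)}) t) of
     Some A \<Rightarrow> A | None \<Rightarrow> t)"

lemma mx_simps [simp]:
  "mx f K (Lf p) = None"
  "mx f K (Jn a b) = (if f then jn (restr f K b) (restr f K a) else jn (restr f K a) (restr f K b))"
  "mx f K (Mv i j a) = (case mx f (pullback i j K) a of None \<Rightarrow> None
     | Some A \<Rightarrow> Some (if j \<in> K then Mv i j A else A))"
  by (auto simp: mx_def restr_def restrict_with_def red_def Let_def)

lemma red_simps:
  "red (Lf p) = Lf p"
  "red (Jn a b) = (if card (dm (Jn a b)) \<ge> 2 then split_red (Jn a b) else Jn a b)"
  "red (Mv i j a) = (if card (dm (Mv i j a)) \<ge> 2 then split_red (Mv i j a) else Mv i j (red a))"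
  by (simp_all add: split_red_def split_or_def Let_def mx_def red_def del: dm.simps)

primrec oord :: "tm option \<Rightarrow> nat list" where
  "oord None = []"
| "oord (Some t) = ord t"

lemma oord_jn [simp]: "oord (jn A B) = oord A @ oord B"
  by (cases "(A, B)" rule: jn.cases) auto

text \<open>Every term has a label, so the empty family needs \<open>None\<close>.\<close>

definition restricts :: "nat \<Rightarrow> tm \<Rightarrow> nat set \<Rightarrow> tm option \<Rightarrow> bool" where
  "restricts D t K A \<longleftrightarrow> (case A of None \<Rightarrow> dm t \<inter> K = {}
     | Some A \<Rightarrow> wft A \<and> cx D A \<and> dm A = dm t \<inter> K \<and> ps A = ps t |` K)"

text \<open>Families with disjoint labels commute, so the restricted parts may be joined in either
  order; the second form is the one used for mirrored restrictions.\<close>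

lemma restricts_jn:
  assumes "restricts D a K A" "restricts D b K B" "dm a \<inter> dm b = {}" "wft a" "wft b"
    "card ((dm a \<union> dm b) \<inter> K) \<le> D"
  shows "restricts D (Jn a b) K (jn A B)" "restricts D (Jn a b) K (jn B A)"
proof -
  have c: "ps a |` K ++ ps b |` K = (ps a ++ ps b) |` K"
    by (auto simp: map_add_def restrict_map_def fun_eq_iff)
  have dis: "dom (ps a) \<inter> dom (ps b) = {}" using assms by (simp add: dom_ps)
  have c': "ps b |` K ++ ps a |` K = (ps a ++ ps b) |` K"
    unfolding c[symmetric] using dis by (intro map_add_comm) auto
  have n: "(ps a ++ ps b) |` K = ps b |` K" if "dm a \<inter> K = {}"
    unfolding c[symmetric] using that dom_ps[OF assms(4)]
    by (auto simp: map_add_def restrict_map_def fun_eq_iff domIff split: option.splits)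
  have n': "(ps a ++ ps b) |` K = ps a |` K" if "dm b \<inter> K = {}"
    unfolding c'[symmetric] using that dom_ps[OF assms(5)]
    by (auto simp: map_add_def restrict_map_def fun_eq_iff domIff split: option.splits)
  have comm: "(dm b \<union> dm a) \<inter> K = (dm a \<union> dm b) \<inter> K" by auto
  show "restricts D (Jn a b) K (jn A B)" "restricts D (Jn a b) K (jn B A)"
    using assms n n' unfolding restricts_def
    by (auto simp: c c' comm Int_Un_distrib2 Un_commute split: option.splits)
qed

text \<open>If \<open>j\<close> lies outside \<open>K\<close>, the moved tree leaves the restricted
  family together with its target, and the move is dropped.\<close>

lemma restricts_Mv:
  assumes "restricts D a (pullback i j K) (Some A)" "i \<in> dm a" "i \<noteq> j"
  shows "restricts D (Mv i j a) K (Some (if j \<in> K then Mv i j A else A))"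
proof (cases "j \<in> K")
  case True
  then have "move i j (ps a |` insert i K) = move i j (ps a) |` K"
    if "ps A = ps a |` insert i K" using assms(3)
    by (auto simp: move_def restrict_map_def fun_eq_iff split: option.splits)
  then show ?thesis using assms True by (auto simp: restricts_def pullback_def)
next
  case False
  then have "ps a |` (K - {i}) = move i j (ps a) |` K" using assms(3)
    by (auto simp: move_def restrict_map_def fun_eq_iff split: option.splits)
  then show ?thesis using assms False by (auto simp: restricts_def pullback_def)
qed

definition complementary :: "tm \<Rightarrow> nat set \<Rightarrow> nat set \<Rightarrow> bool" where
  "complementary t K K' \<longleftrightarrow> K \<inter> K' = {} \<and> dm t \<subseteq> K \<union> K'"

definition mixed :: "tm \<Rightarrow> nat set \<Rightarrow> nat set \<Rightarrow> bool" where
  "mixed t K K' \<longleftrightarrow> complementary t K K' \<and> dm t \<inter> K \<noteq> {} \<and> dm t \<inter> K' \<noteq> {}"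

text \<open>
  A caterpillar: reading \<open>ord t\<close> from right to left, elements of one class are put to the left and
  those of the other class to the right of what has been placed already.
\<close>

definition caterpillar :: "tm \<Rightarrow> tm option \<Rightarrow> tm option \<Rightarrow> bool" where
  "caterpillar t A B \<longleftrightarrow> (\<forall>us vs. sep us vs \<longrightarrow> sep (ord t @ us) (oord A @ vs @ oord B))"

definition red_spec :: "nat \<Rightarrow> tm \<Rightarrow> bool" where
  "red_spec D t \<longleftrightarrow> wft (red t) \<and> cx D (red t) \<and> dm (red t) = dm t \<and> ps (red t) = ps t \<and>
     sep (ord t) (ord (red t))"

definition mx_spec :: "nat \<Rightarrow> tm \<Rightarrow> bool" where
  "mx_spec D t \<longleftrightarrow> (\<forall>K K'. mixed t K K' \<longrightarrow> restricts D t K (mx False K t) \<and>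
     restricts D t K' (mx True K' t) \<and> caterpillar t (mx False K t) (mx True K' t))"

text \<open>If all labels belong to one class, the whole reduced block is put at one end of what is
  already placed, which is a direct or a skew step. Otherwise both classes occur and
  \<open>mx_spec\<close> applies.\<close>

lemma restr_spec:
  assumes "red_spec D t" "mx_spec D t" "complementary t K K'" "wft t"
  shows "restricts D t K (restr False K t)" "restricts D t K' (restr True K' t)"
    "caterpillar t (restr False K t) (restr True K' t)"
proof -
  have r: "ps t |` L = ps t" if "dm t \<subseteq> L" for L
  proof -
    have "ps t x = None" if "x \<notin> L" for x
      using that \<open>dm t \<subseteq> L\<close> dom_ps[OF assms(4)] domIff[of x "ps t"] by blast
    then show ?thesis by (auto simp: restrict_map_def fun_eq_iff)
  qed
  have sepL: "sep (ord t @ us) (ord (red t) @ vs)" "sep (ord t @ us) (vs @ ord (red t))"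
    if "sep us vs" for us vs
    using that assms(1) sep_direct sep_skew unfolding red_spec_def by blast+
  consider "dm t \<subseteq> K" "dm t \<inter> K' = {}" | "dm t \<subseteq> K'" "dm t \<inter> K = {}" | "mixed t K K'"
    using assms(3) unfolding complementary_def mixed_def by blast
  then have "restricts D t K (restr False K t) \<and> restricts D t K' (restr True K' t) \<and>
    caterpillar t (restr False K t) (restr True K' t)"
  proof cases
    case 1
    then show ?thesis using assms(1) dm_nonempty[of t] r sepL
      by (auto simp: restr_def restricts_def red_spec_def caterpillar_def)
  next
    case 2
    then show ?thesis using assms(1) dm_nonempty[of t] r sepL
      by (auto simp: restr_def restricts_def red_spec_def caterpillar_def)
  next
    case 3
    then have "\<not> dm t \<subseteq> K" "\<not> dm t \<subseteq> K'" "dm t \<inter> K \<noteq> {}" "dm t \<inter> K' \<noteq> {}"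
      unfolding mixed_def complementary_def by blast+
    then show ?thesis using assms(2) 3 unfolding mx_spec_def restr_def by auto
  qed
  then show "restricts D t K (restr False K t)" "restricts D t K' (restr True K' t)"
    "caterpillar t (restr False K t) (restr True K' t)" by auto
qed

lemma mixed_Mv:
  assumes "mixed (Mv i j a) K K'" "i \<in> dm a"
  shows "mixed a (pullback i j K) (pullback i j K')"
  using assms by (auto simp: mixed_def complementary_def pullback_def)

lemma restricts_SomeE:
  assumes "restricts D t K A" "dm t \<inter> K \<noteq> {}"
  obtains A' where "A = Some A'" "wft A'" "cx D A'" "dm A' = dm t \<inter> K" "ps A' = ps t |` K"
  using assms by (auto simp: restricts_def split: option.splits)

text \<open>Starting the caterpillar from empty lists makes it a separable rearrangement of the
  whole leaf order, and the two disjoint restrictions together restore the family of trees.\<close>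

lemma red_spec_split:
  assumes "mx_spec D t" "wft t" "2 \<le> card (dm t)" "card (dm t) \<le> D"
  shows "wft (split_red t) \<and> cx D (split_red t) \<and> dm (split_red t) = dm t \<and>
    ps (split_red t) = ps t \<and> sep (ord t) (ord (split_red t))"
proof -
  let ?K = "{Min (dm t)}" and ?K' = "dm t - {Min (dm t)}"
  have m: "Min (dm t) \<in> dm t" by (simp add: dm_nonempty)
  have "?K' \<noteq> {}"
    using assms(3) m by (metis One_nat_def Suc_1 card_1_singleton_iff insert_Diff not_less_eq_eq order_refl)
  then have mixed: "mixed t ?K ?K'" using m unfolding mixed_def complementary_def by auto
  then have sp: "restricts D t ?K (mx False ?K t)" "restricts D t ?K' (mx True ?K' t)"
    "caterpillar t (mx False ?K t) (mx True ?K' t)"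
    using assms(1) unfolding mx_spec_def by auto
  obtain A where A: "mx False ?K t = Some A" "wft A" "cx D A" "dm A = dm t \<inter> ?K" "ps A = ps t |` ?K"
    using restricts_SomeE[OF sp(1)] mixed unfolding mixed_def by metis
  obtain B where B: "mx True ?K' t = Some B" "wft B" "cx D B" "dm B = dm t \<inter> ?K'" "ps B = ps t |` ?K'"
    using restricts_SomeE[OF sp(2)] mixed unfolding mixed_def by metis
  have s: "split_red t = Jn A B" unfolding split_red_def A(1) B(1) by simp
  have d: "dm A \<union> dm B = dm t" unfolding A(4) B(4) using m by blast
  have "ps A ++ ps B = ps t"
    unfolding A(5) B(5) using dom_ps[OF assms(2)]
    by (auto simp: map_add_def restrict_map_def fun_eq_iff domIff split: option.splits)
  moreover have "sep (ord t @ []) (ord A @ [] @ ord B)"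
    using sp(3) sep_Nil unfolding caterpillar_def A(1) B(1) by fastforce
  ultimately show ?thesis unfolding s using A B d assms(4) by auto
qed

text \<open>A join has at most \<open>D + 1\<close> labels. If both classes occur there, each has at
  most \<open>D\<close>; if a child has labels of one class only, its reduction is inserted, which
  is legitimate because a child of a join has at most \<open>D\<close> labels. Hence
  \<open>mx_spec\<close> is proved at every node, and \<open>red_spec\<close> at nodes with at most
  \<open>D\<close> labels.\<close>

theorem red_mx_spec:
  assumes "wft t" "cx (Suc D) t" "2 \<le> D"
  shows "mx_spec D t \<and> (card (dm t) \<le> D \<longrightarrow> red_spec D t)"
  using assms(1,2)
proof (induction t)
  case (Lf p)
  have "\<not> mixed (Lf p) K K'" for K K' by (auto simp: mixed_def complementary_def)
  then show ?case by (auto simp: mx_spec_def red_spec_def red_simps intro: sep_single)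
next
  case (Jn a b)
  have w: "wft a" "wft b" "dm a \<inter> dm b = {}" "card (dm a \<union> dm b) \<le> Suc D" using Jn.prems by auto
  \<comment> \<open>Each child has a label of its own, so neither can have all \<open>D + 1\<close>
    of them.\<close>
  have "card (dm a \<union> dm b) = card (dm a) + card (dm b)" using w by (simp add: card_Un_disjoint)
  moreover have "card (dm a) > 0" "card (dm b) > 0" using dm_nonempty by (simp_all add: card_gt_0_iff)
  ultimately have cab: "card (dm a) \<le> D" "card (dm b) \<le> D" "2 \<le> card (dm (Jn a b))" using w(4) by auto
  then have IH: "mx_spec D a" "red_spec D a" "mx_spec D b" "red_spec D b"
    using Jn by auto
  have mx: "mx_spec D (Jn a b)"
    unfolding mx_spec_def
  proof (intro allI impI)
    fix K K' assume mixed: "mixed (Jn a b) K K'"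
    then have com: "complementary a K K'" "complementary b K K'"
      by (auto simp: mixed_def complementary_def)
    note sa = restr_spec[OF IH(2,1) com(1) w(1)] and sb = restr_spec[OF IH(4,3) com(2) w(2)]
    have "(dm a \<union> dm b) \<inter> K \<subset> dm a \<union> dm b" "(dm a \<union> dm b) \<inter> K' \<subset> dm a \<union> dm b"
      using mixed unfolding mixed_def complementary_def by auto
    then have "card ((dm a \<union> dm b) \<inter> K) < card (dm a \<union> dm b)"
      "card ((dm a \<union> dm b) \<inter> K') < card (dm a \<union> dm b)"
      by (simp_all add: psubset_card_mono)
    then have c: "card ((dm a \<union> dm b) \<inter> K) \<le> D" "card ((dm a \<union> dm b) \<inter> K') \<le> D"
      using w(4) by auto
    \<comment> \<open>The parts of the right child enclose \<open>vs\<close>, and the parts of the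
      left child then enclose those. On the right end the left child therefore comes last, which is
      why the second class is joined in mirrored order.\<close>
    have "caterpillar (Jn a b) (jn (restr False K a) (restr False K b)) (jn (restr True K' b) (restr True K' a))"
      unfolding caterpillar_def
    proof (intro allI impI)
      fix us vs :: "nat list" assume "sep us vs"
      then have "sep (ord b @ us) (oord (restr False K b) @ vs @ oord (restr True K' b))"
        using sb(3) unfolding caterpillar_def by blast
      then have "sep (ord a @ ord b @ us) (oord (restr False K a) @
          (oord (restr False K b) @ vs @ oord (restr True K' b)) @ oord (restr True K' a))"
        using sa(3) unfolding caterpillar_def by blast
      then show "sep (ord (Jn a b) @ us) (oord (jn (restr False K a) (restr False K b)) @ vs @
          oord (jn (restr True K' b) (restr True K' a)))" by simp
    qed
    then show "restricts D (Jn a b) K (mx False K (Jn a b)) \<and>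
      restricts D (Jn a b) K' (mx True K' (Jn a b)) \<and>
      caterpillar (Jn a b) (mx False K (Jn a b)) (mx True K' (Jn a b))"
      using restricts_jn(1)[OF sa(1) sb(1) w(3,1,2) c(1)] restricts_jn(2)[OF sa(2) sb(2) w(3,1,2) c(2)]
      by simp
  qed
  moreover have "red_spec D (Jn a b)" if "card (dm (Jn a b)) \<le> D"
    using red_spec_split[OF mx Jn.prems(1) cab(3) that] cab(3) unfolding red_spec_def red_simps by simp
  ultimately show ?case by blast
next
  case (Mv i j a)
  have w: "wft a" "i \<in> dm a" "i \<noteq> j" using Mv.prems by auto
  have IH: "mx_spec D a" "card (dm a) \<le> D \<longrightarrow> red_spec D a" using Mv by auto
  have mx: "mx_spec D (Mv i j a)"
    unfolding mx_spec_def
  proof (intro allI impI)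
    fix K K' assume mixed: "mixed (Mv i j a) K K'"
    let ?L = "pullback i j K" and ?L' = "pullback i j K'"
    have mixed': "mixed a ?L ?L'" using mixed_Mv[OF mixed w(2)] .
    then have sp: "restricts D a ?L (mx False ?L a)" "restricts D a ?L' (mx True ?L' a)"
      "caterpillar a (mx False ?L a) (mx True ?L' a)"
      using IH(1) unfolding mx_spec_def by auto
    obtain A where A: "mx False ?L a = Some A"
      using restricts_SomeE[OF sp(1)] mixed' unfolding mixed_def by metis
    obtain B where B: "mx True ?L' a = Some B"
      using restricts_SomeE[OF sp(2)] mixed' unfolding mixed_def by metis
    show "restricts D (Mv i j a) K (mx False K (Mv i j a)) \<and>
      restricts D (Mv i j a) K' (mx True K' (Mv i j a)) \<and>
      caterpillar (Mv i j a) (mx False K (Mv i j a)) (mx True K' (Mv i j a))"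
      using restricts_Mv[OF sp(1)[unfolded A] w(2,3)] restricts_Mv[OF sp(2)[unfolded B] w(2,3)] sp(3)
      by (auto simp: A B caterpillar_def)
  qed
  moreover have "red_spec D (Mv i j a)" if "card (dm (Mv i j a)) \<le> D"
  proof (cases "2 \<le> card (dm (Mv i j a))")
    case True
    then show ?thesis
      using red_spec_split[OF mx Mv.prems(1) True that] unfolding red_spec_def red_simps by simp
  next
    case False
    \<comment> \<open>One label after the move means at most two before it; here
      \<open>2 \<le> D\<close> enters.\<close>
    have "dm a \<subseteq> insert i (dm (Mv i j a))" by auto
    then have "card (dm a) \<le> card (insert i (dm (Mv i j a)))" by (intro card_mono) auto
    also have "\<dots> \<le> Suc (card (dm (Mv i j a)))" by (rule card_insert_le_m1) auto
    finally have "card (dm a) \<le> D" using False assms(3) by simp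
    then have "red_spec D a" using IH(2) by blast
    then show ?thesis using False w unfolding red_spec_def red_simps by simp
  qed
  ultimately show ?case by blast
qed

section \<open>Two labels: leaf orders as plane embeddings\<close>

inductive embeds :: "ttree \<Rightarrow> nat list \<Rightarrow> bool" where
  embeds_Leaf: "embeds (TLeaf p) [p]"
| embeds_left: "embeds s xs \<Longrightarrow> embeds t ys \<Longrightarrow> embeds (TNode s t) (xs @ ys)"
| embeds_right: "embeds s xs \<Longrightarrow> embeds t ys \<Longrightarrow> embeds (TNode s t) (ys @ xs)"

text \<open>At each node the two embeddings order the subtrees alike, a direct step, or oppositely,
  a skew step.\<close>

lemma sep_embeds: "embeds T xs \<Longrightarrow> embeds T ys \<Longrightarrow> sep xs ys"
proof (induction arbitrary: ys rule: embeds.induct)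
  case (embeds_Leaf p)
  then show ?case by (auto elim: embeds.cases intro: sep_single)
next
  case (embeds_left s xs t zs)
  from embeds_left.prems show ?case
    by (cases rule: embeds.cases) (auto intro: sep_direct sep_skew embeds_left.IH)
next
  case (embeds_right s xs t zs)
  from embeds_right.prems show ?case
    by (cases rule: embeds.cases) (auto intro: sep_direct sep_skew embeds_right.IH)
qed

text \<open>With at most two labels in use, a join has one label on either side, so the leaves of
  each labelled tree are contiguous in \<open>ord t\<close>. A move that unites two trees then
  unites two adjacent intervals, in one order or the other.\<close>

lemma embeds_ord:
  assumes "wft t" "cx 2 t"
  shows "(\<exists>i. dm t = {i} \<and> embeds (the (ps t i)) (ord t)) \<or>
    (\<exists>i j xs ys. i \<noteq> j \<and> dm t = {i, j} \<and> ord t = xs @ ys \<and>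
       embeds (the (ps t i)) xs \<and> embeds (the (ps t j)) ys)"
  using assms
proof (induction t)
  case (Lf p)
  then show ?case by (auto intro: embeds_Leaf)
next
  case (Jn a b)
  have c: "card (dm a) + card (dm b) \<le> 2" using Jn.prems card_Un_disjoint[of "dm a" "dm b"] by simp
  have "card (dm a) > 0" "card (dm b) > 0" using dm_nonempty by (simp_all add: card_gt_0_iff)
  then have "card (dm a) = 1" "card (dm b) = 1" using c by auto
  then obtain i j where ij: "dm a = {i}" "dm b = {j}" by (auto simp: card_1_singleton_iff)
  then have e: "embeds (the (ps a i)) (ord a)" "embeds (the (ps b j)) (ord b)" using Jn by auto
  have "i \<noteq> j" "wft a" "wft b" using Jn.prems ij by auto
  moreover have "ps b i = None" "ps b j \<noteq> None"
    using dom_ps[of b] ij \<open>i \<noteq> j\<close> \<open>wft b\<close> by auto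
  ultimately have "i \<noteq> j \<and> dm (Jn a b) = {i, j} \<and> ord (Jn a b) = ord a @ ord b \<and>
    embeds (the (ps (Jn a b) i)) (ord a) \<and> embeds (the (ps (Jn a b) j)) (ord b)"
    using e ij by (auto simp: map_add_def)
  then show ?case by blast
next
  case (Mv k l a)
  have w: "k \<in> dm a" "k \<noteq> l" "wft a" using Mv.prems by auto
  consider i where "dm a = {i}" "embeds (the (ps a i)) (ord a)"
    | i j xs ys where "i \<noteq> j" "dm a = {i, j}" "ord a = xs @ ys"
      "embeds (the (ps a i)) xs" "embeds (the (ps a j)) ys"
    using Mv by auto
  then show ?case
  proof cases
    case 1
    then have "ps a l = None" using dom_ps[OF w(3)] w by auto
    then show ?thesis using 1 w by (auto simp: move_def)
  next
    case 2
    show ?thesis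
    proof (cases "l \<in> dm a")
      case True
      then have "ps a l \<noteq> None" using dom_ps[OF w(3)] by auto
      then have p: "ps (Mv k l a) l = Some (TNode (the (ps a l)) (the (ps a k)))"
        by (auto simp: move_def)
      have "l = i \<and> k = j \<or> l = j \<and> k = i" using True w 2(2) by auto
      then have "embeds (the (ps (Mv k l a) l)) (ord (Mv k l a))" "dm (Mv k l a) = {l}"
        unfolding p using 2 by (auto intro: embeds_left embeds_right)
      then show ?thesis by blast
    next
      case False
      then have l: "ps a l = None" "l \<noteq> i" "l \<noteq> j" using dom_ps[OF w(3)] 2(2) by auto
      have p: "ps (Mv k l a) = (ps a)(k := None, l := ps a k)" using l(1) by (simp add: move_def)
      consider (left) "k = i" | (right) "k = j" using w 2(2) by auto
      then show ?thesis
      proof cases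
        case left
        have "l \<noteq> j \<and> dm (Mv k l a) = {l, j} \<and> ord (Mv k l a) = xs @ ys \<and>
            embeds (the (ps (Mv k l a) l)) xs \<and> embeds (the (ps (Mv k l a) j)) ys"
          unfolding p using 2 l left by auto
        then show ?thesis by blast
      next
        case right
        have "i \<noteq> l \<and> dm (Mv k l a) = {i, l} \<and> ord (Mv k l a) = xs @ ys \<and>
            embeds (the (ps (Mv k l a) i)) xs \<and> embeds (the (ps (Mv k l a) l)) ys"
          unfolding p using 2 l right by auto
        then show ?thesis by blast
      qed
    qed
  qed
qed

text \<open>A single label at the root makes \<open>red_mx_spec\<close> applicable to the whole term
  in every round, as long as two labels remain allowed.\<close>

lemma red_iterate:
  assumes "wft t" "cx D t" "dm t = {i}" "2 \<le> D" "s \<le> D - 2"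
  shows "wft ((red ^^ s) t) \<and> cx (D - s) ((red ^^ s) t) \<and> dm ((red ^^ s) t) = {i} \<and>
    ps ((red ^^ s) t) = ps t"
  using assms(5)
proof (induction s)
  case 0
  then show ?case using assms by simp
next
  case (Suc s)
  let ?u = "(red ^^ s) t"
  have u: "wft ?u" "cx (D - s) ?u" "dm ?u = {i}" "ps ?u = ps t" using Suc by auto
  have "D - s = Suc (D - Suc s)" "2 \<le> D - Suc s" using Suc.prems assms(4) by auto
  then have "red_spec (D - Suc s) ?u" using red_mx_spec[of ?u "D - Suc s"] u by simp
  then show ?case using u by (simp add: red_spec_def)
qed

lemma sep_red_iterate:
  assumes "wft t" "cx D t" "dm t = {i}" "s < D - 2"
  shows "sep (ord ((red ^^ s) t)) (ord ((red ^^ Suc s) t))"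
proof -
  let ?u = "(red ^^ s) t"
  have u: "wft ?u" "cx (D - s) ?u" "dm ?u = {i}" using red_iterate[OF assms(1-3), of s] assms(4) by auto
  have "D - s = Suc (D - Suc s)" "2 \<le> D - Suc s" using assms(4) by auto
  then have "red_spec (D - Suc s) ?u" using red_mx_spec[of ?u "D - Suc s"] u by simp
  then show ?thesis by (simp add: red_spec_def)
qed

lemma sep_red_final:
  assumes "wft t" "cx D t" "dm t = {i}" "wft u" "cx D u" "dm u = {i}" "ps t i = ps u i" "2 \<le> D"
  shows "sep (ord ((red ^^ (D - 2)) t)) (ord ((red ^^ (D - 2)) u))"
proof -
  have D: "D - (D - 2) = 2" using assms(8) by simp
  note a = red_iterate[OF assms(1-3,8) order_refl] and b = red_iterate[OF assms(4-6,8) order_refl]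
  have "embeds (the (ps t i)) (ord ((red ^^ (D - 2)) t))"
    using embeds_ord[of "(red ^^ (D - 2)) t"] a unfolding D by (auto simp: doubleton_eq_iff)
  moreover have "embeds (the (ps t i)) (ord ((red ^^ (D - 2)) u))"
    using embeds_ord[of "(red ^^ (D - 2)) u"] b assms(7) unfolding D by (auto simp: doubleton_eq_iff)
  ultimately show ?thesis by (rule sep_embeds)
qed

section \<open>A loop language and its compilation\<close>

record st =
  var :: "nat \<Rightarrow> nat"
  arr :: "nat \<Rightarrow> nat \<Rightarrow> nat"
  io :: "nat \<Rightarrow> nat"
  lim :: nat

text \<open>
  The only way to enlarge a value is \<open>CInc\<close>. So the values occurring in a run are bounded by the
  initial values and the running time, and a linear time bound entails the bound on the word length.
  Array \<open>a\<close> is kept in the memory cells \<open>lim + i * K + a\<close>, and \<open>io\<close> in the cells below \<open>lim\<close>.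
\<close>

datatype com =
    CSkip
  | CConst nat nat
  | CMov nat nat
  | CInc nat
  | CDec nat
  | CLd nat nat nat
  | CSt nat nat nat
  | CIn nat nat
  | COut nat nat
  | CSeq com com
  | CIf nat nat com com
  | CFor nat nat com

definition setv :: "nat \<Rightarrow> nat \<Rightarrow> st \<Rightarrow> st" where
  "setv x v s = s\<lparr>var := (var s)(x := v)\<rparr>"

definition seta :: "nat \<Rightarrow> nat \<Rightarrow> nat \<Rightarrow> st \<Rightarrow> st" where
  "seta a i v s = s\<lparr>arr := (arr s)(a := (arr s a)(i := v))\<rparr>"

text \<open>Writes at or beyond \<open>lim\<close> are suppressed, since in memory they would hit
  the cells of the arrays.\<close>

definition outv :: "nat \<Rightarrow> nat \<Rightarrow> st \<Rightarrow> st" where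
  "outv i v s = (if i < lim s then s\<lparr>io := (io s)(i := v)\<rparr> else s)"

primrec loop :: "(nat \<Rightarrow> 'a \<Rightarrow> 'a) \<Rightarrow> nat \<Rightarrow> 'a \<Rightarrow> 'a" where
  "loop f 0 s = s"
| "loop f (Suc n) s = f n (loop f n s)"

text \<open>\<open>CFor\<close> reads its bound once, on entry. Its body may therefore enlarge the
  bounding variable, as a pass over the heap does when it appends terms.\<close>

primrec run :: "com \<Rightarrow> st \<Rightarrow> st" where
  "run CSkip = (\<lambda>s. s)"
| "run (CConst r c) = setv r c"
| "run (CMov r a) = (\<lambda>s. setv r (var s a) s)"
| "run (CInc r) = (\<lambda>s. setv r (Suc (var s r)) s)"
| "run (CDec r) = (\<lambda>s. setv r (var s r - 1) s)"
| "run (CLd r a i) = (\<lambda>s. setv r (arr s a (var s i)) s)"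
| "run (CSt a i v) = (\<lambda>s. seta a (var s i) (var s v) s)"
| "run (CIn r i) = (\<lambda>s. setv r (if var s i < lim s then io s (var s i) else 0) s)"
| "run (COut i v) = (\<lambda>s. outv (var s i) (var s v) s)"
| "run (CSeq c d) = (\<lambda>s. run d (run c s))"
| "run (CIf a b c d) = (\<lambda>s. if var s a < var s b then run c s else run d s)"
| "run (CFor v b c) = (\<lambda>s. loop (\<lambda>k s. run c (setv v k s)) (var s b) s)"

text \<open>Bounds the number of machine steps of the compiled code: an array access spends four
  steps on the address, and a round of a loop spends four on the test, the copy of the counter, the
  increment and the jump back.\<close>

primrec cost :: "com \<Rightarrow> st \<Rightarrow> nat" where
  "cost CSkip = (\<lambda>s. 0)"
| "cost (CConst r c) = (\<lambda>s. 1)"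
| "cost (CMov r a) = (\<lambda>s. 1)"
| "cost (CInc r) = (\<lambda>s. 1)"
| "cost (CDec r) = (\<lambda>s. 1)"
| "cost (CLd r a i) = (\<lambda>s. 5)"
| "cost (CSt a i v) = (\<lambda>s. 5)"
| "cost (CIn r i) = (\<lambda>s. 3)"
| "cost (COut i v) = (\<lambda>s. 2)"
| "cost (CSeq c d) = (\<lambda>s. cost c s + cost d (run c s))"
| "cost (CIf a b c d) = (\<lambda>s. 2 + (if var s a < var s b then cost c s else cost d s))"
| "cost (CFor v b c) = (\<lambda>s. 4 +
     (\<Sum>k<var s b. 4 + cost c (setv v k (loop (\<lambda>k s. run c (setv v k s)) k s))))"

text \<open>The numbers of arrays are bounded strictly because the bound becomes the stride at which
  the arrays are interleaved in memory.\<close>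

primrec consts_le :: "nat \<Rightarrow> com \<Rightarrow> bool" where
  "consts_le M CSkip \<longleftrightarrow> True"
| "consts_le M (CConst r c) \<longleftrightarrow> c \<le> M"
| "consts_le M (CMov r a) \<longleftrightarrow> True"
| "consts_le M (CInc r) \<longleftrightarrow> True"
| "consts_le M (CDec r) \<longleftrightarrow> True"
| "consts_le M (CLd r a i) \<longleftrightarrow> a < M"
| "consts_le M (CSt a i v) \<longleftrightarrow> a < M"
| "consts_le M (CIn r i) \<longleftrightarrow> True"
| "consts_le M (COut i v) \<longleftrightarrow> True"
| "consts_le M (CSeq c d) \<longleftrightarrow> consts_le M c \<and> consts_le M d"
| "consts_le M (CIf a b c d) \<longleftrightarrow> consts_le M c \<and> consts_le M d"
| "consts_le M (CFor v b c) \<longleftrightarrow> consts_le M c"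

lemma consts_le_mono: "consts_le M c \<Longrightarrow> M \<le> N \<Longrightarrow> consts_le N c"
  by (induction c) auto

lemma consts_le_exists: "\<exists>M. consts_le M c"
proof (induction c)
  case (CSeq c d)
  then show ?case by (metis consts_le.simps(10) consts_le_mono max.cobounded1 max.cobounded2)
next
  case (CIf a b c d)
  then show ?case by (metis consts_le.simps(11) consts_le_mono max.cobounded1 max.cobounded2)
qed auto

lemma lim_simps [simp]:
  "lim (setv x v s) = lim s" "lim (seta a i v s) = lim s" "lim (outv i v s) = lim s"
  by (simp_all add: setv_def seta_def outv_def)

lemma lim_loop: "(\<And>k s. lim (f k s) = lim s) \<Longrightarrow> lim (loop f n s) = lim s"
  by (induction n) auto

lemma lim_run [simp]: "lim (run c s) = lim s"
  by (induction c arbitrary: s) (auto intro: lim_loop)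

definition bnd :: "nat \<Rightarrow> st \<Rightarrow> bool" where
  "bnd M s \<longleftrightarrow> (\<forall>x. var s x \<le> M) \<and> (\<forall>a i. arr s a i \<le> M) \<and> (\<forall>i. io s i \<le> M)"

lemma bnd_mono: "bnd M s \<Longrightarrow> M \<le> N \<Longrightarrow> bnd N s"
  unfolding bnd_def by (meson order_trans)

lemma bnd_setv: "bnd M s \<Longrightarrow> v \<le> M \<Longrightarrow> bnd M (setv x v s)"
  by (simp add: bnd_def setv_def)

lemma bnd_plus: "bnd M s \<Longrightarrow> bnd (M + c) s"
  by (rule bnd_mono) auto

lemma bnd_seta: "bnd M s \<Longrightarrow> v \<le> M \<Longrightarrow> bnd M (seta a i v s)"
  by (simp add: bnd_def seta_def)

lemma bnd_outv: "bnd M s \<Longrightarrow> v \<le> M \<Longrightarrow> bnd M (outv i v s)"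
  by (simp add: bnd_def outv_def)

lemma bnd_values:
  assumes "bnd M s"
  shows "var s x \<le> M + c" "arr s a i \<le> M + c" "io s i \<le> M + c" "Suc (var s x) \<le> M + 1"
    "var s x - 1 \<le> M + c"
proof -
  have "var s x \<le> M" "arr s a i \<le> M" "io s i \<le> M" using assms by (auto simp: bnd_def)
  then show "var s x \<le> M + c" "arr s a i \<le> M + c" "io s i \<le> M + c" "Suc (var s x) \<le> M + 1"
    "var s x - 1 \<le> M + c" by auto
qed

text \<open>An increment raises the bound by one and costs one step; a loop counter stays below a
  value that is already present. Everything else copies, decreases, or writes a program
  constant.\<close>

lemma bnd_run: "bnd M s \<Longrightarrow> consts_le M c \<Longrightarrow> bnd (M + cost c s) (run c s)"
proof (induction c arbitrary: M s)
  case (CSeq c d)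
  then have "bnd (M + cost c s) (run c s)" by simp
  then have "bnd (M + cost c s + cost d (run c s)) (run d (run c s))"
    using CSeq.prems consts_le_mono by (intro CSeq.IH(2)) auto
  then show ?case by (simp add: add.assoc)
next
  case (CIf a b c d)
  then have "var s a < var s b \<Longrightarrow> bnd (M + cost c s) (run c s)"
    "\<not> var s a < var s b \<Longrightarrow> bnd (M + cost d s) (run d s)" by simp_all
  then show ?case by (auto intro: bnd_mono)
next
  case (CFor v b c)
  let ?L = "\<lambda>k. loop (\<lambda>k s. run c (setv v k s)) k s"
  have "bnd (M + (\<Sum>k<n. 4 + cost c (setv v k (?L k)))) (?L n)" if "n \<le> var s b" for n
    using that
  proof (induction n)
    case 0
    then show ?case using CFor.prems by simp
  next
    case (Suc n)
    have "n \<le> M" using Suc.prems CFor.prems(1) unfolding bnd_def by (meson Suc_leD order_trans)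
    then have "bnd (M + (\<Sum>k<n. 4 + cost c (setv v k (?L k)))) (setv v n (?L n))"
      using Suc by (intro bnd_setv) auto
    then have "bnd (M + (\<Sum>k<n. 4 + cost c (setv v k (?L k))) + cost c (setv v n (?L n))) (?L (Suc n))"
      using CFor.IH CFor.prems(2) consts_le_mono by simp
    then show ?case by (rule bnd_mono) simp
  qed
  then have "bnd (M + (\<Sum>k<var s b. 4 + cost c (setv v k (?L k)))) (?L (var s b))" by blast
  then show ?case by (auto intro: bnd_mono)
next
  case (CInc r)
  then show ?case using bnd_setv[OF bnd_plus[of M s 1] bnd_values(4)[of M s r]] by simp
next
  case (CSt a i v)
  then show ?case using bnd_seta[OF bnd_plus bnd_values(1)] by simp
next
  case (COut i v)
  then show ?case using bnd_outv[OF bnd_plus[of M s 2] bnd_values(1)[of M s v 2]] by simp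
next
  case (CIn r i)
  then show ?case using bnd_setv[OF bnd_plus bnd_values(3)] bnd_setv[OF bnd_plus le0] by simp
qed (use bnd_setv[OF bnd_plus bnd_values(1)] bnd_setv[OF bnd_plus bnd_values(2)]
  bnd_setv[OF bnd_plus trans_le_add1] bnd_setv[OF bnd_plus bnd_values(5)] in \<open>simp_all del: One_nat_def\<close>)

text \<open>Variables live in the even registers from 8 on; \<open>counter\<close> and
  \<open>bound\<close> take the residues 1 and 3 modulo 4. Registers 2, 3 and 4 hold 1, the stride
  and \<open>lim\<close>, and 5 and 6 are scratch registers for addresses.\<close>

definition rv :: "nat \<Rightarrow> nat" where "rv x = 8 + 2 * x"

definition counter :: "nat \<Rightarrow> nat" where "counter d = 9 + 4 * d"

definition bound :: "nat \<Rightarrow> nat" where "bound d = 11 + 4 * d"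

definition addr_code :: "nat \<Rightarrow> nat \<Rightarrow> instr list" where
  "addr_code a i = [Mult 5 (rv i) 3, Const 6 a, Add 5 5 6, Add 5 5 4]"

primrec len :: "com \<Rightarrow> nat" where
  "len CSkip = 0"
| "len (CConst r c) = 1"
| "len (CMov r a) = 1"
| "len (CInc r) = 1"
| "len (CDec r) = 1"
| "len (CLd r a i) = 5"
| "len (CSt a i v) = 5"
| "len (CIn r i) = 4"
| "len (COut i v) = 3"
| "len (CSeq c d) = len c + len d"
| "len (CIf a b c d) = len c + len d + 2"
| "len (CFor v b c) = len c + 7"

text \<open>\<open>b\<close> is the address of the first instruction, needed because jumps are
  absolute, and \<open>d\<close> the depth of loop nesting, each depth having registers of its own.
  In a conditional the code for the false case comes first.\<close>

primrec comp :: "com \<Rightarrow> nat \<Rightarrow> nat \<Rightarrow> instr list" where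
  "comp CSkip = (\<lambda>b d. [])"
| "comp (CConst r c) = (\<lambda>b d. [Const (rv r) c])"
| "comp (CMov r a) = (\<lambda>b d. [Move (rv r) (rv a)])"
| "comp (CInc r) = (\<lambda>b d. [Add (rv r) (rv r) 2])"
| "comp (CDec r) = (\<lambda>b d. [Sub (rv r) (rv r) 2])"
| "comp (CLd r a i) = (\<lambda>b d. addr_code a i @ [Load (rv r) 5])"
| "comp (CSt a i v) = (\<lambda>b d. addr_code a i @ [Store 5 (rv v)])"
| "comp (CIn r i) = (\<lambda>b d.
     [JumpLess (rv i) 4 (Suc (Suc (Suc b))), Const (rv r) 0, Jump (Suc (Suc (Suc (Suc b)))), Load (rv r) (rv i)])"
| "comp (COut i v) = (\<lambda>b d. [JumpLess (rv i) 4 (Suc (Suc b)), Jump (Suc (Suc (Suc b))), Store (rv i) (rv v)])"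
| "comp (CSeq c e) = (\<lambda>b d. comp c b d @ comp e (b + len c) d)"
| "comp (CIf x y c e) = (\<lambda>b d. JumpLess (rv x) (rv y) (Suc (Suc (b + len e))) # comp e (Suc b) d @
     Jump (Suc (Suc (b + len e + len c))) # comp c (Suc (Suc (b + len e))) d)"
| "comp (CFor v n c) = (\<lambda>b d.
     [Const (counter d) 0, Move (bound d) (rv n), JumpLess (counter d) (bound d) (Suc (Suc (Suc (Suc b)))),
      Jump (Suc (Suc (Suc (Suc (Suc (Suc (Suc (b + len c)))))))), Move (rv v) (counter d)] @ comp c (Suc (Suc (Suc (Suc (Suc b))))) (Suc d) @
     [Add (counter d) (counter d) 2, Jump (Suc (Suc b))])"

lemma length_comp [simp]: "length (comp c b d) = len c"
  by (induction c arbitrary: b d) (auto simp: addr_code_def)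

section \<open>Correctness of the translation\<close>

definition code_at :: "instr list \<Rightarrow> nat \<Rightarrow> instr list \<Rightarrow> bool" where
  "code_at P b xs \<longleftrightarrow> (\<forall>i<length xs. b + i < length P \<and> P ! (b + i) = xs ! i)"

lemma code_at_Nil [simp]: "code_at P b []"
  by (simp add: code_at_def)

lemma code_at_Cons [simp]: "code_at P b (x # xs) \<longleftrightarrow> b < length P \<and> P ! b = x \<and> code_at P (Suc b) xs"
  by (simp add: code_at_def All_less_Suc2 conj_assoc)

lemma code_at_append [simp]:
  "code_at P b (xs @ ys) \<longleftrightarrow> code_at P b xs \<and> code_at P (b + length xs) ys"
  by (induction xs arbitrary: b) auto

definition cbnd :: "nat \<Rightarrow> config \<Rightarrow> bool" where
  "cbnd W z \<longleftrightarrow> (\<forall>a. reg z a \<le> W \<and> mem z a \<le> W)"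

text \<open>An exact number of steps lets runs be concatenated; the bound is imposed on every
  intermediate configuration, as \<open>runs_to\<close> will demand.\<close>

definition reach :: "instr list \<Rightarrow> nat \<Rightarrow> nat \<Rightarrow> config \<Rightarrow> config \<Rightarrow> bool" where
  "reach P W t z z' \<longleftrightarrow> (step P ^^ t) z = z' \<and> (\<forall>u\<le>t. cbnd W ((step P ^^ u) z))"

lemma reach_refl: "cbnd W z \<Longrightarrow> reach P W 0 z z"
  by (simp add: reach_def)

lemma reach_trans:
  assumes "reach P W t z z'" "reach P W t' z' z''"
  shows "reach P W (t + t') z z''"
proof -
  have "(step P ^^ (t + t')) z = z''"
    using assms unfolding reach_def by (metis add.commute comp_apply funpow_add)
  moreover have "cbnd W ((step P ^^ u) z)" if "u \<le> t + t'" for u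
  proof (cases "u \<le> t")
    case True
    then show ?thesis using assms unfolding reach_def by simp
  next
    case False
    then have "(step P ^^ u) z = (step P ^^ (u - t)) ((step P ^^ t) z)"
      by (metis add.commute comp_apply funpow_add le_add_diff_inverse nat_le_linear)
    then show ?thesis using assms that unfolding reach_def by simp
  qed
  ultimately show ?thesis by (simp add: reach_def)
qed

lemma reach_step:
  assumes "pc z < length P" "cbnd W z" "cbnd W (exec (P ! pc z) z)"
  shows "reach P W 1 z (exec (P ! pc z) z)"
  using assms by (auto simp: reach_def step_def halted_def le_Suc_eq)

lemma reach_Suc:
  assumes "pc z < length P" "cbnd W z" "reach P W t (exec (P ! pc z) z) z'"
  shows "reach P W (Suc t) z z'"
  using reach_trans[OF reach_step[OF assms(1,2)] assms(3)] assms(3) unfolding reach_def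
  by (metis (no_types, lifting) bot_nat_0.extremum funpow_0 plus_1_eq_Suc)

lemma cbnd_set_reg [simp]: "cbnd W z \<Longrightarrow> v \<le> W \<Longrightarrow> cbnd W (set_reg r v z)"
  by (simp add: cbnd_def set_reg_def)

lemma cbnd_pc [simp]: "cbnd W (z\<lparr>pc := p\<rparr>) \<longleftrightarrow> cbnd W z"
  by (simp add: cbnd_def)

lemma set_reg_simps [simp]:
  "pc (set_reg r v z) = Suc (pc z)" "reg (set_reg r v z) = (reg z)(r := v)" "mem (set_reg r v z) = mem z"
  by (simp_all add: set_reg_def)

definition sim :: "nat \<Rightarrow> st \<Rightarrow> config \<Rightarrow> bool" where
  "sim K s z \<longleftrightarrow> (\<forall>x. reg z (rv x) = var s x) \<and> reg z 2 = 1 \<and> reg z 3 = K \<and> reg z 4 = lim s \<and>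
     (\<forall>i<lim s. mem z i = io s i) \<and> (\<forall>a<K. \<forall>i. mem z (lim s + i * K + a) = arr s a i)"

lemma rv_simps [simp]:
  "rv x = rv y \<longleftrightarrow> x = y" "rv x \<noteq> 2" "rv x \<noteq> 3" "rv x \<noteq> 4" "rv x \<noteq> 5" "rv x \<noteq> 6"
  "rv x \<noteq> counter d" "rv x \<noteq> bound d" "counter d \<noteq> rv x" "bound d \<noteq> rv x"
  "2 \<noteq> rv x" "3 \<noteq> rv x" "4 \<noteq> rv x" "5 \<noteq> rv x" "6 \<noteq> rv x"
  "counter d \<noteq> 2" "counter d \<noteq> 3" "counter d \<noteq> 4" "counter d \<noteq> 5" "counter d \<noteq> 6"
  "bound d \<noteq> 2" "bound d \<noteq> 3" "bound d \<noteq> 4" "bound d \<noteq> 5" "bound d \<noteq> 6"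
  "2 \<noteq> counter d" "3 \<noteq> counter d" "4 \<noteq> counter d" "5 \<noteq> counter d" "6 \<noteq> counter d"
  "2 \<noteq> bound d" "3 \<noteq> bound d" "4 \<noteq> bound d" "5 \<noteq> bound d" "6 \<noteq> bound d"
  "counter d = counter e \<longleftrightarrow> d = e" "bound d = bound e \<longleftrightarrow> d = e"
  "counter d \<noteq> bound e" "bound d \<noteq> counter e"
  unfolding rv_def counter_def bound_def by presburger+

text \<open>What enclosing loops rely on: code at depth \<open>d\<close> leaves the registers of all
  shallower depths alone.\<close>

definition same_loops :: "nat \<Rightarrow> config \<Rightarrow> config \<Rightarrow> bool" where
  "same_loops d z z' \<longleftrightarrow> (\<forall>e<d. reg z' (counter e) = reg z (counter e) \<and> reg z' (bound e) = reg z (bound e))"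

lemma same_loops_refl [simp]: "same_loops d z z"
  by (simp add: same_loops_def)

lemma same_loops_trans: "same_loops d z z' \<Longrightarrow> same_loops d z' z'' \<Longrightarrow> same_loops d z z''"
  by (simp add: same_loops_def)

definition implements :: "instr list \<Rightarrow> nat \<Rightarrow> nat \<Rightarrow> com \<Rightarrow> nat \<Rightarrow> st \<Rightarrow> config \<Rightarrow> bool" where
  "implements P W K c d s z \<longleftrightarrow> (\<exists>t z'. t \<le> cost c s \<and> reach P W t z z' \<and> pc z' = pc z + len c \<and>
     sim K (run c s) z' \<and> same_loops d z z')"

lemma cbnd_reach: "reach P W t z z' \<Longrightarrow> cbnd W z'"
  by (auto simp: reach_def)

lemma implementsI:
  "reach P W t z z' \<Longrightarrow> t \<le> cost c s \<Longrightarrow> pc z' = pc z + len c \<Longrightarrow> sim K (run c s) z' \<Longrightarrow>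
    same_loops d z z' \<Longrightarrow> implements P W K c d s z"
  unfolding implements_def by blast

lemma sim_setv: "sim K s z \<Longrightarrow> sim K (setv r v s) (set_reg (rv r) v z)"
  by (auto simp: sim_def setv_def)

lemma sim_pc [simp]: "sim K s (z\<lparr>pc := p\<rparr>) \<longleftrightarrow> sim K s z"
  by (simp add: sim_def)

lemma addr_inj:
  fixes i j a b K :: nat
  assumes "i * K + a = j * K + b" "a < K" "b < K"
  shows "i = j \<and> a = b"
  using assms by (metis add.commute div_mult_self1 div_less add_0 mod_less mod_mult_self1 less_nat_zero_code)

lemma sim_seta:
  assumes "sim K s z" "a < K"
  shows "sim K (seta a i v s) (z\<lparr>pc := p, mem := (mem z)(lim s + i * K + a := v)\<rparr>)"
proof -
  have "((mem z)(lim s + i * K + a := v)) (lim s + j * K + b) = arr (seta a i v s) b j"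
    if "b < K" for j b
    using that assms addr_inj[of j K b i a] unfolding sim_def seta_def by (cases "j = i \<and> b = a") auto
  moreover have "((mem z)(lim s + i * K + a := v)) j = io s j" if "j < lim s" for j
    using that assms(1) unfolding sim_def by auto
  ultimately show ?thesis using assms(1) unfolding sim_def by (simp add: seta_def)
qed

lemma sim_outv:
  assumes "sim K s z" "i < lim s"
  shows "sim K (outv i v s) (z\<lparr>pc := p, mem := (mem z)(i := v)\<rparr>)"
  using assms unfolding sim_def outv_def by auto

lemma reach_addr:
  assumes "code_at P (pc z) (addr_code a i)" "cbnd W z" "sim K s z" "a < K"
    "K * (var s i) + K + lim s \<le> W"
  shows "\<exists>z'. reach P W 4 z z' \<and> sim K s z' \<and> pc z' = pc z + 4 \<and> reg z' 5 = lim s + var s i * K + a \<and>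
    same_loops d z z' \<and> mem z' = mem z"
proof -
  let ?z1 = "set_reg 5 (var s i * K) z"
  let ?z2 = "set_reg 6 a ?z1"
  let ?z3 = "set_reg 5 (var s i * K + a) ?z2"
  let ?z4 = "set_reg 5 (var s i * K + a + lim s) ?z3"
  have r: "reg z (rv i) = var s i" "reg z 3 = K" "reg z 4 = lim s" using assms(3) by (auto simp: sim_def)
  have c: "cbnd W ?z1" "cbnd W ?z2" "cbnd W ?z3" "cbnd W ?z4"
    using assms by (auto intro!: cbnd_set_reg simp: mult.commute)
  have "reach P W (Suc (Suc (Suc (Suc 0)))) z ?z4"
    using assms(1) r unfolding addr_code_def
    by (intro reach_Suc reach_refl c assms(2)) (use c assms(2) in \<open>auto simp: reach_refl intro!: reach_Suc\<close>)
  then have "reach P W 4 z ?z4" by (simp add: numeral_eq_Suc)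
  moreover have "sim K s ?z4" using assms(3) by (auto simp: sim_def)
  ultimately show ?thesis
    by (intro exI[of _ ?z4]) (simp add: same_loops_def)
qed

text \<open>By \<open>bnd_run\<close> every value is at most \<open>M + cost c s\<close>. An array
  address exceeds \<open>lim s\<close> by less than the stride times an index plus one, so
  \<open>K * (M + cost c s + 1) + lim s\<close> bounds all addresses; this is what \<open>W\<close>
  must accommodate.\<close>

theorem comp_correct:
  assumes "code_at P (pc z) (comp c (pc z) d)" "sim K s z" "cbnd W z" "bnd M s" "consts_le K c"
    "consts_le M c" "K * (M + cost c s + 1) + lim s \<le> W" "K > 0"
  shows "implements P W K c d s z"
  using assms
proof (induction c arbitrary: d s z M)
  case CSkip
  then show ?case by (intro implementsI[OF reach_refl]) auto
next
  case (CConst r c)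
  have "c \<le> W" using CConst.prems by (auto intro: order_trans[OF _ CConst.prems(7)])
  then have total: "reach P W (Suc 0) z (set_reg (rv r) c z)"
    using CConst.prems by (intro reach_Suc) (auto intro!: reach_refl)
  show ?case using sim_setv[OF CConst.prems(2)]
    by (intro implementsI[OF total]) (auto simp: same_loops_def)
next
  case (CMov r a)
  have "reg z (rv a) = var s a" using CMov.prems(2) by (simp add: sim_def)
  moreover have "reg z (rv a) \<le> W" using CMov.prems(3) by (simp add: cbnd_def)
  ultimately have total: "reach P W (Suc 0) z (set_reg (rv r) (var s a) z)"
    using CMov.prems by (intro reach_Suc) (auto intro!: reach_refl)
  show ?case using sim_setv[OF CMov.prems(2)]
    by (intro implementsI[OF total]) (auto simp: same_loops_def)
next
  case (CInc r)
  have "var s r \<le> M" using CInc.prems(4) by (simp add: bnd_def)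
  also have "M + 1 \<le> K * (M + 1 + 1)" using \<open>K > 0\<close> by (cases K) auto
  finally have "var s r + 1 \<le> W" using CInc.prems(7) by simp
  moreover have "reg z (rv r) = var s r" "reg z 2 = 1" using CInc.prems(2) by (auto simp: sim_def)
  ultimately have total: "reach P W (Suc 0) z (set_reg (rv r) (Suc (var s r)) z)"
    using CInc.prems by (intro reach_Suc) (auto intro!: reach_refl)
  show ?case using sim_setv[OF CInc.prems(2)]
    by (intro implementsI[OF total]) (auto simp: same_loops_def)
next
  case (CDec r)
  have "reg z (rv r) = var s r" "reg z 2 = 1" using CDec.prems(2) by (auto simp: sim_def)
  moreover have "reg z (rv r) \<le> W" using CDec.prems(3) by (simp add: cbnd_def)
  ultimately have total: "reach P W (Suc 0) z (set_reg (rv r) (var s r - 1) z)"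
    using CDec.prems by (intro reach_Suc) (auto intro!: reach_refl)
  show ?case using sim_setv[OF CDec.prems(2)]
    by (intro implementsI[OF total]) (auto simp: same_loops_def)
next
  case (CLd r a i)
  have "K * var s i \<le> K * M" using CLd.prems(4) by (simp add: bnd_def)
  then have w: "K * var s i + K + lim s \<le> W"
    using CLd.prems(7) unfolding cost.simps add_mult_distrib2 by linarith
  obtain z1 where z1: "reach P W 4 z z1" "sim K s z1" "pc z1 = pc z + 4"
    "reg z1 5 = lim s + var s i * K + a" "same_loops d z z1"
    using reach_addr[of P z a i W K s d] CLd.prems w by auto
  have c1: "cbnd W z1" using z1(1) cbnd_reach by blast
  have m: "mem z1 (reg z1 5) = arr s a (var s i)" using z1(2,4) CLd.prems(5) by (simp add: sim_def)
  have ins: "pc z1 < length P" "P ! pc z1 = Load (rv r) 5"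
    using CLd.prems(1) z1(3) by (simp_all add: addr_code_def eval_nat_numeral)
  have "mem z1 (reg z1 5) \<le> W" using c1 by (simp add: cbnd_def)
  then have "reach P W (Suc 0) z1 (set_reg (rv r) (arr s a (var s i)) z1)"
    using c1 m ins by (intro reach_Suc) (auto intro!: reach_refl)
  note total = reach_trans[OF z1(1) this]
  show ?case using sim_setv[OF z1(2)] z1(3,5)
    by (intro implementsI[OF total]) (auto simp: same_loops_def)
next
  case (CSt a i v)
  have "K * var s i \<le> K * M" using CSt.prems(4) by (simp add: bnd_def)
  then have w: "K * var s i + K + lim s \<le> W"
    using CSt.prems(7) unfolding cost.simps add_mult_distrib2 by linarith
  obtain z1 where z1: "reach P W 4 z z1" "sim K s z1" "pc z1 = pc z + 4"
    "reg z1 5 = lim s + var s i * K + a" "same_loops d z z1"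
    using reach_addr[of P z a i W K s d] CSt.prems w by auto
  have c1: "cbnd W z1" using z1(1) cbnd_reach by blast
  let ?z2 = "z1\<lparr>pc := Suc (pc z1), mem := (mem z1)(lim s + var s i * K + a := var s v)\<rparr>"
  have v: "reg z1 (rv v) = var s v" using z1(2) by (simp add: sim_def)
  then have c2: "cbnd W ?z2" using c1 unfolding cbnd_def by (simp, metis)
  have ins: "pc z1 < length P" "P ! pc z1 = Store 5 (rv v)"
    using CSt.prems(1) z1(3) by (simp_all add: addr_code_def eval_nat_numeral)
  have "exec (Store 5 (rv v)) z1 = ?z2" using z1(4) v by simp
  then have "reach P W (Suc 0) z1 ?z2"
    using c1 c2 ins by (intro reach_Suc) (auto intro!: reach_refl simp del: exec.simps)
  note total = reach_trans[OF z1(1) this]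
  show ?case
    using sim_seta[OF z1(2), of a "var s i" "var s v" "Suc (pc z1)"] z1(3,5) CSt.prems(5)
    by (intro implementsI[OF total]) (auto simp: same_loops_def)
next
  case (CIn r i)
  have r: "reg z (rv i) = var s i" "reg z 4 = lim s" using CIn.prems(2) by (auto simp: sim_def)
  show ?case
  proof (cases "var s i < lim s")
    case True
    let ?z1 = "z\<lparr>pc := Suc (Suc (Suc (pc z)))\<rparr>"
    have m: "mem z (var s i) = io s (var s i)" using CIn.prems(2) True by (auto simp: sim_def)
    have "mem z (var s i) \<le> W" using CIn.prems(3) by (simp add: cbnd_def)
    note m = m this[unfolded m]
    have total: "reach P W (Suc (Suc 0)) z (set_reg (rv r) (io s (var s i)) ?z1)"
      using CIn.prems r True m by (intro reach_Suc) (auto intro!: reach_refl)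
    show ?thesis using sim_setv[of K s ?z1] CIn.prems(2) True
      by (intro implementsI[OF total]) (auto simp: same_loops_def)
  next
    case False
    let ?z1 = "set_reg (rv r) 0 (z\<lparr>pc := Suc (pc z)\<rparr>)\<lparr>pc := Suc (Suc (Suc (Suc (pc z))))\<rparr>"
    have total: "reach P W (Suc (Suc (Suc 0))) z ?z1"
      using CIn.prems r False by (intro reach_Suc) (auto intro!: reach_refl)
    show ?thesis using sim_setv[of K s "z\<lparr>pc := Suc (pc z)\<rparr>"] CIn.prems(2) False
      by (intro implementsI[OF total]) (auto simp: same_loops_def)
  qed
next
  case (COut i v)
  have r: "reg z (rv i) = var s i" "reg z 4 = lim s" "reg z (rv v) = var s v"
    using COut.prems(2) by (auto simp: sim_def)
  show ?case
  proof (cases "var s i < lim s")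
    case True
    let ?z1 = "z\<lparr>pc := Suc (Suc (Suc (pc z))), mem := (mem z)(var s i := var s v)\<rparr>"
    have "cbnd W ?z1" using COut.prems(3) r unfolding cbnd_def by (simp, metis)
    then have total: "reach P W (Suc (Suc 0)) z ?z1"
      using COut.prems r True by (intro reach_Suc) (auto intro!: reach_refl)
    show ?thesis using sim_outv[OF COut.prems(2) True]
      by (intro implementsI[OF total]) (auto simp: same_loops_def)
  next
    case False
    have total: "reach P W (Suc (Suc 0)) z (z\<lparr>pc := Suc (Suc (Suc (pc z)))\<rparr>)"
      using COut.prems r False by (intro reach_Suc) (auto intro!: reach_refl)
    show ?thesis using COut.prems(2) False
      by (intro implementsI[OF total]) (auto simp: same_loops_def outv_def)
  qed
next
  case (CSeq c e)
  have "K * (M + cost c s + 1) \<le> K * (M + cost (CSeq c e) s + 1)" by (intro mult_le_mono2) simp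
  then have "K * (M + cost c s + 1) + lim s \<le> W" using CSeq.prems(7) by linarith
  then have "implements P W K c d s z"
    using CSeq.prems by (intro CSeq.IH(1)[where M = M]) auto
  then obtain t1 z1 where z1: "t1 \<le> cost c s" "reach P W t1 z z1" "pc z1 = pc z + len c"
    "sim K (run c s) z1" "same_loops d z z1" unfolding implements_def by blast
  have "implements P W K e d (run c s) z1"
    using CSeq.prems z1 cbnd_reach[OF z1(2)] bnd_run[of M s c] consts_le_mono[of M e "M + cost c s"]
    by (intro CSeq.IH(2)[where M = "M + cost c s"]) (auto simp: add.assoc)
  then obtain t2 z2 where z2: "t2 \<le> cost e (run c s)" "reach P W t2 z1 z2" "pc z2 = pc z1 + len e"
    "sim K (run e (run c s)) z2" "same_loops d z1 z2" unfolding implements_def by blast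
  show ?case using z1 z2 same_loops_trans
    by (intro implementsI[OF reach_trans[OF z1(2) z2(2)]]) auto
next
  case (CIf x y c e)
  have r: "reg z (rv x) = var s x" "reg z (rv y) = var s y" using CIf.prems(2) by (auto simp: sim_def)
  show ?case
  proof (cases "var s x < var s y")
    case True
    let ?z1 = "z\<lparr>pc := Suc (Suc (pc z + len e))\<rparr>"
    have st: "reach P W (Suc 0) z ?z1"
      using CIf.prems r True by (intro reach_Suc) (auto intro!: reach_refl)
    have "K * (M + cost c s + 1) \<le> K * (M + cost (CIf x y c e) s + 1)"
      using True by (intro mult_le_mono2) simp
    then have "K * (M + cost c s + 1) + lim s \<le> W" using CIf.prems(7) by linarith
    then have "implements P W K c d s ?z1"
      using CIf.prems by (intro CIf.IH(1)[where M = M]) (auto simp: add.assoc)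
    then obtain t1 z1 where z1: "t1 \<le> cost c s" "reach P W t1 ?z1 z1" "pc z1 = pc ?z1 + len c"
      "sim K (run c s) z1" "same_loops d ?z1 z1" unfolding implements_def by blast
    show ?thesis using z1 True
      by (intro implementsI[OF reach_trans[OF st z1(2)]]) (auto simp: same_loops_def)
  next
    case False
    let ?z1 = "z\<lparr>pc := Suc (pc z)\<rparr>"
    have st: "reach P W (Suc 0) z ?z1"
      using CIf.prems r False by (intro reach_Suc) (auto intro!: reach_refl)
    have "K * (M + cost e s + 1) \<le> K * (M + cost (CIf x y c e) s + 1)"
      using False by (intro mult_le_mono2) simp
    then have "K * (M + cost e s + 1) + lim s \<le> W" using CIf.prems(7) by linarith
    then have "implements P W K e d s ?z1"
      using CIf.prems by (intro CIf.IH(2)[where M = M]) (auto simp: add.assoc)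
    then obtain t1 z1 where z1: "t1 \<le> cost e s" "reach P W t1 ?z1 z1" "pc z1 = pc ?z1 + len e"
      "sim K (run e s) z1" "same_loops d ?z1 z1" unfolding implements_def by blast
    let ?z2 = "z1\<lparr>pc := Suc (Suc (pc z + len e + len c))\<rparr>"
    have "reach P W (Suc 0) z1 ?z2"
      using CIf.prems(1) z1(3) cbnd_reach[OF z1(2)] by (intro reach_Suc) (auto intro!: reach_refl)
    note total = reach_trans[OF st reach_trans[OF z1(2) this]]
  show ?thesis using z1 False
      by (intro implementsI[OF total]) (auto simp: same_loops_def)
  qed
next
  case (CFor v n c)
  let ?f = "\<lambda>k s. run c (setv v k s)"
  let ?L = "\<lambda>k. loop ?f k s"
  let ?N = "var s n"
  let ?T = "\<lambda>k. \<Sum>j<k. 4 + cost c (setv v j (?L j))"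
  have NM: "?N \<le> M" using CFor.prems(4) by (simp add: bnd_def)
  have WM: "M + cost (CFor v n c) s + 1 \<le> W"
  proof -
    have "1 * (M + cost (CFor v n c) s + 1) \<le> K * (M + cost (CFor v n c) s + 1)"
      using \<open>K > 0\<close> by (intro mult_le_mono1) simp
    also have "\<dots> \<le> W" using CFor.prems(7) by (rule add_leD1)
    finally show ?thesis by (simp only: mult_1)
  qed
  note code = CFor.prems(1)
  let ?z2 = "set_reg (bound d) ?N (set_reg (counter d) 0 z)"
  have rn: "reg z (rv n) = ?N" using CFor.prems(2) by (simp add: sim_def)
  have st: "reach P W (Suc (Suc 0)) z ?z2"
    using code rn NM WM CFor.prems(3) by (intro reach_Suc) (auto intro!: reach_refl)
  have TM: "?T k \<le> ?T ?N" if "k \<le> ?N" for k using that by (intro sum_mono2) auto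
  have bL: "bnd (M + ?T k) (?L k)" if "k \<le> ?N" for k
    using that
  proof (induction k)
    case 0
    then show ?case using CFor.prems(4) by simp
  next
    case (Suc k)
    have "bnd (M + ?T k) (setv v k (?L k))" using Suc NM by (intro bnd_setv) auto
    then have "bnd (M + ?T k + cost c (setv v k (?L k))) (?L (Suc k))"
      using CFor.prems(6) consts_le_mono[of M c "M + ?T k"] bnd_run by simp
    then show ?case by (rule bnd_mono) simp
  qed
  \<comment> \<open>The invariant belongs to the test of the loop, two instructions behind its
    entry, to which the code jumps back after each round.\<close>
  have it: "\<exists>t z'. t \<le> ?T k \<and> reach P W t ?z2 z' \<and> pc z' = Suc (Suc (pc z)) \<and> sim K (?L k) z' \<and>
      reg z' (counter d) = k \<and> reg z' (bound d) = ?N \<and> same_loops d z z'" if "k \<le> ?N" for k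
    using that
  proof (induction k)
    case 0
    have "sim K s ?z2" using CFor.prems(2) by (auto simp: sim_def)
    then show ?case using cbnd_reach[OF st] by (auto intro!: exI[of _ 0] exI[of _ ?z2] reach_refl simp: same_loops_def)
  next
    case (Suc k)
    then obtain t z' where z': "t \<le> ?T k" "reach P W t ?z2 z'" "pc z' = Suc (Suc (pc z))" "sim K (?L k) z'"
      "reg z' (counter d) = k" "reg z' (bound d) = ?N" "same_loops d z z'" by auto
    have kN: "k < ?N" using Suc.prems by simp
    have c': "cbnd W z'" using cbnd_reach[OF z'(2)] .
    let ?z3 = "set_reg (rv v) k (z'\<lparr>pc := Suc (Suc (Suc (Suc (pc z))))\<rparr>)"
    have s3: "reach P W (Suc (Suc 0)) z' ?z3"
      using code z'(3,5,6) kN NM WM c' by (intro reach_Suc) (auto intro!: reach_refl)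
    have sim3: "sim K (setv v k (?L k)) ?z3" using sim_setv[of K "?L k" "z'\<lparr>pc := Suc (Suc (Suc (Suc (pc z))))\<rparr>"] z'(4) by simp
    have l: "lim (?L k) = lim s" by (intro lim_loop) simp
    have "?T (Suc k) \<le> ?T ?N" using TM[OF Suc.prems] .
    then have "K * (M + ?T k + cost c (setv v k (?L k)) + 1) \<le> K * (M + cost (CFor v n c) s + 1)"
      by (intro mult_le_mono2) simp
    then have "K * (M + ?T k + cost c (setv v k (?L k)) + 1) + lim s \<le> W"
      using CFor.prems(7) by linarith
    then have "implements P W K c (Suc d) (setv v k (?L k)) ?z3"
      using code sim3 cbnd_reach[OF s3] CFor.prems l bL[of k] kN NM consts_le_mono[of M c "M + ?T k"]
      by (intro CFor.IH[where M = "M + ?T k"] bnd_setv) (auto simp: add.assoc numeral_eq_Suc)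
    then obtain t4 z4 where z4: "t4 \<le> cost c (setv v k (?L k))" "reach P W t4 ?z3 z4"
      "pc z4 = pc ?z3 + len c" "sim K (?L (Suc k)) z4" "same_loops (Suc d) ?z3 z4"
      unfolding implements_def by auto
    have r4: "reg z4 (counter d) = k" "reg z4 (bound d) = ?N" "reg z4 2 = 1"
      using z4(4,5) z'(5,6) by (auto simp: same_loops_def sim_def)
    let ?z5 = "set_reg (counter d) (Suc k) z4\<lparr>pc := Suc (Suc (pc z))\<rparr>"
    have s5: "reach P W (Suc (Suc 0)) z4 ?z5"
      using code z4(3) r4 cbnd_reach[OF z4(2)] kN NM WM
      by (intro reach_Suc) (auto intro!: reach_refl simp: add.assoc)
    have "sim K (?L (Suc k)) ?z5" using z4(4) by (auto simp: sim_def)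
    moreover have "same_loops d z ?z5" using z4(5) z'(7) by (auto simp: same_loops_def)
    moreover have "reach P W (t + (2 + (t4 + 2))) ?z2 ?z5"
      using reach_trans[OF z'(2) reach_trans[OF s3 reach_trans[OF z4(2) s5]]] by (simp add: numeral_eq_Suc)
    moreover have "t + (2 + (t4 + 2)) \<le> ?T (Suc k)" using z'(1) z4(1) by simp
    ultimately show ?case using r4
      by (intro exI[of _ "t + (2 + (t4 + 2))"] exI[of _ ?z5]) auto
  qed
  obtain t z' where z': "t \<le> ?T ?N" "reach P W t ?z2 z'" "pc z' = Suc (Suc (pc z))" "sim K (?L ?N) z'"
      "reg z' (counter d) = ?N" "reg z' (bound d) = ?N" "same_loops d z z'" using it[of ?N] by auto
  let ?z6 = "z'\<lparr>pc := Suc (Suc (Suc (Suc (Suc (Suc (Suc (pc z + len c)))))))\<rparr>"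
  have "reach P W (Suc (Suc 0)) z' ?z6"
    using code z'(3,5,6) cbnd_reach[OF z'(2)] by (intro reach_Suc) (auto intro!: reach_refl)
  note total = reach_trans[OF st reach_trans[OF z'(2) this]]
  show ?case
    using z' by (intro implementsI[OF total]) (auto simp: same_loops_def)
qed

text \<open>\<open>lim\<close> leaves room for cell 0, the input in the cells from 1 to
  \<open>n\<close>, and \<open>k\<close> output arrays behind it.\<close>

definition init_st :: "nat \<Rightarrow> nat \<Rightarrow> (nat \<Rightarrow> nat) \<Rightarrow> st" where
  "init_st k n \<sigma> = \<lparr>var = (\<lambda>_. 0)(0 := n), arr = (\<lambda>_ _. 0),
     io = (\<lambda>i. if i \<in> {1..n} then \<sigma> i else 0), lim = Suc k * n + 1\<rparr>"

text \<open>The prologue has six instructions, hence the start address 6; it sets up variable 0 and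
  the three registers reserved by \<open>sim\<close>. The output starts right behind the input, so
  register 1 receives \<open>n\<close>.\<close>

definition program :: "nat \<Rightarrow> nat \<Rightarrow> com \<Rightarrow> instr list" where
  "program k K c = [Move (rv 0) 0, Const 2 1, Const 3 K, Const 5 (Suc k), Mult 4 5 0, Add 4 4 2] @
     comp c 6 0 @ [Const 0 k, Move 1 (rv 0)]"

theorem program_runs:
  assumes "consts_le K c" "K > 0"
  obtains C' where "\<And>n \<sigma>. n \<ge> 1 \<Longrightarrow> \<sigma> permutes {1..n} \<Longrightarrow> cost c (init_st k n \<sigma>) \<le> C * n \<Longrightarrow>
    var (run c (init_st k n \<sigma>)) 0 = n \<Longrightarrow>
    \<exists>z. runs_to (program k K c) (input_config n \<sigma>) (C' * n) (C' * n) z \<and> reg z 0 = k \<and> reg z 1 = n \<and>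
      (\<forall>i \<le> Suc k * n. mem z i = io (run c (init_st k n \<sigma>)) i)"
proof
  let ?P = "program k K c"
  \<comment> \<open>The summands pay, in this order, for the addresses of the arrays, for the cells
    below \<open>lim\<close>, for the constant \<open>k\<close>, for the eight instructions of
    prologue and epilogue, and for the running time.\<close>
  let ?C = "K * (2 + K + C) + Suc k + 1 + k + 8 + C"
  fix n \<sigma>
  assume n: "n \<ge> 1" and perm: "\<sigma> permutes {1..n}" and cost: "cost c (init_st k n \<sigma>) \<le> C * n"
    and n0: "var (run c (init_st k n \<sigma>)) 0 = n"
  let ?s = "init_st k n \<sigma>" and ?z = "input_config n \<sigma>"
  define W where "W = ?C * n"
  have e: "W = K * (2 * n + K * n + C * n) + Suc k * n + n + k * n + 8 * n + C * n"
    unfolding W_def by (simp add: algebra_simps)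
  have kn1: "k \<le> k * n" "K \<le> K * n" using n by auto
  then have "n + K + C * n + 1 \<le> 2 * n + K * n + C * n" using n by linarith
  then have "K * (n + K + C * n + 1) \<le> K * (2 * n + K * n + C * n)" by (rule mult_le_mono2)
  note kn = kn1 this
  then have w: "1 \<le> W" "K \<le> W" "Suc k \<le> W" "Suc k * n + 1 \<le> W" "n \<le> W"
    and w': "K * (n + K + C * n + 1) + (Suc k * n + 1) \<le> W"
  proof -
    have KX: "K \<le> K * (2 * n + K * n + C * n)" using n by simp
    show "1 \<le> W" "K \<le> W" "Suc k \<le> W" "Suc k * n + 1 \<le> W" "n \<le> W"
      "K * (n + K + C * n + 1) + (Suc k * n + 1) \<le> W"
      using e kn n KX unfolding mult_Suc by linarith+
  qed
  have sb: "\<sigma> i \<le> n" if "i \<in> {1..n}" for i using perm that by (metis atLeastAtMost_iff permutes_in_image)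
  have cb: "cbnd W ?z" using w order_trans[OF sb w(5)] by (auto simp: cbnd_def input_config_def)
  define z1 where "z1 = fold exec [Move (rv 0) 0, Const 2 1, Const 3 K, Const 5 (Suc k), Mult 4 5 0, Add 4 4 2] ?z"
  have pcz: "pc ?z = 0" "reg ?z = (\<lambda>_. 0)(0 := n)" by (simp_all add: input_config_def)
  have neq: "rv 0 \<noteq> 0" "0 \<noteq> rv 0" "rv 0 \<noteq> Suc 0" by (simp_all add: rv_def)
  have r1: "reach ?P W (Suc (Suc (Suc (Suc (Suc (Suc 0)))))) ?z z1"
    using w cb pcz neq unfolding z1_def program_def by (intro reach_Suc) (auto intro!: reach_refl)
  have rv0: "rv x = 0 \<longleftrightarrow> False" "rv x = rv 0 \<longleftrightarrow> x = 0" for x by (simp_all add: rv_def)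
  have z1: "pc z1 = 6" "reg z1 = ((\<lambda>_. 0)(0 := n))(rv 0 := n, 2 := 1, 3 := K, 5 := Suc k, 4 := Suc k * n + 1)"
    "mem z1 = mem ?z"
    unfolding z1_def using neq pcz by (simp_all add: fun_eq_iff)
  have "sim K ?s z1"
    using z1 unfolding sim_def by (auto simp: init_st_def input_config_def rv0)
  moreover have "cbnd W z1" using cbnd_reach[OF r1] .
  moreover have "bnd (n + K) ?s" using sb by (auto simp: bnd_def init_st_def intro: trans_le_add1)
  moreover have "K * (n + K + cost c ?s + 1) + lim ?s \<le> W"
  proof -
    have "K * (n + K + cost c ?s + 1) \<le> K * (n + K + C * n + 1)" using cost by (intro mult_le_mono2) simp
    moreover have "lim ?s = Suc k * n + 1" by (simp add: init_st_def)
    ultimately show ?thesis using w' by linarith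
  qed
  moreover have "code_at ?P (pc z1) (comp c (pc z1) 0)"
    unfolding z1(1) code_at_def program_def by (auto simp: nth_append)
  ultimately have "implements ?P W K c 0 ?s z1"
    using assms consts_le_mono[of K c "n + K"] by (intro comp_correct[where M = "n + K"]) auto
  then obtain t z2 where z2: "t \<le> cost c ?s" "reach ?P W t z1 z2" "pc z2 = pc z1 + len c"
    "sim K (run c ?s) z2" unfolding implements_def by blast
  let ?z3 = "set_reg 1 n (set_reg 0 k z2)"
  have c: "code_at ?P (pc z2) [Const 0 k, Move 1 (rv 0)]"
    unfolding z1(1) z2(3) code_at_def program_def by (auto simp: nth_append less_Suc_eq)
  have "reg z2 (rv 0) = n" using z2(4) n0 by (simp add: sim_def)
  then have "reach ?P W (Suc (Suc 0)) z2 ?z3"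
    using c w neq cbnd_reach[OF z2(2)] by (intro reach_Suc) (auto intro!: reach_refl)
  from reach_trans[OF r1 reach_trans[OF z2(2) this]]
  have r: "reach ?P W (8 + t) ?z ?z3" by (simp add: eval_nat_numeral)
  have t8: "8 + t \<le> W"
  proof -
    have "8 + t \<le> 8 * n + C * n" using z2(1) cost n by linarith
    also have "\<dots> \<le> W" unfolding e by linarith
    finally show ?thesis .
  qed
  have "halted ?P ?z3" using z2(3) z1(1) by (simp add: halted_def program_def)
  then have "runs_to ?P ?z W W ?z3"
    using r t8 unfolding runs_to_def reach_def cbnd_def by blast
  moreover have "mem ?z3 i = io (run c ?s) i" if "i \<le> Suc k * n" for i
    using z2(4) that by (simp add: sim_def init_st_def)
  ultimately show "\<exists>z. runs_to ?P ?z (?C * n) (?C * n) z \<and> reg z 0 = k \<and> reg z 1 = n \<and>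
      (\<forall>i \<le> Suc k * n. mem z i = io (run c ?s) i)"
    unfolding W_def by (intro exI[of _ ?z3]) auto
qed

section \<open>Coarsening a matrix of cells\<close>

text \<open>Labels from \<open>D\<close> on are temporary. Each target lies outside the labels in
  use at that moment, so every move is a plain renaming and no trees are united.\<close>

primrec ren :: "nat \<Rightarrow> nat \<Rightarrow> nat \<Rightarrow> tm \<Rightarrow> tm" where
  "ren D x 0 t = t"
| "ren D x (Suc k) t = Mv k (D + x + k) (ren D x k t)"

lemma ord_ren [simp]: "ord (ren D x k t) = ord t"
  by (induction k) auto

lemma cx_ren [simp]: "cx M (ren D x k t) = cx M t"
  by (induction k) auto

lemma ren_props:
  assumes "wft t" "dm t = {..<n}" "n \<le> D" "k \<le> n"
  shows "wft (ren D x k t)" "dm (ren D x k t) = {k..<n} \<union> {D + x..<D + x + k}"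
    "\<And>j. j < k \<Longrightarrow> ps (ren D x k t) (D + x + j) = ps t j"
    "\<And>j. k \<le> j \<Longrightarrow> j < n \<Longrightarrow> ps (ren D x k t) j = ps t j"
proof -
  have "wft (ren D x k t) \<and> dm (ren D x k t) = {k..<n} \<union> {D + x..<D + x + k} \<and>
    (\<forall>j<k. ps (ren D x k t) (D + x + j) = ps t j) \<and> (\<forall>j. k \<le> j \<longrightarrow> j < n \<longrightarrow> ps (ren D x k t) j = ps t j)"
    using assms(4)
  proof (induction k)
    case 0
    then show ?case using assms(1,2) by (simp add: lessThan_atLeast0)
  next
    case (Suc k)
    let ?u = "ren D x k t"
    have u: "wft ?u" "dm ?u = {k..<n} \<union> {D + x..<D + x + k}"
      "\<And>j. j < k \<Longrightarrow> ps ?u (D + x + j) = ps t j" "\<And>j. k \<le> j \<Longrightarrow> j < n \<Longrightarrow> ps ?u j = ps t j"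
      using Suc.IH Suc_leD[OF Suc.prems] by blast+
    have kn: "k < n" using Suc.prems by simp
    have "D + x + k \<notin> dm ?u" unfolding u(2) using kn assms(3) by auto
    then have N: "ps ?u (D + x + k) = None" using dom_ps[OF u(1)] by auto
    have "k \<in> dm ?u" "k \<noteq> D + x + k" unfolding u(2) using kn assms(3) by simp_all
    moreover have "insert (D + x + k) (({k..<n} \<union> {D + x..<D + x + k}) - {k}) =
        {Suc k..<n} \<union> {D + x..<D + x + Suc k}"
    proof -
      have "{k..<n} = insert k {Suc k..<n}" "{D + x..<D + x + Suc k} = insert (D + x + k) {D + x..<D + x + k}"
        using kn by auto
      moreover have "k \<notin> {D + x..<D + x + k}" "k \<notin> {Suc k..<n}" using kn assms(3) by simp_all
      ultimately show ?thesis by blast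
    qed
    ultimately have "wft (Mv k (D + x + k) ?u)" "dm (Mv k (D + x + k) ?u) = {Suc k..<n} \<union> {D + x..<D + x + Suc k}"
      using u(1) unfolding wft.simps dm.simps u(2)[symmetric] by (simp_all only: if_True simp_thms)
    moreover have m: "ps (Mv k (D + x + k) ?u) = (ps ?u)(k := None, D + x + k := ps ?u k)"
      using N by (simp add: move_def)
    have "\<forall>j<Suc k. ps (Mv k (D + x + k) ?u) (D + x + j) = ps t j"
    proof (intro allI impI)
      fix j assume "j < Suc k"
      then consider "j = k" | "j < k" "D + x + j \<noteq> k" using kn assms(3) by linarith
      then show "ps (Mv k (D + x + k) ?u) (D + x + j) = ps t j"
      proof cases
        case 1
        then show ?thesis unfolding m using u(4)[of k] kn by simp
      next
        case 2
        then show ?thesis unfolding m using u(3)[of j] by simp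
      qed
    qed
    moreover have "\<forall>j. Suc k \<le> j \<longrightarrow> j < n \<longrightarrow> ps (Mv k (D + x + k) ?u) j = ps t j"
    proof (intro allI impI)
      fix j assume j: "Suc k \<le> j" "j < n"
      then have "j \<noteq> k" "j \<noteq> D + x + k" using assms(3) by linarith+
      then show "ps (Mv k (D + x + k) ?u) j = ps t j" unfolding m using u(4)[of j] j by simp
    qed
    ultimately show ?case by (simp only: ren.simps simp_thms)
  qed
  then show "wft (ren D x k t)" "dm (ren D x k t) = {k..<n} \<union> {D + x..<D + x + k}"
    "\<And>j. j < k \<Longrightarrow> ps (ren D x k t) (D + x + j) = ps t j"
    "\<And>j. k \<le> j \<Longrightarrow> j < n \<Longrightarrow> ps (ren D x k t) j = ps t j" by auto
qed

definition side :: "nat \<Rightarrow> nat \<Rightarrow> (nat \<Rightarrow> nat) \<Rightarrow> (nat \<Rightarrow> tm) \<Rightarrow> bool" where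
  "side D m cnt X \<longleftrightarrow> (\<forall>c<m. wft (X c) \<and> cx D (X c) \<and> dm (X c) = {..<cnt c} \<and> cnt c \<le> D)"

text \<open>\<open>acc\<close> counts the labels of the last of the \<open>G\<close> groups. The
  inequality is an amortised count: a group is opened only if its predecessor and the new column
  exceed \<open>D\<close> together, so each label is charged at most twice. The initial
  \<open>acc = D + 1\<close> forces the first column to open a group.\<close>

definition scanned ::
  "nat \<Rightarrow> (nat \<Rightarrow> nat) \<Rightarrow> (nat \<Rightarrow> tm) \<Rightarrow> nat \<Rightarrow> nat \<Rightarrow> nat \<Rightarrow> (nat \<Rightarrow> nat) \<Rightarrow> (nat \<Rightarrow> nat) \<Rightarrow> (nat \<Rightarrow> tm) \<Rightarrow> bool"
where
  "scanned D cnt X c G acc gc off Z \<longleftrightarrow>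
     G \<le> c \<and> (c = 0 \<longrightarrow> acc = D + 1) \<and> (0 < c \<longrightarrow> 0 < G \<and> acc \<le> D) \<and>
     G * (D + 1) + acc \<le> 2 * (\<Sum>i<c. cnt i) + D + 1 \<and>
     (\<forall>i<c. gc i < G \<and> off i + cnt i \<le> D \<and> (Suc (gc i) = G \<longrightarrow> off i + cnt i \<le> acc)) \<and>
     (\<forall>i j. i < j \<longrightarrow> j < c \<longrightarrow> gc i \<le> gc j) \<and>
     (\<forall>i j. i < j \<longrightarrow> j < c \<longrightarrow> gc i = gc j \<longrightarrow> off i + cnt i \<le> off j) \<and>
     (\<forall>g<G. wft (Z g) \<and> cx D (Z g) \<and> dm (Z g) = {D + off i + k | i k. i < c \<and> gc i = g \<and> k < cnt i}) \<and>
     (\<forall>i<c. \<forall>k<cnt i. ps (Z (gc i)) (D + off i + k) = ps (X i) k) \<and>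
     concat (map (\<lambda>g. ord (Z g)) [0..<G]) = concat (map (\<lambda>i. ord (X i)) [0..<c])"

lemma scanned_init: "scanned D cnt X 0 0 (D + 1) gc off Z"
  by (simp add: scanned_def)

lemma concat_map_upt_cong:
  "(\<And>i. i < n \<Longrightarrow> f i = g i) \<Longrightarrow> concat (map f [0..<n]) = concat (map g [0..<n])"
  by (metis atLeastLessThan_iff map_cong set_upt)

text \<open>The left side of the count grows by \<open>D + 1 + cnt c - acc\<close>, which is at most
  \<open>2 * cnt c\<close> since \<open>D < acc + cnt c\<close>.\<close>

lemma scanned_new:
  assumes "scanned D cnt X c G acc gc off Z" "wft (X c)" "cx D (X c)" "dm (X c) = {..<cnt c}"
    "cnt c \<le> D" "D < acc + cnt c"
  shows "scanned D cnt X (Suc c) (Suc G) (cnt c) (gc(c := G)) (off(c := 0)) (Z(G := ren D 0 (cnt c) (X c)))"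
proof -
  let ?R = "ren D 0 (cnt c) (X c)"
  note r = ren_props[where x = 0, OF assms(2,4,5) order_refl]
  note a = assms(1)[unfolded scanned_def]
  have 1: "\<forall>i<c. gc i < G" using a by blast
  have dR: "dm ?R = {D + k | k. k < cnt c}"
    unfolding r(2) using le_Suc_ex[of D] by fastforce
  have dZ: "dm (Z g) = {D + (off(c := 0)) i + k | i k. i < Suc c \<and> (gc(c := G)) i = g \<and> k < cnt i}" if "g < G" for g
  proof -
    have "dm (Z g) = {D + off i + k | i k. i < c \<and> gc i = g \<and> k < cnt i}" using a that by blast
    also have "\<dots> = {D + (off(c := 0)) i + k | i k. i < Suc c \<and> (gc(c := G)) i = g \<and> k < cnt i}"
      using that 1 by (intro Collect_cong ex_cong1) (auto simp: less_Suc_eq)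
    finally show ?thesis .
  qed
  have dG: "{D + (off(c := 0)) i + k | i k. i < Suc c \<and> (gc(c := G)) i = G \<and> k < cnt i} = {D + k | k. k < cnt c}"
    using 1 by (auto simp: less_Suc_eq)
  have dm: "\<forall>g<Suc G. dm ((Z(G := ?R)) g) =
      {D + (off(c := 0)) i + k | i k. i < Suc c \<and> (gc(c := G)) i = g \<and> k < cnt i}"
  proof (intro allI impI)
    fix g assume "g < Suc G"
    then consider "g < G" | "g = G" by linarith
    then show "dm ((Z(G := ?R)) g) =
      {D + (off(c := 0)) i + k | i k. i < Suc c \<and> (gc(c := G)) i = g \<and> k < cnt i}"
    proof cases
      case 1
      then show ?thesis using dZ by simp
    next
      case 2
      then show ?thesis using dR dG by simp
    qed
  qed
  have cc: "concat (map (\<lambda>g. ord ((Z(G := ?R)) g)) [0..<G]) = concat (map (\<lambda>g. ord (Z g)) [0..<G])"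
    by (intro concat_map_upt_cong) simp
  have p: "\<forall>i<Suc c. \<forall>k<cnt i. ps ((Z(G := ?R)) ((gc(c := G)) i)) (D + (off(c := 0)) i + k) = ps (X i) k"
    using a r(3) 1 by (auto simp: less_Suc_eq)
  have wc: "\<forall>g<Suc G. wft ((Z(G := ?R)) g) \<and> cx D ((Z(G := ?R)) g)"
    using a r(1) assms(3) by (auto simp: less_Suc_eq)
  show ?thesis
    unfolding scanned_def
  proof (intro conjI)
    show "Suc G * (D + 1) + cnt c \<le> 2 * (\<Sum>i<Suc c. cnt i) + D + 1" using a assms(6) by simp
    show "concat (map (\<lambda>g. ord ((Z(G := ?R)) g)) [0..<Suc G]) = concat (map (\<lambda>i. ord (X i)) [0..<Suc c])"
      using a cc by simp
    show "\<forall>g<Suc G. wft ((Z(G := ?R)) g) \<and> cx D ((Z(G := ?R)) g) \<and> dm ((Z(G := ?R)) g) =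
      {D + (off(c := 0)) i + k | i k. i < Suc c \<and> (gc(c := G)) i = g \<and> k < cnt i}"
      using wc dm by blast
    show "\<forall>i<Suc c. (gc(c := G)) i < Suc G \<and> (off(c := 0)) i + cnt i \<le> D \<and>
       (Suc ((gc(c := G)) i) = Suc G \<longrightarrow> (off(c := 0)) i + cnt i \<le> cnt c)"
      using a assms(5) by (auto simp: less_Suc_eq)
    show "\<forall>i j. i < j \<longrightarrow> j < Suc c \<longrightarrow> (gc(c := G)) i \<le> (gc(c := G)) j"
      using a 1 by (auto simp: less_Suc_eq intro: less_imp_le)
    show "\<forall>i j. i < j \<longrightarrow> j < Suc c \<longrightarrow> (gc(c := G)) i = (gc(c := G)) j \<longrightarrow>
        (off(c := 0)) i + cnt i \<le> (off(c := 0)) j"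
      using a 1 by (auto simp: less_Suc_eq)
  qed (use a assms(5) p in auto)
qed

text \<open>The offset \<open>acc\<close> puts the new labels right above those of the current group
  and below \<open>2 * D\<close>, so the join is disjoint and has at most \<open>D\<close>
  labels.\<close>

lemma scanned_join:
  assumes "scanned D cnt X c G acc gc off Z" "wft (X c)" "cx D (X c)" "dm (X c) = {..<cnt c}"
    "cnt c \<le> D" "acc + cnt c \<le> D"
  shows "0 < G \<and> scanned D cnt X (Suc c) G (acc + cnt c) (gc(c := G - 1)) (off(c := acc))
    (Z(G - 1 := Jn (Z (G - 1)) (ren D acc (cnt c) (X c))))"
proof -
  let ?R = "ren D acc (cnt c) (X c)"
  note r = ren_props[where x = acc, OF assms(2,4,5) order_refl]
  note a = assms(1)[unfolded scanned_def]
  have c0: "0 < c" using a assms(6) by (cases c) auto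
  then have G0: "0 < G" using a by blast
  then obtain H where H: "G = Suc H" by (cases G) auto
  let ?Z = "Z(H := Jn (Z H) ?R)" and ?g = "gc(c := H)" and ?o = "off(c := acc)"
  have 1: "\<forall>i<c. gc i \<le> H" using a H by auto
  have oa: "off i + cnt i \<le> acc" if "i < c" "gc i = H" for i using a that H by blast
  have dR: "dm ?R = {D + acc + k | k. k < cnt c}"
    unfolding r(2) using le_Suc_ex[of "D + acc"] by fastforce
  have dZ: "dm (Z H) = {D + off i + k | i k. i < c \<and> gc i = H \<and> k < cnt i}" using a H by blast
  have dJ: "dm (Jn (Z H) ?R) = {D + ?o i + k | i k. i < Suc c \<and> ?g i = H \<and> k < cnt i}"
    unfolding dm.simps dR dZ by (auto simp: less_Suc_eq)
  have dis: "dm (Z H) \<inter> dm ?R = {}"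
    unfolding dR dZ using oa by fastforce
  have sub: "dm (Jn (Z H) ?R) \<subseteq> {D..<D + D}"
    unfolding dm.simps dR dZ using oa assms(6) by fastforce
  have card: "card (dm (Z H) \<union> dm ?R) \<le> D"
    using card_mono[OF _ sub] by simp
  have dm: "dm (?Z g) = {D + ?o i + k | i k. i < Suc c \<and> ?g i = g \<and> k < cnt i}" if "g < G" for g
  proof (cases "g = H")
    case True
    then show ?thesis using dJ by simp
  next
    case False
    have "dm (Z g) = {D + off i + k | i k. i < c \<and> gc i = g \<and> k < cnt i}" using a that by blast
    also have "\<dots> = {D + ?o i + k | i k. i < Suc c \<and> ?g i = g \<and> k < cnt i}"
      using False by (intro Collect_cong ex_cong1) (auto simp: less_Suc_eq)
    finally show ?thesis using False by simp
  qed
  have N: "ps ?R (D + off i + k) = None" if "i < c" "gc i = H" "k < cnt i" for i k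
  proof -
    have "D + off i + k \<notin> dm ?R" using dis that dZ by blast
    then show ?thesis using dom_ps[OF r(1)] by auto
  qed
  have p: "\<forall>i<Suc c. \<forall>k<cnt i. ps (?Z (?g i)) (D + ?o i + k) = ps (X i) k"
  proof (intro allI impI)
    fix i k assume ik: "i < Suc c" "k < cnt i"
    show "ps (?Z (?g i)) (D + ?o i + k) = ps (X i) k"
    proof (cases "i = c")
      case True
      have "D + acc + k \<in> dom (ps ?R)" using dom_ps[OF r(1)] dR ik True by auto
      then have "ps (Jn (Z H) ?R) (D + acc + k) = ps ?R (D + acc + k)"
        by (simp add: map_add_dom_app_simps(1))
      also have "\<dots> = ps (X c) k" using ik True by (intro r(3)) simp
      finally show ?thesis using True by simp
    next
      case False
      then have "ps (Z (gc i)) (D + off i + k) = ps (X i) k" using a ik by auto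
      then show ?thesis using False ik N[of i k] by (auto simp: map_add_def)
    qed
  qed
  have wc: "wft (?Z g) \<and> cx D (?Z g)" if "g < G" for g
    using a r(1) assms(3) dis card that H by auto
  have cc: "concat (map (\<lambda>g. ord (?Z g)) [0..<H]) = concat (map (\<lambda>g. ord (Z g)) [0..<H])"
    by (intro concat_map_upt_cong) simp
  have "scanned D cnt X (Suc c) G (acc + cnt c) ?g ?o ?Z"
    unfolding scanned_def
  proof (intro conjI)
    show "concat (map (\<lambda>g. ord (?Z g)) [0..<G]) = concat (map (\<lambda>i. ord (X i)) [0..<Suc c])"
      using a cc H by simp
    show "\<forall>g<G. wft (?Z g) \<and> cx D (?Z g) \<and> dm (?Z g) =
      {D + ?o i + k | i k. i < Suc c \<and> ?g i = g \<and> k < cnt i}"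
      using wc dm by blast
    show "\<forall>i<Suc c. ?g i < G \<and> ?o i + cnt i \<le> D \<and> (Suc (?g i) = G \<longrightarrow> ?o i + cnt i \<le> acc + cnt c)"
      using a assms(6) H oa by (auto simp: less_Suc_eq intro: trans_le_add1)
    show "\<forall>i j. i < j \<longrightarrow> j < Suc c \<longrightarrow> ?g i \<le> ?g j"
      using a 1 by (auto simp: less_Suc_eq)
    show "\<forall>i j. i < j \<longrightarrow> j < Suc c \<longrightarrow> ?g i = ?g j \<longrightarrow> ?o i + cnt i \<le> ?o j"
      using a oa by (auto simp: less_Suc_eq)
  qed (use a assms(6) p H in auto)
  then show ?thesis using H by simp
qed

text \<open>Cells before \<open>e\<close> have their final labels, which fill an initial segment
  below \<open>nc g\<close>; the remaining cells of the group keep temporary labels. The bound on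
  the number of all labels together keeps the final ones below \<open>D\<close>.\<close>

definition relabelled ::
  "nat \<Rightarrow> nat \<Rightarrow> nat \<Rightarrow> (nat \<Rightarrow> nat) \<Rightarrow> (nat \<Rightarrow> nat) \<Rightarrow> (nat \<Rightarrow> tm) \<Rightarrow> nat \<Rightarrow> (nat \<Rightarrow> nat) \<Rightarrow> (nat \<Rightarrow> tm) \<Rightarrow> bool"
where
  "relabelled D N m ga la X0 e nc X \<longleftrightarrow>
     (\<forall>g<m. wft (X g) \<and> cx D (X g) \<and> ord (X g) = ord (X0 g) \<and> card (dm (X g)) \<le> D \<and>
       dm (X g) = {..<nc g} \<union> {la i | i. e \<le> i \<and> i < N \<and> ga i = g})"

definition separate :: "nat \<Rightarrow> nat \<Rightarrow> nat \<Rightarrow> (nat \<Rightarrow> nat) \<Rightarrow> (nat \<Rightarrow> nat) \<Rightarrow> bool" where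
  "separate D N m ga la \<longleftrightarrow> (\<forall>i<N. ga i < m \<and> D \<le> la i) \<and> inj_on (\<lambda>i. (ga i, la i)) {..<N}"

lemma remove_between: "a \<notin> A \<Longrightarrow> a \<notin> S \<Longrightarrow> insert l (A \<union> insert a S - {a}) = insert l A \<union> S"
  by blast

lemma relabelled_step:
  assumes "relabelled D N m ga la X0 e nc X" "separate D N m ga la" "e < N" "l \<le> nc (ga e)"
  defines "X' \<equiv> X(ga e := Mv (la e) l (X (ga e)))"
  shows "relabelled D N m ga la X0 (Suc e) (nc(ga e := max (nc (ga e)) (Suc l))) X'" (is ?A)
    "(g, x) \<noteq> (ga e, la e) \<Longrightarrow> (g, x) \<noteq> (ga e, l) \<Longrightarrow> ps (X' g) x = ps (X g) x" (is "?p1 \<Longrightarrow> ?p2 \<Longrightarrow> ?B")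
    "ps (X' (ga e)) l = (if l < nc (ga e) then Some (TNode (the (ps (X (ga e)) l)) (the (ps (X (ga e)) (la e))))
       else ps (X (ga e)) (la e))" (is ?C)
    "l < D"
proof -
  let ?g = "ga e"
  let ?nc = "nc(?g := max (nc ?g) (Suc l))"
  have g: "?g < m" "D \<le> la e" using assms(2,3) by (auto simp: separate_def)
  have X: "wft (X ?g)" "cx D (X ?g)" "ord (X ?g) = ord (X0 ?g)" "card (dm (X ?g)) \<le> D"
    and d: "dm (X ?g) = {..<nc ?g} \<union> {la i | i. e \<le> i \<and> i < N \<and> ga i = ?g}"
    using assms(1) g unfolding relabelled_def by blast+
  have le: "la e \<in> dm (X ?g)" unfolding d using assms(3) by blast
  \<comment> \<open>The temporary label \<open>la e\<close> is none of the \<open>nc ?g\<close>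
    final labels, and all of them are at most \<open>D\<close> in number, so \<open>nc ?g\<close>
    itself is below \<open>D\<close>.\<close>
  have "nc ?g \<le> D" using card_mono[OF finite_dm, of "{..<nc ?g}" "X ?g"] X(4) d by auto
  then have "la e \<notin> {..<nc ?g}" using g by auto
  then have "Suc (nc ?g) = card (insert (la e) {..<nc ?g})" by simp
  also have "\<dots> \<le> card (dm (X ?g))" using le d by (intro card_mono) auto
  finally show lD: "l < D" using X(4) assms(4) by simp
  have neq: "la i \<noteq> la e" if "i < N" "Suc e \<le> i" "ga i = ?g" for i
  proof -
    have "(ga i, la i) = (ga e, la e) \<Longrightarrow> i = e"
      using assms(2,3) that(1) unfolding separate_def inj_on_def by blast
    then show ?thesis using that by auto
  qed
  have "{la i | i. e \<le> i \<and> i < N \<and> ga i = ?g} = insert (la e) {la i | i. Suc e \<le> i \<and> i < N \<and> ga i = ?g}"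
  proof -
    have "e \<le> i \<longleftrightarrow> i = e \<or> Suc e \<le> i" for i by auto
    then show ?thesis using assms(3) by auto
  qed
  moreover have "la e \<notin> {la i | i. Suc e \<le> i \<and> i < N \<and> ga i = ?g}"
  proof
    assume "la e \<in> {la i | i. Suc e \<le> i \<and> i < N \<and> ga i = ?g}"
    then obtain i where "la e = la i" "Suc e \<le> i" "i < N" "ga i = ?g" by blast
    then show False using neq[of i] by simp
  qed
  ultimately have "insert l (dm (X ?g) - {la e}) =
      insert l {..<nc ?g} \<union> {la i | i. Suc e \<le> i \<and> i < N \<and> ga i = ?g}"
    unfolding d using remove_between[OF \<open>la e \<notin> {..<nc ?g}\<close>] by simp
  moreover have "insert l {..<nc ?g} = {..<?nc ?g}" using assms(4) by auto
  ultimately have d': "dm (X' ?g) = {..<?nc ?g} \<union> {la i | i. Suc e \<le> i \<and> i < N \<and> ga i = ?g}"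
    unfolding X'_def using le by simp
  have "card (dm (X' ?g)) \<le> card (dm (X ?g))"
    unfolding X'_def using le card_Suc_Diff1[OF finite_dm le] by (simp add: card_insert_if)
  then have "card (dm (X' ?g)) \<le> D" using X(4) by linarith
  moreover have "wft (X' ?g)" using X(1) le lD g(2) by (simp add: X'_def)
  moreover have "cx D (X' ?g)" "ord (X' ?g) = ord (X0 ?g)" using X by (simp_all add: X'_def)
  moreover have "{la i | i. Suc e \<le> i \<and> i < N \<and> ga i = g'} = {la i | i. e \<le> i \<and> i < N \<and> ga i = g'}"
    if "g' \<noteq> ?g" for g'
  proof -
    have "Suc e \<le> i \<and> i < N \<and> ga i = g' \<longleftrightarrow> e \<le> i \<and> i < N \<and> ga i = g'" for i
      using that by (cases "i = e") auto
    then show ?thesis by simp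
  qed
  ultimately have Xg: "wft (X' g') \<and> cx D (X' g') \<and> ord (X' g') = ord (X0 g') \<and> card (dm (X' g')) \<le> D \<and>
      dm (X' g') = {..<?nc g'} \<union> {la i | i. Suc e \<le> i \<and> i < N \<and> ga i = g'}" if "g' < m" for g'
  proof (cases "g' = ?g")
    case True
    then show ?thesis
      using d' \<open>card (dm (X' ?g)) \<le> D\<close> \<open>wft (X' ?g)\<close> \<open>cx D (X' ?g)\<close> \<open>ord (X' ?g) = ord (X0 ?g)\<close> by simp
  next
    case False
    have "wft (X g') \<and> cx D (X g') \<and> ord (X g') = ord (X0 g') \<and> card (dm (X g')) \<le> D \<and>
      dm (X g') = {..<nc g'} \<union> {la i | i. e \<le> i \<and> i < N \<and> ga i = g'}"
      using assms(1) that unfolding relabelled_def by blast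
    moreover have same: "X' g' = X g'" "?nc g' = nc g'" using False by (simp_all add: X'_def)
    ultimately show ?thesis unfolding same
      \<open>\<And>g'. g' \<noteq> ?g \<Longrightarrow> {la i | i. Suc e \<le> i \<and> i < N \<and> ga i = g'} = {la i | i. e \<le> i \<and> i < N \<and> ga i = g'}\<close>[OF False]
      by blast
  qed
  then show ?A unfolding relabelled_def by blast
  have N: "ps (X ?g) l = None \<longleftrightarrow> \<not> l < nc ?g"
  proof -
    have "l \<notin> {la i | i. e \<le> i \<and> i < N \<and> ga i = ?g}" using assms(2) lD unfolding separate_def by fastforce
    then show ?thesis using dom_ps[OF X(1)] d by auto
  qed
  show "?p1 \<Longrightarrow> ?p2 \<Longrightarrow> ?B" by (auto simp: X'_def move_def)
  show ?C using N lD g(2) by (auto simp: X'_def move_def split: option.splits)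
qed

text \<open>The equation between \<open>ps (X (cc i)) (lx i)\<close> and
  \<open>ps (Y (cr i)) (ly i)\<close> is the heart: a cell carries one tree, seen from its column
  and from its row. \<open>mk h\<close> is the latest cell in row \<open>h\<close>; it serves to
  recognise a repeated cell in constant time.\<close>

definition merged ::
  "nat \<Rightarrow> nat \<Rightarrow> nat \<Rightarrow> nat \<Rightarrow> (nat \<Rightarrow> nat) \<Rightarrow> (nat \<Rightarrow> nat) \<Rightarrow> (nat \<Rightarrow> nat) \<Rightarrow> (nat \<Rightarrow> nat) \<Rightarrow>
   (nat \<Rightarrow> tm) \<Rightarrow> (nat \<Rightarrow> tm) \<Rightarrow> nat \<Rightarrow> nat \<Rightarrow> (nat \<Rightarrow> nat) \<Rightarrow> (nat \<Rightarrow> nat) \<Rightarrow> (nat \<Rightarrow> nat) \<Rightarrow> (nat \<Rightarrow> nat) \<Rightarrow>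
   (nat \<Rightarrow> nat) \<Rightarrow> (nat \<Rightarrow> nat) \<Rightarrow> (nat \<Rightarrow> nat) \<Rightarrow> (nat \<Rightarrow> tm) \<Rightarrow> (nat \<Rightarrow> tm) \<Rightarrow> bool"
where
  "merged D N gx gy ga ha la lb X0 Y0 e n cc cr lx ly nc nr mk X Y \<longleftrightarrow>
     n \<le> e \<and>
     (\<forall>i<n. lx i < nc (cc i) \<and> ly i < nr (cr i) \<and> ps (X (cc i)) (lx i) = ps (Y (cr i)) (ly i)) \<and>
     (\<lambda>i. (cc i, cr i)) ` {..<n} = (\<lambda>i. (ga i, ha i)) ` {..<e} \<and>
     inj_on (\<lambda>i. (cc i, cr i)) {..<n} \<and>
     (\<forall>i j. i < j \<longrightarrow> j < n \<longrightarrow> cc i \<le> cc j) \<and>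
     inj_on (\<lambda>i. (cc i, lx i)) {..<n} \<and> inj_on (\<lambda>i. (cr i, ly i)) {..<n} \<and>
     (\<forall>g k. k < nc g \<longrightarrow> (\<exists>i<n. cc i = g \<and> lx i = k)) \<and>
     (\<forall>h k. k < nr h \<longrightarrow> (\<exists>i<n. cr i = h \<and> ly i = k)) \<and>
     (\<forall>h. 0 < nr h \<longrightarrow> mk h < n \<and> cr (mk h) = h) \<and> (\<forall>i<n. i \<le> mk (cr i)) \<and>
     relabelled D N gx ga la X0 e nc X \<and> relabelled D N gy ha lb Y0 e nr Y \<and>
     (\<forall>i. e \<le> i \<longrightarrow> i < N \<longrightarrow> ps (X (ga i)) (la i) = ps (Y (ha i)) (lb i))"

definition merging :: "nat \<Rightarrow> nat \<Rightarrow> nat \<Rightarrow> nat \<Rightarrow> (nat \<Rightarrow> nat) \<Rightarrow> (nat \<Rightarrow> nat) \<Rightarrow> (nat \<Rightarrow> nat) \<Rightarrow> (nat \<Rightarrow> nat) \<Rightarrow> bool" where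
  "merging D N gx gy ga ha la lb \<longleftrightarrow> separate D N gx ga la \<and> separate D N gy ha lb \<and>
     (\<forall>i j. i < j \<longrightarrow> j < N \<longrightarrow> ga i \<le> ga j)"

lemma merged_cc_le:
  assumes "merged D N gx gy ga ha la lb X0 Y0 e n cc cr lx ly nc nr mk X Y"
    "merging D N gx gy ga ha la lb" "e < N" "i < n"
  shows "cc i \<le> ga e"
proof -
  have "(cc i, cr i) \<in> (\<lambda>i. (ga i, ha i)) ` {..<e}" using assms(1,4) unfolding merged_def by blast
  then obtain j where "j < e" "cc i = ga j" by auto
  then show ?thesis using assms(2,3) unfolding merging_def by auto
qed

text \<open>The latest cell of the row is not left of the current column, hence lies in it. Both
  terms then move a tree onto that cell, and as the trees involved agree on both sides, so do the
  resulting nodes.\<close>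

lemma merged_old_cell:
  assumes m: "merged D N gx gy ga ha la lb X0 Y0 e n cc cr lx ly nc nr mk X Y"
    and mg: "merging D N gx gy ga ha la lb" and e: "e < N"
    and old: "0 < nr (ha e)" "\<not> cc (mk (ha e)) < ga e"
  defines "f \<equiv> mk (ha e)"
  shows "merged D N gx gy ga ha la lb X0 Y0 (Suc e) n cc cr lx ly nc nr mk
    (X(ga e := Mv (la e) (lx f) (X (ga e)))) (Y(ha e := Mv (lb e) (ly f) (Y (ha e))))" (is "merged _ _ _ _ _ _ _ _ _ _ _ _ _ _ _ _ _ _ _ ?X ?Y")
proof -
  have M: "n \<le> e" "\<And>i. i < n \<Longrightarrow> lx i < nc (cc i)" "\<And>i. i < n \<Longrightarrow> ly i < nr (cr i)"
    "\<And>i. i < n \<Longrightarrow> ps (X (cc i)) (lx i) = ps (Y (cr i)) (ly i)"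
    "(\<lambda>i. (cc i, cr i)) ` {..<n} = (\<lambda>i. (ga i, ha i)) ` {..<e}"
    "inj_on (\<lambda>i. (cc i, cr i)) {..<n}" "\<And>i j. i < j \<Longrightarrow> j < n \<Longrightarrow> cc i \<le> cc j"
    "inj_on (\<lambda>i. (cc i, lx i)) {..<n}" "inj_on (\<lambda>i. (cr i, ly i)) {..<n}"
    "\<And>g k. k < nc g \<Longrightarrow> \<exists>i<n. cc i = g \<and> lx i = k" "\<And>h k. k < nr h \<Longrightarrow> \<exists>i<n. cr i = h \<and> ly i = k"
    "\<And>h. 0 < nr h \<Longrightarrow> mk h < n" "\<And>h. 0 < nr h \<Longrightarrow> cr (mk h) = h" "\<And>i. i < n \<Longrightarrow> i \<le> mk (cr i)"
    "relabelled D N gx ga la X0 e nc X" "relabelled D N gy ha lb Y0 e nr Y"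
    "\<And>i. e \<le> i \<Longrightarrow> i < N \<Longrightarrow> ps (X (ga i)) (la i) = ps (Y (ha i)) (lb i)"
    using m unfolding merged_def by blast+
  have O: "\<And>i. i < N \<Longrightarrow> ga i < gx" "\<And>i. i < N \<Longrightarrow> D \<le> la i" "\<And>i. i < N \<Longrightarrow> ha i < gy" "\<And>i. i < N \<Longrightarrow> D \<le> lb i"
    "\<And>i j. i < N \<Longrightarrow> j < N \<Longrightarrow> (ga i, la i) = (ga j, la j) \<Longrightarrow> i = j"
    "\<And>i j. i < N \<Longrightarrow> j < N \<Longrightarrow> (ha i, lb i) = (ha j, lb j) \<Longrightarrow> i = j"
    using mg unfolding merging_def separate_def inj_on_def by (blast intro: lessThan_iff[THEN iffD2])+
  have f: "f < n" "cr f = ha e" using M(12,13)[OF old(1)] unfolding f_def by auto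
  then have cf: "cc f = ga e" using merged_cc_le[OF m mg e f(1)] old(2) unfolding f_def by simp
  have lxf: "lx f < nc (ga e)" "ly f < nr (ha e)" "ps (X (ga e)) (lx f) = ps (Y (ha e)) (ly f)"
    using M(2-4)[OF f(1)] f(2) cf by simp_all
  note rX = M(15) and rY = M(16)
  have sX: "separate D N gx ga la" and sY: "separate D N gy ha lb" using mg unfolding merging_def by blast+
  note x = relabelled_step[OF rX sX e less_imp_le[OF lxf(1)]] and y = relabelled_step[OF rY sY e less_imp_le[OF lxf(2)]]
  have nX: "nc(ga e := max (nc (ga e)) (Suc (lx f))) = nc" using lxf(1) by (auto simp: fun_eq_iff)
  have nY: "nr(ha e := max (nr (ha e)) (Suc (ly f))) = nr" using lxf(2) by (auto simp: fun_eq_iff)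
  have ee: "ps (X (ga e)) (la e) = ps (Y (ha e)) (lb e)" using M(17) e by simp
  have ncD: "nc (ga e) \<le> D" "nr (ha e) \<le> D"
  proof -
    have "ga e < gx" "ha e < gy" using O e by blast+
    then have s: "{..<nc (ga e)} \<subseteq> dm (X (ga e))" "{..<nr (ha e)} \<subseteq> dm (Y (ha e))"
      and c: "card (dm (X (ga e))) \<le> D" "card (dm (Y (ha e))) \<le> D"
      using rX rY unfolding relabelled_def by blast+
    show "nc (ga e) \<le> D" using card_mono[OF finite_dm s(1)] c(1) by simp
    show "nr (ha e) \<le> D" using card_mono[OF finite_dm s(2)] c(2) by simp
  qed
  note laD = O(2,4)
  have p: "ps (?X (cc i)) (lx i) = ps (?Y (cr i)) (ly i)" if "i < n" for i
  proof (cases "i = f")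
    case True
    then show ?thesis using x(3) y(3) lxf ee cf f(2) by simp
  next
    case False
    then have "(cc i, lx i) \<noteq> (ga e, lx f)" "(cr i, ly i) \<noteq> (ha e, ly f)"
      using inj_onD[OF M(8), of i f] inj_onD[OF M(9), of i f] that f cf by auto
    moreover have "(cc i, lx i) \<noteq> (ga e, la e)" "(cr i, ly i) \<noteq> (ha e, lb e)"
      using M(2,3)[OF that] laD[OF e] ncD by auto
    ultimately show ?thesis using x(2) y(2) M(4)[OF that] by simp
  qed
  have q: "ps (?X (ga i)) (la i) = ps (?Y (ha i)) (lb i)" if "Suc e \<le> i" "i < N" for i
  proof -
    have "(ga i, la i) \<noteq> (ga e, la e)" "(ha i, lb i) \<noteq> (ha e, lb e)"
      using O(5,6)[of i e] that e by auto
    moreover have "(ga i, la i) \<noteq> (ga e, lx f)" "(ha i, lb i) \<noteq> (ha e, ly f)"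
      using laD[OF that(2)] x(4) y(4) by auto
    ultimately show ?thesis using x(2) y(2) M(17)[of i] that by simp
  qed
  have "(ga e, ha e) \<in> (\<lambda>i. (ga i, ha i)) ` {..<e}" using M(5) f cf by (metis (no_types, lifting) imageI lessThan_iff)
  then have s: "(\<lambda>i. (ga i, ha i)) ` {..<Suc e} = (\<lambda>i. (ga i, ha i)) ` {..<e}"
    by (auto simp: lessThan_Suc)
  show ?thesis
    unfolding merged_def s using M p q x(1)[unfolded nX] y(1)[unfolded nY] by (intro conjI) (simp_all add: le_SucI)
qed

text \<open>Cells are visited by increasing column group, so the latest cell of a row is its
  rightmost one. If it lies to the left of the current column, the current pair has not occurred
  before.\<close>

lemma merged_new_cell:
  assumes m: "merged D N gx gy ga ha la lb X0 Y0 e n cc cr lx ly nc nr mk X Y"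
    and mg: "merging D N gx gy ga ha la lb" and e: "e < N"
    and new: "nr (ha e) = 0 \<or> cc (mk (ha e)) < ga e"
  shows "merged D N gx gy ga ha la lb X0 Y0 (Suc e) (Suc n) (cc(n := ga e)) (cr(n := ha e))
    (lx(n := nc (ga e))) (ly(n := nr (ha e))) (nc(ga e := Suc (nc (ga e)))) (nr(ha e := Suc (nr (ha e))))
    (mk(ha e := n))
    (X(ga e := Mv (la e) (nc (ga e)) (X (ga e)))) (Y(ha e := Mv (lb e) (nr (ha e)) (Y (ha e))))"
    (is "merged _ _ _ _ _ _ _ _ _ _ _ _ ?cc ?cr ?lx ?ly ?nc ?nr ?mk ?X ?Y")
proof -
  have M: "n \<le> e" "\<And>i. i < n \<Longrightarrow> lx i < nc (cc i)" "\<And>i. i < n \<Longrightarrow> ly i < nr (cr i)"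
    "\<And>i. i < n \<Longrightarrow> ps (X (cc i)) (lx i) = ps (Y (cr i)) (ly i)"
    "(\<lambda>i. (cc i, cr i)) ` {..<n} = (\<lambda>i. (ga i, ha i)) ` {..<e}"
    "inj_on (\<lambda>i. (cc i, cr i)) {..<n}" "\<And>i j. i < j \<Longrightarrow> j < n \<Longrightarrow> cc i \<le> cc j"
    "inj_on (\<lambda>i. (cc i, lx i)) {..<n}" "inj_on (\<lambda>i. (cr i, ly i)) {..<n}"
    "\<And>g k. k < nc g \<Longrightarrow> \<exists>i<n. cc i = g \<and> lx i = k" "\<And>h k. k < nr h \<Longrightarrow> \<exists>i<n. cr i = h \<and> ly i = k"
    "\<And>h. 0 < nr h \<Longrightarrow> mk h < n" "\<And>h. 0 < nr h \<Longrightarrow> cr (mk h) = h" "\<And>i. i < n \<Longrightarrow> i \<le> mk (cr i)"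
    "relabelled D N gx ga la X0 e nc X" "relabelled D N gy ha lb Y0 e nr Y"
    "\<And>i. e \<le> i \<Longrightarrow> i < N \<Longrightarrow> ps (X (ga i)) (la i) = ps (Y (ha i)) (lb i)"
    using m unfolding merged_def by blast+
  have O: "\<And>i. i < N \<Longrightarrow> ga i < gx" "\<And>i. i < N \<Longrightarrow> D \<le> la i" "\<And>i. i < N \<Longrightarrow> ha i < gy" "\<And>i. i < N \<Longrightarrow> D \<le> lb i"
    "\<And>i j. i < N \<Longrightarrow> j < N \<Longrightarrow> (ga i, la i) = (ga j, la j) \<Longrightarrow> i = j"
    "\<And>i j. i < N \<Longrightarrow> j < N \<Longrightarrow> (ha i, lb i) = (ha j, lb j) \<Longrightarrow> i = j"
    using mg unfolding merging_def separate_def inj_on_def by (blast intro: lessThan_iff[THEN iffD2])+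
  have fresh: "(ga e, ha e) \<notin> (\<lambda>i. (cc i, cr i)) ` {..<n}"
  proof
    assume "(ga e, ha e) \<in> (\<lambda>i. (cc i, cr i)) ` {..<n}"
    then obtain i where i: "i < n" "cc i = ga e" "cr i = ha e" by auto
    then have "0 < nr (ha e)" using M(3)[OF i(1)] by simp
    moreover from this have "mk (ha e) < n" using M(12) by blast
    moreover have "i \<le> mk (ha e)" using M(14)[OF i(1)] i by simp
    ultimately have "cc i \<le> cc (mk (ha e))" using M(7)[of i "mk (ha e)"] by (cases "i = mk (ha e)") auto
    then show False using new \<open>0 < nr (ha e)\<close> i by auto
  qed
  note rX = M(15) and rY = M(16)
  have sX: "separate D N gx ga la" and sY: "separate D N gy ha lb" using mg unfolding merging_def by blast+
  note x = relabelled_step[OF rX sX e order_refl] and y = relabelled_step[OF rY sY e order_refl]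
  have ee: "ps (X (ga e)) (la e) = ps (Y (ha e)) (lb e)" using M(17) e by simp
  note laD = O(2,4)
  have p: "ps (?X (cc i)) (lx i) = ps (?Y (cr i)) (ly i)" if "i < n" for i
  proof -
    have "lx i < nc (cc i)" "ly i < nr (cr i)" using M(2,3) that by blast+
    then have "(cc i, lx i) \<noteq> (ga e, nc (ga e))" "(cr i, ly i) \<noteq> (ha e, nr (ha e))"
      "(cc i, lx i) \<noteq> (ga e, la e)" "(cr i, ly i) \<noteq> (ha e, lb e)"
      using laD[OF e] x(4) y(4) by auto
    then show ?thesis using x(2) y(2) M(4)[OF that] by simp
  qed
  have q: "ps (?X (ga i)) (la i) = ps (?Y (ha i)) (lb i)" if "Suc e \<le> i" "i < N" for i
  proof -
    have "(ga i, la i) \<noteq> (ga e, la e)" "(ha i, lb i) \<noteq> (ha e, lb e)"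
      using O(5,6)[of i e] that e by auto
    moreover have "(ga i, la i) \<noteq> (ga e, nc (ga e))" "(ha i, lb i) \<noteq> (ha e, nr (ha e))"
      using laD[OF that(2)] x(4) y(4) by auto
    ultimately show ?thesis using x(2) y(2) M(17)[of i] that by simp
  qed
  have r: "ps (?X (ga e)) (nc (ga e)) = ps (?Y (ha e)) (nr (ha e))" using x(3) y(3) ee by simp
  note old = M(2,3)
  show ?thesis
    unfolding merged_def
  proof (intro conjI)
    show "Suc n \<le> Suc e" using M(1) by simp
    show "\<forall>i<Suc n. ?lx i < ?nc (?cc i) \<and> ?ly i < ?nr (?cr i) \<and> ps (?X (?cc i)) (?lx i) = ps (?Y (?cr i)) (?ly i)"
    proof (intro allI impI)
      fix i assume "i < Suc n"
      then consider "i < n" | "i = n" by linarith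
      then show "?lx i < ?nc (?cc i) \<and> ?ly i < ?nr (?cr i) \<and> ps (?X (?cc i)) (?lx i) = ps (?Y (?cr i)) (?ly i)"
      proof cases
        case 1
        then have "?lx i < ?nc (?cc i)" "?ly i < ?nr (?cr i)" using old[of i] by auto
        moreover have "?cc i = cc i" "?cr i = cr i" "?lx i = lx i" "?ly i = ly i" using 1 by simp_all
        ultimately show ?thesis using p[OF 1] by (simp only: simp_thms)
      next
        case 2
        have "?cc i = ga e" "?cr i = ha e" "?lx i = nc (ga e)" "?ly i = nr (ha e)" using 2 by simp_all
        then show ?thesis using r by (simp only: fun_upd_same lessI simp_thms)
      qed
    qed
    have im: "(\<lambda>i. (?cc i, ?cr i)) ` {..<n} = (\<lambda>i. (cc i, cr i)) ` {..<n}" by (intro image_cong) auto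
    show "(\<lambda>i. (?cc i, ?cr i)) ` {..<Suc n} = (\<lambda>i. (ga i, ha i)) ` {..<Suc e}"
      unfolding lessThan_Suc image_insert im M(5) by simp
    from M(6) have "inj_on (\<lambda>i. (?cc i, ?cr i)) {..<n}" by (rule inj_on_cong[THEN iffD1, rotated]) auto
    then show "inj_on (\<lambda>i. (?cc i, ?cr i)) {..<Suc n}"
      unfolding lessThan_Suc using fresh im by auto
    show "\<forall>i j. i < j \<longrightarrow> j < Suc n \<longrightarrow> ?cc i \<le> ?cc j"
      using M(7) merged_cc_le[OF m mg e] by (auto simp: less_Suc_eq)
    from M(8) M(9) have "inj_on (\<lambda>i. (?cc i, ?lx i)) {..<n}" "inj_on (\<lambda>i. (?cr i, ?ly i)) {..<n}"
      by (simp_all add: inj_on_def)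
    moreover have "(ga e, nc (ga e)) \<notin> (\<lambda>i. (?cc i, ?lx i)) ` {..<n}" "(ha e, nr (ha e)) \<notin> (\<lambda>i. (?cr i, ?ly i)) ` {..<n}"
      using old by (auto simp: image_iff) (metis less_irrefl_nat)+
    ultimately show "inj_on (\<lambda>i. (?cc i, ?lx i)) {..<Suc n}" "inj_on (\<lambda>i. (?cr i, ?ly i)) {..<Suc n}"
      unfolding lessThan_Suc by auto
    from M(10) show "\<forall>g k. k < ?nc g \<longrightarrow> (\<exists>i<Suc n. ?cc i = g \<and> ?lx i = k)"
      by (auto simp: less_Suc_eq) (metis less_irrefl_nat)+
    from M(11) show "\<forall>h k. k < ?nr h \<longrightarrow> (\<exists>i<Suc n. ?cr i = h \<and> ?ly i = k)"
      by (auto simp: less_Suc_eq) (metis less_irrefl_nat)+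
    from M(12,13) show "\<forall>h. 0 < ?nr h \<longrightarrow> ?mk h < Suc n \<and> ?cr (?mk h) = h"
      by (auto simp: less_Suc_eq)
    from M(14) show "\<forall>i<Suc n. i \<le> ?mk (?cr i)" by (auto simp: less_Suc_eq)
    have "max (nc (ga e)) (Suc (nc (ga e))) = Suc (nc (ga e))" "max (nr (ha e)) (Suc (nr (ha e))) = Suc (nr (ha e))"
      by simp_all
    then show "relabelled D N gx ga la X0 (Suc e) ?nc ?X" "relabelled D N gy ha lb Y0 (Suc e) ?nr ?Y"
      using x(1) y(1) by simp_all
    show "\<forall>i. Suc e \<le> i \<longrightarrow> i < N \<longrightarrow> ps (?X (ga i)) (la i) = ps (?Y (ha i)) (lb i)" using q by blast
  qed
qed

section \<open>Reasoning about loop programs\<close>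

lemma st_simps [simp]:
  "var (setv x v s) = (var s)(x := v)" "arr (setv x v s) = arr s" "io (setv x v s) = io s"
  "var (seta a i v s) = var s" "arr (seta a i v s) = (arr s)(a := (arr s a)(i := v))"
  "io (seta a i v s) = io s" "var (outv i v s) = var s" "arr (outv i v s) = arr s"
  by (simp_all add: setv_def seta_def outv_def)

lemma setv_setv [simp]: "setv x v (setv x w s) = setv x v s"
  by (simp add: setv_def)

primrec wvars :: "com \<Rightarrow> nat set" where
  "wvars CSkip = {}"
| "wvars (CConst r c) = {r}"
| "wvars (CMov r a) = {r}"
| "wvars (CInc r) = {r}"
| "wvars (CDec r) = {r}"
| "wvars (CLd r a i) = {r}"
| "wvars (CSt a i v) = {}"
| "wvars (CIn r i) = {r}"
| "wvars (COut i v) = {}"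
| "wvars (CSeq c d) = wvars c \<union> wvars d"
| "wvars (CIf a b c d) = wvars c \<union> wvars d"
| "wvars (CFor v b c) = insert v (wvars c)"

primrec warrs :: "com \<Rightarrow> nat set" where
  "warrs CSkip = {}"
| "warrs (CConst r c) = {}"
| "warrs (CMov r a) = {}"
| "warrs (CInc r) = {}"
| "warrs (CDec r) = {}"
| "warrs (CLd r a i) = {}"
| "warrs (CSt a i v) = {a}"
| "warrs (CIn r i) = {}"
| "warrs (COut i v) = {}"
| "warrs (CSeq c d) = warrs c \<union> warrs d"
| "warrs (CIf a b c d) = warrs c \<union> warrs d"
| "warrs (CFor v b c) = warrs c"

primrec silent :: "com \<Rightarrow> bool" where
  "silent CSkip \<longleftrightarrow> True"
| "silent (CConst r c) \<longleftrightarrow> True"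
| "silent (CMov r a) \<longleftrightarrow> True"
| "silent (CInc r) \<longleftrightarrow> True"
| "silent (CDec r) \<longleftrightarrow> True"
| "silent (CLd r a i) \<longleftrightarrow> True"
| "silent (CSt a i v) \<longleftrightarrow> True"
| "silent (CIn r i) \<longleftrightarrow> True"
| "silent (COut i v) \<longleftrightarrow> False"
| "silent (CSeq c d) \<longleftrightarrow> silent c \<and> silent d"
| "silent (CIf a b c d) \<longleftrightarrow> silent c \<and> silent d"
| "silent (CFor v b c) \<longleftrightarrow> silent c"

lemma loop_induct:
  assumes "I 0 s" "\<And>k s. k < n \<Longrightarrow> I k s \<Longrightarrow> I (Suc k) (f k s)"
  shows "I n (loop f n s)"
proof -
  have "k \<le> n \<Longrightarrow> I k (loop f k s)" for k
    by (induction k) (use assms in auto)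
  then show ?thesis by simp
qed

lemma run_frame: "x \<notin> wvars c \<Longrightarrow> var (run c s) x = var s x"
proof (induction c arbitrary: s)
  case (CFor v b c)
  show ?case unfolding run.simps
    by (rule loop_induct[where I = "\<lambda>_ s'. var s' x = var s x"]) (use CFor in auto)
qed auto

lemma run_frame_arr: "a \<notin> warrs c \<Longrightarrow> arr (run c s) a = arr s a"
proof (induction c arbitrary: s)
  case (CFor v b c)
  show ?case unfolding run.simps
    by (rule loop_induct[where I = "\<lambda>_ s'. arr s' a = arr s a"]) (use CFor in auto)
qed auto

lemma run_frame_io: "silent c \<Longrightarrow> io (run c s) = io s"
proof (induction c arbitrary: s)
  case (CFor v b c)
  show ?case unfolding run.simps
    by (rule loop_induct[where I = "\<lambda>_ s'. io s' = io s"]) (use CFor in auto)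
qed auto

primrec flat :: "com \<Rightarrow> bool" where
  "flat CSkip \<longleftrightarrow> True"
| "flat (CConst r c) \<longleftrightarrow> True"
| "flat (CMov r a) \<longleftrightarrow> True"
| "flat (CInc r) \<longleftrightarrow> True"
| "flat (CDec r) \<longleftrightarrow> True"
| "flat (CLd r a i) \<longleftrightarrow> True"
| "flat (CSt a i v) \<longleftrightarrow> True"
| "flat (CIn r i) \<longleftrightarrow> True"
| "flat (COut i v) \<longleftrightarrow> True"
| "flat (CSeq c d) \<longleftrightarrow> flat c \<and> flat d"
| "flat (CIf a b c d) \<longleftrightarrow> flat c \<and> flat d"
| "flat (CFor v b c) \<longleftrightarrow> False"

text \<open>A loop with a loop-free body takes time linear in its bound, so the syntax alone gives
  the running time; the nested loop of \<open>phases\<close> is counted separately.\<close>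

primrec unnested :: "com \<Rightarrow> bool" where
  "unnested CSkip \<longleftrightarrow> True"
| "unnested (CConst r c) \<longleftrightarrow> True"
| "unnested (CMov r a) \<longleftrightarrow> True"
| "unnested (CInc r) \<longleftrightarrow> True"
| "unnested (CDec r) \<longleftrightarrow> True"
| "unnested (CLd r a i) \<longleftrightarrow> True"
| "unnested (CSt a i v) \<longleftrightarrow> True"
| "unnested (CIn r i) \<longleftrightarrow> True"
| "unnested (COut i v) \<longleftrightarrow> True"
| "unnested (CSeq c d) \<longleftrightarrow> unnested c \<and> unnested d"
| "unnested (CIf a b c d) \<longleftrightarrow> unnested c \<and> unnested d"
| "unnested (CFor v b c) \<longleftrightarrow> flat c"

lemma flat_cost: "flat c \<Longrightarrow> \<exists>A. \<forall>s. cost c s \<le> A"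
proof (induction c)
  case (CSeq c d)
  then obtain A B where "\<forall>s. cost c s \<le> A" "\<forall>s. cost d s \<le> B" by auto
  then have "\<forall>s. cost (CSeq c d) s \<le> A + B" by (simp add: add_mono)
  then show ?case by blast
next
  case (CIf a b c d)
  then obtain A B where A: "\<forall>s. cost c s \<le> A" "\<forall>s. cost d s \<le> B" by auto
  have "cost (CIf a b c d) s \<le> 2 + (A + B)" for s
    using A by (auto intro: trans_le_add1 trans_le_add2)
  then show ?case by blast
qed auto

lemma for_cost: "flat c \<Longrightarrow> \<exists>A. \<forall>s. cost (CFor v b c) s \<le> A * (var s b + 1)"
proof -
  assume "flat c"
  then obtain A where A: "\<forall>s. cost c s \<le> A" using flat_cost by blast
  have "cost (CFor v b c) s \<le> (4 + A) * (var s b + 1)" for s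
  proof -
    have "(\<Sum>k<var s b. 4 + cost c (setv v k (loop (\<lambda>k s. run c (setv v k s)) k s))) \<le> (\<Sum>k<var s b. 4 + A)"
      using A by (intro sum_mono) simp
    then show ?thesis by (simp add: algebra_simps)
  qed
  then show ?thesis by blast
qed

text \<open>A command raises the values by at most its own cost, so linear bounds compose along a
  sequence.\<close>

lemma unnested_cost:
  "unnested c \<Longrightarrow> \<exists>A. \<forall>M s. bnd M s \<longrightarrow> consts_le M c \<longrightarrow> cost c s \<le> A * (M + 1)"
proof (induction c)
  case (CSeq c d)
  then obtain A B where A: "\<And>M s. bnd M s \<Longrightarrow> consts_le M c \<Longrightarrow> cost c s \<le> A * (M + 1)"
    and B: "\<And>M s. bnd M s \<Longrightarrow> consts_le M d \<Longrightarrow> cost d s \<le> B * (M + 1)" by auto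
  have "cost (CSeq c d) s \<le> (A + B * (1 + A)) * (M + 1)" if "bnd M s" "consts_le M (CSeq c d)" for M s
  proof -
    have c: "cost c s \<le> A * (M + 1)" using A that by simp
    have "bnd (M + cost c s) (run c s)" using that by (intro bnd_run) auto
    then have "bnd (M + A * (M + 1)) (run c s)" using c by (elim bnd_mono) simp
    then have "cost d (run c s) \<le> B * (M + A * (M + 1) + 1)"
      using that consts_le_mono[of M d "M + A * (M + 1)"] by (intro B) auto
    then show ?thesis using c by (simp add: algebra_simps)
  qed
  then show ?case by blast
next
  case (CIf a b c d)
  then obtain A B where A: "\<And>M s. bnd M s \<Longrightarrow> consts_le M c \<Longrightarrow> cost c s \<le> A * (M + 1)"
    and B: "\<And>M s. bnd M s \<Longrightarrow> consts_le M d \<Longrightarrow> cost d s \<le> B * (M + 1)" by auto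
  have "cost (CIf a b c d) s \<le> (2 + A + B) * (M + 1)" if "bnd M s" "consts_le M (CIf a b c d)" for M s
  proof -
    have "cost c s \<le> A * (M + 1)" "cost d s \<le> B * (M + 1)" using A B that by simp_all
    then have "cost (CIf a b c d) s \<le> 2 + A * (M + 1) + B * (M + 1)" by simp
    also have "\<dots> \<le> (2 + A + B) * (M + 1)" by (simp add: algebra_simps)
    finally show ?thesis .
  qed
  then show ?case by blast
next
  case (CFor v b c)
  then obtain A where A: "\<And>s. cost (CFor v b c) s \<le> A * (var s b + 1)" using for_cost by (metis unnested.simps(12))
  have "cost (CFor v b c) s \<le> A * (M + 1)" if "bnd M s" for M s
  proof -
    have "A * (var s b + 1) \<le> A * (M + 1)" using that by (simp add: bnd_def)
    then show ?thesis using A order_trans by blast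
  qed
  then show ?case by blast
qed (auto intro!: exI[of _ 5])

primrec seqs :: "com list \<Rightarrow> com" where
  "seqs [] = CSkip"
| "seqs (c # cs) = CSeq c (seqs cs)"

lemma run_seqs_append: "run (seqs (xs @ ys)) s = run (seqs ys) (run (seqs xs) s)"
  by (induction xs arbitrary: s) auto

lemma wvars_seqs: "wvars (seqs cs) = (\<Union>c\<in>set cs. wvars c)"
  by (induction cs) auto

lemma warrs_seqs: "warrs (seqs cs) = (\<Union>c\<in>set cs. warrs c)"
  by (induction cs) auto

lemma silent_seqs: "silent (seqs cs) \<longleftrightarrow> (\<forall>c\<in>set cs. silent c)"
  by (induction cs) auto

lemma flat_seqs: "flat (seqs cs) \<longleftrightarrow> (\<forall>c\<in>set cs. flat c)"
  by (induction cs) auto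

lemma unnested_seqs: "unnested (seqs cs) \<longleftrightarrow> (\<forall>c\<in>set cs. unnested c)"
  by (induction cs) auto

text \<open>The index is known when the program is written, so it may select arrays and constants,
  which are fixed parts of an instruction.\<close>

definition unroll :: "nat \<Rightarrow> (nat \<Rightarrow> com) \<Rightarrow> com" where
  "unroll D f = seqs (map f [0..<D])"

lemma unroll_simps [simp]:
  "wvars (unroll D f) = (\<Union>k<D. wvars (f k))" "warrs (unroll D f) = (\<Union>k<D. warrs (f k))"
  "silent (unroll D f) \<longleftrightarrow> (\<forall>k<D. silent (f k))" "flat (unroll D f) \<longleftrightarrow> (\<forall>k<D. flat (f k))"
  by (auto simp: unroll_def wvars_seqs warrs_seqs silent_seqs flat_seqs)

lemma run_unroll [simp]:
  "run (unroll 0 f) s = s" "run (unroll (Suc D) f) s = run (f D) (run (unroll D f) s)"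
  by (simp_all add: unroll_def run_seqs_append)

lemma unroll_induct:
  assumes "I 0 s" "\<And>k s. k < n \<Longrightarrow> I k s \<Longrightarrow> I (Suc k) (run (f k) s)"
  shows "I n (run (unroll n f) s)"
proof -
  have "k \<le> n \<Longrightarrow> I k (run (unroll k f) s)" for k
    by (induction k) (use assms in auto)
  then show ?thesis by simp
qed

text \<open>Comparisons that turn a value below \<open>n\<close> into an index of the code.
  Functions on a fixed finite set, such as operations on sets of labels, thereby become tables
  inside the program.\<close>

primrec switch :: "nat \<Rightarrow> nat \<Rightarrow> (nat \<Rightarrow> com) \<Rightarrow> nat \<Rightarrow> com" where
  "switch t x f 0 = CSkip"
| "switch t x f (Suc n) = CSeq (CConst t n) (CIf x t (switch t x f n) (f n))"

lemma run_switch: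
  assumes "x \<noteq> t"
  shows "var s x < n \<Longrightarrow> \<exists>v. run (switch t x f n) s = run (f (var s x)) (setv t v s)"
proof (induction n arbitrary: s)
  case (Suc n)
  show ?case
  proof (cases "var s x < n")
    case True
    then have "\<exists>v. run (switch t x f n) (setv t n s) = run (f (var s x)) (setv t v (setv t n s))"
      using Suc.IH[of "setv t n s"] assms by simp
    then show ?thesis using True assms by auto
  next
    case False
    then have "var s x = n" using Suc.prems by simp
    then show ?thesis using assms by auto
  qed
qed simp

lemma switch_simps [simp]:
  "wvars (switch t x f n) \<subseteq> insert t (\<Union>k<n. wvars (f k))" "warrs (switch t x f n) = (\<Union>k<n. warrs (f k))"
  "silent (switch t x f n) \<longleftrightarrow> (\<forall>k<n. silent (f k))" "flat (switch t x f n) \<longleftrightarrow> (\<forall>k<n. flat (f k))"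
  by (induction n) (auto simp: less_Suc_eq)

text \<open>The language cannot add; where a summand is known to be at most \<open>D\<close>,
  conditional increments do. Variable 31 is the common scratch variable.\<close>

definition plus_upto :: "nat \<Rightarrow> nat \<Rightarrow> nat \<Rightarrow> com" where
  "plus_upto D r a = unroll D (\<lambda>j. CSeq (CConst 31 j) (CIf 31 a (CInc r) CSkip))"

lemma plus_upto_simps [simp]:
  "wvars (plus_upto D r a) \<subseteq> {31, r}" "warrs (plus_upto D r a) = {}"
  "silent (plus_upto D r a)" "flat (plus_upto D r a)"
  by (auto simp: plus_upto_def)

lemma run_plus_upto:
  assumes "r \<noteq> a" "r \<noteq> 31" "a \<noteq> 31"
  shows "\<exists>v. run (plus_upto D r a) s = setv r (var s r + min D (var s a)) (setv 31 v s)"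
proof -
  have *: "run (CSeq (CConst 31 k) (CIf 31 a (CInc r) CSkip)) (setv r x (setv 31 v s)) =
    setv r (if k < var s a then Suc x else x) (setv 31 k s)" for k x v
    using assms by (auto simp: setv_def fun_upd_twist)
  have "\<exists>v. run (plus_upto D r a) s = setv r (var s r + min D (var s a)) (setv 31 v s)"
    unfolding plus_upto_def
  proof (induction D)
    case 0
    then show ?case by (auto simp: setv_def intro!: exI[of _ "var s 31"])
  next
    case (Suc D)
    then obtain v where "run (unroll D (\<lambda>j. CSeq (CConst 31 j) (CIf 31 a (CInc r) CSkip))) s =
      setv r (var s r + min D (var s a)) (setv 31 v s)" by blast
    then have "run (unroll (Suc D) (\<lambda>j. CSeq (CConst 31 j) (CIf 31 a (CInc r) CSkip))) s =
      setv r (if D < var s a then Suc (var s r + min D (var s a)) else var s r + min D (var s a)) (setv 31 D s)"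
      by (simp only: run_unroll *)
    also have "(if D < var s a then Suc (var s r + min D (var s a)) else var s r + min D (var s a)) =
      var s r + min (Suc D) (var s a)" by auto
    finally show ?case by blast
  qed
  then show ?thesis .
qed

subsection \<open>The heap of terms\<close>

text \<open>
  Terms are stored in arrays \<open>2\<close> (constructor) and \<open>3, 4, 5\<close> (arguments), never overwritten, with
  children before parents; variable \<open>2\<close> is the next free index. Index \<open>0\<close> is never a term.
  For the term at an index, \<open>6\<close> holds the code of its labels, \<open>7\<close> its reduction, \<open>8\<close> the first
  descendant that is not a \<open>Mv\<close>, and \<open>26 + 3q\<close> the restriction number \<open>q\<close>; \<open>9\<close> is a stack.

  Variables \<open>3, 4, 5\<close> count columns, rows, and cells. A cell has column \<open>10\<close>, row \<open>11\<close>, and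
  labels \<open>12\<close> and \<open>13\<close> in the terms of its column and row; \<open>14\<close> is, for each row, the last merged cell.
  A column has number of labels \<open>15\<close>, term \<open>16\<close>, group \<open>17\<close>, and label offset within its group \<open>18\<close>.
  The corresponding arrays for rows are \<open>19, \<dots>, 22\<close>. Arrays \<open>24 + 3j\<close> and \<open>25 + 3j\<close> hold the
  \<open>j\<close>-th leaf order and its inverse.
\<close>

definition node :: "nat \<Rightarrow> tm list \<Rightarrow> nat \<Rightarrow> nat \<Rightarrow> nat \<Rightarrow> nat \<Rightarrow> nat \<Rightarrow> tm \<Rightarrow> bool" where
  "node L Ts i k x y z t \<longleftrightarrow> (case t of
     Lf p \<Rightarrow> k = 0 \<and> x = p
   | Jn a b \<Rightarrow> k = 1 \<and> x < i \<and> y < i \<and> Ts ! x = a \<and> Ts ! y = b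
   | Mv j l a \<Rightarrow> k = 2 \<and> x < i \<and> Ts ! x = a \<and> y = j \<and> z = l \<and> j < L \<and> l < L)"

definition heap :: "nat \<Rightarrow> st \<Rightarrow> tm list \<Rightarrow> bool" where
  "heap L s Ts \<longleftrightarrow> length Ts = var s 2 \<and>
     (\<forall>i<length Ts. node L Ts i (arr s 2 i) (arr s 3 i) (arr s 4 i) (arr s 5 i) (Ts ! i))"

lemma heap_cong:
  "var s' 2 = var s 2 \<Longrightarrow> arr s' 2 = arr s 2 \<Longrightarrow> arr s' 3 = arr s 3 \<Longrightarrow> arr s' 4 = arr s 4 \<Longrightarrow>
    arr s' 5 = arr s 5 \<Longrightarrow> heap L s' Ts = heap L s Ts"
  by (simp add: heap_def)

definition ref :: "tm list \<Rightarrow> nat \<Rightarrow> tm \<Rightarrow> bool" where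
  "ref Ts i t \<longleftrightarrow> 0 < i \<and> i < length Ts \<and> Ts ! i = t"

lemma ref_append: "ref Ts i t \<Longrightarrow> ref (Ts @ Us) i t"
  by (simp add: ref_def nth_append)

lemma ref_last: "Ts \<noteq> [] \<Longrightarrow> ref (Ts @ [t]) (length Ts) t"
  by (simp add: ref_def)

text \<open>Terms are only ever appended, so references and recorded facts about terms survive along
  this relation.\<close>

definition extends :: "tm list \<Rightarrow> tm list \<Rightarrow> bool" where
  "extends Ts Ts' \<longleftrightarrow> (\<exists>Us. Ts' = Ts @ Us)"

lemma extends_refl [simp]: "extends Ts Ts"
  by (simp add: extends_def)

lemma extends_append [simp]: "extends Ts (Ts @ Us)"
  by (simp add: extends_def)

lemma extends_trans: "extends Ts Us \<Longrightarrow> extends Us Vs \<Longrightarrow> extends Ts Vs"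
  by (auto simp: extends_def)

lemma ref_extends: "ref Ts i t \<Longrightarrow> extends Ts Us \<Longrightarrow> ref Us i t"
  by (auto simp: extends_def ref_append)

definition emit :: "nat \<Rightarrow> nat \<Rightarrow> nat \<Rightarrow> nat \<Rightarrow> nat \<Rightarrow> com" where
  "emit k x y z r = seqs [CConst 31 k, CSt 2 2 31, CSt 3 2 x, CSt 4 2 y, CSt 5 2 z, CMov r 2, CInc 2]"

lemma emit_simps [simp]:
  "wvars (emit k x y z r) = {31, r, 2}" "warrs (emit k x y z r) = {2, 3, 4, 5}"
  "silent (emit k x y z r)" "flat (emit k x y z r)"
  by (auto simp: emit_def)

lemma var_emit:
  "r \<noteq> 2 \<Longrightarrow> var (run (emit k x y z r) s) 2 = Suc (var s 2)"
  "r \<noteq> 2 \<Longrightarrow> r \<noteq> 31 \<Longrightarrow> var (run (emit k x y z r) s) r = var s 2"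
  by (simp_all add: emit_def)

lemma node_append: "node L Ts i k x y z t \<Longrightarrow> i \<le> length Ts \<Longrightarrow> node L (Ts @ Us) i k x y z t"
  by (auto simp: node_def nth_append split: tm.splits)

lemma heap_emit:
  assumes "heap L s Ts" "node L Ts (length Ts) k (var s x) (var s y) (var s z) t"
    "x \<noteq> 31" "y \<noteq> 31" "z \<noteq> 31" "r \<noteq> 2"
  shows "heap L (run (emit k x y z r) s) (Ts @ [t])"
  unfolding heap_def
proof (intro conjI allI impI)
  let ?s = "run (emit k x y z r) s"
  have l: "length Ts = var s 2" using assms(1) by (simp add: heap_def)
  show "length (Ts @ [t]) = var ?s 2" using l assms(6) by (simp add: var_emit)
  fix i assume i: "i < length (Ts @ [t])"
  have arrs: "arr ?s 2 = (arr s 2)(var s 2 := k)" "arr ?s 3 = (arr s 3)(var s 2 := var s x)"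
    "arr ?s 4 = (arr s 4)(var s 2 := var s y)" "arr ?s 5 = (arr s 5)(var s 2 := var s z)"
    using assms by (simp_all add: emit_def)
  show "node L (Ts @ [t]) i (arr ?s 2 i) (arr ?s 3 i) (arr ?s 4 i) (arr ?s 5 i) ((Ts @ [t]) ! i)"
  proof (cases "i = length Ts")
    case True
    then have "(Ts @ [t]) ! i = t" "i = var s 2" using l by (metis nth_append_length, simp)
    then show ?thesis unfolding arrs using node_append[OF assms(2)] l by simp
  next
    case False
    then have "i < length Ts" using i by simp
    then show ?thesis unfolding arrs using assms(1) l node_append[of L Ts i]
      by (simp add: heap_def nth_append)
  qed
qed

subsection \<open>Grouping consecutive columns\<close>

definition rename_labels :: "nat \<Rightarrow> com" where
  "rename_labels D = unroll D (\<lambda>j. CSeq (CConst 31 j) (CIf 31 10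
     (seqs [CConst 17 j, CConst 18 (D + j), plus_upto D 18 14, emit 2 8 17 18 8]) CSkip))"

lemma rename_labels_frame:
  "x \<notin> {31, 17, 18, 8, 2} \<Longrightarrow> var (run (rename_labels D) s) x = var s x"
  "a \<notin> {2, 3, 4, 5} \<Longrightarrow> arr (run (rename_labels D) s) a = arr s a"
proof -
  have w: "wvars (rename_labels D) \<subseteq> {31, 17, 18, 8, 2}" "warrs (rename_labels D) \<subseteq> {2, 3, 4, 5}"
    by (auto simp: rename_labels_def dest: subsetD[OF plus_upto_simps(1)])
  show "x \<notin> {31, 17, 18, 8, 2} \<Longrightarrow> var (run (rename_labels D) s) x = var s x"
    using w by (intro run_frame) blast
  show "a \<notin> {2, 3, 4, 5} \<Longrightarrow> arr (run (rename_labels D) s) a = arr s a"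
    using w by (intro run_frame_arr) blast
qed

lemma ref_emit:
  assumes "heap L s Ts" "node L Ts (length Ts) k (var s x) (var s y) (var s z) t"
    "x \<noteq> 31" "y \<noteq> 31" "z \<noteq> 31" "r \<noteq> 2" "r \<noteq> 31" "Ts \<noteq> []"
  shows "ref (Ts @ [t]) (var (run (emit k x y z r) s) r) t"
  using assms var_emit(2)[of r k x y z s] ref_last[of Ts t] by (simp add: heap_def)

lemma ref_nonempty: "ref Ts i t \<Longrightarrow> Ts \<noteq> []"
  by (auto simp: ref_def)

lemma rename_labels_spec:
  assumes "heap (2 * D) s Ts" "ref Ts (var s 8) t" "var s 14 + var s 10 \<le> D"
  shows "\<exists>Ts'. extends Ts Ts' \<and> heap (2 * D) (run (rename_labels D) s) Ts' \<and>
    ref Ts' (var (run (rename_labels D) s) 8) (ren D (var s 14) (var s 10) t)"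
proof -
  let ?k = "var s 10" and ?o = "var s 14"
  let ?I = "\<lambda>j s'. \<exists>Ts'. extends Ts Ts' \<and> heap (2 * D) s' Ts' \<and> ref Ts' (var s' 8) (ren D ?o (min j ?k) t) \<and>
    var s' 10 = ?k \<and> var s' 14 = ?o"
  have "?I D (run (rename_labels D) s)"
    unfolding rename_labels_def
  proof (rule unroll_induct[where I = ?I])
    show "?I 0 s" using assms(1,2) by (auto intro!: exI[of _ Ts])
  next
    fix j s' assume j: "j < D" and "?I j s'"
    then obtain Ts' where I: "extends Ts Ts'" "heap (2 * D) s' Ts'" "ref Ts' (var s' 8) (ren D ?o (min j ?k) t)"
      "var s' 10 = ?k" "var s' 14 = ?o" by blast
    show "?I (Suc j) (run (CSeq (CConst 31 j) (CIf 31 10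
      (seqs [CConst 17 j, CConst 18 (D + j), plus_upto D 18 14, emit 2 8 17 18 8]) CSkip)) s')"
    proof (cases "j < ?k")
      case False
      then have "min (Suc j) ?k = min j ?k" by simp
      moreover have "heap (2 * D) (setv 31 j s') Ts'" using I(2) by (subst heap_cong[of _ s']) auto
      ultimately show ?thesis using I False by (auto intro!: exI[of _ Ts'])
    next
      case True
      obtain v where v: "run (plus_upto D 18 14) (setv 18 (D + j) (setv 17 j (setv 31 j s'))) =
        setv 18 (D + j + min D ?o) (setv 31 v (setv 18 (D + j) (setv 17 j (setv 31 j s'))))"
        using run_plus_upto[of 18 14 D "setv 18 (D + j) (setv 17 j (setv 31 j s'))"] I by auto
      define s1 where "s1 = setv 18 (D + j + ?o) (setv 31 v (setv 18 (D + j) (setv 17 j (setv 31 j s'))))"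
      have s1: "var s1 8 = var s' 8" "var s1 17 = j" "var s1 18 = D + ?o + j" "var s1 10 = ?k" "var s1 14 = ?o"
        unfolding s1_def using I by simp_all
      have h: "heap (2 * D) s1 Ts'" using I(2) unfolding s1_def by (subst heap_cong[of _ s']) auto
      have "node (2 * D) Ts' (length Ts') 2 (var s1 8) (var s1 17) (var s1 18) (Mv j (D + ?o + j) (ren D ?o j t))"
        using I(3) True assms(3) unfolding s1 node_def ref_def by simp
      note e = heap_emit[OF h this, of 8] ref_emit[OF h this, of 8]
      have run: "run (CSeq (CConst 31 j) (CIf 31 10
        (seqs [CConst 17 j, CConst 18 (D + j), plus_upto D 18 14, emit 2 8 17 18 8]) CSkip)) s' =
        run (emit 2 8 17 18 8) s1"
        using True I(4) v assms(3) by (simp add: s1_def)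
      show ?thesis unfolding run
        using e I(1) True s1 ref_nonempty[OF I(3)] extends_trans[OF I(1)]
          run_frame[of 10 "emit 2 8 17 18 8" s1] run_frame[of 14 "emit 2 8 17 18 8" s1]
        by (intro exI[of _ "Ts' @ [Mv j (D + ?o + j) (ren D ?o j t)]"]) (auto simp: min_def)
    qed
  qed
  moreover have "min D ?k = ?k" using assms(3) by simp
  ultimately show ?thesis by auto
qed

text \<open>Groups overwrite the entries of the columns in place, which is safe since a group never
  has a larger index than the column being read. Variable 24 holds \<open>D + 1\<close>, so the test
  means \<open>acc + cnt \<le> D\<close>. The count of a new group is reset to 0 in preparation for
  merging.\<close>

definition scan_body :: "nat \<Rightarrow> nat \<Rightarrow> nat \<Rightarrow> nat \<Rightarrow> nat \<Rightarrow> com" where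
  "scan_body D cnt cur gc off = seqs
    [CLd 8 cur 6, CLd 10 cnt 6, CMov 11 15, plus_upto D 11 10,
     CIf 11 24 (seqs [CMov 14 15, CMov 15 11, CConst 26 1])
       (seqs [CConst 14 0, CMov 15 10, CMov 12 16, CInc 16, CConst 26 0]),
     CSt off 6 14, CSt gc 6 12, rename_labels D, CConst 31 0,
     CIf 31 26 (seqs [CLd 9 cur 12, emit 1 9 8 8 8]) (CSt cnt 12 31),
     CSt cur 12 8]"

definition scan :: "nat \<Rightarrow> nat \<Rightarrow> nat \<Rightarrow> nat \<Rightarrow> nat \<Rightarrow> nat \<Rightarrow> com" where
  "scan D m cnt cur gc off = seqs
    [CConst 16 0, CConst 15 (D + 1), CConst 24 (D + 1), CFor 6 m (scan_body D cnt cur gc off), CMov m 16]"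

definition scan_inv ::
  "nat \<Rightarrow> nat \<Rightarrow> nat \<Rightarrow> nat \<Rightarrow> nat \<Rightarrow> (nat \<Rightarrow> nat) \<Rightarrow> (nat \<Rightarrow> tm) \<Rightarrow> nat \<Rightarrow> tm list \<Rightarrow> nat \<Rightarrow> st \<Rightarrow> bool"
where
  "scan_inv D cnt cur gc off cnt0 X m Ts0 c s \<longleftrightarrow>
    (\<exists>Ts Z. extends Ts0 Ts \<and> heap (2 * D) s Ts \<and>
      scanned D cnt0 X c (var s 16) (var s 15) (arr s gc) (arr s off) Z \<and>
      (\<forall>i. c \<le> i \<longrightarrow> i < m \<longrightarrow> arr s cnt i = cnt0 i \<and> ref Ts (arr s cur i) (X i)) \<and>
      (\<forall>g<var s 16. arr s cnt g = 0 \<and> ref Ts (arr s cur g) (Z g)) \<and>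
      var s 24 = D + 1 \<and> (0 < c \<longrightarrow> Suc (var s 12) = var s 16))"

lemma scan_step:
  assumes inv: "scan_inv D cnt cur gc off cnt0 X m Ts0 c s" and c: "c < m" and sd: "side D m cnt0 X"
    and ids: "distinct [2, 3, 4, 5, cnt, cur, gc, off]"
  shows "scan_inv D cnt cur gc off cnt0 X m Ts0 (Suc c) (run (scan_body D cnt cur gc off) (setv 6 c s))"
proof -
  from inv obtain Ts Z where I0: "extends Ts0 Ts \<and> heap (2 * D) s Ts \<and>
      scanned D cnt0 X c (var s 16) (var s 15) (arr s gc) (arr s off) Z \<and>
      (\<forall>i. c \<le> i \<longrightarrow> i < m \<longrightarrow> arr s cnt i = cnt0 i \<and> ref Ts (arr s cur i) (X i)) \<and>
      (\<forall>g<var s 16. arr s cnt g = 0 \<and> ref Ts (arr s cur g) (Z g)) \<and>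
      var s 24 = D + 1 \<and> (0 < c \<longrightarrow> Suc (var s 12) = var s 16)"
    unfolding scan_inv_def by (elim exE)
  have I: "extends Ts0 Ts" "heap (2 * D) s Ts"
      "scanned D cnt0 X c (var s 16) (var s 15) (arr s gc) (arr s off) Z"
      "\<And>i. c \<le> i \<Longrightarrow> i < m \<Longrightarrow> arr s cnt i = cnt0 i" "\<And>i. c \<le> i \<Longrightarrow> i < m \<Longrightarrow> ref Ts (arr s cur i) (X i)"
      "\<And>g. g < var s 16 \<Longrightarrow> arr s cnt g = 0" "\<And>g. g < var s 16 \<Longrightarrow> ref Ts (arr s cur g) (Z g)"
      "var s 24 = D + 1" "0 < c \<Longrightarrow> Suc (var s 12) = var s 16"
    using I0 by (simp_all only: simp_thms)
  have X: "wft (X c)" "cx D (X c)" "dm (X c) = {..<cnt0 c}" "cnt0 c \<le> D" using sd c by (auto simp: side_def)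
  let ?k = "cnt0 c" and ?acc = "var s 15" and ?G = "var s 16"
  have Gc: "?G \<le> c" using I(3) by (simp add: scanned_def)
  have ne: "cnt \<noteq> cur" "gc \<noteq> cnt" "gc \<noteq> cur" "off \<noteq> cnt" "off \<noteq> cur" "off \<noteq> gc"
    "cnt \<notin> {2,3,4,5}" "cur \<notin> {2,3,4,5}" "gc \<notin> {2,3,4,5}" "off \<notin> {2,3,4,5}"
    using ids by auto
  obtain v where v: "run (plus_upto D 11 10) (setv 11 ?acc (setv 10 ?k (setv 8 (arr s cur c) (setv 6 c s)))) =
     setv 11 (?acc + ?k) (setv 31 v (setv 11 ?acc (setv 10 ?k (setv 8 (arr s cur c) (setv 6 c s)))))"
    using run_plus_upto[of 11 10 D "setv 11 ?acc (setv 10 ?k (setv 8 (arr s cur c) (setv 6 c s)))"] X(4) by auto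
  define s1 where "s1 = setv 11 (?acc + ?k) (setv 31 v (setv 11 ?acc (setv 10 ?k (setv 8 (arr s cur c) (setv 6 c s)))))"
  have s1: "var s1 8 = arr s cur c" "var s1 10 = ?k" "var s1 11 = ?acc + ?k" "var s1 15 = ?acc" "var s1 16 = ?G"
    "var s1 12 = var s 12" "var s1 24 = D + 1" "var s1 6 = c" "arr s1 = arr s" "var s1 2 = var s 2"
    unfolding s1_def using I(8) by simp_all
  show ?thesis
  proof (cases "?acc + ?k \<le> D")
    case False
    define s3 where "s3 = seta gc c ?G (seta off c 0 (setv 26 0 (setv 16 (Suc ?G) (setv 12 ?G (setv 15 ?k (setv 14 0 s1))))))"
    have s3: "var s3 8 = arr s cur c" "var s3 10 = ?k" "var s3 14 = 0" "var s3 15 = ?k" "var s3 16 = Suc ?G"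
      "var s3 12 = ?G" "var s3 24 = D + 1" "var s3 26 = 0" "var s3 6 = c" "arr s3 cnt = arr s cnt"
      "arr s3 cur = arr s cur" "arr s3 gc = (arr s gc)(c := ?G)" "arr s3 off = (arr s off)(c := 0)"
      unfolding s3_def using s1 ne by auto
    have "heap (2 * D) s3 Ts" using I(2) s1 ne unfolding s3_def by (subst heap_cong[of _ s]) auto
    then obtain Ts' where Ts': "extends Ts Ts'" "heap (2 * D) (run (rename_labels D) s3) Ts'"
      "ref Ts' (var (run (rename_labels D) s3) 8) (ren D 0 ?k (X c))"
      using rename_labels_spec[of D s3 Ts "X c"] I(5)[of c] c s3 X(4) by auto
    define s4 where "s4 = run (rename_labels D) s3"
    have s4: "var s4 x = var s3 x" if "x \<notin> {31, 17, 18, 8, 2}" for x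
      unfolding s4_def using rename_labels_frame(1) that .
    have a4: "arr s4 a = arr s3 a" if "a \<notin> {2, 3, 4, 5}" for a
      unfolding s4_def using rename_labels_frame(2) that .
    let ?s' = "run (scan_body D cnt cur gc off) (setv 6 c s)"
    have r: "?s' = seta cur ?G (var s4 8) (seta cnt ?G 0 (setv 31 0 s4))"
      unfolding scan_body_def using False I(4)[of c] c v s4[of 26] s4[of 12] s3 s1 ne
      by (simp add: s1_def[symmetric] s3_def[symmetric] s4_def[symmetric] del: unroll_simps)
    show ?thesis
      unfolding scan_inv_def
    proof (intro exI[of _ Ts'] exI[of _ "Z(?G := ren D 0 ?k (X c))"] conjI)
      show "extends Ts0 Ts'" using I(1) Ts'(1) extends_trans by blast
      show "heap (2 * D) ?s' Ts'" unfolding r using Ts'(2) ne by (subst heap_cong[of _ s4]) (auto simp: s4_def)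
      show "scanned D cnt0 X (Suc c) (var ?s' 16) (var ?s' 15) (arr ?s' gc) (arr ?s' off) (Z(?G := ren D 0 ?k (X c)))"
        using scanned_new[OF I(3) X] False s3 s4 a4 ne unfolding r by auto
      show "\<forall>i. Suc c \<le> i \<longrightarrow> i < m \<longrightarrow> arr ?s' cnt i = cnt0 i \<and> ref Ts' (arr ?s' cur i) (X i)"
        using I(4,5) Gc s3 a4 ne ref_extends[OF _ Ts'(1)] unfolding r by auto
      show "\<forall>g<var ?s' 16. arr ?s' cnt g = 0 \<and> ref Ts' (arr ?s' cur g) ((Z(?G := ren D 0 ?k (X c))) g)"
        using I(6,7) s3 s4 a4 ne ref_extends[OF _ Ts'(1)] Ts'(3) unfolding r by (auto simp: less_Suc_eq s4_def[symmetric])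
      show "var ?s' 24 = D + 1" "0 < Suc c \<longrightarrow> Suc (var ?s' 12) = var ?s' 16"
        using s3 s4 unfolding r by auto
    qed
  next
    case True
    have j: "0 < ?G" "scanned D cnt0 X (Suc c) ?G (?acc + ?k) ((arr s gc)(c := ?G - 1)) ((arr s off)(c := ?acc))
        (Z(?G - 1 := Jn (Z (?G - 1)) (ren D ?acc ?k (X c))))"
      using scanned_join[OF I(3) X True] by auto
    then have c0: "0 < c" using Gc by simp
    define H where "H = ?G - 1"
    have H: "?G = Suc H" "var s 12 = H" using j(1) I(9)[OF c0] unfolding H_def by auto
    define s3 where "s3 = seta gc c H (seta off c ?acc (setv 26 (Suc 0) (setv 15 (?acc + ?k) (setv 14 ?acc s1))))"
    have s3: "var s3 8 = arr s cur c" "var s3 10 = ?k" "var s3 14 = ?acc" "var s3 15 = ?acc + ?k" "var s3 16 = ?G"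
      "var s3 12 = H" "var s3 24 = D + 1" "var s3 26 = 1" "var s3 6 = c" "arr s3 cnt = arr s cnt"
      "arr s3 cur = arr s cur" "arr s3 gc = (arr s gc)(c := H)" "arr s3 off = (arr s off)(c := ?acc)"
      unfolding s3_def using s1 ne H by auto
    have "heap (2 * D) s3 Ts" using I(2) s1 ne unfolding s3_def by (subst heap_cong[of _ s]) auto
    then obtain Ts' where Ts': "extends Ts Ts'" "heap (2 * D) (run (rename_labels D) s3) Ts'"
      "ref Ts' (var (run (rename_labels D) s3) 8) (ren D ?acc ?k (X c))"
      using rename_labels_spec[of D s3 Ts "X c"] I(5)[of c] c s3 True by auto
    define s4 where "s4 = run (rename_labels D) s3"
    have s4: "var s4 x = var s3 x" if "x \<notin> {31, 17, 18, 8, 2}" for x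
      unfolding s4_def using rename_labels_frame(1) that .
    have a4: "arr s4 a = arr s3 a" if "a \<notin> {2, 3, 4, 5}" for a
      unfolding s4_def using rename_labels_frame(2) that .
    define s5 where "s5 = setv 9 (arr s cur H) (setv 31 0 s4)"
    have h5: "heap (2 * D) s5 Ts'" using Ts'(2) unfolding s5_def by (subst heap_cong[of _ s4]) (auto simp: s4_def)
    have v5: "var s5 9 = arr s cur H" "var s5 8 = var s4 8" by (simp_all add: s5_def)
    have rH: "ref Ts' (arr s cur H) (Z H)" using I(7) H ref_extends[OF _ Ts'(1)] by auto
    let ?J = "Jn (Z H) (ren D ?acc ?k (X c))"
    have "node (2 * D) Ts' (length Ts') (Suc 0) (var s5 9) (var s5 8) (var s5 8) ?J"
      using rH Ts'(3) unfolding v5 node_def ref_def s4_def by simp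
    note e = heap_emit[OF h5 this, of 8] ref_emit[OF h5 this, of 8]
    define s6 where "s6 = run (emit (Suc 0) 9 8 8 8) s5"
    have s6: "var s6 x = var s3 x" if "x \<notin> {31, 17, 18, 8, 2, 9}" for x
      unfolding s6_def using run_frame[of x "emit (Suc 0) 9 8 8 8" s5] s4[of x] that by (auto simp: s5_def)
    have a6: "arr s6 a = arr s3 a" if "a \<notin> {2, 3, 4, 5}" for a
      unfolding s6_def using run_frame_arr[of a "emit (Suc 0) 9 8 8 8" s5] a4[of a] that by (auto simp: s5_def)
    let ?s' = "run (scan_body D cnt cur gc off) (setv 6 c s)"
    have r: "?s' = seta cur H (var s6 8) s6"
      unfolding scan_body_def using True I(4)[of c] c v s4[of 26] s4[of 12] s3 s1 ne H a4[of cur] s6[of 12]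
      by (simp add: s1_def[symmetric] s3_def[symmetric] s4_def[symmetric] s5_def[symmetric] s6_def[symmetric] del: unroll_simps)
    let ?Ts = "Ts' @ [?J]"
    have ext: "extends Ts ?Ts" using Ts'(1) extends_trans by (metis extends_append)
    show ?thesis
      unfolding scan_inv_def
    proof (intro exI[of _ ?Ts] exI[of _ "Z(H := ?J)"] conjI)
      show "extends Ts0 ?Ts" using I(1) ext extends_trans by blast
      show "heap (2 * D) ?s' ?Ts" unfolding r using e(1) ne by (subst heap_cong[of _ s6]) (auto simp: s6_def)
      show "scanned D cnt0 X (Suc c) (var ?s' 16) (var ?s' 15) (arr ?s' gc) (arr ?s' off) (Z(H := ?J))"
        using j(2) H s3 s6 a6 ne unfolding r by auto
      show "\<forall>i. Suc c \<le> i \<longrightarrow> i < m \<longrightarrow> arr ?s' cnt i = cnt0 i \<and> ref ?Ts (arr ?s' cur i) (X i)"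
        using I(4,5) Gc H s3 a6 ne ref_extends[OF _ ext] unfolding r by auto
      show "\<forall>g<var ?s' 16. arr ?s' cnt g = 0 \<and> ref ?Ts (arr ?s' cur g) ((Z(H := ?J)) g)"
        using I(6,7) H s3 s6 a6 ne ref_extends[OF _ ext] e(2) ref_nonempty[OF rH] unfolding r by (auto simp: s6_def[symmetric])
      show "var ?s' 24 = D + 1" "0 < Suc c \<longrightarrow> Suc (var ?s' 12) = var ?s' 16"
        using s3 s6 H unfolding r by auto
    qed
  qed
qed

lemma scan_spec:
  assumes h: "heap (2 * D) s Ts" and sd: "side D (var s m) (arr s cnt) X"
    and refs: "\<And>i. i < var s m \<Longrightarrow> ref Ts (arr s cur i) (X i)"
    and ids: "distinct [2, 3, 4, 5, cnt, cur, gc, off]" and m: "m \<in> {3, 4}"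
  defines "s' \<equiv> run (scan D m cnt cur gc off) s"
  shows "\<exists>Ts' Z acc. extends Ts Ts' \<and> heap (2 * D) s' Ts' \<and>
    scanned D (arr s cnt) X (var s m) (var s' m) acc (arr s' gc) (arr s' off) Z \<and>
    (\<forall>g<var s' m. arr s' cnt g = 0 \<and> ref Ts' (arr s' cur g) (Z g))"
proof -
  define s0 where "s0 = setv 24 (Suc D) (setv 15 (Suc D) (setv 16 0 s))"
  have v0: "var s0 m = var s m" "var s0 16 = 0" "var s0 15 = D + 1" "var s0 24 = D + 1" "arr s0 = arr s"
    using m by (auto simp: s0_def)
  have "scan_inv D cnt cur gc off (arr s cnt) X (var s m) Ts (var s m)
    (loop (\<lambda>c s. run (scan_body D cnt cur gc off) (setv 6 c s)) (var s m) s0)"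
  proof (rule loop_induct[where I = "scan_inv D cnt cur gc off (arr s cnt) X (var s m) Ts"])
    have "heap (2 * D) s0 Ts" using h by (subst heap_cong[of _ s]) (auto simp: s0_def)
    then show "scan_inv D cnt cur gc off (arr s cnt) X (var s m) Ts 0 s0"
      using refs scanned_init unfolding scan_inv_def v0 by (intro exI[of _ Ts] exI[of _ X]) auto
  next
    fix c s1 assume "c < var s m" "scan_inv D cnt cur gc off (arr s cnt) X (var s m) Ts c s1"
    then show "scan_inv D cnt cur gc off (arr s cnt) X (var s m) Ts (Suc c)
      (run (scan_body D cnt cur gc off) (setv 6 c s1))" using scan_step sd ids by blast
  qed
  moreover define s2 where "s2 = loop (\<lambda>c s. run (scan_body D cnt cur gc off) (setv 6 c s)) (var s m) s0"
  moreover have s': "s' = setv m (var s2 16) s2"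
    unfolding s'_def scan_def s2_def using v0(1) m by (auto simp: s0_def[symmetric])
  ultimately obtain Ts' Z where I: "extends Ts Ts'" "heap (2 * D) s2 Ts'"
    "scanned D (arr s cnt) X (var s m) (var s2 16) (var s2 15) (arr s2 gc) (arr s2 off) Z"
    "\<forall>g<var s2 16. arr s2 cnt g = 0 \<and> ref Ts' (arr s2 cur g) (Z g)"
    unfolding scan_inv_def by blast
  have "heap (2 * D) s' Ts'" using I(2) m unfolding s' by (subst heap_cong[of _ s2]) auto
  then show ?thesis using I unfolding s'
    by (intro exI[of _ Ts'] exI[of _ Z] exI[of _ "var s2 15"]) auto
qed

subsection \<open>Merging the cells\<close>

definition fetch :: "nat \<Rightarrow> com" where
  "fetch D = seqs
    [CLd 8 10 6, CLd 9 11 6, CLd 12 17 8, CLd 13 21 9, CLd 14 18 8, CLd 15 22 9, CLd 17 12 6, CLd 18 13 6,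
     CConst 21 D, plus_upto D 21 14, plus_upto D 21 17, CConst 22 D, plus_upto D 22 15, plus_upto D 22 18]"

text \<open>Variable 26 becomes 1 exactly if the cell exists already. The count of the row is tested
  first because the entry of array 14 means nothing for an empty row.\<close>

definition locate :: com where
  "locate = seqs
    [CConst 26 0, CConst 28 0, CLd 20 19 13, CLd 19 14 13, CLd 27 10 19,
     CIf 28 20 (CIf 27 12 CSkip (CConst 26 1)) CSkip]"

text \<open>The merged cells overwrite the list of old cells; their number, variable 23, never
  exceeds the index of the cell being read.\<close>

definition new_cell :: com where
  "new_cell = seqs
    [CMov 19 23, CSt 10 19 12, CSt 11 19 13, CLd 10 15 12, CSt 12 19 10, CInc 10, CSt 15 12 10,
     CSt 13 19 20, CInc 20, CSt 19 13 20, CSt 14 13 19, CInc 23]"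

definition relink :: com where
  "relink = seqs
    [CLd 29 12 19, CLd 30 13 19, CLd 8 16 12, emit 2 8 21 29 8, CSt 16 12 8,
     CLd 9 20 13, emit 2 9 22 30 9, CSt 20 13 9]"

definition merge_body :: "nat \<Rightarrow> com" where
  "merge_body D = seqs [fetch D, locate, CIf 28 26 CSkip new_cell, relink]"

definition merge :: "nat \<Rightarrow> com" where
  "merge D = seqs [CConst 23 0, CFor 6 5 (merge_body D), CMov 5 23]"

lemma fetch_spec:
  fixes D s
  defines "s' \<equiv> run (fetch D) s" and "c \<equiv> arr s 10 (var s 6)" and "r \<equiv> arr s 11 (var s 6)"
  assumes "arr s 18 c + arr s 12 (var s 6) \<le> D" "arr s 22 r + arr s 13 (var s 6) \<le> D"
  shows "var s' 12 = arr s 17 c" "var s' 13 = arr s 21 r"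
    "var s' 21 = D + arr s 18 c + arr s 12 (var s 6)" "var s' 22 = D + arr s 22 r + arr s 13 (var s 6)"
    "arr s' = arr s" "var s' 2 = var s 2" "var s' 6 = var s 6" "var s' 23 = var s 23"
proof -
  let ?e = "var s 6"
  define s1 where "s1 = setv 21 D (setv 18 (arr s 13 ?e) (setv 17 (arr s 12 ?e) (setv 15 (arr s 22 r)
    (setv 14 (arr s 18 c) (setv 13 (arr s 21 r) (setv 12 (arr s 17 c) (setv 9 r (setv 8 c s))))))))"
  obtain v1 where v1: "run (plus_upto D 21 14) s1 = setv 21 (D + arr s 18 c) (setv 31 v1 s1)"
    using run_plus_upto[of 21 14 D s1] assms(4) by (auto simp: s1_def)
  define s2 where "s2 = setv 21 (D + arr s 18 c) (setv 31 v1 s1)"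
  obtain v2 where v2: "run (plus_upto D 21 17) s2 = setv 21 (D + arr s 18 c + arr s 12 ?e) (setv 31 v2 s2)"
    using run_plus_upto[of 21 17 D s2] assms(4) by (auto simp: s1_def s2_def)
  define s3 where "s3 = setv 22 D (setv 21 (D + arr s 18 c + arr s 12 ?e) (setv 31 v2 s2))"
  obtain v3 where v3: "run (plus_upto D 22 15) s3 = setv 22 (D + arr s 22 r) (setv 31 v3 s3)"
    using run_plus_upto[of 22 15 D s3] assms(5) by (auto simp: s1_def s2_def s3_def)
  define s4 where "s4 = setv 22 (D + arr s 22 r) (setv 31 v3 s3)"
  obtain v4 where v4: "run (plus_upto D 22 18) s4 = setv 22 (D + arr s 22 r + arr s 13 ?e) (setv 31 v4 s4)"
    using run_plus_upto[of 22 18 D s4] assms(5) by (auto simp: s1_def s2_def s3_def s4_def)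
  have "s' = setv 22 (D + arr s 22 r + arr s 13 ?e) (setv 31 v4 s4)"
    unfolding s'_def fetch_def using v1 v2 v3 v4 unfolding s1_def s2_def s3_def s4_def c_def r_def by simp
  then show "var s' 12 = arr s 17 c" "var s' 13 = arr s 21 r"
    "var s' 21 = D + arr s 18 c + arr s 12 (var s 6)" "var s' 22 = D + arr s 22 r + arr s 13 (var s 6)"
    "arr s' = arr s" "var s' 2 = var s 2" "var s' 6 = var s 6" "var s' 23 = var s 23"
    by (simp_all add: s1_def s2_def s3_def s4_def)
qed

lemma locate_spec:
  fixes s
  defines "s' \<equiv> run locate s"
  shows "var s' 26 = (if 0 < arr s 19 (var s 13) \<and> \<not> arr s 10 (arr s 14 (var s 13)) < var s 12 then 1 else 0)"
    "var s' 28 = 0" "var s' 20 = arr s 19 (var s 13)" "var s' 19 = arr s 14 (var s 13)"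
    "x \<notin> {26, 28, 20, 19, 27} \<Longrightarrow> var s' x = var s x" "arr s' = arr s"
  unfolding s'_def locate_def by auto

lemma new_cell_spec:
  fixes s
  defines "s' \<equiv> run new_cell s"
  defines "n \<equiv> var s 23" and "g \<equiv> var s 12" and "h \<equiv> var s 13"
  shows "var s' 19 = n" "var s' 23 = Suc n" "x \<notin> {19, 10, 20, 23} \<Longrightarrow> var s' x = var s x"
    "arr s' 10 = (arr s 10)(n := g)" "arr s' 11 = (arr s 11)(n := h)" "arr s' 12 = (arr s 12)(n := arr s 15 g)"
    "arr s' 13 = (arr s 13)(n := var s 20)" "arr s' 15 = (arr s 15)(g := Suc (arr s 15 g))"
    "arr s' 19 = (arr s 19)(h := Suc (var s 20))" "arr s' 14 = (arr s 14)(h := n)"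
    "a \<notin> {10, 11, 12, 13, 14, 15, 19} \<Longrightarrow> arr s' a = arr s a"
  unfolding s'_def new_cell_def n_def g_def h_def by auto

lemma relink_spec:
  fixes s
  defines "s' \<equiv> run relink s" and "g \<equiv> var s 12" and "h \<equiv> var s 13" and "f \<equiv> var s 19"
  assumes "heap (2 * D) s Ts" "ref Ts (arr s 16 g) t" "ref Ts (arr s 20 h) u"
    "var s 21 < 2 * D" "var s 22 < 2 * D" "arr s 12 f < D" "arr s 13 f < D"
  shows "\<exists>Ts' p q. extends Ts Ts' \<and> heap (2 * D) s' Ts' \<and> ref Ts' p (Mv (var s 21) (arr s 12 f) t) \<and>
      ref Ts' q (Mv (var s 22) (arr s 13 f) u) \<and>
      arr s' 16 = (arr s 16)(g := p) \<and> arr s' 20 = (arr s 20)(h := q)"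
    "x \<notin> {29, 30, 8, 9, 31, 2} \<Longrightarrow> var s' x = var s x" "a \<notin> {2, 3, 4, 5, 16, 20} \<Longrightarrow> arr s' a = arr s a"
proof -
  define s1 where "s1 = setv 8 (arr s 16 g) (setv 30 (arr s 13 f) (setv 29 (arr s 12 f) s))"
  have h1: "heap (2 * D) s1 Ts" using assms(5) unfolding s1_def by (subst heap_cong[of _ s]) auto
  have "node (2 * D) Ts (length Ts) 2 (var s1 8) (var s1 21) (var s1 29) (Mv (var s 21) (arr s 12 f) t)"
    using assms by (simp add: node_def ref_def s1_def)
  note e1 = heap_emit[OF h1 this, of 8] ref_emit[OF h1 this, of 8]
  define s2 where "s2 = run (emit 2 8 21 29 8) s1"
  define T1 where "T1 = Ts @ [Mv (var s 21) (arr s 12 f) t]"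
  have s2: "var s2 x = var s1 x" if "x \<notin> {31, 8, 2}" for x
    unfolding s2_def using that by (intro run_frame) auto
  have a2: "arr s2 a = arr s1 a" if "a \<notin> {2, 3, 4, 5}" for a
    unfolding s2_def using that by (intro run_frame_arr) auto
  define s3 where "s3 = setv 9 (arr s 20 h) (seta 16 g (var s2 8) s2)"
  have h3: "heap (2 * D) s3 T1" using e1(1) unfolding s3_def T1_def by (subst heap_cong[of _ s2]) (auto simp: s2_def)
  have r3: "ref T1 (var s2 8) (Mv (var s 21) (arr s 12 f) t)" "ref T1 (arr s 20 h) u"
    using e1(2) ref_nonempty[OF assms(6)] ref_append[OF assms(7)] unfolding T1_def s2_def by auto
  have v3: "var s3 9 = arr s 20 h" "var s3 22 = var s 22" "var s3 30 = arr s 13 f"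
    unfolding s3_def by (simp_all add: s2) (simp_all add: s1_def)
  have "node (2 * D) T1 (length T1) 2 (var s3 9) (var s3 22) (var s3 30) (Mv (var s 22) (arr s 13 f) u)"
    using r3(2) assms unfolding v3 by (simp add: node_def ref_def)
  note e3 = heap_emit[OF h3 this, of 9] ref_emit[OF h3 this, of 9]
  define s4 where "s4 = run (emit 2 9 22 30 9) s3"
  define T2 where "T2 = T1 @ [Mv (var s 22) (arr s 13 f) u]"
  have s4: "var s4 x = var s3 x" if "x \<notin> {31, 9, 2}" for x
    unfolding s4_def using that by (intro run_frame) auto
  have a4: "arr s4 a = arr s3 a" if "a \<notin> {2, 3, 4, 5}" for a
    unfolding s4_def using that by (intro run_frame_arr) auto
  have g: "var s2 12 = g" "var s4 13 = h" "var s2 13 = h" "arr s2 20 = arr s 20"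
    unfolding g_def h_def by (simp_all add: s4 s3_def s2 a2) (simp_all add: s1_def)
  have s': "s' = seta 20 h (var s4 9) s4"
    unfolding s'_def relink_def using g
    by (simp add: f_def[symmetric] g_def[symmetric] s1_def[symmetric] s2_def[symmetric] s3_def[symmetric] s4_def[symmetric])
  have "extends Ts T2" by (simp add: T2_def T1_def extends_def)
  moreover have "heap (2 * D) s' T2"
    unfolding s' using e3(1) unfolding T2_def by (subst heap_cong[of _ s4]) (auto simp: s4_def)
  moreover have "ref T2 (var s2 8) (Mv (var s 21) (arr s 12 f) t)"
    unfolding T2_def using r3(1) by (rule ref_append)
  moreover have "ref T2 (var s4 9) (Mv (var s 22) (arr s 13 f) u)"
    using e3(2) ref_nonempty[OF r3(1)] unfolding T2_def s4_def by auto
  moreover have "arr s' 16 = (arr s 16)(g := var s2 8)" "arr s' 20 = (arr s 20)(h := var s4 9)"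
    unfolding s' by (simp_all add: a4 s3_def a2) (simp_all add: s1_def)
  ultimately show "\<exists>Ts' p q. extends Ts Ts' \<and> heap (2 * D) s' Ts' \<and> ref Ts' p (Mv (var s 21) (arr s 12 f) t) \<and>
      ref Ts' q (Mv (var s 22) (arr s 13 f) u) \<and>
      arr s' 16 = (arr s 16)(g := p) \<and> arr s' 20 = (arr s 20)(h := q)" by blast
  show "x \<notin> {29, 30, 8, 9, 31, 2} \<Longrightarrow> var s' x = var s x"
    unfolding s' by (simp add: s4 s3_def s2) (simp add: s1_def)
  show "a \<notin> {2, 3, 4, 5, 16, 20} \<Longrightarrow> arr s' a = arr s a"
    unfolding s' by (simp add: a4 s3_def a2) (simp add: s1_def)
qed

lemma merged_label_less:
  assumes "merged D N gx gy ga ha la lb X0 Y0 e n cc cr lx ly nc nr mk X Y"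
    "merging D N gx gy ga ha la lb" "e < N"
  shows "nc (ga e) < D" "nr (ha e) < D"
  using assms relabelled_step(4)[of D N gx ga la X0 e nc X "nc (ga e)"]
    relabelled_step(4)[of D N gy ha lb Y0 e nr Y "nr (ha e)"]
  unfolding merged_def merging_def by blast+

text \<open>\<open>A\<close> holds the arrays as they were before the pass. Cells from
  \<open>e\<close> on are still as in \<open>A\<close>, while earlier entries may have been
  overwritten.\<close>

definition cells_inv ::
  "nat \<Rightarrow> nat \<Rightarrow> nat \<Rightarrow> nat \<Rightarrow> (nat \<Rightarrow> nat \<Rightarrow> nat) \<Rightarrow> (nat \<Rightarrow> tm) \<Rightarrow> (nat \<Rightarrow> tm) \<Rightarrow> tm list \<Rightarrow> nat \<Rightarrow> st \<Rightarrow>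
   tm list \<Rightarrow> (nat \<Rightarrow> nat) \<Rightarrow> (nat \<Rightarrow> nat) \<Rightarrow> (nat \<Rightarrow> tm) \<Rightarrow> (nat \<Rightarrow> tm) \<Rightarrow> bool"
where
  "cells_inv D N gx gy A X0 Y0 Ts0 e s Ts nc nr X Y \<longleftrightarrow>
     extends Ts0 Ts \<and> heap (2 * D) s Ts \<and>
     merged D N gx gy (\<lambda>i. A 17 (A 10 i)) (\<lambda>i. A 21 (A 11 i)) (\<lambda>i. D + A 18 (A 10 i) + A 12 i)
       (\<lambda>i. D + A 22 (A 11 i) + A 13 i) X0 Y0 e (var s 23) (arr s 10) (arr s 11) (arr s 12) (arr s 13)
       nc nr (arr s 14) X Y \<and>
     (\<forall>i. e \<le> i \<longrightarrow> i < N \<longrightarrow> arr s 10 i = A 10 i \<and> arr s 11 i = A 11 i \<and> arr s 12 i = A 12 i \<and> arr s 13 i = A 13 i) \<and>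
     arr s 17 = A 17 \<and> arr s 18 = A 18 \<and> arr s 21 = A 21 \<and> arr s 22 = A 22 \<and>
     (\<forall>g<gx. arr s 15 g = nc g \<and> ref Ts (arr s 16 g) (X g)) \<and>
     (\<forall>h<gy. arr s 19 h = nr h \<and> ref Ts (arr s 20 h) (Y h))"

lemma merge_step:
  assumes inv: "cells_inv D N gx gy A X0 Y0 Ts0 e s Ts nc nr X Y" and e: "e < N"
    and mg: "merging D N gx gy (\<lambda>i. A 17 (A 10 i)) (\<lambda>i. A 21 (A 11 i)) (\<lambda>i. D + A 18 (A 10 i) + A 12 i)
       (\<lambda>i. D + A 22 (A 11 i) + A 13 i)"
    and small: "A 18 (A 10 e) + A 12 e < D" "A 22 (A 11 e) + A 13 e < D"
  shows "\<exists>Ts' nc' nr' X' Y'. cells_inv D N gx gy A X0 Y0 Ts0 (Suc e) (run (merge_body D) (setv 6 e s)) Ts' nc' nr' X' Y'"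
proof -
  let ?ga = "\<lambda>i. A 17 (A 10 i)" and ?ha = "\<lambda>i. A 21 (A 11 i)"
  let ?la = "\<lambda>i. D + A 18 (A 10 i) + A 12 i" and ?lb = "\<lambda>i. D + A 22 (A 11 i) + A 13 i"
  have I: "extends Ts0 Ts" "heap (2 * D) s Ts"
     "merged D N gx gy ?ga ?ha ?la ?lb X0 Y0 e (var s 23) (arr s 10) (arr s 11) (arr s 12) (arr s 13)
       nc nr (arr s 14) X Y"
     "\<And>i. e \<le> i \<Longrightarrow> i < N \<Longrightarrow> arr s 10 i = A 10 i" "\<And>i. e \<le> i \<Longrightarrow> i < N \<Longrightarrow> arr s 11 i = A 11 i"
     "\<And>i. e \<le> i \<Longrightarrow> i < N \<Longrightarrow> arr s 12 i = A 12 i" "\<And>i. e \<le> i \<Longrightarrow> i < N \<Longrightarrow> arr s 13 i = A 13 i"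
     "arr s 17 = A 17" "arr s 18 = A 18" "arr s 21 = A 21" "arr s 22 = A 22"
     "\<And>g. g < gx \<Longrightarrow> arr s 15 g = nc g" "\<And>g. g < gx \<Longrightarrow> ref Ts (arr s 16 g) (X g)"
     "\<And>h. h < gy \<Longrightarrow> arr s 19 h = nr h" "\<And>h. h < gy \<Longrightarrow> ref Ts (arr s 20 h) (Y h)"
    using inv unfolding cells_inv_def by (simp_all only: simp_thms)
  define g where "g = ?ga e"
  define h where "h = ?ha e"
  define n where "n = var s 23"
  have gx: "g < gx" "h < gy" using mg e unfolding merging_def separate_def g_def h_def by blast+
  have ne: "n \<le> e" using I(3) unfolding merged_def n_def by blast
  have ncD: "nc g < D" "nr h < D" using merged_label_less[OF I(3) mg e] by (simp_all add: g_def h_def)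
  define s1 where "s1 = run (fetch D) (setv 6 e s)"
  have "arr (setv 6 e s) 18 (arr (setv 6 e s) 10 (var (setv 6 e s) 6)) + arr (setv 6 e s) 12 (var (setv 6 e s) 6) \<le> D"
    "arr (setv 6 e s) 22 (arr (setv 6 e s) 11 (var (setv 6 e s) 6)) + arr (setv 6 e s) 13 (var (setv 6 e s) 6) \<le> D"
    using I e small by simp_all
  from fetch_spec[OF this] have s1: "var s1 12 = g" "var s1 13 = h" "var s1 21 = ?la e" "var s1 22 = ?lb e"
    "arr s1 = arr s" "var s1 2 = var s 2" "var s1 23 = n"
    using I e unfolding s1_def[symmetric] g_def h_def n_def by simp_all
  define s2 where "s2 = run locate s1"
  note s2 = locate_spec[where s = s1, folded s2_def, unfolded s1]
  have h2: "heap (2 * D) s2 Ts" using I(2) s2 s1 by (subst heap_cong[of _ s]) auto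
  have v2: "var s2 12 = g" "var s2 13 = h" "var s2 21 = ?la e" "var s2 22 = ?lb e" "var s2 23 = n" "var s2 2 = var s 2"
    using s2(5) s1 by simp_all
  define s3 where "s3 = run (CIf 28 26 CSkip new_cell) s2"
  have fin: "run (merge_body D) (setv 6 e s) = run relink s3"
    unfolding merge_body_def s3_def s2_def s1_def by simp
  have len: "?la e < 2 * D" "?lb e < 2 * D" using small by simp_all
  show ?thesis
  proof (cases "0 < nr h \<and> \<not> arr s 10 (arr s 14 h) < g")
    case True
    have s3: "s3 = s2" unfolding s3_def using s2(1,2) True I(14)[OF gx(2)] by simp
    define f where "f = arr s 14 h"
    have f: "f < n" "arr s 11 f = h" using I(3) True unfolding merged_def f_def n_def by blast+
    have "arr s 10 f = g"
      using merged_cc_le[OF I(3) mg e f(1)[unfolded n_def]] True unfolding f_def g_def by simp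
    then have lf: "arr s 12 f < nc g" "arr s 13 f < nr h"
      using I(3) f unfolding merged_def n_def by blast+
    have pre: "ref Ts (arr s2 16 (var s2 12)) (X g)" "ref Ts (arr s2 20 (var s2 13)) (Y h)"
      "var s2 21 < 2 * D" "var s2 22 < 2 * D" "arr s2 12 (var s2 19) < D" "arr s2 13 (var s2 19) < D"
      using I(13,15) gx v2 s2(4,6) len lf ncD by (simp_all add: f_def)
    note rs = relink_spec[OF h2 pre]
    obtain Ts' p q where r: "extends Ts Ts'" "heap (2 * D) (run relink s2) Ts'"
      "ref Ts' p (Mv (?la e) (arr s 12 f) (X g))" "ref Ts' q (Mv (?lb e) (arr s 13 f) (Y h))"
      "arr (run relink s2) 16 = (arr s 16)(g := p)" "arr (run relink s2) 20 = (arr s 20)(h := q)"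
      using rs(1) v2 s2(4,6) unfolding f_def by auto
    have m: "merged D N gx gy ?ga ?ha ?la ?lb X0 Y0 (Suc e) n (arr s 10) (arr s 11) (arr s 12) (arr s 13)
       nc nr (arr s 14) (X(g := Mv (?la e) (arr s 12 f) (X g))) (Y(h := Mv (?lb e) (arr s 13 f) (Y h)))"
      using merged_old_cell[OF I(3) mg e conjunct1[OF True[unfolded g_def h_def]]
          conjunct2[OF True[unfolded g_def h_def]]] unfolding f_def g_def h_def n_def .
    have a: "arr (run relink s2) a = arr s a" if "a \<notin> {2, 3, 4, 5, 16, 20}" for a
      using rs(3)[OF that] s2(6) by simp
    have b: "var (run relink s2) 23 = n" using rs(2)[of 23] v2 by simp
    have "cells_inv D N gx gy A X0 Y0 Ts0 (Suc e) (run relink s2) Ts' nc nr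
      (X(g := Mv (?la e) (arr s 12 f) (X g))) (Y(h := Mv (?lb e) (arr s 13 f) (Y h)))"
      unfolding cells_inv_def
      using extends_trans[OF I(1) r(1)] r m I(4-15) ref_extends[OF _ r(1)] by (simp add: a b)
    then show ?thesis unfolding fin s3 by blast
  next
    case False
    have "s3 = run new_cell s2" unfolding s3_def using s2(1,2) False I(14)[OF gx(2)] by auto
    note s3 = new_cell_spec[where s = s2, folded this, unfolded v2]
    have a3: "arr s3 10 = (arr s 10)(n := g)" "arr s3 11 = (arr s 11)(n := h)" "arr s3 12 = (arr s 12)(n := nc g)"
      "arr s3 13 = (arr s 13)(n := nr h)" "arr s3 15 = (arr s 15)(g := Suc (nc g))"
      "arr s3 19 = (arr s 19)(h := Suc (nr h))" "arr s3 14 = (arr s 14)(h := n)"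
      using s3(4-10) s2(3,6) I(12)[OF gx(1)] I(14)[OF gx(2)] by simp_all
    have v3: "var s3 12 = g" "var s3 13 = h" "var s3 21 = ?la e" "var s3 22 = ?lb e" "var s3 19 = n" "var s3 23 = Suc n"
      using s3(1-3) v2 by simp_all
    have b3: "arr s3 a = arr s a" if "a \<notin> {10, 11, 12, 13, 14, 15, 19}" for a
      using s3(11)[OF that] s2(6) by simp
    have h3: "heap (2 * D) s3 Ts" using h2 s3(3) s3(11) by (subst heap_cong[of _ s2]) auto
    have pre: "ref Ts (arr s3 16 (var s3 12)) (X g)" "ref Ts (arr s3 20 (var s3 13)) (Y h)"
      "var s3 21 < 2 * D" "var s3 22 < 2 * D" "arr s3 12 (var s3 19) < D" "arr s3 13 (var s3 19) < D"
      using I(13,15) gx v3 b3 a3 len ncD by simp_all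
    note rs = relink_spec[OF h3 pre]
    obtain Ts' p q where r: "extends Ts Ts'" "heap (2 * D) (run relink s3) Ts'"
      "ref Ts' p (Mv (?la e) (nc g) (X g))" "ref Ts' q (Mv (?lb e) (nr h) (Y h))"
      "arr (run relink s3) 16 = (arr s 16)(g := p)" "arr (run relink s3) 20 = (arr s 20)(h := q)"
      using rs(1) v3 a3 b3[of 16] b3[of 20] by auto
    have new: "nr (?ha e) = 0 \<or> arr s 10 (arr s 14 (?ha e)) < ?ga e" using False unfolding g_def h_def by auto
    have m: "merged D N gx gy ?ga ?ha ?la ?lb X0 Y0 (Suc e) (Suc n) ((arr s 10)(n := g)) ((arr s 11)(n := h))
       ((arr s 12)(n := nc g)) ((arr s 13)(n := nr h)) (nc(g := Suc (nc g))) (nr(h := Suc (nr h)))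
       ((arr s 14)(h := n)) (X(g := Mv (?la e) (nc g) (X g))) (Y(h := Mv (?lb e) (nr h) (Y h)))"
      using merged_new_cell[OF I(3) mg e new] unfolding g_def h_def n_def .
    have a: "arr (run relink s3) a = arr s3 a" if "a \<notin> {2, 3, 4, 5, 16, 20}" for a
      using rs(3)[OF that] .
    have b: "var (run relink s3) 23 = Suc n" using rs(2)[of 23] v3 by simp
    have "cells_inv D N gx gy A X0 Y0 Ts0 (Suc e) (run relink s3) Ts' (nc(g := Suc (nc g))) (nr(h := Suc (nr h)))
      (X(g := Mv (?la e) (nc g) (X g))) (Y(h := Mv (?lb e) (nr h) (Y h)))"
      unfolding cells_inv_def
      using extends_trans[OF I(1) r(1)] r m I(4-15) ref_extends[OF _ r(1)] ne by (simp add: a b a3 b3)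
    then show ?thesis unfolding fin by blast
  qed
qed

text \<open>Within a group the columns own disjoint intervals of temporary labels, so group and
  temporary label determine the column and the old label, and hence the cell.\<close>

lemma relabelled_start:
  assumes sc: "scanned D cnt X m G acc gc off Z"
    and c: "\<And>i. i < N \<Longrightarrow> c i < m" and l: "\<And>i. i < N \<Longrightarrow> l i < cnt (c i)"
    and inj: "inj_on (\<lambda>i. (c i, l i)) {..<N}"
    and surj: "\<And>j k. j < m \<Longrightarrow> k < cnt j \<Longrightarrow> \<exists>i<N. c i = j \<and> l i = k"
  shows "separate D N G (\<lambda>i. gc (c i)) (\<lambda>i. D + off (c i) + l i)"
    "relabelled D N G (\<lambda>i. gc (c i)) (\<lambda>i. D + off (c i) + l i) Z 0 (\<lambda>_. 0) Z"
proof -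
  have S: "\<And>i. i < m \<Longrightarrow> gc i < G" "\<And>i. i < m \<Longrightarrow> off i + cnt i \<le> D"
    "\<And>i j. i < j \<Longrightarrow> j < m \<Longrightarrow> gc i = gc j \<Longrightarrow> off i + cnt i \<le> off j"
    "\<And>g. g < G \<Longrightarrow> wft (Z g) \<and> cx D (Z g)"
    "\<And>g. g < G \<Longrightarrow> dm (Z g) = {D + off i + k | i k. i < m \<and> gc i = g \<and> k < cnt i}"
    using sc unfolding scanned_def by (simp_all only: simp_thms)
  have "i = j" if ij: "i < N" "j < N" and e: "gc (c i) = gc (c j)" "D + off (c i) + l i = D + off (c j) + l j" for i j
  proof -
    have "\<not> c i < c j" "\<not> c j < c i"
      using S(3)[of "c i" "c j"] S(3)[of "c j" "c i"] c ij l[of i] l[of j] e by auto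
    then have "c i = c j" by simp
    then show "i = j" using inj_onD[OF inj, of i j] ij e by simp
  qed
  then show "separate D N G (\<lambda>i. gc (c i)) (\<lambda>i. D + off (c i) + l i)"
    using S(1) c unfolding separate_def inj_on_def by auto
  have dm: "dm (Z g) = {D + off (c i) + l i | i. i < N \<and> gc (c i) = g}" if "g < G" for g
    unfolding S(5)[OF that] using surj c l by blast
  have "card (dm (Z g)) \<le> D" if g: "g < G" for g
  proof -
    have "dm (Z g) \<subseteq> {D..<D + D}" unfolding S(5)[OF g] using S(2) by fastforce
    from card_mono[OF _ this] show ?thesis by simp
  qed
  then show "relabelled D N G (\<lambda>i. gc (c i)) (\<lambda>i. D + off (c i) + l i) Z 0 (\<lambda>_. 0) Z"
    using S(4) dm unfolding relabelled_def by simp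
qed

text \<open>The last four clauses put the labels of a column, and of a row, in bijection with its
  cells. So the number of labels of a column is its number of nonempty cells, to which the bound on
  avoiding matrices applies.\<close>

definition matrix ::
  "nat \<Rightarrow> nat \<Rightarrow> nat \<Rightarrow> (nat \<Rightarrow> nat) \<Rightarrow> (nat \<Rightarrow> nat) \<Rightarrow> (nat \<Rightarrow> nat) \<Rightarrow> (nat \<Rightarrow> nat) \<Rightarrow> (nat \<Rightarrow> nat) \<Rightarrow> (nat \<Rightarrow> nat) \<Rightarrow>
   (nat \<Rightarrow> tm) \<Rightarrow> (nat \<Rightarrow> tm) \<Rightarrow> bool"
where
  "matrix mc mr N cc cr lx ly cntc cntr X Y \<longleftrightarrow>
     (\<forall>i<N. cc i < mc \<and> cr i < mr \<and> lx i < cntc (cc i) \<and> ly i < cntr (cr i) \<and>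
        ps (X (cc i)) (lx i) = ps (Y (cr i)) (ly i)) \<and>
     inj_on (\<lambda>i. (cc i, cr i)) {..<N} \<and> (\<forall>i j. i < j \<longrightarrow> j < N \<longrightarrow> cc i \<le> cc j) \<and>
     inj_on (\<lambda>i. (cc i, lx i)) {..<N} \<and> inj_on (\<lambda>i. (cr i, ly i)) {..<N} \<and>
     (\<forall>c<mc. \<forall>k<cntc c. \<exists>i<N. cc i = c \<and> lx i = k) \<and>
     (\<forall>r<mr. \<forall>k<cntr r. \<exists>i<N. cr i = r \<and> ly i = k)"

lemma matrixD:
  assumes "matrix mc mr N cc cr lx ly cntc cntr X Y"
  shows "i < N \<Longrightarrow> cc i < mc" "i < N \<Longrightarrow> cr i < mr" "i < N \<Longrightarrow> lx i < cntc (cc i)" "i < N \<Longrightarrow> ly i < cntr (cr i)"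
    "i < N \<Longrightarrow> ps (X (cc i)) (lx i) = ps (Y (cr i)) (ly i)"
    "inj_on (\<lambda>i. (cc i, cr i)) {..<N}" "i < j \<Longrightarrow> j < N \<Longrightarrow> cc i \<le> cc j"
    "inj_on (\<lambda>i. (cc i, lx i)) {..<N}" "inj_on (\<lambda>i. (cr i, ly i)) {..<N}"
    "c < mc \<Longrightarrow> k < cntc c \<Longrightarrow> \<exists>i<N. cc i = c \<and> lx i = k"
    "r < mr \<Longrightarrow> k < cntr r \<Longrightarrow> \<exists>i<N. cr i = r \<and> ly i = k"
  using assms unfolding matrix_def by (simp_all only: simp_thms)

lemma sum_counts_le:
  fixes c l cnt :: "nat \<Rightarrow> nat"
  assumes "\<And>j k. j < m \<Longrightarrow> k < cnt j \<Longrightarrow> \<exists>i<N. c i = j \<and> l i = k"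
  shows "(\<Sum>j<m. cnt j) \<le> N"
proof -
  have "(SIGMA j:{..<m}. {..<cnt j}) \<subseteq> (\<lambda>i. (c i, l i)) ` {..<N}"
  proof (rule subrelI)
    fix j k assume "(j, k) \<in> (SIGMA j:{..<m}. {..<cnt j})"
    then have "j < m" "k < cnt j" by auto
    then obtain i where "i < N" "c i = j" "l i = k" using assms by blast
    then show "(j, k) \<in> (\<lambda>i. (c i, l i)) ` {..<N}" by auto
  qed
  then have "card (SIGMA j:{..<m}. {..<cnt j}) \<le> card ((\<lambda>i. (c i, l i)) ` {..<N})"
    by (intro card_mono finite_imageI) auto
  also have "\<dots> \<le> card {..<N}" by (rule card_image_le) simp
  finally show ?thesis by simp
qed

lemma merging_start:
  assumes mt: "matrix mc mr N cc cr lx ly cntc cntr X Y"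
    and sx: "scanned D cntc X mc gx accx gc offc Zx" and sy: "scanned D cntr Y mr gy accy gr offr Zy"
  shows "merging D N gx gy (\<lambda>i. gc (cc i)) (\<lambda>i. gr (cr i)) (\<lambda>i. D + offc (cc i) + lx i) (\<lambda>i. D + offr (cr i) + ly i)"
    "merged D N gx gy (\<lambda>i. gc (cc i)) (\<lambda>i. gr (cr i)) (\<lambda>i. D + offc (cc i) + lx i) (\<lambda>i. D + offr (cr i) + ly i)
       Zx Zy 0 0 cc' cr' lx' ly' (\<lambda>_. 0) (\<lambda>_. 0) mk Zx Zy"
proof -
  note m = matrixD[OF mt]
  note x = relabelled_start[OF sx m(1,3,8,10)] and y = relabelled_start[OF sy m(2,4,9,11)]
  have "gc i \<le> gc j" if "i < j" "j < mc" for i j using sx that unfolding scanned_def by blast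
  then have "gc (cc i) \<le> gc (cc j)" if "i < j" "j < N" for i j
    using m(7)[OF that] m(1)[OF that(2)] by (cases "cc i = cc j") auto
  then show "merging D N gx gy (\<lambda>i. gc (cc i)) (\<lambda>i. gr (cr i)) (\<lambda>i. D + offc (cc i) + lx i) (\<lambda>i. D + offr (cr i) + ly i)"
    using x(1) y(1) unfolding merging_def by blast
  have "\<And>i k. i < mc \<Longrightarrow> k < cntc i \<Longrightarrow> ps (Zx (gc i)) (D + offc i + k) = ps (X i) k"
    "\<And>i k. i < mr \<Longrightarrow> k < cntr i \<Longrightarrow> ps (Zy (gr i)) (D + offr i + k) = ps (Y i) k"
    using sx sy unfolding scanned_def by (simp_all only: simp_thms)
  then have "ps (Zx (gc (cc i))) (D + offc (cc i) + lx i) = ps (Zy (gr (cr i))) (D + offr (cr i) + ly i)"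
    if "i < N" for i using m(1-5)[OF that] by simp
  then show "merged D N gx gy (\<lambda>i. gc (cc i)) (\<lambda>i. gr (cr i)) (\<lambda>i. D + offc (cc i) + lx i) (\<lambda>i. D + offr (cr i) + ly i)
       Zx Zy 0 0 cc' cr' lx' ly' (\<lambda>_. 0) (\<lambda>_. 0) mk Zx Zy"
    using x(2) y(2) unfolding merged_def by simp
qed

text \<open>After the last old cell no temporary labels remain, so the term of a group has exactly
  the labels below its new count.\<close>

lemma merging_end:
  assumes mg: "merged D N gx gy ga ha la lb X0 Y0 N n cc cr lx ly nc nr mk X Y"
    and bounds: "\<And>i. i < N \<Longrightarrow> ga i < gx" "\<And>i. i < N \<Longrightarrow> ha i < gy"
  shows "matrix gx gy n cc cr lx ly nc nr X Y" "side D gx nc X" "side D gy nr Y"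
    "(\<lambda>i. (cc i, cr i)) ` {..<n} = (\<lambda>i. (ga i, ha i)) ` {..<N}"
    "\<And>g. g < gx \<Longrightarrow> ord (X g) = ord (X0 g)" "\<And>h. h < gy \<Longrightarrow> ord (Y h) = ord (Y0 h)"
proof -
  have M: "\<And>i. i < n \<Longrightarrow> lx i < nc (cc i)" "\<And>i. i < n \<Longrightarrow> ly i < nr (cr i)"
    "\<And>i. i < n \<Longrightarrow> ps (X (cc i)) (lx i) = ps (Y (cr i)) (ly i)"
    "(\<lambda>i. (cc i, cr i)) ` {..<n} = (\<lambda>i. (ga i, ha i)) ` {..<N}"
    "inj_on (\<lambda>i. (cc i, cr i)) {..<n}" "\<And>i j. i < j \<Longrightarrow> j < n \<Longrightarrow> cc i \<le> cc j"
    "inj_on (\<lambda>i. (cc i, lx i)) {..<n}" "inj_on (\<lambda>i. (cr i, ly i)) {..<n}"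
    "\<And>g k. k < nc g \<Longrightarrow> \<exists>i<n. cc i = g \<and> lx i = k" "\<And>h k. k < nr h \<Longrightarrow> \<exists>i<n. cr i = h \<and> ly i = k"
    and rX: "relabelled D N gx ga la X0 N nc X" and rY: "relabelled D N gy ha lb Y0 N nr Y"
    using mg unfolding merged_def by (simp_all only: simp_thms)
  have b: "cc i < gx \<and> cr i < gy" if "i < n" for i
  proof -
    have "(cc i, cr i) \<in> (\<lambda>i. (ga i, ha i)) ` {..<N}" using M(4) that by blast
    then show ?thesis using bounds by auto
  qed
  show "matrix gx gy n cc cr lx ly nc nr X Y" unfolding matrix_def using M b by simp
  have x: "wft (X g) \<and> cx D (X g) \<and> ord (X g) = ord (X0 g) \<and> dm (X g) = {..<nc g} \<and> nc g \<le> D" if "g < gx" for g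
  proof -
    have d: "wft (X g) \<and> cx D (X g) \<and> ord (X g) = ord (X0 g) \<and> card (dm (X g)) \<le> D" "dm (X g) = {..<nc g}"
      using rX that unfolding relabelled_def by auto
    then show ?thesis by simp
  qed
  have y: "wft (Y g) \<and> cx D (Y g) \<and> ord (Y g) = ord (Y0 g) \<and> dm (Y g) = {..<nr g} \<and> nr g \<le> D" if "g < gy" for g
  proof -
    have d: "wft (Y g) \<and> cx D (Y g) \<and> ord (Y g) = ord (Y0 g) \<and> card (dm (Y g)) \<le> D" "dm (Y g) = {..<nr g}"
      using rY that unfolding relabelled_def by auto
    then show ?thesis by simp
  qed
  show "side D gx nc X" "side D gy nr Y" using x y unfolding side_def by blast+
  show "(\<lambda>i. (cc i, cr i)) ` {..<n} = (\<lambda>i. (ga i, ha i)) ` {..<N}" by (rule M(4))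
  show "\<And>g. g < gx \<Longrightarrow> ord (X g) = ord (X0 g)" "\<And>h. h < gy \<Longrightarrow> ord (Y h) = ord (Y0 h)" using x y by blast+
qed

lemma merge_spec:
  assumes h: "heap (2 * D) s Ts" and N: "var s 5 = N"
    and mt: "matrix mc mr N (arr s 10) (arr s 11) (arr s 12) (arr s 13) cntc cntr X Y"
    and sx: "scanned D cntc X mc gx accx (arr s 17) (arr s 18) Zx"
    and sy: "scanned D cntr Y mr gy accy (arr s 21) (arr s 22) Zy"
    and rx: "\<And>g. g < gx \<Longrightarrow> arr s 15 g = 0 \<and> ref Ts (arr s 16 g) (Zx g)"
    and ry: "\<And>g. g < gy \<Longrightarrow> arr s 19 g = 0 \<and> ref Ts (arr s 20 g) (Zy g)"
  defines "s' \<equiv> run (merge D) s"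
  shows "\<exists>Ts' X' Y'. extends Ts Ts' \<and> heap (2 * D) s' Ts' \<and>
    matrix gx gy (var s' 5) (arr s' 10) (arr s' 11) (arr s' 12) (arr s' 13) (arr s' 15) (arr s' 19) X' Y' \<and>
    side D gx (arr s' 15) X' \<and> side D gy (arr s' 19) Y' \<and>
    (\<lambda>i. (arr s' 10 i, arr s' 11 i)) ` {..<var s' 5} =
      (\<lambda>i. (arr s 17 (arr s 10 i), arr s 21 (arr s 11 i))) ` {..<N} \<and>
    (\<forall>g<gx. ord (X' g) = ord (Zx g) \<and> ref Ts' (arr s' 16 g) (X' g)) \<and>
    (\<forall>g<gy. ord (Y' g) = ord (Zy g) \<and> ref Ts' (arr s' 20 g) (Y' g))"
proof -
  let ?A = "arr s"
  let ?ga = "\<lambda>i. ?A 17 (?A 10 i)" and ?ha = "\<lambda>i. ?A 21 (?A 11 i)"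
  let ?la = "\<lambda>i. D + ?A 18 (?A 10 i) + ?A 12 i" and ?lb = "\<lambda>i. D + ?A 22 (?A 11 i) + ?A 13 i"
  note st = merging_start[OF mt sx sy] and m = matrixD[OF mt]
  let ?I = "\<lambda>e s. \<exists>Ts' nc nr X Y. cells_inv D N gx gy ?A Zx Zy Ts e s Ts' nc nr X Y"
  define s0 where "s0 = setv 23 0 s"
  define s1 where "s1 = loop (\<lambda>e s. run (merge_body D) (setv 6 e s)) N s0"
  have "?I N s1"
    unfolding s1_def
  proof (rule loop_induct[where I = ?I])
    have "heap (2 * D) s0 Ts" using h by (subst heap_cong[of _ s]) (auto simp: s0_def)
    then have "cells_inv D N gx gy ?A Zx Zy Ts 0 s0 Ts (\<lambda>_. 0) (\<lambda>_. 0) Zx Zy"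
      using st(2) rx ry unfolding cells_inv_def by (simp add: s0_def)
    then show "?I 0 s0" by blast
  next
    fix e s1 assume e: "e < N" and "?I e s1"
    then obtain Ts' nc nr X Y where I: "cells_inv D N gx gy ?A Zx Zy Ts e s1 Ts' nc nr X Y" by blast
    have "arr s 18 i + cntc i \<le> D" if "i < mc" for i using sx that unfolding scanned_def by blast
    then have 1: "?A 18 (?A 10 e) + ?A 12 e < D" using m(1,3)[OF e] by (meson add_less_cancel_left order.strict_trans2)
    have "arr s 22 i + cntr i \<le> D" if "i < mr" for i using sy that unfolding scanned_def by blast
    then have 2: "?A 22 (?A 11 e) + ?A 13 e < D" using m(2,4)[OF e] by (meson add_less_cancel_left order.strict_trans2)
    show "?I (Suc e) (run (merge_body D) (setv 6 e s1))" using merge_step[OF I e st(1) 1 2] .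
  qed
  then obtain Ts' nc nr X' Y' where I: "cells_inv D N gx gy ?A Zx Zy Ts N s1 Ts' nc nr X' Y'" by blast
  then have J: "extends Ts Ts'" "heap (2 * D) s1 Ts'"
     "merged D N gx gy ?ga ?ha ?la ?lb Zx Zy N (var s1 23) (arr s1 10) (arr s1 11) (arr s1 12) (arr s1 13)
       nc nr (arr s1 14) X' Y'"
     "\<And>g. g < gx \<Longrightarrow> arr s1 15 g = nc g" "\<And>g. g < gx \<Longrightarrow> ref Ts' (arr s1 16 g) (X' g)"
     "\<And>h. h < gy \<Longrightarrow> arr s1 19 h = nr h" "\<And>h. h < gy \<Longrightarrow> ref Ts' (arr s1 20 h) (Y' h)"
    unfolding cells_inv_def by (simp_all only: simp_thms)
  have s': "s' = setv 5 (var s1 23) s1"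
    unfolding s'_def merge_def s1_def s0_def using N by simp
  have ga: "\<And>i. i < N \<Longrightarrow> ?ga i < gx" "\<And>i. i < N \<Longrightarrow> ?ha i < gy"
    using st(1) unfolding merging_def separate_def by blast+
  note E = merging_end[OF J(3) ga]
  have eqs: "matrix gx gy (var s1 23) (arr s1 10) (arr s1 11) (arr s1 12) (arr s1 13) (arr s1 15) (arr s1 19) X' Y'"
    using E(1) J(4,6) unfolding matrix_def by simp
  have sd: "side D gx (arr s1 15) X'" "side D gy (arr s1 19) Y'"
    using E(2,3) J(4,6) unfolding side_def by auto
  have "heap (2 * D) s' Ts'" using J(2) unfolding s' by (subst heap_cong[of _ s1]) auto
  then show ?thesis
    using J(1,5,7) E(4-6) eqs sd unfolding s'
    by (intro exI[of _ Ts'] exI[of _ X'] exI[of _ Y']) simp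
qed

text \<open>Ties the current matrix to \<open>\<sigma>\<close>: it is the quotient of the
  permutation matrix by monotone groupings of the positions and of the values.\<close>

definition covering :: "nat \<Rightarrow> (nat \<Rightarrow> nat) \<Rightarrow> nat \<Rightarrow> nat \<Rightarrow> (nat \<Rightarrow> nat) \<Rightarrow> (nat \<Rightarrow> nat) \<Rightarrow> (nat \<times> nat) set \<Rightarrow> bool" where
  "covering n \<sigma> mc mr \<gamma> \<rho> S \<longleftrightarrow> (\<forall>x\<in>{1..n}. \<gamma> x < mc \<and> \<rho> x < mr) \<and>
     mono_on {1..n} \<gamma> \<and> mono_on {1..n} \<rho> \<and> S = (\<lambda>x. (\<gamma> x, \<rho> (\<sigma> x))) ` {1..n}"

lemma covering_step:
  assumes "covering n \<sigma> mc mr \<gamma> \<rho> S" "\<sigma> permutes {1..n}"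
    "\<And>i. i < mc \<Longrightarrow> u i < gx" "\<And>i j. i < j \<Longrightarrow> j < mc \<Longrightarrow> u i \<le> u j"
    "\<And>i. i < mr \<Longrightarrow> v i < gy" "\<And>i j. i < j \<Longrightarrow> j < mr \<Longrightarrow> v i \<le> v j"
  shows "covering n \<sigma> gx gy (u \<circ> \<gamma>) (v \<circ> \<rho>) ((\<lambda>(i, j). (u i, v j)) ` S)"
proof -
  have b: "\<gamma> x < mc" "\<rho> x < mr" if "x \<in> {1..n}" for x using assms(1) that unfolding covering_def by blast+
  have m: "mono_on {1..n} \<gamma>" "mono_on {1..n} \<rho>" using assms(1) unfolding covering_def by blast+
  have "mono_on {1..n} (u \<circ> \<gamma>)"
  proof (rule mono_onI)
    fix x y assume xy: "x \<in> {1..n}" "y \<in> {1..n}" "x \<le> y"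
    then have "\<gamma> x \<le> \<gamma> y" using m(1) by (simp add: mono_onD)
    then show "(u \<circ> \<gamma>) x \<le> (u \<circ> \<gamma>) y" using assms(4) b xy by (cases "\<gamma> x = \<gamma> y") auto
  qed
  moreover have "mono_on {1..n} (v \<circ> \<rho>)"
  proof (rule mono_onI)
    fix x y assume xy: "x \<in> {1..n}" "y \<in> {1..n}" "x \<le> y"
    then have "\<rho> x \<le> \<rho> y" using m(2) by (simp add: mono_onD)
    then show "(v \<circ> \<rho>) x \<le> (v \<circ> \<rho>) y" using assms(6) b xy by (cases "\<rho> x = \<rho> y") auto
  qed
  ultimately show ?thesis using assms(1,3,5) unfolding covering_def by auto
qed

text \<open>A point of \<open>\<sigma>\<close> is chosen in each cell of an occurrence; distinct
  groups are ordered like their members, so these points form the pattern in \<open>\<sigma>\<close>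
  itself.\<close>

lemma covering_avoids:
  assumes cov: "covering n \<sigma> mc mr \<gamma> \<rho> S" and perm: "\<sigma> permutes {1..n}" "\<pi> permutes {1..p}"
    and av: "avoids n \<sigma> p \<pi>"
  shows "\<not> contains_pattern p \<pi> S"
proof
  assume "contains_pattern p \<pi> S"
  then obtain f g where f: "strict_mono_on {1..p} f" and g: "strict_mono_on {1..p} g"
    and fg: "\<forall>i\<in>{1..p}. (f i, g (\<pi> i)) \<in> S" unfolding contains_pattern_def by blast
  have m: "mono_on {1..n} \<gamma>" "mono_on {1..n} \<rho>" using cov unfolding covering_def by blast+
  have "\<forall>i\<in>{1..p}. \<exists>x\<in>{1..n}. \<gamma> x = f i \<and> \<rho> (\<sigma> x) = g (\<pi> i)"
    using fg cov unfolding covering_def by fastforce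
  then obtain x where x: "\<And>i. i \<in> {1..p} \<Longrightarrow> x i \<in> {1..n} \<and> \<gamma> (x i) = f i \<and> \<rho> (\<sigma> (x i)) = g (\<pi> i)"
    by metis
  have pi: "\<pi> i \<in> {1..p}" if "i \<in> {1..p}" for i using that perm(2) by (meson permutes_in_image)
  have si: "\<sigma> i \<in> {1..n}" if "i \<in> {1..n}" for i using that perm(1) by (meson permutes_in_image)
  have mono: "strict_mono_on {1..p} x"
  proof (rule strict_mono_onI)
    fix r s assume rs: "r \<in> {1..p}" "s \<in> {1..p}" "r < s"
    then have "\<gamma> (x r) < \<gamma> (x s)" using f x by (simp add: strict_mono_onD)
    then show "x r < x s" using m(1) x rs by (metis leD leI mono_onD)
  qed
  have lt: "\<sigma> (x i) < \<sigma> (x j)" if ij: "i \<in> {1..p}" "j \<in> {1..p}" "\<pi> i < \<pi> j" for i j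
  proof -
    have "g (\<pi> i) < g (\<pi> j)" using g pi ij by (simp add: strict_mono_onD)
    then have "\<rho> (\<sigma> (x i)) < \<rho> (\<sigma> (x j))" using x ij by simp
    then show ?thesis using m(2) x si ij by (metis leD leI mono_onD)
  qed
  have "\<pi> i < \<pi> j \<longleftrightarrow> \<sigma> (x i) < \<sigma> (x j)" if ij: "i \<in> {1..p}" "j \<in> {1..p}" for i j
  proof
    assume "\<sigma> (x i) < \<sigma> (x j)"
    then have "\<not> \<pi> j < \<pi> i" "i \<noteq> j" using lt[of j i] ij by auto
    then show "\<pi> i < \<pi> j" using perm(2) by (metis linorder_neqE_nat permutes_inj injD)
  qed (use lt ij in blast)
  then have "pattern_of p \<pi> n \<sigma>" unfolding pattern_of_def using mono x by (intro exI[of _ x]) auto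
  then show False using av by (simp add: avoids_def)
qed

section \<open>One level of coarsening and its iteration\<close>

definition level :: "nat \<Rightarrow> com" where
  "level D = seqs [scan D 3 15 16 17 18, scan D 4 19 20 21 22, merge D]"

definition level_inv :: "nat \<Rightarrow> nat \<Rightarrow> (nat \<Rightarrow> nat) \<Rightarrow> st \<Rightarrow> bool" where
  "level_inv D n \<sigma> s \<longleftrightarrow> (\<exists>Ts X Y \<gamma> \<rho>. heap (2 * D) s Ts \<and>
     matrix (var s 3) (var s 4) (var s 5) (arr s 10) (arr s 11) (arr s 12) (arr s 13) (arr s 15) (arr s 19) X Y \<and>
     side D (var s 3) (arr s 15) X \<and> side D (var s 4) (arr s 19) Y \<and>
     (\<forall>g<var s 3. ref Ts (arr s 16 g) (X g)) \<and> (\<forall>h<var s 4. ref Ts (arr s 20 h) (Y h)) \<and>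
     covering n \<sigma> (var s 3) (var s 4) \<gamma> \<rho> ((\<lambda>i. (arr s 10 i, arr s 11 i)) ` {..<var s 5}) \<and>
     concat (map (\<lambda>g. ord (X g)) [0..<var s 3]) = [1..<Suc n] \<and>
     concat (map (\<lambda>g. ord (Y g)) [0..<var s 4]) = map (inv \<sigma>) [1..<Suc n])"

lemma scan_frame:
  "x \<notin> {16, 15, 24, 6, m, 8, 10, 11, 14, 26, 12, 31, 17, 18, 2, 9} \<Longrightarrow> var (run (scan D m cnt cur gc off) s) x = var s x"
  "a \<notin> {2, 3, 4, 5, cnt, cur, gc, off} \<Longrightarrow> arr (run (scan D m cnt cur gc off) s) a = arr s a"
proof -
  have r: "wvars (rename_labels D) \<subseteq> {31, 17, 18, 8, 2}" "warrs (rename_labels D) \<subseteq> {2, 3, 4, 5}"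
    by (auto simp: rename_labels_def dest: subsetD[OF plus_upto_simps(1)])
  have "wvars (scan D m cnt cur gc off) \<subseteq> {16, 15, 24, 6, m, 8, 10, 11, 14, 26, 12, 31, 17, 18, 2, 9}"
    using r by (auto simp: scan_def scan_body_def dest: subsetD[OF plus_upto_simps(1)])
  then show "x \<notin> {16, 15, 24, 6, m, 8, 10, 11, 14, 26, 12, 31, 17, 18, 2, 9} \<Longrightarrow>
    var (run (scan D m cnt cur gc off) s) x = var s x" by (intro run_frame) blast
  have "warrs (scan D m cnt cur gc off) \<subseteq> {2, 3, 4, 5, cnt, cur, gc, off}"
  proof -
    have "warrs (scan D m cnt cur gc off) \<subseteq> warrs (rename_labels D) \<union> {2, 3, 4, 5, cnt, cur, gc, off}"
      by (simp add: scan_def scan_body_def) blast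
    then show ?thesis using r by blast
  qed
  then show "a \<notin> {2, 3, 4, 5, cnt, cur, gc, off} \<Longrightarrow> arr (run (scan D m cnt cur gc off) s) a = arr s a"
    by (intro run_frame_arr) blast
qed

lemma merge_frame: "x \<in> {0, 3, 4, 7} \<Longrightarrow> var (run (merge D) s) x = var s x"
proof (rule run_frame)
  have "wvars (fetch D) \<subseteq> {8, 9, 12, 13, 14, 15, 17, 18, 21, 22, 31}"
    by (auto simp: fetch_def dest: subsetD[OF plus_upto_simps(1)])
  moreover assume "x \<in> {0, 3, 4, 7}"
  ultimately show "x \<notin> wvars (merge D)"
    by (auto simp: merge_def merge_body_def locate_def new_cell_def relink_def)
qed

text \<open>This is where the factor 4 comes from: the amortised count gives
  \<open>(G - 1) * (4 * C + 1) \<le> 2 * C * M\<close>, hence \<open>2 * (G - 1) < M\<close>. The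
  rounding loss still lets the number of groups fall until it is 1.\<close>

lemma group_count:
  assumes "scanned (4 * C) cnt X m G acc gc off Z" "0 < m" "(\<Sum>i<m. cnt i) \<le> C * M" "0 < M"
  shows "0 < G" "2 * G \<le> M + 1"
proof -
  have a: "0 < G" "G * (4 * C + 1) + acc \<le> 2 * (\<Sum>i<m. cnt i) + 4 * C + 1"
    using assms(1,2) unfolding scanned_def by blast+
  show "0 < G" by fact
  obtain H where H: "G = Suc H" using a(1) by (cases G) auto
  have "H * (4 * C + 1) \<le> 2 * (C * M)" using a(2) assms(3) H by simp
  then have "2 * H * (4 * C + 1) \<le> 4 * C * M" by simp
  also have "\<dots> < M * (4 * C + 1)" using assms(4) by simp
  finally have "2 * H < M" by (metis mult_less_cancel2)
  then show "2 * G \<le> M + 1" using H by simp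
qed

lemma level_spec:
  fixes \<sigma> \<pi> :: "nat \<Rightarrow> nat"
  assumes inv: "level_inv (4 * C) n \<sigma> s" and n: "n \<ge> 1" and perm: "\<sigma> permutes {1..n}" "\<pi> permutes {1..p}"
    and av: "avoids n \<sigma> p \<pi>"
    and MT: "\<And>m S. S \<subseteq> {..<m} \<times> {..<m} \<Longrightarrow> \<not> contains_pattern p \<pi> S \<Longrightarrow> card S \<le> C * m"
  defines "s' \<equiv> run (level (4 * C)) s"
  shows "level_inv (4 * C) n \<sigma> s'" "var s 5 \<le> C * max (var s 3) (var s 4)" "0 < var s 3"
    "2 * max (var s' 3) (var s' 4) \<le> max (var s 3) (var s 4) + 1"
    "var s' 0 = var s 0"
proof -
  let ?D = "4 * C"
  from inv obtain Ts X Y \<gamma> \<rho> where I0: "heap (2 * ?D) s Ts \<and>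
     matrix (var s 3) (var s 4) (var s 5) (arr s 10) (arr s 11) (arr s 12) (arr s 13) (arr s 15) (arr s 19) X Y \<and>
     side ?D (var s 3) (arr s 15) X \<and> side ?D (var s 4) (arr s 19) Y \<and>
     (\<forall>g<var s 3. ref Ts (arr s 16 g) (X g)) \<and> (\<forall>h<var s 4. ref Ts (arr s 20 h) (Y h)) \<and>
     covering n \<sigma> (var s 3) (var s 4) \<gamma> \<rho> ((\<lambda>i. (arr s 10 i, arr s 11 i)) ` {..<var s 5}) \<and>
     concat (map (\<lambda>g. ord (X g)) [0..<var s 3]) = [1..<Suc n] \<and>
     concat (map (\<lambda>g. ord (Y g)) [0..<var s 4]) = map (inv \<sigma>) [1..<Suc n]"
    unfolding level_inv_def by (elim exE)
  then have I: "heap (2 * ?D) s Ts"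
     "matrix (var s 3) (var s 4) (var s 5) (arr s 10) (arr s 11) (arr s 12) (arr s 13) (arr s 15) (arr s 19) X Y"
     "side ?D (var s 3) (arr s 15) X" "side ?D (var s 4) (arr s 19) Y"
     "\<And>g. g < var s 3 \<Longrightarrow> ref Ts (arr s 16 g) (X g)" "\<And>h. h < var s 4 \<Longrightarrow> ref Ts (arr s 20 h) (Y h)"
     "covering n \<sigma> (var s 3) (var s 4) \<gamma> \<rho> ((\<lambda>i. (arr s 10 i, arr s 11 i)) ` {..<var s 5})"
     "concat (map (\<lambda>g. ord (X g)) [0..<var s 3]) = [1..<Suc n]"
     "concat (map (\<lambda>g. ord (Y g)) [0..<var s 4]) = map (inv \<sigma>) [1..<Suc n]"
    by (simp_all only: simp_thms)
  note mt = matrixD[OF I(2)]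
  let ?M = "max (var s 3) (var s 4)" and ?S = "(\<lambda>i. (arr s 10 i, arr s 11 i)) ` {..<var s 5}"
  have "1 \<in> {1..n}" using n by simp
  then have pos: "0 < var s 3" "0 < var s 4" using I(7) unfolding covering_def by fastforce+
  then show "0 < var s 3" by simp
  \<comment> \<open>The matrix is embedded in a square one, the shape for which the bound is
    stated.\<close>
  have "?S \<subseteq> {..<?M} \<times> {..<?M}" using mt(1,2) by (auto simp: less_max_iff_disj)
  then have "card ?S \<le> C * ?M" using MT covering_avoids[OF I(7) perm av] by blast
  moreover have "card ?S = var s 5" using card_image[OF mt(6)] by simp
  ultimately show N: "var s 5 \<le> C * ?M" by simp
  define s1 where "s1 = run (scan ?D 3 15 16 17 18) s"
  define s2 where "s2 = run (scan ?D 4 19 20 21 22) s1"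
  have s': "s' = run (merge ?D) s2" unfolding s'_def level_def s1_def s2_def by simp
  have v1: "var s1 4 = var s 4" "var s1 5 = var s 5" "var s1 0 = var s 0"
    unfolding s1_def by (auto intro!: scan_frame(1))
  have a1: "arr s1 a = arr s a" if "a \<notin> {2, 3, 4, 5, 15, 16, 17, 18}" for a
    unfolding s1_def using that by (intro scan_frame(2)) auto
  have v2: "var s2 3 = var s1 3" "var s2 5 = var s 5" "var s2 0 = var s 0"
    unfolding s2_def using v1 by (auto simp: scan_frame(1))
  have a2: "arr s2 a = arr s1 a" if "a \<notin> {2, 3, 4, 5, 19, 20, 21, 22}" for a
    unfolding s2_def using that by (intro scan_frame(2)) auto
  from scan_spec[OF I(1,3,5), of 17 18, folded s1_def]
  obtain Ts1 Zx accx where x: "extends Ts Ts1" "heap (2 * ?D) s1 Ts1"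
    "scanned ?D (arr s 15) X (var s 3) (var s1 3) accx (arr s1 17) (arr s1 18) Zx"
    "\<And>g. g < var s1 3 \<Longrightarrow> arr s1 15 g = 0 \<and> ref Ts1 (arr s1 16 g) (Zx g)" by auto
  have "side ?D (var s1 4) (arr s1 19) Y" "\<And>h. h < var s1 4 \<Longrightarrow> ref Ts1 (arr s1 20 h) (Y h)"
    using I(4,6) v1 a1 ref_extends[OF _ x(1)] by auto
  from scan_spec[OF x(2) this, of 21 22, folded s2_def]
  obtain Ts2 Zy accy where y: "extends Ts1 Ts2" "heap (2 * ?D) s2 Ts2"
    "scanned ?D (arr s 19) Y (var s 4) (var s2 4) accy (arr s2 21) (arr s2 22) Zy"
    "\<And>g. g < var s2 4 \<Longrightarrow> arr s2 19 g = 0 \<and> ref Ts2 (arr s2 20 g) (Zy g)" using v1 a1 by auto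
  have x2: "scanned ?D (arr s 15) X (var s 3) (var s2 3) accx (arr s2 17) (arr s2 18) Zx"
    "\<And>g. g < var s2 3 \<Longrightarrow> arr s2 15 g = 0 \<and> ref Ts2 (arr s2 16 g) (Zx g)"
    using x(3,4) a2 v2 ref_extends[OF _ y(1)] by auto
  have mt2: "matrix (var s 3) (var s 4) (var s 5) (arr s2 10) (arr s2 11) (arr s2 12) (arr s2 13) (arr s 15) (arr s 19) X Y"
    using I(2) a1 a2 by simp
  from merge_spec[OF y(2) v2(2) mt2 x2(1) y(3) x2(2) y(4), folded s']
  obtain Ts' X' Y' where m: "heap (2 * ?D) s' Ts'"
    "matrix (var s2 3) (var s2 4) (var s' 5) (arr s' 10) (arr s' 11) (arr s' 12) (arr s' 13) (arr s' 15) (arr s' 19) X' Y'"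
    "side ?D (var s2 3) (arr s' 15) X'" "side ?D (var s2 4) (arr s' 19) Y'"
    "(\<lambda>i. (arr s' 10 i, arr s' 11 i)) ` {..<var s' 5} =
      (\<lambda>i. (arr s2 17 (arr s2 10 i), arr s2 21 (arr s2 11 i))) ` {..<var s 5}"
    "\<forall>g<var s2 3. ord (X' g) = ord (Zx g) \<and> ref Ts' (arr s' 16 g) (X' g)"
    "\<forall>g<var s2 4. ord (Y' g) = ord (Zy g) \<and> ref Ts' (arr s' 20 g) (Y' g)" by blast
  have v': "var s' 3 = var s2 3" "var s' 4 = var s2 4" "var s' 0 = var s 0"
    unfolding s' using merge_frame v2 by auto
  have gx: "arr s2 17 i < var s2 3" if "i < var s 3" for i using x2(1) that unfolding scanned_def by blast
  have gy: "arr s2 21 i < var s2 4" if "i < var s 4" for i using y(3) that unfolding scanned_def by blast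
  have mx: "arr s2 17 i \<le> arr s2 17 j" if "i < j" "j < var s 3" for i j using x2(1) that unfolding scanned_def by blast
  have my: "arr s2 21 i \<le> arr s2 21 j" if "i < j" "j < var s 4" for i j using y(3) that unfolding scanned_def by blast
  have im: "(\<lambda>i. (arr s' 10 i, arr s' 11 i)) ` {..<var s' 5} = (\<lambda>(i, j). (arr s2 17 i, arr s2 21 j)) ` ?S"
    unfolding m(5) using a1 a2 by (auto simp: image_image)
  have cov: "covering n \<sigma> (var s' 3) (var s' 4) (arr s2 17 \<circ> \<gamma>) (arr s2 21 \<circ> \<rho>)
      ((\<lambda>i. (arr s' 10 i, arr s' 11 i)) ` {..<var s' 5})"
    unfolding im v' using covering_step[OF I(7) perm(1) gx mx gy my] .
  have "concat (map (\<lambda>g. ord (Zx g)) [0..<var s2 3]) = [1..<Suc n]"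
    "concat (map (\<lambda>g. ord (Zy g)) [0..<var s2 4]) = map (inv \<sigma>) [1..<Suc n]"
    using x2(1) y(3) I(8,9) unfolding scanned_def by (simp_all only: simp_thms)
  moreover have "concat (map (\<lambda>g. ord (X' g)) [0..<var s2 3]) = concat (map (\<lambda>g. ord (Zx g)) [0..<var s2 3])"
    "concat (map (\<lambda>g. ord (Y' g)) [0..<var s2 4]) = concat (map (\<lambda>g. ord (Zy g)) [0..<var s2 4])"
    using m(6,7) by (auto intro!: concat_map_upt_cong)
  ultimately have o: "concat (map (\<lambda>g. ord (X' g)) [0..<var s' 3]) = [1..<Suc n]"
    "concat (map (\<lambda>g. ord (Y' g)) [0..<var s' 4]) = map (inv \<sigma>) [1..<Suc n]" unfolding v' by simp_all
  show "level_inv ?D n \<sigma> s'"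
    unfolding level_inv_def
    using m(1-4,6,7) cov o unfolding v'
    by (intro exI[of _ Ts'] exI[of _ X'] exI[of _ Y'] exI[of _ "arr s2 17 \<circ> \<gamma>"] exI[of _ "arr s2 21 \<circ> \<rho>"]) blast
  have "(\<Sum>i<var s 3. arr s 15 i) \<le> C * ?M" "(\<Sum>i<var s 4. arr s 19 i) \<le> C * ?M"
    using sum_counts_le[of "var s 3" "arr s 15" "var s 5" "arr s 10" "arr s 12"]
      sum_counts_le[of "var s 4" "arr s 19" "var s 5" "arr s 11" "arr s 13"] mt(10,11) N by (meson order_trans)+
  then show "2 * max (var s' 3) (var s' 4) \<le> ?M + 1"
    using group_count(2)[OF x2(1) pos(1)] group_count(2)[OF y(3) pos(2)] pos unfolding v' by (auto simp: max_def)
  show "var s' 0 = var s 0" by (rule v'(3))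
qed

lemma level_cost: "\<exists>A. \<forall>s. cost (level D) s \<le> A * (var s 3 + var s 4 + var s 5 + 1)"
proof -
  have f: "flat (scan_body D cnt cur gc off)" for cnt cur gc off
    by (simp add: scan_body_def rename_labels_def)
  have g: "flat (merge_body D)"
    by (simp add: merge_body_def fetch_def locate_def new_cell_def relink_def)
  obtain A1 where A1: "\<And>s. cost (CFor 6 3 (scan_body D 15 16 17 18)) s \<le> A1 * (var s 3 + 1)"
    using for_cost[OF f] by metis
  obtain A2 where A2: "\<And>s. cost (CFor 6 4 (scan_body D 19 20 21 22)) s \<le> A2 * (var s 4 + 1)"
    using for_cost[OF f] by metis
  obtain A3 where A3: "\<And>s. cost (CFor 6 5 (merge_body D)) s \<le> A3 * (var s 5 + 1)"
    using for_cost[OF g] by metis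
  have sc: "cost (scan D m cnt cur gc off) s =
      4 + cost (CFor 6 m (scan_body D cnt cur gc off)) (setv 24 (D + 1) (setv 15 (D + 1) (setv 16 0 s)))"
    for m cnt cur gc off s by (simp add: scan_def del: cost.simps(12))
  have me: "cost (merge D) s = 2 + cost (CFor 6 5 (merge_body D)) (setv 23 0 s)" for s
    by (simp add: merge_def del: cost.simps(12))
  have "cost (level D) s \<le> (10 + A1 + A2 + A3) * (var s 3 + var s 4 + var s 5 + 1)" for s
  proof -
    define s1 where "s1 = run (scan D 3 15 16 17 18) s"
    define s2 where "s2 = run (scan D 4 19 20 21 22) s1"
    have v: "var s1 4 = var s 4" "var s2 5 = var s 5"
      unfolding s2_def s1_def by (simp_all add: scan_frame(1))
    have "cost (level D) s = cost (scan D 3 15 16 17 18) s + (cost (scan D 4 19 20 21 22) s1 + cost (merge D) s2)"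
      unfolding level_def s1_def s2_def by simp
    also have "\<dots> \<le> (4 + A1 * (var s 3 + 1)) + ((4 + A2 * (var s 4 + 1)) + (2 + A3 * (var s 5 + 1)))"
      unfolding sc me using v
        A1[of "setv 24 (D + 1) (setv 15 (D + 1) (setv 16 0 s))"]
        A2[of "setv 24 (D + 1) (setv 15 (D + 1) (setv 16 0 s1))"]
        A3[of "setv 23 0 s2"] by (intro add_mono) simp_all
    also have "\<dots> \<le> (10 + A1 + A2 + A3) * (var s 3 + var s 4 + var s 5 + 1)"
      by (simp add: algebra_simps)
    finally show ?thesis .
  qed
  then show ?thesis by blast
qed

text \<open>Without unbounded loops the number of rounds is simply \<open>n\<close>. Once a single
  column and a single row are left, a round costs a constant, so the surplus rounds keep the total
  linear.\<close>

definition phases :: "nat \<Rightarrow> com" where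
  "phases D = CFor 7 0 (level D)"

lemma level_inv_setv: "level_inv D n \<sigma> (setv 7 k s) \<longleftrightarrow> level_inv D n \<sigma> s"
proof -
  have "heap L (setv 7 k s) Ts \<longleftrightarrow> heap L s Ts" for L Ts by (rule heap_cong) auto
  then show ?thesis by (simp add: level_inv_def)
qed

lemma phases_spec:
  fixes \<sigma> \<pi> :: "nat \<Rightarrow> nat"
  assumes n: "n \<ge> 1" and perm: "\<sigma> permutes {1..n}" "\<pi> permutes {1..p}"
    and av: "avoids n \<sigma> p \<pi>"
    and MT: "\<And>m S. S \<subseteq> {..<m} \<times> {..<m} \<Longrightarrow> \<not> contains_pattern p \<pi> S \<Longrightarrow> card S \<le> C * m"
    and inv: "level_inv (4 * C) n \<sigma> s" and v: "var s 0 = n" "var s 3 = n" "var s 4 = n"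
    and A: "\<And>s. cost (level (4 * C)) s \<le> A * (var s 3 + var s 4 + var s 5 + 1)"
  defines "s' \<equiv> run (phases (4 * C)) s"
  shows "level_inv (4 * C) n \<sigma> s'" "var s' 3 = 1" "var s' 4 = 1" "var s' 0 = n"
    "cost (phases (4 * C)) s \<le> (8 + 4 * A * (C + 3)) * n"
proof -
  let ?L = "\<lambda>k. loop (\<lambda>k s. run (level (4 * C)) (setv 7 k s)) k s"
  let ?M = "\<lambda>s. max (var s 3) (var s 4)"
  note spec = level_spec[OF _ n perm av MT]
  \<comment> \<open>Two consequences of \<open>2 * M' \<le> M + 1\<close> for consecutive sizes: the
    size is 1 after \<open>n\<close> rounds, and the sum of the past sizes plus twice the current
    one grows by at most 1 per round, so all sizes together are linear in \<open>n\<close>.\<close>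
  have it: "level_inv (4 * C) n \<sigma> (?L k) \<and> ?M (?L k) \<le> max 1 (n - k) \<and> var (?L k) 0 = n \<and>
      (\<Sum>j<k. ?M (?L j)) + 2 * ?M (?L k) \<le> 2 * n + k" if "k \<le> n" for k
    using that
  proof (induction k)
    case 0
    then show ?case using inv v by simp
  next
    case (Suc k)
    let ?s = "setv 7 k (?L k)"
    have IH: "level_inv (4 * C) n \<sigma> ?s" "?M ?s \<le> max 1 (n - k)" "var ?s 0 = n"
      "(\<Sum>j<k. ?M (?L j)) + 2 * ?M ?s \<le> 2 * n + k" "?M ?s = ?M (?L k)"
      using Suc by (simp_all add: level_inv_setv)
    have r: "?L (Suc k) = run (level (4 * C)) ?s" by simp
    have sp: "level_inv (4 * C) n \<sigma> (?L (Suc k))" "2 * ?M (?L (Suc k)) \<le> ?M ?s + 1" "var (?L (Suc k)) 0 = n"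
      unfolding r using spec[OF IH(1)] IH(3) by auto
    moreover have "?M (?L (Suc k)) \<le> max 1 (n - Suc k)" using sp(2) IH(2) by linarith
    moreover have "(\<Sum>j<Suc k. ?M (?L j)) + 2 * ?M (?L (Suc k)) \<le> 2 * n + Suc k"
      using sp(2) IH(4,5) by simp
    ultimately show ?case by blast
  qed
  have s': "s' = ?L n" unfolding s'_def phases_def using v by simp
  show inv': "level_inv (4 * C) n \<sigma> s'" "var s' 0 = n" unfolding s' using it[of n] by auto
  have "0 < var s' 3" using spec(3)[OF inv'(1)] .
  moreover have "0 < var s' 4"
  proof -
    have "1 \<in> {1..n}" using n by simp
    then show ?thesis using inv'(1) unfolding level_inv_def covering_def by fastforce
  qed
  moreover have "?M s' \<le> 1" unfolding s' using it[of n] by simp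
  ultimately show "var s' 3 = 1" "var s' 4 = 1" by auto
  have "cost (level (4 * C)) (setv 7 k (?L k)) \<le> A * (C + 3) * (?M (?L k) + 1)" if "k < n" for k
  proof -
    let ?s = "setv 7 k (?L k)"
    have "level_inv (4 * C) n \<sigma> ?s" using it[of k] that by (simp add: level_inv_setv)
    then have N: "var ?s 5 \<le> C * ?M ?s" by (rule spec(2))
    have "var ?s 3 + var ?s 4 + var ?s 5 + 1 \<le> (C + 3) * (?M ?s + 1)"
      using N by (simp add: algebra_simps)
    then have "A * (var ?s 3 + var ?s 4 + var ?s 5 + 1) \<le> A * ((C + 3) * (?M ?s + 1))" by (rule mult_le_mono2)
    with A[of ?s] have "cost (level (4 * C)) ?s \<le> A * ((C + 3) * (?M ?s + 1))" by (rule order_trans)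
    moreover have "?M ?s = ?M (?L k)" by simp
    ultimately show ?thesis by (simp only: mult.assoc)
  qed
  then have "(\<Sum>k<n. 4 + cost (level (4 * C)) (setv 7 k (?L k))) \<le> (\<Sum>k<n. 4 + A * (C + 3) * (?M (?L k) + 1))"
    by (intro sum_mono) simp
  also have "\<dots> = 4 * n + A * (C + 3) * ((\<Sum>k<n. ?M (?L k)) + n)"
    unfolding sum.distrib sum_distrib_left[symmetric] by simp
  also have "\<dots> \<le> 4 * n + A * (C + 3) * (4 * n)"
    using it[of n] by (intro add_left_mono mult_le_mono2) simp
  finally have "cost (phases (4 * C)) s \<le> 4 + (4 * n + A * (C + 3) * (4 * n))"
    unfolding phases_def using v by simp
  also have "\<dots> \<le> (8 + 4 * A * (C + 3)) * n" using n by (simp add: algebra_simps)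
  finally show "cost (phases (4 * C)) s \<le> (8 + 4 * A * (C + 3)) * n" .
qed

section \<open>The initial matrix\<close>

definition init_body :: com where
  "init_body = seqs
    [CMov 8 6, CInc 8, CIn 9 8, emit 0 8 8 8 10, CDec 9, CSt 10 6 6, CSt 11 6 9, CSt 16 6 10, CSt 20 9 10,
     CConst 11 1, CSt 15 6 11, CSt 19 6 11]"

definition initialise :: com where
  "initialise = seqs [CConst 2 1, CFor 6 0 init_body, CMov 3 0, CMov 4 0, CMov 5 0]"

lemma initialise_spec:
  fixes k :: nat
  assumes n: "n \<ge> 1" and perm: "\<sigma> permutes {1..n}" and D: "D \<ge> 1"
  defines "s' \<equiv> run initialise (init_st k n \<sigma>)"
  shows "level_inv D n \<sigma> s'" "var s' 0 = n" "var s' 3 = n" "var s' 4 = n"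
proof -
  let ?s = "init_st k n \<sigma>"
  have sb: "\<sigma> i \<in> {1..n}" if "i \<in> {1..n}" for i using that perm by (meson permutes_in_image)
  \<comment> \<open>The zeros in fresh arrays read as \<open>Lf 0\<close> at index 0, a filler, so
    that \<open>Lf i\<close> gets index \<open>i\<close>. This one node serves as the term of column
    \<open>i - 1\<close> and of row \<open>\<sigma> i - 1\<close>.\<close>
  define I where "I = (\<lambda>e s. heap (2 * D) s (map Lf [0..<Suc e]) \<and> var s 0 = n \<and> io s = io ?s \<and> lim s = lim ?s \<and>
    arr s 12 = (\<lambda>_. 0) \<and> arr s 13 = (\<lambda>_. 0) \<and>
    (\<forall>i<e. arr s 10 i = i \<and> arr s 11 i = \<sigma> (Suc i) - 1 \<and> arr s 16 i = Suc i \<and> arr s 20 (\<sigma> (Suc i) - 1) = Suc i \<and>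
      arr s 15 i = 1 \<and> arr s 19 i = 1))"
  define s0 where "s0 = setv 2 1 ?s"
  define s1 where "s1 = loop (\<lambda>e s. run init_body (setv 6 e s)) n s0"
  have "I n s1"
    unfolding s1_def
  proof (rule loop_induct[where I = I])
    show "I 0 s0"
      unfolding I_def s0_def by (simp add: heap_def node_def init_st_def)
  next
    fix e s assume e: "e < n" and "I e s"
    then have I: "heap (2 * D) s (map Lf [0..<Suc e])" "var s 0 = n" "io s = io ?s" "lim s = lim ?s"
      "arr s 12 = (\<lambda>_. 0)" "arr s 13 = (\<lambda>_. 0)"
      "\<And>i. i < e \<Longrightarrow> arr s 10 i = i \<and> arr s 11 i = \<sigma> (Suc i) - 1 \<and> arr s 16 i = Suc i \<and>
        arr s 20 (\<sigma> (Suc i) - 1) = Suc i \<and> arr s 15 i = 1 \<and> arr s 19 i = 1"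
      unfolding I_def by blast+
    let ?\<sigma> = "\<sigma> (Suc e)"
    define s2 where "s2 = setv 9 ?\<sigma> (setv 8 (Suc e) (setv 6 e s))"
    define s3 where "s3 = run (emit 0 8 8 8 10) s2"
    have io: "io ?s (Suc e) = ?\<sigma>" "Suc e < lim ?s" using e by (auto simp: init_st_def)
    have h2: "heap (2 * D) s2 (map Lf [0..<Suc e])"
      using I(1) by (subst heap_cong[of _ s]) (auto simp: s2_def)
    have nd: "node (2 * D) (map Lf [0..<Suc e]) (length (map Lf [0..<Suc e])) 0 (var s2 8) (var s2 8) (var s2 8) (Lf (Suc e))"
      by (simp add: node_def s2_def)
    have h3: "heap (2 * D) s3 (map Lf [0..<Suc (Suc e)])"
      using heap_emit[OF h2 nd, of 10] unfolding s3_def by simp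
    have l: "var s2 2 = Suc e" using h2 by (simp add: heap_def)
    have v3: "var s3 10 = Suc e" unfolding s3_def using l var_emit(2)[of 10 0 8 8 8 s2] by simp
    have f3: "var s3 x = var s2 x" if "x \<notin> {31, 10, 2}" for x
      unfolding s3_def using that by (intro run_frame) auto
    have a3: "arr s3 a = arr s a" if "a \<notin> {2, 3, 4, 5}" for a
      unfolding s3_def using that run_frame_arr[of a "emit 0 8 8 8 10" s2] by (auto simp: s2_def)
    have io3: "io s3 = io ?s" "lim s3 = lim ?s"
      unfolding s3_def using I(3,4) run_frame_io[of "emit 0 8 8 8 10" s2] by (auto simp: s2_def)
    define s4 where "s4 = seta 19 e 1 (seta 15 e 1 (setv 11 1 (seta 20 (?\<sigma> - 1) (Suc e) (seta 16 e (Suc e)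
      (seta 11 e (?\<sigma> - 1) (seta 10 e e (setv 9 (?\<sigma> - 1) s3)))))))"
    have r: "run init_body (setv 6 e s) = s4"
      unfolding init_body_def s4_def using io I(3,4) v3 f3
      by (simp add: s2_def[symmetric] s3_def[symmetric]) (simp add: s2_def)
    have ne: "\<sigma> (Suc i) - 1 \<noteq> ?\<sigma> - 1" if "i < e" for i
    proof
      assume "\<sigma> (Suc i) - 1 = ?\<sigma> - 1"
      then have "\<sigma> (Suc i) = ?\<sigma>" using sb[of "Suc i"] sb[of "Suc e"] e that by auto
      then show False using perm that by (metis Suc_inject less_irrefl_nat permutes_inj injD)
    qed
    have "heap (2 * D) s4 (map Lf [0..<Suc (Suc e)])"
      using h3 by (subst heap_cong[of _ s3]) (auto simp: s4_def)
    then show "I (Suc e) (run init_body (setv 6 e s))"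
      unfolding r I_def using I(2,5-7) io3 f3 a3 ne unfolding s4_def
      by (auto simp: less_Suc_eq s2_def)
  qed
  then have I: "heap (2 * D) s1 (map Lf [0..<Suc n])" "var s1 0 = n"
      "arr s1 12 = (\<lambda>_. 0)" "arr s1 13 = (\<lambda>_. 0)"
      "\<And>i. i < n \<Longrightarrow> arr s1 10 i = i" "\<And>i. i < n \<Longrightarrow> arr s1 11 i = \<sigma> (Suc i) - 1" "\<And>i. i < n \<Longrightarrow> arr s1 16 i = Suc i"
      "\<And>i. i < n \<Longrightarrow> arr s1 20 (\<sigma> (Suc i) - 1) = Suc i" "\<And>i. i < n \<Longrightarrow> arr s1 15 i = 1" "\<And>i. i < n \<Longrightarrow> arr s1 19 i = 1"
    unfolding I_def by blast+
  have s': "s' = setv 5 n (setv 4 n (setv 3 n s1))"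
    unfolding s'_def initialise_def using I(2) by (simp add: s1_def s0_def init_st_def)
  then show v': "var s' 0 = n" "var s' 3 = n" "var s' 4 = n" using I(2) by simp_all
  have v5: "var s' 5 = n" "arr s' = arr s1" using s' by simp_all
  define X where "X = (\<lambda>i. Lf (Suc i))"
  define Y where "Y = (\<lambda>i. Lf (inv \<sigma> (Suc i)))"
  have inv: "inv \<sigma> (\<sigma> x) = x" "\<sigma> (inv \<sigma> x) = x" for x using perm by (simp_all add: permutes_inverses)
  have ib: "inv \<sigma> i \<in> {1..n}" if "i \<in> {1..n}" for i using that perm by (meson permutes_in_image permutes_inv)
  have cr: "\<sigma> (Suc i) - 1 < n" "Suc (\<sigma> (Suc i) - 1) = \<sigma> (Suc i)" if "i < n" for i using sb[of "Suc i"] that by auto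
  have rc: "\<exists>i<n. \<sigma> (Suc i) - 1 = r \<and> i = inv \<sigma> (Suc r) - 1" if "r < n" for r
    using ib[of "Suc r"] that inv(2)[of "Suc r"] by (intro exI[of _ "inv \<sigma> (Suc r) - 1"]) auto
  have inj: "inj_on (\<lambda>i. \<sigma> (Suc i) - 1) {..<n}"
    by (rule inj_onI) (metis Suc_inject cr(2) inv(1) lessThan_iff)
  have h: "heap (2 * D) s' (map Lf [0..<Suc n])" using I(1) by (subst heap_cong[of _ s1]) (auto simp: s')
  have m: "matrix n n n (arr s1 10) (arr s1 11) (arr s1 12) (arr s1 13) (arr s1 15) (arr s1 19) X Y"
    unfolding matrix_def
  proof (intro conjI)
    show "\<forall>i<n. arr s1 10 i < n \<and> arr s1 11 i < n \<and> arr s1 12 i < arr s1 15 (arr s1 10 i) \<and>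
        arr s1 13 i < arr s1 19 (arr s1 11 i) \<and> ps (X (arr s1 10 i)) (arr s1 12 i) = ps (Y (arr s1 11 i)) (arr s1 13 i)"
      using I cr inv by (auto simp: X_def Y_def)
    show "inj_on (\<lambda>i. (arr s1 10 i, arr s1 11 i)) {..<n}" "inj_on (\<lambda>i. (arr s1 10 i, arr s1 12 i)) {..<n}"
      using I(5) by (auto simp: inj_on_def)
    show "inj_on (\<lambda>i. (arr s1 11 i, arr s1 13 i)) {..<n}"
      using I(6) inj by (auto simp: inj_on_def)
    show "\<forall>i j. i < j \<longrightarrow> j < n \<longrightarrow> arr s1 10 i \<le> arr s1 10 j" using I(5) by auto
    show "\<forall>c<n. \<forall>k<arr s1 15 c. \<exists>i<n. arr s1 10 i = c \<and> arr s1 12 i = k"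
      using I(3,5,9) by auto
    show "\<forall>r<n. \<forall>k<arr s1 19 r. \<exists>i<n. arr s1 11 i = r \<and> arr s1 13 i = k"
    proof (intro allI impI)
      fix r k assume r: "r < n" "k < arr s1 19 r"
      then show "\<exists>i<n. arr s1 11 i = r \<and> arr s1 13 i = k"
        using rc[OF r(1)] I(4,6,10) by auto
    qed
  qed
  have sd: "side D n (arr s1 15) X" "side D n (arr s1 19) Y"
    using I(9,10) D by (auto simp: side_def X_def Y_def)
  have rx: "\<forall>g<n. ref (map Lf [0..<Suc n]) (arr s1 16 g) (X g)"
    using I(7) by (auto simp: ref_def X_def nth_append simp del: upt_Suc)
  have ry: "\<forall>g<n. ref (map Lf [0..<Suc n]) (arr s1 20 g) (Y g)"
  proof (intro allI impI)
    fix g assume "g < n"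
    then obtain i where i: "i < n" "\<sigma> (Suc i) - 1 = g" "Suc g = \<sigma> (Suc i)" using rc cr by metis
    then have "arr s1 20 g = Suc i" "Y g = Lf (Suc i)" using I(8)[OF i(1)] inv by (auto simp: Y_def)
    then show "ref (map Lf [0..<Suc n]) (arr s1 20 g) (Y g)"
      using i(1) by (auto simp: ref_def nth_append simp del: upt_Suc)
  qed
  have cov: "covering n \<sigma> n n (\<lambda>x. x - 1) (\<lambda>x. x - 1) ((\<lambda>i. (arr s1 10 i, arr s1 11 i)) ` {..<n})"
  proof -
    have "(\<lambda>i. (arr s1 10 i, arr s1 11 i)) ` {..<n} = (\<lambda>i. (Suc i - 1, \<sigma> (Suc i) - 1)) ` {..<n}"
      using I(5,6) by (intro image_cong) auto
    also have "\<dots> = (\<lambda>x. (x - 1, \<sigma> x - 1)) ` Suc ` {..<n}" by (simp add: image_image)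
    also have "Suc ` {..<n} = {1..n}" by (simp add: image_Suc_lessThan)
    finally show ?thesis by (auto simp: covering_def mono_on_def)
  qed
  have o: "concat (map (\<lambda>g. ord (X g)) [0..<n]) = [1..<Suc n]"
    "concat (map (\<lambda>g. ord (Y g)) [0..<n]) = map (inv \<sigma>) [1..<Suc n]"
  proof -
    have "concat (map (\<lambda>g. ord (X g)) [0..<n]) = map Suc [0..<n]" by (induction n) (auto simp: X_def)
    then show "concat (map (\<lambda>g. ord (X g)) [0..<n]) = [1..<Suc n]" by (simp add: map_Suc_upt del: upt_Suc)
    have "concat (map (\<lambda>g. ord (Y g)) [0..<n]) = map (inv \<sigma>) (map Suc [0..<n])" by (induction n) (auto simp: Y_def)
    then show "concat (map (\<lambda>g. ord (Y g)) [0..<n]) = map (inv \<sigma>) [1..<Suc n]"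
      unfolding map_Suc_upt by simp
  qed
  show "level_inv D n \<sigma> s'"
    unfolding level_inv_def v' v5 using h m sd rx ry cov o
    by (intro exI[of _ "map Lf [0..<Suc n]"] exI[of _ X] exI[of _ Y] exI[of _ "\<lambda>x. x - 1"]) blast
qed

section \<open>Reducing all terms of the heap\<close>

text \<open>The arrays from 2 to 5 are exempt because they hold the heap, whose growth is tracked by
  \<open>extends\<close>. All recorded tables change at one index only.\<close>

definition only_at :: "nat \<Rightarrow> st \<Rightarrow> st \<Rightarrow> bool" where
  "only_at i s s' \<longleftrightarrow> (\<forall>a. a \<notin> {2, 3, 4, 5} \<longrightarrow> (\<forall>j. j \<noteq> i \<longrightarrow> arr s' a j = arr s a j))"

lemma only_at_refl [simp]: "only_at i s s"
  by (simp add: only_at_def)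

lemma only_at_trans: "only_at i s s' \<Longrightarrow> only_at i s' s'' \<Longrightarrow> only_at i s s''"
  by (simp add: only_at_def)

lemma only_at_setv [simp]: "only_at i s (setv x v s') \<longleftrightarrow> only_at i s s'" "only_at i (setv x v s) s' \<longleftrightarrow> only_at i s s'"
  by (simp_all add: only_at_def)

lemma only_at_seta: "only_at i s s' \<Longrightarrow> only_at i s (seta a i v s')"
  by (simp add: only_at_def)

lemma only_at_arrs: "(\<And>a. a \<notin> {2, 3, 4, 5} \<Longrightarrow> arr s' a = arr s a) \<Longrightarrow> only_at i s s'"
  by (simp add: only_at_def)

text \<open>Index 0, which is never a reference, encodes \<open>None\<close>.\<close>

definition oref :: "tm list \<Rightarrow> nat \<Rightarrow> tm option \<Rightarrow> bool" where
  "oref Ts p x \<longleftrightarrow> (case x of None \<Rightarrow> p = 0 | Some t \<Rightarrow> ref Ts p t)"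

lemma oref_simps [simp]:
  "oref Ts p None \<longleftrightarrow> p = 0" "oref Ts p (Some t) \<longleftrightarrow> ref Ts p t"
  by (simp_all add: oref_def)

lemma oref_extends: "oref Ts p x \<Longrightarrow> extends Ts Us \<Longrightarrow> oref Us p x"
  by (cases x) (auto intro: ref_extends)

lemma oref_pos: "oref Ts p x \<Longrightarrow> 0 < p \<longleftrightarrow> x \<noteq> None"
  by (cases x) (auto simp: ref_def)

lemma heap_setv: "x \<noteq> 2 \<Longrightarrow> heap L (setv x v s) Ts \<longleftrightarrow> heap L s Ts"
  by (rule heap_cong) auto

lemma heap_seta: "a \<notin> {2, 3, 4, 5} \<Longrightarrow> heap L (seta a i v s) Ts \<longleftrightarrow> heap L s Ts"
  by (rule heap_cong) auto

definition join :: "nat \<Rightarrow> nat \<Rightarrow> nat \<Rightarrow> com" where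
  "join x y r = CSeq (CConst 19 0) (CIf 19 x (CIf 19 y (emit 1 x y y r) (CMov r x)) (CMov r y))"

lemma join_spec:
  assumes "heap L s Ts" "oref Ts (var s x) A" "oref Ts (var s y) B" "x \<notin> {19, 31}" "y \<notin> {19, 31}" "r \<notin> {2, 19, 31}"
  defines "s' \<equiv> run (join x y r) s"
  shows "\<exists>Ts'. extends Ts Ts' \<and> heap L s' Ts' \<and> oref Ts' (var s' r) (jn A B)"
proof -
  note pos = oref_pos[OF assms(2)] oref_pos[OF assms(3)]
  have h: "heap L (setv z v s) Ts" if "z \<noteq> 2" for z v using assms(1) that by (simp add: heap_setv)
  consider "A = None" | a where "A = Some a" "B = None" | a b where "A = Some a" "B = Some b" by fastforce
  then show ?thesis
  proof cases
    case 1
    then have s': "s' = setv r (var s y) (setv 19 0 s)" using assms(2-6) pos by (simp add: s'_def join_def)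
    then have "heap L s' Ts" using assms(1,6) by (simp add: heap_setv)
    then show ?thesis using 1 assms(2-6) unfolding s' by (intro exI[of _ Ts]) simp
  next
    case 2
    then have s': "s' = setv r (var s x) (setv 19 0 s)" using assms(2-6) pos by (simp add: s'_def join_def)
    then have "heap L s' Ts" using assms(1,6) by (simp add: heap_setv)
    then show ?thesis using 2 assms(2-6) unfolding s' by (intro exI[of _ Ts]) simp
  next
    case 3
    let ?s = "setv 19 0 s"
    have s': "s' = run (emit (Suc 0) x y y r) ?s" using assms(2-6) pos 3 by (simp add: s'_def join_def)
    have "node L Ts (length Ts) (Suc 0) (var ?s x) (var ?s y) (var ?s y) (Jn a b)"
      using assms(2-6) 3 by (simp add: node_def ref_def)
    note e = heap_emit[OF h[of 19] this] ref_emit[OF h[of 19] this]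
    show ?thesis using e assms(2-6) 3 ref_nonempty unfolding s'
      by (intro exI[of _ "Ts @ [Jn a b]"]) auto
  qed
qed

lemma join_frame:
  "wvars (join x y r) \<subseteq> {19, 31, 2, r}" "warrs (join x y r) = {2, 3, 4, 5}" "silent (join x y r)" "flat (join x y r)"
  by (auto simp: join_def)

section \<open>Tables of restrictions\<close>

definition slot :: "nat \<Rightarrow> nat" where "slot q = 26 + 3 * q"

text \<open>The lowest bit is the mirroring flag and the rest the set of labels, so the queries are
  the numbers below \<open>2 * 2 ^ L\<close>.\<close>

definition code :: "bool \<Rightarrow> nat set \<Rightarrow> nat" where
  "code f K = 2 * set_encode K + (if f then 1 else 0)"

definition queries :: "nat \<Rightarrow> nat" where "queries L = 2 * 2 ^ L"

lemma set_encode_less: "A \<subseteq> {..<L} \<Longrightarrow> set_encode A < 2 ^ L"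
proof -
  assume A: "A \<subseteq> {..<L}"
  have "set_encode A \<le> (\<Sum>i<L. 2 ^ i)" unfolding set_encode_def using A by (intro sum_mono2) auto
  also have "\<dots> < 2 ^ L" by (induction L) auto
  finally show ?thesis .
qed

lemma set_decode_subset: "c < 2 ^ L \<Longrightarrow> set_decode c \<subseteq> {..<L}"
proof
  fix i assume c: "c < 2 ^ L" and "i \<in> set_decode c"
  then have "odd (c div 2 ^ i)" by (simp add: set_decode_def)
  then have "c div 2 ^ i \<noteq> 0" by (metis even_zero)
  then have "2 ^ i \<le> c" by (metis div_less not_le)
  then have "(2::nat) ^ i < 2 ^ L" using c by linarith
  then show "i \<in> {..<L}" by simp
qed

lemma code_props:
  assumes "K \<subseteq> {..<L}"
  shows "code f K < queries L" "odd (code f K) = f" "set_decode (code f K div 2) = K"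
proof -
  have "finite K" using assms finite_subset by blast
  then show "set_decode (code f K div 2) = K" by (simp add: code_def set_encode_inverse)
  show "code f K < queries L" using set_encode_less[OF assms] by (simp add: code_def queries_def)
  show "odd (code f K) = f" by (simp add: code_def)
qed

lemma query_subset: "q < queries L \<Longrightarrow> set_decode (q div 2) \<subseteq> {..<L}"
  by (rule set_decode_subset) (auto simp: queries_def)

abbreviation answer :: "tm \<Rightarrow> nat \<Rightarrow> tm option" where
  "answer t q \<equiv> mx (odd q) (set_decode (q div 2)) t"

text \<open>The set of labels of a child is known only at run time, but its code is below
  \<open>2 ^ L\<close>, so the three cases of \<open>restr\<close> can be decided by a
  table.\<close>

definition restrict_child :: "nat \<Rightarrow> nat \<Rightarrow> nat \<Rightarrow> nat \<Rightarrow> nat \<Rightarrow> com" where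
  "restrict_child L q d p r = switch 31 d (\<lambda>u.
     if set_decode u \<subseteq> set_decode (q div 2) then CLd r 7 p
     else if set_decode u \<inter> set_decode (q div 2) = {} then CConst r 0 else CLd r (slot q) p) (2 ^ L)"

text \<open>Every answer is recorded, also where \<open>K\<close> does not split the labels and
  \<open>mx\<close> has no meaning. The program thus follows the recursive equations literally, for
  all terms alike.\<close>

definition known :: "nat \<Rightarrow> tm list \<Rightarrow> st \<Rightarrow> nat \<Rightarrow> tm \<Rightarrow> bool" where
  "known L Ts s i t \<longleftrightarrow> arr s 6 i = set_encode (dm t) \<and> ref Ts (arr s 7 i) (red t) \<and>
     (\<forall>q<queries L. oref Ts (arr s (slot q) i) (answer t q))"

lemma known_extends: "known L Ts s i t \<Longrightarrow> extends Ts Us \<Longrightarrow> known L Us s i t"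
  by (auto simp: known_def intro: ref_extends oref_extends)

lemma known_only_at: "known L Ts s j t \<Longrightarrow> only_at i s s' \<Longrightarrow> j \<noteq> i \<Longrightarrow> known L Ts s' j t"
  by (simp add: known_def only_at_def slot_def)

lemma restrict_child_spec:
  assumes "known L Ts s (var s p) t" "dm t \<subseteq> {..<L}" "var s d = set_encode (dm t)" "q < queries L"
    "d \<noteq> 31" "p \<noteq> 31"
  shows "\<exists>v w. run (restrict_child L q d p r) s = setv r v (setv 31 w s) \<and>
    oref Ts v (restr (odd q) (set_decode (q div 2)) t)"
proof -
  let ?K = "set_decode (q div 2)"
  have fd: "set_decode (var s d) = dm t" unfolding assms(3) by (simp add: set_encode_inverse)
  have "var s d < 2 ^ L" unfolding assms(3) by (rule set_encode_less[OF assms(2)])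
  then obtain w where w: "run (restrict_child L q d p r) s =
    run (if dm t \<subseteq> ?K then CLd r 7 p else if dm t \<inter> ?K = {} then CConst r 0 else CLd r (slot q) p) (setv 31 w s)"
    using run_switch[of d 31 s "2 ^ L" "\<lambda>u. if set_decode u \<subseteq> ?K then CLd r 7 p
      else if set_decode u \<inter> ?K = {} then CConst r 0 else CLd r (slot q) p"] assms(5)
    unfolding restrict_child_def fd by auto
  show ?thesis
    using w assms(1,4,6) unfolding restr_def known_def
    by (intro exI[of _ "if dm t \<subseteq> ?K then arr s 7 (var s p) else if dm t \<inter> ?K = {} then 0 else arr s (slot q) (var s p)"]
        exI[of _ w]) auto
qed

definition jn_query :: "nat \<Rightarrow> nat \<Rightarrow> com" where
  "jn_query L q = seqs [restrict_child L q 13 9 16, restrict_child L q 14 10 17,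
     if odd q then join 17 16 18 else join 16 17 18, CSt (slot q) 6 18]"

text \<open>With \<open>j\<close>, \<open>l\<close> and \<open>q\<close> fixed in the code, the slot
  of the pulled back set is a constant, as an array number has to be.\<close>

definition mv_query :: "nat \<Rightarrow> nat \<Rightarrow> nat \<Rightarrow> nat \<Rightarrow> com" where
  "mv_query L j l q = seqs [CLd 16 (slot (code (odd q) (pullback j l (set_decode (q div 2))))) 9, CConst 19 0,
     CIf 19 16 (if l \<in> set_decode (q div 2) then emit 2 16 10 11 18 else CMov 18 16) (CConst 18 0),
     CSt (slot q) 6 18]"

text \<open>What must survive while one index is processed: the index with its constructor and
  arguments, the codes of the labels of the children and of the term, the candidate reduction in 20,
  the two roots in 27 and 28, and the size.\<close>

definition stable :: "nat set" where "stable = {6, 8, 9, 10, 11, 13, 14, 15, 20, 27, 28, 0}"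

definition processed :: "nat \<Rightarrow> nat \<Rightarrow> tm list \<Rightarrow> st \<Rightarrow> tm list \<Rightarrow> st \<Rightarrow> bool" where
  "processed L i Ts s Ts' s' \<longleftrightarrow> extends Ts Ts' \<and> heap L s' Ts' \<and> only_at i s s' \<and> (\<forall>x\<in>stable. var s' x = var s x)"

lemma processed_trans:
  "processed L i Ts s Ts' s' \<Longrightarrow> processed L i Ts' s' Ts'' s'' \<Longrightarrow> processed L i Ts s Ts'' s''"
  unfolding processed_def using extends_trans only_at_trans by (metis (no_types, lifting))

lemma processed_known:
  "known L Ts s j t \<Longrightarrow> processed L i Ts s Ts' s' \<Longrightarrow> j \<noteq> i \<Longrightarrow> known L Ts' s' j t"
  unfolding processed_def using known_only_at known_extends by blast

lemma slot_simps [simp]: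
  "slot q \<noteq> 2" "slot q \<noteq> 3" "slot q \<noteq> 4" "slot q \<noteq> 5" "slot q \<noteq> 6" "slot q \<noteq> 7"
  "2 \<noteq> slot q" "3 \<noteq> slot q" "4 \<noteq> slot q" "5 \<noteq> slot q" "6 \<noteq> slot q" "7 \<noteq> slot q"
  "slot q = slot q' \<longleftrightarrow> q = q'"
  by (auto simp: slot_def)

lemma jn_query_spec:
  assumes h: "heap L s Ts" and k: "known L Ts s (var s 9) a" "known L Ts s (var s 10) b"
    and d: "dm a \<subseteq> {..<L}" "dm b \<subseteq> {..<L}" "var s 13 = set_encode (dm a)" "var s 14 = set_encode (dm b)"
    and q: "q < queries L" and i: "var s 6 = i" "var s 10 \<noteq> i" "var s 9 \<noteq> i"
  defines "s' \<equiv> run (jn_query L q) s"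
  shows "\<exists>Ts'. processed L i Ts s Ts' s' \<and> oref Ts' (arr s' (slot q) i) (answer (Jn a b) q) \<and>
    (\<forall>x. x \<noteq> slot q \<longrightarrow> x \<notin> {2, 3, 4, 5} \<longrightarrow> arr s' x = arr s x)"
proof -
  let ?K = "set_decode (q div 2)"
  obtain v w where s1: "run (restrict_child L q 13 9 16) s = setv 16 v (setv 31 w s)"
    and v: "oref Ts v (restr (odd q) ?K a)"
    using restrict_child_spec[OF k(1) d(1,3) q] by (metis numeral_eq_iff semiring_norm(83,87,88,89,90))
  let ?s1 = "setv 16 v (setv 31 w s)"
  have "known L Ts ?s1 (var ?s1 10) b" using k(2) by (simp add: known_def)
  then obtain v' w' where s2: "run (restrict_child L q 14 10 17) ?s1 = setv 17 v' (setv 31 w' ?s1)"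
    and v': "oref Ts v' (restr (odd q) ?K b)"
    using restrict_child_spec[of L Ts ?s1 10 b 14 q 17] d(2,4) q by auto
  let ?s2 = "setv 17 v' (setv 31 w' ?s1)"
  define s3 where "s3 = run (if odd q then join 17 16 18 else join 16 17 18) ?s2"
  have h2: "heap L ?s2 Ts" using h by (simp add: heap_setv)
  have o: "oref Ts (var ?s2 16) (restr (odd q) ?K a)" "oref Ts (var ?s2 17) (restr (odd q) ?K b)"
    using v v' by simp_all
  obtain Ts' where T: "extends Ts Ts'" "heap L s3 Ts'" "oref Ts' (var s3 18) (answer (Jn a b) q)"
    using join_spec[OF h2 o(2) o(1), of 18] join_spec[OF h2 o(1) o(2), of 18]
    unfolding s3_def mx_simps by (cases "odd q") auto
  have f: "var s3 x = var ?s2 x" if "x \<notin> {19, 31, 2, 18}" for x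
    unfolding s3_def using that by (intro run_frame) (auto dest!: subsetD[OF join_frame(1)] split: if_splits)
  have g: "arr s3 x = arr s x" if "x \<notin> {2, 3, 4, 5}" for x
    unfolding s3_def using that run_frame_arr[of x _ ?s2] by (auto simp: join_frame)
  have s': "s' = seta (slot q) i (var s3 18) s3"
    unfolding s'_def jn_query_def using s1 s2 i(1) f[of 6] by (simp add: s3_def)
  have "processed L i Ts s Ts' s'"
    unfolding processed_def s'
  proof (intro conjI)
    show "heap L (seta (slot q) i (var s3 18) s3) Ts'" using T(2) by (simp add: heap_seta)
    have "only_at i s s3" using g by (rule only_at_arrs)
    then show "only_at i s (seta (slot q) i (var s3 18) s3)" by (rule only_at_seta)
    show "\<forall>x\<in>stable. var (seta (slot q) i (var s3 18) s3) x = var s x"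
      using f by (simp add: stable_def)
  qed (rule T(1))
  moreover have "oref Ts' (arr s' (slot q) i) (answer (Jn a b) q)" using T(3) s' by simp
  moreover have "\<forall>x. x \<noteq> slot q \<longrightarrow> x \<notin> {2, 3, 4, 5} \<longrightarrow> arr s' x = arr s x" using g s' by simp
  ultimately show ?thesis by blast
qed

lemma pullback_subset: "K \<subseteq> {..<L} \<Longrightarrow> j < L \<Longrightarrow> pullback j l K \<subseteq> {..<L}"
  by (auto simp: pullback_def)

lemma mv_query_spec:
  assumes h: "heap L s Ts" and k: "known L Ts s (var s 9) a" and l: "var s 10 = j" "var s 11 = l" "j < L" "l < L"
    and q: "q < queries L" and i: "var s 6 = i" "var s 9 \<noteq> i"
  defines "s' \<equiv> run (mv_query L j l q) s"
  shows "\<exists>Ts'. processed L i Ts s Ts' s' \<and> oref Ts' (arr s' (slot q) i) (answer (Mv j l a) q) \<and>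
    (\<forall>x. x \<noteq> slot q \<longrightarrow> x \<notin> {2, 3, 4, 5} \<longrightarrow> arr s' x = arr s x)"
proof -
  let ?K = "set_decode (q div 2)"
  let ?c = "code (odd q) (pullback j l ?K)"
  note c = code_props[OF pullback_subset[OF query_subset[OF q] l(3)], of "odd q" l]
  have o: "oref Ts (arr s (slot ?c) (var s 9)) (mx (odd q) (pullback j l ?K) a)"
  proof -
    have "oref Ts (arr s (slot ?c) (var s 9)) (answer a ?c)" using k c(1) unfolding known_def by blast
    then show ?thesis unfolding c(2,3) .
  qed
  define p where "p = arr s (slot ?c) (var s 9)"
  define s2 where "s2 = setv 19 0 (setv 16 p s)"
  have h2: "heap L s2 Ts" using h by (simp add: s2_def heap_setv)
  define s3 where "s3 = run (CIf 19 16 (if l \<in> ?K then emit 2 16 10 11 18 else CMov 18 16) (CConst 18 0)) s2"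
  have s': "s' = seta (slot q) (var s3 6) (var s3 18) s3"
    unfolding s'_def mv_query_def s3_def s2_def p_def by simp
  have w: "wvars (CIf 19 16 (if l \<in> ?K then emit 2 16 10 11 18 else CMov 18 16) (CConst 18 0)) \<subseteq> {31, 18, 2}" by simp
  have f: "var s3 x = var s2 x" if "x \<notin> {31, 18, 2}" for x
    unfolding s3_def using that w by (intro run_frame) blast
  have w': "warrs (CIf 19 16 (if l \<in> ?K then emit 2 16 10 11 18 else CMov 18 16) (CConst 18 0)) \<subseteq> {2, 3, 4, 5}" by simp
  have g: "arr s3 x = arr s x" if "x \<notin> {2, 3, 4, 5}" for x
    unfolding s3_def using that w' run_frame_arr[of x _ s2] by (auto simp: s2_def subset_iff)
  have "\<exists>Ts'. extends Ts Ts' \<and> heap L s3 Ts' \<and> oref Ts' (var s3 18) (answer (Mv j l a) q)"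
  proof (cases "mx (odd q) (pullback j l ?K) a")
    case None
    then have "p = 0" using o by (simp add: p_def)
    then have "s3 = setv 18 0 s2" by (simp add: s3_def s2_def)
    then show ?thesis using None h2 by (intro exI[of _ Ts]) (simp add: heap_setv)
  next
    case (Some t)
    then have r: "ref Ts p t" using o by (simp add: p_def)
    then have p: "0 < p" by (simp add: ref_def)
    show ?thesis
    proof (cases "l \<in> ?K")
      case True
      then have s3: "s3 = run (emit 2 16 10 11 18) s2" using p by (simp add: s3_def s2_def)
      have "node L Ts (length Ts) 2 (var s2 16) (var s2 10) (var s2 11) (Mv j l t)"
        using r l by (simp add: node_def s2_def ref_def)
      note e = heap_emit[OF h2 this, of 18] ref_emit[OF h2 this, of 18]
      show ?thesis using e True Some ref_nonempty[OF r] unfolding s3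
        by (intro exI[of _ "Ts @ [Mv j l t]"]) simp
    next
      case False
      then have "s3 = setv 18 p s2" using p by (simp add: s3_def s2_def)
      then show ?thesis using False Some h2 r by (intro exI[of _ Ts]) (simp add: heap_setv)
    qed
  qed
  then obtain Ts' where T: "extends Ts Ts'" "heap L s3 Ts'" "oref Ts' (var s3 18) (answer (Mv j l a) q)" by blast
  have v6: "var s3 6 = i" using f[of 6] i by (simp add: s2_def)
  have "processed L i Ts s Ts' s'"
    unfolding processed_def s' v6
  proof (intro conjI)
    show "heap L (seta (slot q) i (var s3 18) s3) Ts'" using T(2) by (simp add: heap_seta)
    have "only_at i s s3" using g by (rule only_at_arrs)
    then show "only_at i s (seta (slot q) i (var s3 18) s3)" by (rule only_at_seta)
    show "\<forall>x\<in>stable. var (seta (slot q) i (var s3 18) s3) x = var s x"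
      using f by (simp add: stable_def s2_def)
  qed (rule T(1))
  moreover have "oref Ts' (arr s' (slot q) i) (answer (Mv j l a) q)" using T(3) s' v6 by simp
  moreover have "\<forall>x. x \<noteq> slot q \<longrightarrow> x \<notin> {2, 3, 4, 5} \<longrightarrow> arr s' x = arr s x" using g s' by simp
  ultimately show ?thesis by blast
qed

lemma queries_spec:
  assumes h: "heap L s Ts" and i: "var s 6 = i"
    and step: "\<And>q s1 Ts1. q < queries L \<Longrightarrow> processed L i Ts s Ts1 s1 \<Longrightarrow>
      \<exists>Ts2. processed L i Ts1 s1 Ts2 (run (g q) s1) \<and> oref Ts2 (arr (run (g q) s1) (slot q) i) (answer t q) \<and>
        (\<forall>x. x \<noteq> slot q \<longrightarrow> x \<notin> {2, 3, 4, 5} \<longrightarrow> arr (run (g q) s1) x = arr s1 x)"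
  defines "s' \<equiv> run (unroll (queries L) g) s"
  shows "\<exists>Ts'. processed L i Ts s Ts' s' \<and> (\<forall>q<queries L. oref Ts' (arr s' (slot q) i) (answer t q)) \<and>
    arr s' 6 = arr s 6 \<and> arr s' 7 = arr s 7"
proof -
  let ?I = "\<lambda>n s'. \<exists>Ts'. processed L i Ts s Ts' s' \<and> (\<forall>q<n. oref Ts' (arr s' (slot q) i) (answer t q)) \<and>
    arr s' 6 = arr s 6 \<and> arr s' 7 = arr s 7"
  have "?I (queries L) s'"
    unfolding s'_def
  proof (rule unroll_induct[where I = ?I])
    show "?I 0 s" using h by (intro exI[of _ Ts]) (simp add: processed_def)
  next
    fix q s1 assume q: "q < queries L" and "?I q s1"
    then obtain Ts1 where 1: "processed L i Ts s Ts1 s1" "\<forall>q'<q. oref Ts1 (arr s1 (slot q') i) (answer t q')"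
      "arr s1 6 = arr s 6" "arr s1 7 = arr s 7" by blast
    obtain Ts2 where 2: "processed L i Ts1 s1 Ts2 (run (g q) s1)" "oref Ts2 (arr (run (g q) s1) (slot q) i) (answer t q)"
      "\<And>x. x \<noteq> slot q \<Longrightarrow> x \<notin> {2, 3, 4, 5} \<Longrightarrow> arr (run (g q) s1) x = arr s1 x" using step[OF q 1(1)] by blast
    have e: "extends Ts1 Ts2" using 2(1) by (simp add: processed_def)
    have "oref Ts2 (arr (run (g q) s1) (slot q') i) (answer t q')" if "q' < Suc q" for q'
      using that 1(2) 2(2) 2(3)[of "slot q'"] oref_extends[OF _ e] by (cases "q' = q") auto
    moreover have "processed L i Ts s Ts2 (run (g q) s1)" using processed_trans 1(1) 2(1) by blast
    moreover have "arr (run (g q) s1) 6 = arr s 6" "arr (run (g q) s1) 7 = arr s 7" using 2(3) 1(3,4) by auto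
    ultimately show "?I (Suc q) (run (g q) s1)" by blast
  qed
  then show ?thesis .
qed

text \<open>\<open>Min\<close> and \<open>card\<close> are evaluated for each code when the program
  is written. If the join yields nothing, the term itself is stored, matching the default in
  \<open>split_red\<close>; variable 20 supplies the result for fewer than two labels.\<close>

definition red_finish :: "nat \<Rightarrow> com" where
  "red_finish L = seqs [CSt 7 6 20, switch 31 15 (\<lambda>u. if 2 \<le> card (set_decode u) then
     seqs [CLd 16 (slot (code False {Min (set_decode u)})) 6,
       CLd 17 (slot (code True (set_decode u - {Min (set_decode u)}))) 6,
       join 16 17 18, CConst 19 0, CIf 19 18 (CSt 7 6 18) (CSt 7 6 6)] else CSkip) (2 ^ L)]"

lemma red_finish_spec:
  assumes h: "heap L s Ts" and i: "var s 6 = i" "ref Ts i t" and d: "dm t \<subseteq> {..<L}" "var s 15 = set_encode (dm t)"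
    and a: "\<And>q. q < queries L \<Longrightarrow> oref Ts (arr s (slot q) i) (answer t q)"
    and t': "ref Ts (var s 20) t'" "red t = (if 2 \<le> card (dm t) then split_red t else t')"
  defines "s' \<equiv> run (red_finish L) s"
  shows "\<exists>Ts'. processed L i Ts s Ts' s' \<and> ref Ts' (arr s' 7 i) (red t) \<and>
    (\<forall>x. x \<noteq> 7 \<longrightarrow> x \<notin> {2, 3, 4, 5} \<longrightarrow> arr s' x = arr s x)"
proof -
  let ?K = "{Min (dm t)}" and ?K' = "dm t - {Min (dm t)}"
  define s1 where "s1 = seta 7 i (var s 20) s"
  have fd: "set_decode (var s1 15) = dm t" unfolding s1_def using d(2) by (simp add: set_encode_inverse)
  have "var s1 15 < 2 ^ L" unfolding s1_def using set_encode_less[OF d(1)] d(2) by simp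
  then obtain w where w: "s' = run (if 2 \<le> card (dm t) then
     seqs [CLd 16 (slot (code False ?K)) 6, CLd 17 (slot (code True ?K')) 6,
       join 16 17 18, CConst 19 0, CIf 19 18 (CSt 7 6 18) (CSt 7 6 6)] else CSkip) (setv 31 w s1)"
    using run_switch[of 15 31 s1 "2 ^ L" "\<lambda>u. if 2 \<le> card (set_decode u) then
     seqs [CLd 16 (slot (code False {Min (set_decode u)})) 6,
       CLd 17 (slot (code True (set_decode u - {Min (set_decode u)}))) 6,
       join 16 17 18, CConst 19 0, CIf 19 18 (CSt 7 6 18) (CSt 7 6 6)] else CSkip"]
    unfolding s'_def red_finish_def fd by (auto simp: s1_def i(1))
  have h1: "heap L s1 Ts" using h by (simp add: s1_def heap_seta)
  have o1: "only_at i s s1" unfolding s1_def by (rule only_at_seta) simp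
  show ?thesis
  proof (cases "2 \<le> card (dm t)")
    case False
    then have s': "s' = setv 31 w s1" using w by simp
    have "processed L i Ts s Ts s'"
      unfolding processed_def s' using h1 o1 by (simp add: heap_setv stable_def s1_def)
    then show ?thesis using False t' by (intro exI[of _ Ts]) (simp add: s' s1_def)
  next
    case True
    have "Min (dm t) \<in> dm t" by (simp add: dm_nonempty)
    then have K: "?K \<subseteq> {..<L}" "?K' \<subseteq> {..<L}" using d(1) by auto
    note c = code_props[OF K(1), of False] and c' = code_props[OF K(2), of True]
    define p where "p = arr s (slot (code False ?K)) i"
    define p' where "p' = arr s (slot (code True ?K')) i"
    have o: "oref Ts p (mx False ?K t)" "oref Ts p' (mx True ?K' t)"
      using a[OF c(1)] a[OF c'(1)] unfolding c(2,3) c'(2,3) p_def p'_def by auto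
    define s2 where "s2 = setv 17 p' (setv 16 p (setv 31 w s1))"
    have h2: "heap L s2 Ts" using h1 by (simp add: s2_def heap_setv)
    have o2: "oref Ts (var s2 16) (mx False ?K t)" "oref Ts (var s2 17) (mx True ?K' t)" using o by (simp_all add: s2_def)
    define s3 where "s3 = run (join 16 17 18) s2"
    obtain Ts' where T: "extends Ts Ts'" "heap L s3 Ts'" "oref Ts' (var s3 18) (jn (mx False ?K t) (mx True ?K' t))"
      using join_spec[OF h2 o2, of 18] unfolding s3_def by auto
    have f: "var s3 x = var s2 x" if "x \<notin> {19, 31, 2, 18}" for x
      unfolding s3_def using that by (intro run_frame) (auto dest!: subsetD[OF join_frame(1)])
    have g: "arr s3 x = arr s1 x" if "x \<notin> {2, 3, 4, 5}" for x
      unfolding s3_def using that run_frame_arr[of x "join 16 17 18" s2] by (auto simp: join_frame s2_def)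
    have f6: "var s3 6 = i" using f[of 6] i(1) by (simp add: s2_def s1_def)
    define r where "r = (if 0 < var s3 18 then var s3 18 else i)"
    have s': "s' = seta 7 i r (setv 19 0 s3)"
      using w True f6 i(1) by (simp add: s3_def[symmetric] s2_def[symmetric] p_def p'_def s1_def r_def)
        (simp add: s3_def s2_def s1_def p_def p'_def)
    have "red t = split_red t" using t'(2) True by simp
    then have "ref Ts' r (red t)"
      unfolding split_red_def r_def using T(3) ref_extends[OF i(2) T(1)] oref_pos[OF T(3)]
      by (auto split: option.splits)
    moreover have "processed L i Ts s Ts' s'"
      unfolding processed_def s'
    proof (intro conjI)
      show "heap L (seta 7 i r (setv 19 0 s3)) Ts'" using T(2) by (simp add: heap_seta heap_setv)
      have "only_at i s1 s3" using g by (rule only_at_arrs)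
      then show "only_at i s (seta 7 i r (setv 19 0 s3))"
        by (intro only_at_seta) (use o1 only_at_trans in auto)
      show "\<forall>x\<in>stable. var (seta 7 i r (setv 19 0 s3)) x = var s x"
        using f by (simp add: stable_def s2_def s1_def)
    qed (rule T(1))
    ultimately show ?thesis using g unfolding s'
      by (intro exI[of _ Ts']) (simp add: s1_def)
  qed
qed

section \<open>Processing one index of the heap\<close>

definition lf_case :: "nat \<Rightarrow> com" where
  "lf_case L = seqs [CConst 15 1, CSt 6 6 15, emit 0 9 9 9 20, CSt 7 6 20,
     unroll (queries L) (\<lambda>q. seqs [CConst 18 0, CSt (slot q) 6 18])]"

definition jn_case :: "nat \<Rightarrow> com" where
  "jn_case L = seqs [CLd 13 6 9, CLd 14 6 10,
     switch 31 13 (\<lambda>u. switch 31 14 (\<lambda>w. CConst 15 (set_encode (set_decode u \<union> set_decode w))) (2 ^ L)) (2 ^ L),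
     CSt 6 6 15, unroll (queries L) (jn_query L), CMov 20 6, red_finish L]"

definition mv_body :: "nat \<Rightarrow> nat \<Rightarrow> nat \<Rightarrow> com" where
  "mv_body L j l = seqs [CLd 13 6 9,
     switch 31 13 (\<lambda>u. CConst 15 (set_encode (if j \<in> set_decode u then insert l (set_decode u - {j}) else set_decode u))) (2 ^ L),
     CSt 6 6 15, unroll (queries L) (mv_query L j l), CLd 12 7 9, emit 2 12 10 11 20, red_finish L]"

definition round_body :: "nat \<Rightarrow> com" where
  "round_body L = seqs [CLd 8 2 6, CLd 9 3 6, CLd 10 4 6, CLd 11 5 6,
     switch 31 8 (\<lambda>k. if k = 0 then lf_case L else if k = 1 then jn_case L
       else switch 31 10 (\<lambda>j. switch 31 11 (mv_body L j) L) L) 3]"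

text \<open>Children precede parents, so one pass over the indices is a bottom-up evaluation. Terms
  appended during the pass are not visited by it. Each visit takes constant time, so the heap grows
  at most by a constant factor.\<close>

definition round :: "nat \<Rightarrow> com" where
  "round L = seqs [CFor 6 2 (round_body L), CLd 27 7 27, CLd 28 7 28]"

definition grown :: "nat \<Rightarrow> nat \<Rightarrow> tm list \<Rightarrow> st \<Rightarrow> tm list \<Rightarrow> st \<Rightarrow> bool" where
  "grown L i Ts s Ts' s' \<longleftrightarrow> extends Ts Ts' \<and> heap L s' Ts' \<and> only_at i s s'"

lemma grown_trans: "grown L i Ts s Ts' s' \<Longrightarrow> grown L i Ts' s' Ts'' s'' \<Longrightarrow> grown L i Ts s Ts'' s''"
  unfolding grown_def using extends_trans only_at_trans by blast

lemma grown_processed: "processed L i Ts s Ts' s' \<Longrightarrow> grown L i Ts s Ts' s'"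
  unfolding grown_def processed_def by blast

lemma lf_case_spec:
  assumes h: "heap L s Ts" and i: "var s 6 = i" and p: "var s 9 = p" and ne: "Ts \<noteq> []"
  shows "\<exists>Ts'. grown L i Ts s Ts' (run (lf_case L) s) \<and> known L Ts' (run (lf_case L) s) i (Lf p)"
proof -
  define s1 where "s1 = seta 6 i 1 (setv 15 1 s)"
  have h1: "heap L s1 Ts" using h by (simp add: s1_def heap_seta heap_setv)
  have "node L Ts (length Ts) 0 (var s1 9) (var s1 9) (var s1 9) (Lf p)" using p by (simp add: node_def s1_def)
  note e = heap_emit[OF h1 this, of 20] ref_emit[OF h1 this, of 20]
  define s2 where "s2 = run (emit 0 9 9 9 20) s1"
  define Ts' where "Ts' = Ts @ [Lf p]"
  have f: "var s2 6 = i" unfolding s2_def using run_frame[of 6 "emit 0 9 9 9 20" s1] i by (simp add: s1_def)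
  have g: "arr s2 x = arr s1 x" if "x \<notin> {2, 3, 4, 5}" for x
    unfolding s2_def using that by (intro run_frame_arr) simp
  define s3 where "s3 = seta 7 i (var s2 20) s2"
  have r: "run (lf_case L) s = run (unroll (queries L) (\<lambda>q. seqs [CConst 18 0, CSt (slot q) 6 18])) s3"
    unfolding lf_case_def s3_def using f i by (simp add: s2_def s1_def)
  have h3: "heap L s3 Ts'" using e(1) by (simp add: s3_def heap_seta Ts'_def s2_def)
  have "\<exists>Ts''. processed L i Ts' s3 Ts'' (run (lf_case L) s) \<and>
      (\<forall>q<queries L. oref Ts'' (arr (run (lf_case L) s) (slot q) i) (answer (Lf p) q)) \<and>
      arr (run (lf_case L) s) 6 = arr s3 6 \<and> arr (run (lf_case L) s) 7 = arr s3 7"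
    unfolding r
  proof (rule queries_spec[OF h3])
    show "var s3 6 = i" using f by (simp add: s3_def)
    fix q sa Tsa assume pr: "processed L i Ts' s3 Tsa sa"
    then have "var sa 6 = i" "heap L sa Tsa" using f by (auto simp: processed_def stable_def s3_def)
    then show "\<exists>Ts2. processed L i Tsa sa Ts2 (run (seqs [CConst 18 0, CSt (slot q) 6 18]) sa) \<and>
      oref Ts2 (arr (run (seqs [CConst 18 0, CSt (slot q) 6 18]) sa) (slot q) i) (answer (Lf p) q) \<and>
      (\<forall>x. x \<noteq> slot q \<longrightarrow> x \<notin> {2, 3, 4, 5} \<longrightarrow> arr (run (seqs [CConst 18 0, CSt (slot q) 6 18]) sa) x = arr sa x)"
      by (intro exI[of _ Tsa]) (auto simp: processed_def heap_seta heap_setv stable_def intro!: only_at_seta)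
  qed
  then obtain Ts'' where T: "processed L i Ts' s3 Ts'' (run (lf_case L) s)"
    "\<forall>q<queries L. oref Ts'' (arr (run (lf_case L) s) (slot q) i) (answer (Lf p) q)"
    "arr (run (lf_case L) s) 6 = arr s3 6" "arr (run (lf_case L) s) 7 = arr s3 7" by blast
  have o: "only_at i s s3"
  proof -
    have "only_at i s s1" unfolding s1_def by (rule only_at_seta) simp
    moreover have "only_at i s1 s2" using g by (rule only_at_arrs)
    ultimately show ?thesis unfolding s3_def by (intro only_at_seta) (rule only_at_trans)
  qed
  have "grown L i Ts s Ts' s3" unfolding grown_def using h3 o by (simp add: Ts'_def)
  then have "grown L i Ts s Ts'' (run (lf_case L) s)" using grown_trans grown_processed[OF T(1)] by blast
  moreover have "ref Ts'' (arr s3 7 i) (Lf p)"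
    using e(2) ne ref_extends[of Ts' _ _ Ts''] T(1) by (simp add: s3_def Ts'_def s2_def processed_def)
  ultimately show ?thesis using T g[of 6]
    unfolding known_def by (intro exI[of _ Ts'']) (simp add: red_simps s3_def s1_def set_encode_def)
qed

lemma jn_case_spec:
  assumes h: "heap L s Ts" and i: "var s 6 = i" "ref Ts i (Jn a b)"
    and k: "known L Ts s (var s 9) a" "known L Ts s (var s 10) b" "var s 9 \<noteq> i" "var s 10 \<noteq> i"
    and d: "dm a \<subseteq> {..<L}" "dm b \<subseteq> {..<L}"
  shows "\<exists>Ts'. grown L i Ts s Ts' (run (jn_case L) s) \<and> known L Ts' (run (jn_case L) s) i (Jn a b)"
proof -
  let ?t = "Jn a b" and ?d = "set_encode (dm (Jn a b))"
  define s1 where "s1 = setv 14 (set_encode (dm b)) (setv 13 (set_encode (dm a)) s)"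
  have "var s1 13 < 2 ^ L" using set_encode_less[OF d(1)] by (simp add: s1_def)
  then obtain w where w: "run (switch 31 13 (\<lambda>u. switch 31 14 (\<lambda>w. CConst 15 (set_encode (set_decode u \<union> set_decode w))) (2 ^ L)) (2 ^ L)) s1 =
      run (switch 31 14 (\<lambda>w. CConst 15 (set_encode (set_decode (var s1 13) \<union> set_decode w))) (2 ^ L)) (setv 31 w s1)"
    using run_switch[of 13 31 s1] by fastforce
  have "var (setv 31 w s1) 14 < 2 ^ L" using set_encode_less[OF d(2)] by (simp add: s1_def)
  then obtain w' where "run (switch 31 14 (\<lambda>w. CConst 15 (set_encode (set_decode (var s1 13) \<union> set_decode w))) (2 ^ L)) (setv 31 w s1) =
      run (CConst 15 (set_encode (set_decode (var s1 13) \<union> set_decode (var (setv 31 w s1) 14)))) (setv 31 w' (setv 31 w s1))"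
    using run_switch[of 14 31 "setv 31 w s1"] by fastforce
  then have s2: "run (switch 31 13 (\<lambda>u. switch 31 14 (\<lambda>w. CConst 15 (set_encode (set_decode u \<union> set_decode w))) (2 ^ L)) (2 ^ L)) s1 =
      setv 15 ?d (setv 31 w' s1)"
    unfolding w by (simp add: s1_def set_encode_inverse)
  define s3 where "s3 = seta 6 i ?d (setv 15 ?d (setv 31 w' s1))"
  have l1: "arr s 6 (var s 9) = set_encode (dm a)" "arr s 6 (var s 10) = set_encode (dm b)"
    using k by (simp_all add: known_def)
  define s4 where "s4 = run (unroll (queries L) (jn_query L)) s3"
  define s5 where "s5 = setv 20 (var s4 6) s4"
  have r: "run (jn_case L) s = run (red_finish L) s5"
    unfolding jn_case_def s5_def s4_def s3_def using l1 s2 i(1) by (simp add: s1_def)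
  have h3: "heap L s3 Ts" using h by (simp add: s3_def s1_def heap_seta heap_setv)
  have o3: "only_at i s s3" unfolding s3_def s1_def by (intro only_at_seta) simp
  have v3: "var s3 6 = i" "var s3 9 = var s 9" "var s3 10 = var s 10" "var s3 13 = set_encode (dm a)"
    "var s3 14 = set_encode (dm b)" "var s3 15 = ?d" using i(1) by (simp_all add: s3_def s1_def)
  have k3: "known L Ts s3 (var s3 9) a" "known L Ts s3 (var s3 10) b"
    unfolding v3 using known_only_at[OF k(1) o3 k(3)] known_only_at[OF k(2) o3 k(4)] .
  have "\<exists>Ts'. processed L i Ts s3 Ts' s4 \<and> (\<forall>q<queries L. oref Ts' (arr s4 (slot q) i) (answer ?t q)) \<and>
    arr s4 6 = arr s3 6 \<and> arr s4 7 = arr s3 7"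
    unfolding s4_def
  proof (rule queries_spec[OF h3 v3(1)])
    fix q sa Tsa assume q: "q < queries L" and pr: "processed L i Ts s3 Tsa sa"
    have va: "\<And>x. x \<in> stable \<Longrightarrow> var sa x = var s3 x" "heap L sa Tsa" using pr by (simp_all add: processed_def)
    have vs: "var sa 6 = i" "var sa 9 = var s3 9" "var sa 10 = var s3 10" "var sa 13 = set_encode (dm a)"
      "var sa 14 = set_encode (dm b)" using va(1) v3 by (auto simp: stable_def)
    have "known L Tsa sa (var sa 9) a" "known L Tsa sa (var sa 10) b"
      unfolding vs using processed_known[OF k3(1) pr] processed_known[OF k3(2) pr] k v3 by auto
    then show "\<exists>Ts2. processed L i Tsa sa Ts2 (run (jn_query L q) sa) \<and>
      oref Ts2 (arr (run (jn_query L q) sa) (slot q) i) (answer ?t q) \<and>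
      (\<forall>x. x \<noteq> slot q \<longrightarrow> x \<notin> {2, 3, 4, 5} \<longrightarrow> arr (run (jn_query L q) sa) x = arr sa x)"
      using jn_query_spec[OF va(2) _ _ d vs(4,5) q vs(1)] k(3,4) vs v3 by simp
  qed
  then obtain Ts' where T: "processed L i Ts s3 Ts' s4" "\<forall>q<queries L. oref Ts' (arr s4 (slot q) i) (answer ?t q)"
    "arr s4 6 = arr s3 6" by blast
  have e: "extends Ts Ts'" "heap L s4 Ts'" and v4: "var s4 6 = i" "var s4 15 = ?d"
    using T(1) v3 by (auto simp: processed_def stable_def)
  have h5: "heap L s5 Ts'" using e(2) by (simp add: s5_def heap_setv)
  have i5: "var s5 6 = i" "ref Ts' i ?t" "dm ?t \<subseteq> {..<L}" "var s5 15 = ?d" "ref Ts' (var s5 20) ?t"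
    using v4 ref_extends[OF i(2) e(1)] d by (auto simp: s5_def)
  have q5: "oref Ts' (arr s5 (slot q) i) (answer ?t q)" if "q < queries L" for q using T(2) that by (simp add: s5_def)
  obtain Ts'' where U: "processed L i Ts' s5 Ts'' (run (red_finish L) s5)"
    "ref Ts'' (arr (run (red_finish L) s5) 7 i) (red ?t)"
    "\<And>x. x \<noteq> 7 \<Longrightarrow> x \<notin> {2, 3, 4, 5} \<Longrightarrow> arr (run (red_finish L) s5) x = arr s5 x"
    using red_finish_spec[OF h5 i5(1-4) q5 i5(5) red_simps(2)] by blast
  have "grown L i Ts s Ts s3" using h3 o3 by (simp add: grown_def)
  moreover have "grown L i Ts s3 Ts' s5" using T(1) h5 by (simp add: grown_def processed_def s5_def)
  ultimately have "grown L i Ts s Ts'' (run (jn_case L) s)"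
    unfolding r using grown_processed[OF U(1)] grown_trans by blast
  moreover have e5: "extends Ts' Ts''" using U(1) by (simp add: processed_def)
  have "oref Ts'' (arr (run (red_finish L) s5) (slot q) i) (answer ?t q)" if "q < queries L" for q
    using oref_extends[OF q5[OF that] e5] U(3)[of "slot q"] by (simp del: mx_simps)
  then have "known L Ts'' (run (jn_case L) s) i ?t"
    unfolding r known_def using U(2) U(3)[of 6] T(3) by (simp add: s5_def s3_def del: mx_simps)
  ultimately show ?thesis by blast
qed

lemma mv_body_spec:
  assumes h: "heap L s Ts" and i: "var s 6 = i" "ref Ts i (Mv j l a)"
    and k: "known L Ts s (var s 9) a" "var s 9 \<noteq> i" and jl: "var s 10 = j" "var s 11 = l" "j < L" "l < L"
    and d: "dm a \<subseteq> {..<L}"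
  shows "\<exists>Ts'. grown L i Ts s Ts' (run (mv_body L j l) s) \<and> known L Ts' (run (mv_body L j l) s) i (Mv j l a)"
proof -
  let ?t = "Mv j l a" and ?d = "set_encode (dm (Mv j l a))"
  define s1 where "s1 = setv 13 (set_encode (dm a)) s"
  let ?c = "\<lambda>u. CConst 15 (set_encode (if j \<in> set_decode u then insert l (set_decode u - {j}) else set_decode u))"
  have "var s1 13 < 2 ^ L" using set_encode_less[OF d] by (simp add: s1_def)
  then obtain w where "run (switch 31 13 ?c (2 ^ L)) s1 = run (?c (var s1 13)) (setv 31 w s1)"
    using run_switch[of 13 31 s1] by fastforce
  then have s2: "run (switch 31 13 ?c (2 ^ L)) s1 = setv 15 ?d (setv 31 w s1)"
    by (simp add: s1_def set_encode_inverse)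
  define s3 where "s3 = seta 6 i ?d (setv 15 ?d (setv 31 w s1))"
  have l1: "arr s 6 (var s 9) = set_encode (dm a)" using k by (simp add: known_def)
  define s4 where "s4 = run (unroll (queries L) (mv_query L j l)) s3"
  define s5 where "s5 = setv 12 (arr s4 7 (var s4 9)) s4"
  define s6 where "s6 = run (emit 2 12 10 11 20) s5"
  have r: "run (mv_body L j l) s = run (red_finish L) s6"
    unfolding mv_body_def s6_def s5_def s4_def s3_def using l1 s2 i(1) by (simp add: s1_def)
  have h3: "heap L s3 Ts" using h by (simp add: s3_def s1_def heap_seta heap_setv)
  have o3: "only_at i s s3" unfolding s3_def s1_def by (intro only_at_seta) simp
  have v3: "var s3 6 = i" "var s3 9 = var s 9" "var s3 10 = j" "var s3 11 = l" "var s3 15 = ?d"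
    using i(1) jl by (simp_all add: s3_def s1_def)
  have k3: "known L Ts s3 (var s3 9) a"
    unfolding v3 using known_only_at[OF k(1) o3 k(2)] .
  have "\<exists>Ts'. processed L i Ts s3 Ts' s4 \<and> (\<forall>q<queries L. oref Ts' (arr s4 (slot q) i) (answer ?t q)) \<and>
    arr s4 6 = arr s3 6 \<and> arr s4 7 = arr s3 7"
    unfolding s4_def
  proof (rule queries_spec[OF h3 v3(1)])
    fix q sa Tsa assume q: "q < queries L" and pr: "processed L i Ts s3 Tsa sa"
    have va: "\<And>x. x \<in> stable \<Longrightarrow> var sa x = var s3 x" "heap L sa Tsa" using pr by (simp_all add: processed_def)
    have vs: "var sa 6 = i" "var sa 9 = var s3 9" "var sa 10 = j" "var sa 11 = l"
      using va(1) v3 by (auto simp: stable_def)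
    have "known L Tsa sa (var sa 9) a"
      unfolding vs using processed_known[OF k3(1) pr] k v3 by auto
    then show "\<exists>Ts2. processed L i Tsa sa Ts2 (run (mv_query L j l q) sa) \<and>
      oref Ts2 (arr (run (mv_query L j l q) sa) (slot q) i) (answer ?t q) \<and>
      (\<forall>x. x \<noteq> slot q \<longrightarrow> x \<notin> {2, 3, 4, 5} \<longrightarrow> arr (run (mv_query L j l q) sa) x = arr sa x)"
      using mv_query_spec[OF va(2) _ vs(3,4) jl(3,4) q vs(1)] k(2) vs v3 by simp
  qed
  then obtain Ts' where T: "processed L i Ts s3 Ts' s4" "\<forall>q<queries L. oref Ts' (arr s4 (slot q) i) (answer ?t q)"
    "arr s4 6 = arr s3 6" by blast
  have e: "extends Ts Ts'" "heap L s4 Ts'"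
    and v4: "var s4 6 = i" "var s4 15 = ?d" "var s4 9 = var s 9" "var s4 10 = j" "var s4 11 = l"
    using T(1) v3 by (auto simp: processed_def stable_def)
  have h5: "heap L s5 Ts'" using e(2) by (simp add: s5_def heap_setv)
  have "known L Ts' s4 (var s4 9) a" using processed_known[OF k3 T(1)] k(2) v3 v4 by simp
  then have r5: "ref Ts' (var s5 12) (red a)" by (simp add: s5_def known_def)
  have v5: "var s5 10 = j" "var s5 11 = l" "var s5 6 = i" "var s5 15 = ?d" using v4 by (simp_all add: s5_def)
  have "node L Ts' (length Ts') 2 (var s5 12) (var s5 10) (var s5 11) (Mv j l (red a))"
    using r5 v5 jl by (simp add: node_def ref_def)
  note em = heap_emit[OF h5 this, of 20] ref_emit[OF h5 this, of 20]
  let ?Ts = "Ts' @ [Mv j l (red a)]"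
  have h6: "heap L s6 ?Ts" and t6: "ref ?Ts (var s6 20) (Mv j l (red a))"
    using em ref_nonempty[OF r5] by (simp_all add: s6_def)
  have g6: "arr s6 x = arr s4 x" if "x \<notin> {2, 3, 4, 5}" for x
    unfolding s6_def using that run_frame_arr[of x "emit 2 12 10 11 20" s5] by (simp add: s5_def)
  have f6: "var s6 x = var s5 x" if "x \<notin> {31, 20, 2}" for x
    unfolding s6_def using that by (intro run_frame) simp
  have i6: "var s6 6 = i" "ref ?Ts i ?t" "dm ?t \<subseteq> {..<L}" "var s6 15 = ?d"
    using f6 v5 ref_append[OF ref_extends[OF i(2) e(1)]] d jl(4) by auto
  have q6: "oref ?Ts (arr s6 (slot q) i) (answer ?t q)" if "q < queries L" for q
    using T(2) that g6[of "slot q"] oref_extends[OF _ extends_append] by simp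
  obtain Ts'' where U: "processed L i ?Ts s6 Ts'' (run (red_finish L) s6)"
    "ref Ts'' (arr (run (red_finish L) s6) 7 i) (red ?t)"
    "\<And>x. x \<noteq> 7 \<Longrightarrow> x \<notin> {2, 3, 4, 5} \<Longrightarrow> arr (run (red_finish L) s6) x = arr s6 x"
    using red_finish_spec[OF h6 i6 q6 t6 red_simps(3)] by blast
  have "grown L i Ts s Ts s3" using h3 o3 by (simp add: grown_def)
  moreover have "grown L i Ts s3 Ts' s4" using T(1) by (rule grown_processed)
  moreover have "grown L i Ts' s4 ?Ts s6" using h6 g6 by (simp add: grown_def only_at_def)
  ultimately have "grown L i Ts s Ts'' (run (mv_body L j l) s)"
    unfolding r using grown_processed[OF U(1)] grown_trans by blast
  moreover have e6: "extends ?Ts Ts''" using U(1) by (simp add: processed_def)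
  have "oref Ts'' (arr (run (red_finish L) s6) (slot q) i) (answer ?t q)" if "q < queries L" for q
    using oref_extends[OF q6[OF that] e6] U(3)[of "slot q"] by (simp del: mx_simps)
  then have "known L Ts'' (run (mv_body L j l) s) i ?t"
    unfolding r known_def using U(2) U(3)[of 6] T(3) g6[of 6] by (simp add: s3_def del: mx_simps)
  ultimately show ?thesis by blast
qed

text \<open>Ensures that codes of sets of labels stay within the range of the tables;
  \<open>0 < L\<close> accounts for label 0 of the leaves.\<close>

lemma heap_dm:
  assumes "heap L s Ts" "0 < L"
  shows "i < length Ts \<Longrightarrow> dm (Ts ! i) \<subseteq> {..<L}"
proof (induction i rule: less_induct)
  case (less i)
  then have "node L Ts i (arr s 2 i) (arr s 3 i) (arr s 4 i) (arr s 5 i) (Ts ! i)"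
    using assms(1) by (simp add: heap_def)
  then show ?case
    using less assms(2) unfolding node_def
    by (cases "Ts ! i") (auto split: if_splits dest: order.strict_trans)
qed

lemma round_step:
  assumes L: "0 < L" and h: "heap L s Ts'" and ext: "extends Ts Ts'" and i: "i < length Ts"
    and k: "\<And>j. j < i \<Longrightarrow> known L Ts' s j (Ts ! j)"
  shows "\<exists>Ts''. grown L i Ts' s Ts'' (run (round_body L) (setv 6 i s)) \<and>
    known L Ts'' (run (round_body L) (setv 6 i s)) i (Ts ! i)"
proof -
  have same: "j < length Ts \<Longrightarrow> Ts' ! j = Ts ! j" "length Ts \<le> length Ts'" for j
    using ext by (auto simp: extends_def nth_append)
  have i': "i < length Ts'" using i same(2) by simp
  then have nd: "node L Ts' i (arr s 2 i) (arr s 3 i) (arr s 4 i) (arr s 5 i) (Ts ! i)"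
    using h same(1)[OF i] unfolding heap_def by metis
  define s1 where "s1 = setv 11 (arr s 5 i) (setv 10 (arr s 4 i) (setv 9 (arr s 3 i) (setv 8 (arr s 2 i) (setv 6 i s))))"
  let ?f = "\<lambda>k. if k = 0 then lf_case L else if k = 1 then jn_case L
       else switch 31 10 (\<lambda>j. switch 31 11 (mv_body L j) L) L"
  have kd: "arr s 2 i < 3" using nd by (auto simp: node_def split: tm.splits)
  have k8: "var s1 8 = arr s 2 i" by (simp add: s1_def)
  have "\<exists>w. run (switch 31 8 ?f 3) s1 = run (?f (var s1 8)) (setv 31 w s1)"
    using kd unfolding k8[symmetric] by (intro run_switch) simp_all
  then obtain w where w: "run (switch 31 8 ?f 3) s1 = run (?f (arr s 2 i)) (setv 31 w s1)"
    unfolding k8 by blast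
  have r: "run (round_body L) (setv 6 i s) = run (?f (arr s 2 i)) (setv 31 w s1)"
    unfolding round_body_def w[symmetric] by (simp add: s1_def)
  let ?s = "setv 31 w s1"
  have hs: "heap L ?s Ts'" using h by (simp add: s1_def heap_setv)
  have v: "var ?s 6 = i" "var ?s 9 = arr s 3 i" "var ?s 10 = arr s 4 i" "var ?s 11 = arr s 5 i"
    by (simp_all add: s1_def)
  have arrs: "arr ?s = arr s" by (simp add: s1_def)
  have o: "only_at i s ?s" by (simp add: s1_def)
  have k': "known L Ts' ?s j (Ts ! j)" if "j < i" for j using k[OF that] unfolding known_def arrs .
  have dm: "dm (Ts ! j) \<subseteq> {..<L}" if "j < length Ts" for j
    using heap_dm[OF h L, of j] same that by simp
  have fin: "\<exists>Ts''. grown L i Ts' ?s Ts'' s' \<and> known L Ts'' s' i (Ts ! i) \<Longrightarrow>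
    \<exists>Ts''. grown L i Ts' s Ts'' s' \<and> known L Ts'' s' i (Ts ! i)" for s'
    using o only_at_trans unfolding grown_def by blast
  show ?thesis
  proof (rule fin, cases "Ts ! i")
    case (Lf p)
    then have "arr s 2 i = 0" "var ?s 9 = p" using nd v(2) by (auto simp: node_def)
    moreover have "Ts' \<noteq> []" using i' by auto
    ultimately show "\<exists>Ts''. grown L i Ts' ?s Ts'' (run (round_body L) (setv 6 i s)) \<and>
        known L Ts'' (run (round_body L) (setv 6 i s)) i (Ts ! i)"
      unfolding r using lf_case_spec[OF hs v(1), of p] Lf by simp
  next
    case (Jn a b)
    then have n: "arr s 2 i = 1" "arr s 3 i < i" "arr s 4 i < i" "Ts' ! arr s 3 i = a" "Ts' ! arr s 4 i = b"
      using nd by (auto simp: node_def)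
    then have ab: "Ts ! arr s 3 i = a" "Ts ! arr s 4 i = b" using same(1) i by auto
    have "ref Ts' i (Jn a b)" using n i' same(1)[OF i] Jn by (simp add: ref_def)
    then show "\<exists>Ts''. grown L i Ts' ?s Ts'' (run (round_body L) (setv 6 i s)) \<and>
        known L Ts'' (run (round_body L) (setv 6 i s)) i (Ts ! i)"
      unfolding r using jn_case_spec[OF hs v(1)] k'[OF n(2)] k'[OF n(3)] ab dm[of "arr s 3 i"] dm[of "arr s 4 i"]
        n i v Jn by simp
  next
    case (Mv j l a)
    then have n: "arr s 2 i = 2" "arr s 3 i < i" "Ts' ! arr s 3 i = a" "arr s 4 i = j" "arr s 5 i = l" "j < L" "l < L"
      using nd by (auto simp: node_def)
    then have ab: "Ts ! arr s 3 i = a" using same(1) i by auto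
    have ri: "ref Ts' i (Mv j l a)" using n i' same(1)[OF i] Mv by (simp add: ref_def)
    obtain w1 where w1: "run (switch 31 10 (\<lambda>j. switch 31 11 (mv_body L j) L) L) ?s =
        run (switch 31 11 (mv_body L j) L) (setv 31 w1 ?s)"
      using run_switch[of 10 31 ?s L "\<lambda>j. switch 31 11 (mv_body L j) L"] v n by auto
    obtain w2 where w2: "run (switch 31 11 (mv_body L j) L) (setv 31 w1 ?s) =
        run (mv_body L j l) (setv 31 w2 (setv 31 w1 ?s))"
      using run_switch[of 11 31 "setv 31 w1 ?s" L "mv_body L j"] v n by auto
    let ?s2 = "setv 31 w2 (setv 31 w1 ?s)"
    have r2: "run (round_body L) (setv 6 i s) = run (mv_body L j l) ?s2"
      unfolding r using n w1 w2 by simp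
    have h2: "heap L ?s2 Ts'" using hs by (simp add: heap_setv)
    have "known L Ts' ?s2 (arr s 3 i) a" using k'[OF n(2)] ab by (simp add: known_def)
    then have "\<exists>Ts''. grown L i Ts' ?s2 Ts'' (run (mv_body L j l) ?s2) \<and> known L Ts'' (run (mv_body L j l) ?s2) i (Mv j l a)"
      using mv_body_spec[OF h2 _ ri] n v dm[of "arr s 3 i"] ab i by simp
    then show "\<exists>Ts''. grown L i Ts' ?s Ts'' (run (round_body L) (setv 6 i s)) \<and>
        known L Ts'' (run (round_body L) (setv 6 i s)) i (Ts ! i)"
      unfolding r2 Mv grown_def by simp
  qed
qed

lemma round_loop_spec:
  assumes L: "0 < L" and h: "heap L s Ts"
  defines "s' \<equiv> run (CFor 6 2 (round_body L)) s"
  shows "\<exists>Ts'. extends Ts Ts' \<and> heap L s' Ts' \<and> (\<forall>i<length Ts. ref Ts' (arr s' 7 i) (red (Ts ! i)))"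
proof -
  let ?I = "\<lambda>e s. \<exists>Ts'. extends Ts Ts' \<and> heap L s Ts' \<and> (\<forall>i<e. known L Ts' s i (Ts ! i))"
  have l: "var s 2 = length Ts" using h by (simp add: heap_def)
  have "?I (length Ts) s'"
    unfolding s'_def run.simps l
  proof (rule loop_induct[where I = ?I])
    show "?I 0 s" using h by (intro exI[of _ Ts]) simp
  next
    fix e s assume e: "e < length Ts" and "?I e s"
    then obtain Ts' where I: "extends Ts Ts'" "heap L s Ts'" "\<And>i. i < e \<Longrightarrow> known L Ts' s i (Ts ! i)" by blast
    obtain Ts'' where g: "grown L e Ts' s Ts'' (run (round_body L) (setv 6 e s))"
      "known L Ts'' (run (round_body L) (setv 6 e s)) e (Ts ! e)" using round_step[OF L I(2,1) e I(3)] by blast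
    have "known L Ts'' (run (round_body L) (setv 6 e s)) i (Ts ! i)" if "i < Suc e" for i
    proof (cases "i = e")
      case False
      then have "known L Ts' s i (Ts ! i)" using that I(3) by simp
      then show ?thesis using g(1) False known_only_at known_extends unfolding grown_def by blast
    qed (use g(2) in simp)
    then show "?I (Suc e) (run (round_body L) (setv 6 e s))"
      using g(1) extends_trans[OF I(1)] unfolding grown_def by blast
  qed
  then show ?thesis unfolding known_def by blast
qed

lemma join_vars: "wvars (join x y r) = {19, 31, 2, r}"
  by (auto simp: join_def)

lemma restrict_child_frame:
  "wvars (restrict_child L q d p r) \<subseteq> {31, r}" "warrs (restrict_child L q d p r) = {}"
  "silent (restrict_child L q d p r)" "flat (restrict_child L q d p r)"
  by (auto simp: restrict_child_def dest!: subsetD[OF switch_simps(1)] split: if_splits)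

lemma jn_query_frame:
  "wvars (jn_query L q) \<subseteq> {2, 16, 17, 18, 19, 31}" "warrs (jn_query L q) = {2, 3, 4, 5, slot q}" "flat (jn_query L q)"
  by (auto simp: jn_query_def join_vars join_frame restrict_child_frame
      dest!: subsetD[OF restrict_child_frame(1)])

lemma mv_query_frame:
  "wvars (mv_query L j l q) \<subseteq> {2, 16, 18, 19, 31}" "warrs (mv_query L j l q) \<subseteq> {2, 3, 4, 5, slot q}" "flat (mv_query L j l q)"
  by (auto simp: mv_query_def)

lemma red_finish_frame:
  "wvars (red_finish L) \<subseteq> {2, 16, 17, 18, 19, 31}" "warrs (red_finish L) \<subseteq> {2, 3, 4, 5, 7}" "flat (red_finish L)"
  by (auto simp: red_finish_def join_vars join_frame dest!: subsetD[OF switch_simps(1)] split: if_splits)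

lemma lf_case_frame:
  "wvars (lf_case L) \<subseteq> {2, 15, 18, 20, 31}" "warrs (lf_case L) \<subseteq> {2, 3, 4, 5, 6, 7} \<union> range slot" "flat (lf_case L)"
  by (auto simp: lf_case_def)

lemma jn_case_frame:
  "wvars (jn_case L) \<subseteq> {2, 13, 14, 15, 16, 17, 18, 19, 20, 31}"
  "warrs (jn_case L) \<subseteq> {2, 3, 4, 5, 6, 7} \<union> range slot" "flat (jn_case L)"
  by (auto simp: jn_case_def jn_query_frame red_finish_frame
      dest!: subsetD[OF switch_simps(1)] subsetD[OF jn_query_frame(1)] subsetD[OF red_finish_frame(1)]
        subsetD[OF red_finish_frame(2)])

lemma mv_body_frame:
  "wvars (mv_body L j l) \<subseteq> {2, 12, 13, 15, 16, 17, 18, 19, 20, 31}"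
  "warrs (mv_body L j l) \<subseteq> {2, 3, 4, 5, 6, 7} \<union> range slot" "flat (mv_body L j l)"
  by (auto simp: mv_body_def mv_query_frame red_finish_frame
      dest!: subsetD[OF switch_simps(1)] subsetD[OF mv_query_frame(1)] subsetD[OF red_finish_frame(1)]
        subsetD[OF red_finish_frame(2)] subsetD[OF mv_query_frame(2)] split: if_splits)

lemma round_body_frame:
  "wvars (round_body L) \<inter> {0, 27, 28} = {}"
  "warrs (round_body L) \<subseteq> {2, 3, 4, 5, 6, 7} \<union> range slot" "flat (round_body L)"
proof -
  show "warrs (round_body L) \<subseteq> {2, 3, 4, 5, 6, 7} \<union> range slot"
  proof -
    let ?S = "{2, 3, 4, 5, 6, 7} \<union> range slot"
    let ?sw = "switch 31 10 (\<lambda>j. switch 31 11 (mv_body L j) L) L"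
    have "warrs ?sw \<subseteq> ?S" unfolding switch_simps by (intro UN_least mv_body_frame(2))
    then have "warrs (if k = 0 then lf_case L else if k = 1 then jn_case L else ?sw) \<subseteq> ?S" for k :: nat
      using lf_case_frame(2)[of L] jn_case_frame(2)[of L]
      by (cases "k = 0"; cases "k = 1") (simp_all only: if_True if_False simp_thms)
    then have "(\<Union>k<3::nat. warrs (if k = 0 then lf_case L else if k = 1 then jn_case L else ?sw)) \<subseteq> ?S"
      by (intro UN_least)
    then show ?thesis by (simp only: round_body_def warrs_seqs switch_simps warrs.simps set_simps
      UN_insert UN_empty Un_empty_left Un_empty_right)
  qed
  show "flat (round_body L)"
    by (simp add: round_body_def lf_case_frame jn_case_frame mv_body_frame)
  show "wvars (round_body L) \<inter> {0, 27, 28} = {}"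
    by (auto simp: round_body_def dest!: subsetD[OF switch_simps(1)] subsetD[OF mv_body_frame(1)]
        subsetD[OF lf_case_frame(1)] subsetD[OF jn_case_frame(1)] split: if_splits)
qed

lemma unnested_round: "unnested (round L)"
  by (simp add: round_def round_body_frame)

lemma round_spec:
  assumes L: "0 < L" and h: "heap L s Ts" and r: "ref Ts (var s 27) X" "ref Ts (var s 28) Y"
  defines "s' \<equiv> run (round L) s"
  shows "\<exists>Ts'. heap L s' Ts' \<and> ref Ts' (var s' 27) (red X) \<and> ref Ts' (var s' 28) (red Y)"
    "var s' 0 = var s 0" "\<And>j. arr s' (24 + 3 * j) = arr s (24 + 3 * j)"
proof -
  define s1 where "s1 = run (CFor 6 2 (round_body L)) s"
  obtain Ts' where T: "extends Ts Ts'" "heap L s1 Ts'" "\<And>i. i < length Ts \<Longrightarrow> ref Ts' (arr s1 7 i) (red (Ts ! i))"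
    using round_loop_spec[OF L h] unfolding s1_def by blast
  have v: "var s1 x = var s x" if "x \<in> {0, 27, 28}" for x
    unfolding s1_def using that round_body_frame(1)[of L] by (intro run_frame) auto
  have s': "s' = setv 28 (arr s1 7 (var s 28)) (setv 27 (arr s1 7 (var s 27)) s1)"
    unfolding s'_def round_def using v[of 27] v[of 28] by (simp add: s1_def)
  have "heap L s' Ts'" using T(2) by (simp add: s' heap_setv)
  moreover have "ref Ts' (var s' 27) (red X)" "ref Ts' (var s' 28) (red Y)"
    using T(3)[of "var s 27"] T(3)[of "var s 28"] r by (simp_all add: s' ref_def)
  ultimately show "\<exists>Ts'. heap L s' Ts' \<and> ref Ts' (var s' 27) (red X) \<and> ref Ts' (var s' 28) (red Y)" by blast
  show "var s' 0 = var s 0" using v[of 0] by (simp add: s')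
  fix j
  have "24 + 3 * j \<notin> range slot"
    by (auto simp: slot_def) presburger
  then have "24 + 3 * j \<notin> warrs (CFor 6 2 (round_body L))" using round_body_frame(2)[of L] by auto
  then show "arr s' (24 + 3 * j) = arr s (24 + 3 * j)"
    unfolding s' s1_def by (simp add: run_frame_arr del: run.simps)
qed

section \<open>Traversing terms\<close>

text \<open>Chains of moves can be long above a single node, while the traversal may spend only a
  constant number of steps per leaf; so the moves are jumped over.\<close>

primrec strip :: "tm \<Rightarrow> tm" where
  "strip (Lf p) = Lf p"
| "strip (Jn a b) = Jn a b"
| "strip (Mv i j a) = strip a"

lemma ord_strip [simp]: "ord (strip t) = ord t"
  by (induction t) auto

lemma strip_cases: obtains p where "strip t = Lf p" | a b where "strip t = Jn a b"
  by (induction t) auto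

definition skip_body :: com where
  "skip_body = seqs [CLd 8 2 6, CConst 9 2, CIf 8 9 (CSt 8 6 6) (seqs [CLd 10 3 6, CLd 11 8 10, CSt 8 6 11])]"

text \<open>Two steps per leaf suffice, since a binary tree has fewer than twice as many nodes as leaves.\<close>

definition dfs_step :: "nat \<Rightarrow> com" where
  "dfs_step l = seqs [CConst 24 0, CIf 24 26 (seqs
     [CDec 26, CLd 8 9 26, CLd 8 8 8, CLd 10 2 8,
      CIf 24 10 (seqs [CLd 11 3 8, CLd 12 4 8, CSt 9 26 12, CInc 26, CSt 9 26 11, CInc 26])
        (seqs [CInc 25, CLd 11 3 8, CSt l 25 11])]) CSkip]"

definition dfs :: "nat \<Rightarrow> nat \<Rightarrow> com" where
  "dfs r l = seqs [CConst 26 0, CConst 25 0, CSt 9 26 r, CInc 26, CFor 6 0 (CSeq (dfs_step l) (dfs_step l))]"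

definition skips :: "tm list \<Rightarrow> st \<Rightarrow> bool" where
  "skips Ts s \<longleftrightarrow> (\<forall>i<length Ts. arr s 8 i < length Ts \<and> Ts ! arr s 8 i = strip (Ts ! i))"

lemma skip_spec:
  assumes h: "heap L s Ts"
  defines "s' \<equiv> run (CFor 6 2 skip_body) s"
  shows "heap L s' Ts" "skips Ts s'"
proof -
  let ?I = "\<lambda>e s. heap L s Ts \<and> (\<forall>i<e. arr s 8 i < length Ts \<and> Ts ! arr s 8 i = strip (Ts ! i))"
  have l: "var s 2 = length Ts" using h by (simp add: heap_def)
  have "?I (length Ts) s'"
    unfolding s'_def run.simps l
  proof (rule loop_induct[where I = ?I])
    show "?I 0 s" using h by simp
  next
    fix e s assume e: "e < length Ts" and I: "?I e s"
    have nd: "node L Ts e (arr s 2 e) (arr s 3 e) (arr s 4 e) (arr s 5 e) (Ts ! e)"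
      using I e by (simp add: heap_def)
    have r: "run skip_body (setv 6 e s) = (if arr s 2 e < 2 then seta 8 e e (setv 9 2 (setv 8 (arr s 2 e) (setv 6 e s)))
      else seta 8 e (arr s 8 (arr s 3 e)) (setv 11 (arr s 8 (arr s 3 e)) (setv 10 (arr s 3 e)
        (setv 9 2 (setv 8 (arr s 2 e) (setv 6 e s))))))"
      by (simp add: skip_body_def)
    have "arr s 8 (arr s 3 e) < length Ts \<and> Ts ! arr s 8 (arr s 3 e) = strip (Ts ! e)" if k2: "\<not> arr s 2 e < 2"
    proof -
      obtain j l a where "Ts ! e = Mv j l a" using nd k2 by (cases "Ts ! e") (auto simp: node_def)
      then have "arr s 3 e < e" "Ts ! arr s 3 e = a" "strip (Ts ! e) = strip a" using nd by (auto simp: node_def)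
      then show ?thesis using I by simp
    qed
    moreover have "strip (Ts ! e) = Ts ! e" if "arr s 2 e < 2"
      using nd that by (auto simp: node_def split: tm.splits)
    ultimately show "?I (Suc e) (run skip_body (setv 6 e s))"
      using I e unfolding r by (auto simp: heap_seta heap_setv less_Suc_eq)
  qed
  then show "heap L s' Ts" "skips Ts s'" unfolding skips_def by blast+
qed

text \<open>The top of the stack is the last element of \<open>us\<close> and is output next. A
  stripped tree with \<open>m\<close> leaves takes \<open>2 * m - 1\<close> steps, and the last
  clause says that what is pending fits into \<open>2 * length xs\<close> steps in all.\<close>

definition dfs_inv :: "nat \<Rightarrow> tm list \<Rightarrow> nat \<Rightarrow> nat list \<Rightarrow> nat \<Rightarrow> st \<Rightarrow> bool" where
  "dfs_inv L Ts l xs k s \<longleftrightarrow> heap L s Ts \<and> skips Ts s \<and>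
     (\<exists>us. length us = var s 26 \<and> (\<forall>j<length us. arr s 9 j < length Ts \<and> Ts ! arr s 9 j = us ! j) \<and>
        map (arr s l) [1..<Suc (var s 25)] @ concat (map ord (rev us)) = xs \<and>
        (us = [] \<or> sum_list (map (\<lambda>t. 2 * length (ord t) - 1) us) + k < 2 * length xs))"

lemma dfs_step_spec:
  assumes inv: "dfs_inv L Ts l xs k s" and l: "l > 9"
  shows "dfs_inv L Ts l xs (Suc k) (run (dfs_step l) s)"
proof -
  obtain us where I: "heap L s Ts" "skips Ts s" "length us = var s 26"
    "\<And>j. j < length us \<Longrightarrow> arr s 9 j < length Ts \<and> Ts ! arr s 9 j = us ! j"
    "map (arr s l) [1..<Suc (var s 25)] @ concat (map ord (rev us)) = xs"
    "us = [] \<or> sum_list (map (\<lambda>t. 2 * length (ord t) - 1) us) + k < 2 * length xs"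
    using inv unfolding dfs_inv_def by blast
  show ?thesis
  proof (cases us rule: rev_cases)
    case Nil
    then have r: "run (dfs_step l) s = setv 24 0 s" using I(3) by (simp add: dfs_step_def)
    show ?thesis unfolding r dfs_inv_def
      using I Nil by (intro conjI exI[of _ "[]"]) (simp_all add: heap_setv skips_def)
  next
    case (snoc vs t)
    let ?m = "length vs"
    let ?x = "arr s 9 ?m"
    let ?y = "arr s 8 ?x"
    have sp: "var s 26 = Suc ?m" using I(3) snoc by simp
    have x: "?x < length Ts" "Ts ! ?x = t" using I(4)[of ?m] snoc by auto
    then have y: "?y < length Ts" "Ts ! ?y = strip t" using I(2) by (auto simp: skips_def)
    then have nd: "node L Ts ?y (arr s 2 ?y) (arr s 3 ?y) (arr s 4 ?y) (arr s 5 ?y) (strip t)"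
      using I(1) unfolding heap_def by metis
    have vs: "arr s 9 j < length Ts" "Ts ! arr s 9 j = vs ! j" if "j < ?m" for j
      using I(4)[of j] that snoc by (auto simp: nth_append)
    define s1 where "s1 = setv 10 (arr s 2 ?y) (setv 8 ?y (setv 26 ?m (setv 24 0 s)))"
    show ?thesis
    proof (cases rule: strip_cases[of t])
      case (1 p)
      then have n: "arr s 2 ?y = 0" "arr s 3 ?y = p" using nd by (auto simp: node_def)
      have r: "run (dfs_step l) s = seta l (Suc (var s 25)) p (setv 11 p (setv 25 (Suc (var s 25)) s1))"
        using sp n by (simp add: dfs_step_def s1_def)
      have o: "ord t = [p]" using 1 by (metis ord.simps(1) ord_strip)
      have "heap L (run (dfs_step l) s) Ts" unfolding r s1_def using I(1) l by (simp add: heap_seta heap_setv)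
      moreover have "skips Ts (run (dfs_step l) s)" unfolding r s1_def using I(2) l by (simp add: skips_def)
      moreover have "map (arr (run (dfs_step l) s) l) [1..<Suc (var (run (dfs_step l) s) 25)] @ concat (map ord (rev vs)) = xs"
      proof -
        have "map ((arr s l)(Suc (var s 25) := p)) [1..<Suc (var s 25)] = map (arr s l) [1..<Suc (var s 25)]"
          by (intro map_cong) auto
        then show ?thesis using I(5) o l unfolding r s1_def snoc by simp
      qed
      ultimately show ?thesis
        unfolding dfs_inv_def using I(6) snoc o vs l
        by (intro conjI exI[of _ vs]) (auto simp: r s1_def)
    next
      case (2 a b)
      then have n: "arr s 2 ?y = 1" "arr s 3 ?y < length Ts" "Ts ! arr s 3 ?y = a" "arr s 4 ?y < length Ts" "Ts ! arr s 4 ?y = b"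
        using nd y(1) by (auto simp: node_def)
      have r: "run (dfs_step l) s = setv 26 (Suc (Suc ?m)) (seta 9 (Suc ?m) (arr s 3 ?y) (setv 26 (Suc ?m)
          (seta 9 ?m (arr s 4 ?y) (setv 12 (arr s 4 ?y) (setv 11 (arr s 3 ?y) s1)))))"
        using sp n by (simp add: dfs_step_def s1_def)
      have o: "ord t = ord a @ ord b" using 2 by (metis ord.simps(2) ord_strip)
      have pos: "length (ord a) > 0" "length (ord b) > 0" using ord_nonempty by auto
      have "heap L (run (dfs_step l) s) Ts" unfolding r s1_def using I(1) by (simp add: heap_seta heap_setv)
      moreover have "skips Ts (run (dfs_step l) s)" unfolding r s1_def using I(2) by (simp add: skips_def)
      moreover have "map (arr (run (dfs_step l) s) l) [1..<Suc (var (run (dfs_step l) s) 25)] @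
          concat (map ord (rev (vs @ [b, a]))) = xs"
        using I(5) o l unfolding r s1_def snoc by simp
      moreover have "arr (run (dfs_step l) s) 9 j < length Ts \<and> Ts ! arr (run (dfs_step l) s) 9 j = (vs @ [b, a]) ! j"
        if jl: "j < length (vs @ [b, a])" for j
      proof -
        consider "j < ?m" | "j = ?m" | "j = Suc ?m" using jl by (auto simp: less_Suc_eq)
        then show ?thesis
        proof cases
          case 1
          then show ?thesis using vs[OF 1] unfolding r s1_def by (simp add: nth_append)
        next
          case 2
          then show ?thesis using n unfolding r s1_def by (simp add: nth_append)
        next
          case 3
          then show ?thesis using n unfolding r s1_def by (simp add: nth_append)
        qed
      qed
      moreover have "sum_list (map (\<lambda>t. 2 * length (ord t) - 1) (vs @ [b, a])) + Suc k < 2 * length xs"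
      proof -
        \<comment> \<open>Replacing a join by its children lowers the pending amount by exactly 1,
          and so does the output of a leaf.\<close>
        have "2 * length (ord t) - 1 = Suc ((2 * length (ord b) - 1) + (2 * length (ord a) - 1))"
          using o pos by (simp, linarith)
        then show ?thesis using I(6) unfolding snoc by simp
      qed
      ultimately show ?thesis
        unfolding dfs_inv_def by (intro conjI exI[of _ "vs @ [b, a]"]) (auto simp: r s1_def)
    qed
  qed
qed

lemma dfs_frame:
  "wvars (dfs r l) = {6, 8, 10, 11, 12, 24, 25, 26}" "warrs (dfs r l) = {9, l}" "unnested (dfs r l)"
  by (auto simp: dfs_def dfs_step_def)

lemma dfs_inv_setv: "dfs_inv L Ts l xs k (setv 6 v s) \<longleftrightarrow> dfs_inv L Ts l xs k s"
  by (simp add: dfs_inv_def heap_setv skips_def)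

lemma dfs_spec:
  assumes h: "heap L s Ts" "skips Ts s" and r: "ref Ts (var s r) t" "r \<notin> {6, 8, 10, 11, 12, 24, 25, 26}"
    and l: "l > 9" and n: "length (ord t) = var s 0"
  defines "s' \<equiv> run (dfs r l) s"
  shows "heap L s' Ts" "skips Ts s'" "map (arr s' l) [1..<Suc (var s 0)] = ord t"
proof -
  let ?n = "var s 0"
  define s0 where "s0 = setv 26 1 (seta 9 0 (var s r) (setv 25 0 (setv 26 0 s)))"
  have s': "s' = loop (\<lambda>e s. run (dfs_step l) (run (dfs_step l) (setv 6 e s))) ?n s0"
    unfolding s'_def dfs_def s0_def using r(2) by simp
  have "dfs_inv L Ts l (ord t) (2 * ?n) s'"
    unfolding s'
  proof (rule loop_induct[where I = "\<lambda>e. dfs_inv L Ts l (ord t) (2 * e)"])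
    have "ord t \<noteq> []" by (rule ord_nonempty)
    then show "dfs_inv L Ts l (ord t) (2 * 0) s0"
      unfolding dfs_inv_def using h r(1) by (intro conjI exI[of _ "[t]"])
        (auto simp: s0_def heap_seta heap_setv skips_def ref_def)
  next
    fix e s assume "dfs_inv L Ts l (ord t) (2 * e) s"
    then show "dfs_inv L Ts l (ord t) (2 * Suc e) (run (dfs_step l) (run (dfs_step l) (setv 6 e s)))"
      using dfs_step_spec[OF dfs_step_spec[OF _ l] l, of L Ts "ord t" "2 * e" "setv 6 e s"]
      by (simp add: dfs_inv_setv)
  qed
  then obtain us where I: "heap L s' Ts" "skips Ts s'"
    "map (arr s' l) [1..<Suc (var s' 25)] @ concat (map ord (rev us)) = ord t"
    "us = [] \<or> sum_list (map (\<lambda>t. 2 * length (ord t) - 1) us) + 2 * ?n < 2 * length (ord t)"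
    unfolding dfs_inv_def by blast
  \<comment> \<open>All \<open>2 * ?n\<close> steps are used up, so only the empty stack satisfies
    the clause.\<close>
  then have "us = []" using n by simp
  then have e: "map (arr s' l) [1..<Suc (var s' 25)] = ord t" using I(3) by simp
  then have "length (map (arr s' l) [1..<Suc (var s' 25)]) = ?n" using n by simp
  then have "var s' 25 = ?n" by (simp del: upt_Suc)
  then show "heap L s' Ts" "skips Ts s'" "map (arr s' l) [1..<Suc (var s 0)] = ord t" using I e by auto
qed

section \<open>The factorisation program\<close>

definition lst :: "nat \<Rightarrow> nat" where "lst j = 24 + 3 * j"

definition pos_table :: "nat \<Rightarrow> nat" where "pos_table j = 25 + 3 * j"

lemma lst_simps [simp]:
  "lst i = lst j \<longleftrightarrow> i = j" "pos_table i = pos_table j \<longleftrightarrow> i = j" "lst i \<noteq> pos_table j" "pos_table j \<noteq> lst i"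
  "lst j > 9" "lst j \<noteq> 8" "lst j \<noteq> 9"
  unfolding lst_def pos_table_def by presburger+

text \<open>The lists are numbered along the whole chain: those obtained from the positions upwards
  from 0, those obtained from the values downwards from \<open>2 * D - 3\<close>.\<close>

definition record_orders :: "nat \<Rightarrow> nat \<Rightarrow> com" where
  "record_orders D j = seqs [CFor 6 2 skip_body, dfs 27 (lst j), dfs 28 (lst (2 * D - 3 - j))]"

definition reductions :: "nat \<Rightarrow> com" where
  "reductions D = unroll (D - 1) (\<lambda>j. CSeq (record_orders D j) (round (2 * D)))"

definition position_body :: "nat \<Rightarrow> com" where
  "position_body j = seqs [CMov 8 6, CInc 8, CLd 9 (lst j) 8, CSt (pos_table j) 9 8]"

definition positions :: "nat \<Rightarrow> com" where
  "positions k = unroll (Suc k) (\<lambda>j. CFor 6 0 (position_body j))"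

text \<open>Output number \<open>t\<close> belongs to the step from list \<open>k - 1 - t\<close> to
  list \<open>k - t\<close>, as a product lists the last step first. Variable 13 runs through the
  output cells consecutively.\<close>

definition output_body :: "nat \<Rightarrow> nat \<Rightarrow> com" where
  "output_body k t = seqs [CMov 8 6, CInc 8, CLd 9 (lst (k - 1 - t)) 8, CLd 10 (pos_table (k - t)) 9, CInc 13, COut 13 10]"

definition output_all :: "nat \<Rightarrow> com" where
  "output_all k = CSeq (CMov 13 0) (unroll k (\<lambda>t. CFor 6 0 (output_body k t)))"

definition finish :: "nat \<Rightarrow> com" where
  "finish D = seqs [CConst 8 0, CLd 27 16 8, CLd 28 20 8, reductions D, positions (2 * D - 3), output_all (2 * D - 3)]"

definition main :: "nat \<Rightarrow> com" where
  "main D = seqs [initialise, phases D, finish D]"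

lemma unnested_unroll: "(\<And>k. k < n \<Longrightarrow> unnested (f k)) \<Longrightarrow> unnested (unroll n f)"
  by (auto simp: unroll_def unnested_seqs)

lemma unnested_finish: "unnested (finish D)"
proof -
  have "unnested (reductions D)"
    unfolding reductions_def
    by (intro unnested_unroll) (simp add: record_orders_def unnested_round dfs_frame skip_body_def)
  moreover have "unnested (positions k)" for k
    unfolding positions_def by (intro unnested_unroll) (simp add: position_body_def)
  moreover have "unnested (unroll k (\<lambda>t. CFor 6 0 (output_body k t)))" for k
    by (intro unnested_unroll) (simp add: output_body_def)
  ultimately show ?thesis by (simp add: finish_def output_all_def)
qed

lemma unnested_initialise: "unnested initialise"
  by (simp add: initialise_def init_body_def)

lemma record_orders_spec:
  assumes h: "heap (2 * D) s Ts" and r: "ref Ts (var s 27) X" "ref Ts (var s 28) Y"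
    and n: "length (ord X) = var s 0" "length (ord Y) = var s 0" and j: "j \<noteq> 2 * D - 3 - j"
  defines "s' \<equiv> run (record_orders D j) s"
  shows "heap (2 * D) s' Ts" "var s' 27 = var s 27" "var s' 28 = var s 28" "var s' 0 = var s 0"
    "map (arr s' (lst j)) [1..<Suc (var s 0)] = ord X"
    "map (arr s' (lst (2 * D - 3 - j))) [1..<Suc (var s 0)] = ord Y"
    "i \<noteq> j \<Longrightarrow> i \<noteq> 2 * D - 3 - j \<Longrightarrow> arr s' (lst i) = arr s (lst i)"
proof -
  let ?l = "2 * D - 3 - j"
  define s1 where "s1 = run (CFor 6 2 skip_body) s"
  define s2 where "s2 = run (dfs 27 (lst j)) s1"
  have s': "s' = run (dfs 28 (lst ?l)) s2" by (simp add: s'_def record_orders_def s2_def s1_def)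
  note s1 = skip_spec[OF h, folded s1_def]
  have v1: "var s1 x = var s x" if "x \<in> {0, 27, 28}" for x
    unfolding s1_def using that by (intro run_frame) (auto simp: skip_body_def)
  have a1: "arr s1 (lst i) = arr s (lst i)" for i
    unfolding s1_def by (rule run_frame_arr) (simp add: skip_body_def)
  have v2: "var s2 x = var s1 x" if "x \<in> {0, 27, 28}" for x
    unfolding s2_def using that by (intro run_frame) (auto simp: dfs_frame)
  have a2: "arr s2 (lst i) = arr s1 (lst i)" if "i \<noteq> j" for i
    unfolding s2_def using that by (intro run_frame_arr) (auto simp: dfs_frame)
  have v3: "var s' x = var s2 x" if "x \<in> {0, 27, 28}" for x
    unfolding s' using that by (intro run_frame) (auto simp: dfs_frame)
  have a3: "arr s' (lst i) = arr s2 (lst i)" if "i \<noteq> ?l" for i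
    unfolding s' using that by (intro run_frame_arr) (auto simp: dfs_frame)
  have r1: "ref Ts (var s1 27) X" "length (ord X) = var s1 0" using r n v1 by simp_all
  note s2 = dfs_spec[OF s1 r1(1) _ lst_simps(5) r1(2), of j, folded s2_def]
  have r2: "ref Ts (var s2 28) Y" "length (ord Y) = var s2 0" using r n v1 v2 by simp_all
  note s3 = dfs_spec[OF s2(1,2) r2(1) _ lst_simps(5) r2(2), of ?l, folded s']
  show "heap (2 * D) s' Ts" using s3 by simp
  show "var s' 27 = var s 27" "var s' 28 = var s 28" "var s' 0 = var s 0" using v1 v2 v3 by simp_all
  show "map (arr s' (lst j)) [1..<Suc (var s 0)] = ord X" using s2(3) a3[OF j] v1 by simp
  show "map (arr s' (lst ?l)) [1..<Suc (var s 0)] = ord Y" using s3(3) v1 v2 by simp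
  show "i \<noteq> j \<Longrightarrow> i \<noteq> ?l \<Longrightarrow> arr s' (lst i) = arr s (lst i)" using a1 a2 a3 by simp
qed

lemma reductions_spec:
  assumes D: "3 \<le> D" and h: "heap (2 * D) s Ts" and r: "ref Ts (var s 27) X" "ref Ts (var s 28) Y"
    and n: "\<And>j. j \<le> D - 2 \<Longrightarrow> length (ord ((red ^^ j) X)) = n" "\<And>j. j \<le> D - 2 \<Longrightarrow> length (ord ((red ^^ j) Y)) = n"
      "var s 0 = n"
  defines "s' \<equiv> run (reductions D) s"
  shows "var s' 0 = n"
    "j \<le> D - 2 \<Longrightarrow> map (arr s' (lst j)) [1..<Suc n] = ord ((red ^^ j) X)"
    "j \<le> D - 2 \<Longrightarrow> map (arr s' (lst (2 * D - 3 - j))) [1..<Suc n] = ord ((red ^^ j) Y)"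
proof -
  let ?I = "\<lambda>e s. (\<exists>Ts. heap (2 * D) s Ts \<and> ref Ts (var s 27) ((red ^^ e) X) \<and> ref Ts (var s 28) ((red ^^ e) Y)) \<and>
    var s 0 = n \<and> (\<forall>j<e. map (arr s (lst j)) [1..<Suc n] = ord ((red ^^ j) X) \<and>
      map (arr s (lst (2 * D - 3 - j))) [1..<Suc n] = ord ((red ^^ j) Y))"
  have "?I (D - 1) s'"
    unfolding s'_def reductions_def
  proof (rule unroll_induct[where I = ?I])
    show "?I 0 s" using h r n(3) by auto
  next
    fix e s assume e: "e < D - 1" and I: "?I e s"
    then obtain Ts where T: "heap (2 * D) s Ts" "ref Ts (var s 27) ((red ^^ e) X)" "ref Ts (var s 28) ((red ^^ e) Y)"
      by blast
    have v0: "var s 0 = n" using I by blast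
    define s1 where "s1 = run (record_orders D e) s"
    define s2 where "s2 = run (round (2 * D)) s1"
    \<comment> \<open>The first family of lists uses the numbers up to \<open>D - 2\<close> and the
      second those from \<open>D - 1\<close> on, so neither overwrites the other.\<close>
    have ne: "e \<noteq> 2 * D - 3 - e" "e \<le> D - 2" using e D by auto
    have ln: "length (ord ((red ^^ e) X)) = var s 0" "length (ord ((red ^^ e) Y)) = var s 0"
      using n(1,2)[OF ne(2)] v0 by auto
    note R = record_orders_spec[OF T ln ne(1), folded s1_def, unfolded v0]
    have T1: "ref Ts (var s1 27) ((red ^^ e) X)" "ref Ts (var s1 28) ((red ^^ e) Y)" using T R(2,3) by simp_all
    have D0: "0 < 2 * D" using D by simp
    note Q = round_spec[OF D0 R(1) T1, folded s2_def, folded lst_def]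
    have "map (arr s2 (lst j)) [1..<Suc n] = ord ((red ^^ j) X) \<and>
      map (arr s2 (lst (2 * D - 3 - j))) [1..<Suc n] = ord ((red ^^ j) Y)" if "j < Suc e" for j
    proof (cases "j = e")
      case True
      then show ?thesis using R(5,6) Q(3) by simp
    next
      case False
      then have "j < e" using that by simp
      moreover have "j \<noteq> 2 * D - 3 - e" "2 * D - 3 - j \<noteq> e" "2 * D - 3 - j \<noteq> 2 * D - 3 - e"
        using calculation e D by auto
      ultimately show ?thesis using I R(7) Q(3) by simp
    qed
    moreover have "run (CSeq (record_orders D e) (round (2 * D))) s = s2" by (simp add: s2_def s1_def)
    moreover have "var s2 0 = n" using Q(2) R(4) by simp
    ultimately show "?I (Suc e) (run (CSeq (record_orders D e) (round (2 * D))) s)" using Q(1) by simp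
  qed
  then show "var s' 0 = n"
    "j \<le> D - 2 \<Longrightarrow> map (arr s' (lst j)) [1..<Suc n] = ord ((red ^^ j) X)"
    "j \<le> D - 2 \<Longrightarrow> map (arr s' (lst (2 * D - 3 - j))) [1..<Suc n] = ord ((red ^^ j) Y)"
    using D by auto
qed

lemma positions_spec:
  fixes s :: st
  assumes n: "var s 0 = n" and L: "\<And>j. j \<le> k \<Longrightarrow> map (arr s (lst j)) [1..<Suc n] = Ls j"
    and d: "\<And>j. j \<le> k \<Longrightarrow> distinct (Ls j)"
  defines "s' \<equiv> run (positions k) s"
  shows "var s' 0 = n" "\<And>j. arr s' (lst j) = arr s (lst j)" "lim s' = lim s"
    "\<And>j p. j \<le> k \<Longrightarrow> p \<in> set (Ls j) \<Longrightarrow> arr s' (pos_table j) p = position (Ls j) p"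
proof -
  let ?I = "\<lambda>e (s' :: st). var s' 0 = n \<and> (\<forall>j. arr s' (lst j) = arr s (lst j)) \<and>
    (\<forall>j<e. \<forall>p\<in>set (Ls j). arr s' (pos_table j) p = position (Ls j) p)"
  have "?I (Suc k) s'"
    unfolding s'_def positions_def
  proof (rule unroll_induct[where I = ?I])
    show "?I 0 s" using n by simp
  next
    fix j s1 assume j: "j < Suc k" and I: "?I j s1"
    have Lj: "length (Ls j) = n" "\<And>i. i < n \<Longrightarrow> Ls j ! i = arr s (lst j) (Suc i)"
      using L[of j] j by (auto simp del: upt_Suc simp flip: L)
    let ?J = "\<lambda>e (s2 :: st). var s2 0 = n \<and> (\<forall>i. arr s2 (lst i) = arr s (lst i)) \<and>
      (\<forall>i. i \<noteq> j \<longrightarrow> arr s2 (pos_table i) = arr s1 (pos_table i)) \<and>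
      (\<forall>i<e. arr s2 (pos_table j) (Ls j ! i) = Suc i)"
    have "?J n (run (CFor 6 0 (position_body j)) s1)"
      unfolding run.simps conjunct1[OF I]
    proof (rule loop_induct[where I = ?J])
      show "?J 0 s1" using I by simp
    next
      fix e s2 assume e: "e < n" and J: "?J e s2"
      have r: "run (position_body j) (setv 6 e s2) = seta (pos_table j) (Ls j ! e) (Suc e)
          (setv 9 (Ls j ! e) (setv 8 (Suc e) (setv 6 e s2)))"
        unfolding position_body_def using J Lj(2)[OF e] by simp
      have "Ls j ! i \<noteq> Ls j ! e" if "i < e" for i
        using d[of j] j that e Lj(1) by (simp add: nth_eq_iff_index_eq)
      then show "?J (Suc e) (run (position_body j) (setv 6 e s2))"
        unfolding r using J by (auto simp: less_Suc_eq)
    qed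
    moreover have "arr (run (CFor 6 0 (position_body j)) s1) (pos_table j) p = position (Ls j) p"
      if p: "p \<in> set (Ls j)" and q: "\<And>i. i < n \<Longrightarrow> arr (run (CFor 6 0 (position_body j)) s1) (pos_table j) (Ls j ! i) = Suc i" for p
    proof -
      obtain i where "i < n" "p = Ls j ! i" using p Lj(1) by (metis in_set_conv_nth)
      then show ?thesis using q position_nth[of "Ls j" i] d[of j] j Lj(1) by simp
    qed
    ultimately show "?I (Suc j) (run (CFor 6 0 (position_body j)) s1)"
      using I by (simp add: less_Suc_eq del: run.simps)
  qed
  then show "var s' 0 = n" "\<And>j. arr s' (lst j) = arr s (lst j)"
    "\<And>j p. j \<le> k \<Longrightarrow> p \<in> set (Ls j) \<Longrightarrow> arr s' (pos_table j) p = position (Ls j) p" by simp_all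
  show "lim s' = lim s" by (simp add: s'_def)
qed

lemma output_spec:
  fixes s :: st
  assumes n: "var s 0 = n" and lim: "lim s = Suc k * n + 1"
    and L: "\<And>j. j \<le> k \<Longrightarrow> map (arr s (lst j)) [1..<Suc n] = Ls j"
    and P: "\<And>j p. j \<le> k \<Longrightarrow> p \<in> {1..n} \<Longrightarrow> arr s (pos_table j) p = position (Ls j) p"
    and S: "\<And>j. j \<le> k \<Longrightarrow> set (Ls j) = {1..n}"
  defines "s' \<equiv> run (output_all k) s"
  shows "var s' 0 = n"
    "\<And>t i. t < k \<Longrightarrow> i \<in> {1..n} \<Longrightarrow> io s' (n + t * n + i) = perm_between (Ls (k - 1 - t)) (Ls (k - t)) i"
proof -
  let ?v = "\<lambda>t. perm_between (Ls (k - 1 - t)) (Ls (k - t))"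
  \<comment> \<open>The cells written so far are those up to \<open>(t, e)\<close> in lexicographic
    order, expressed by comparing \<open>t' * n + i\<close> with \<open>t * n + e\<close>.\<close>
  let ?I = "\<lambda>t e (s' :: st). var s' 0 = n \<and> lim s' = lim s \<and> arr s' = arr s \<and> var s' 13 = n + t * n + e \<and>
    (\<forall>t'<k. \<forall>i\<in>{1..n}. t' * n + i \<le> t * n + e \<longrightarrow> io s' (n + t' * n + i) = ?v t' i)"
  have "?I k 0 (run (unroll k (\<lambda>t. CFor 6 0 (output_body k t))) (setv 13 n s))"
  proof (rule unroll_induct[where I = "\<lambda>t. ?I t 0"])
    show "?I 0 0 (setv 13 n s)" using n by simp
  next
    fix t s1 assume t: "t < k" and I: "?I t 0 s1"
    have "?I t n (run (CFor 6 0 (output_body k t)) s1)"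
      unfolding run.simps conjunct1[OF I]
    proof (rule loop_induct[where I = "?I t"])
      show "?I t 0 s1" using I by simp
    next
      fix e s2 assume e: "e < n" and J: "?I t e s2"
      have Lt: "arr s (lst (k - 1 - t)) (Suc e) = Ls (k - 1 - t) ! e" "length (Ls (k - 1 - t)) = n"
        using L[of "k - 1 - t"] e by (auto simp del: upt_Suc simp flip: L)
      have "Ls (k - 1 - t) ! e \<in> {1..n}" using S[of "k - 1 - t"] Lt(2) e nth_mem by (metis diff_le_self diff_diff_left)
      then have v: "arr s (pos_table (k - t)) (Ls (k - 1 - t) ! e) = ?v t (Suc e)"
        using P[of "k - t"] Lt(2) e by (simp add: perm_between_def)
      have "Suc t * n \<le> k * n" using t by (intro mult_le_mono1) simp
      then have b: "n + t * n + Suc e < lim s2" using J lim e by simp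
      have r: "run (output_body k t) (setv 6 e s2) = outv (n + t * n + Suc e) (?v t (Suc e))
          (setv 13 (n + t * n + Suc e) (setv 10 (?v t (Suc e)) (setv 9 (Ls (k - 1 - t) ! e) (setv 8 (Suc e) (setv 6 e s2)))))"
        unfolding output_body_def using J Lt(1) v by simp
      have io: "io (run (output_body k t) (setv 6 e s2)) = (io s2)(n + t * n + Suc e := ?v t (Suc e))"
        unfolding r using b by (simp add: outv_def)
      have "io (run (output_body k t) (setv 6 e s2)) (n + t' * n + i) = ?v t' i"
        if ti: "t' < k" "i \<in> {1..n}" "t' * n + i \<le> t * n + Suc e" for t' i
      proof (cases "t' * n + i = t * n + Suc e")
        case True
        then have "t' * n + (i - 1) = t * n + e" "i - 1 < n" using ti(2) by auto
        then have "t' = t" "i - 1 = e" using addr_inj[of t' n "i - 1" t e] e by auto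
        then show ?thesis unfolding io using ti(2) by auto
      next
        case False
        then have "t' * n + i \<le> t * n + e" "n + t' * n + i \<noteq> n + t * n + Suc e" using ti(3) by auto
        then show ?thesis unfolding io using J ti(1,2) by simp
      qed
      then show "?I t (Suc e) (run (output_body k t) (setv 6 e s2))"
        using J unfolding r by (simp add: outv_def del: atLeastAtMost_iff split: if_splits) 
    qed
    then show "?I (Suc t) 0 (run (CFor 6 0 (output_body k t)) s1)" by (simp add: add.commute add.left_commute del: run.simps)
  qed
  moreover have "s' = run (unroll k (\<lambda>t. CFor 6 0 (output_body k t))) (setv 13 n s)"
    unfolding s'_def output_all_def using n by simp
  ultimately have F: "?I k 0 s'" by simp
  then show "var s' 0 = n" by blast
  fix t i assume ti: "t < k" "i \<in> {1..n}"
  have "Suc t * n \<le> k * n" using ti(1) by (intro mult_le_mono1) simp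
  then have "t * n + i \<le> k * n + 0" using ti(2) by simp
  then show "io s' (n + t * n + i) = perm_between (Ls (k - 1 - t)) (Ls (k - t)) i" using F ti by blast
qed

text \<open>One column and one row leave a single cell, hence a single label on either side, and the
  cell carries the same tree in both terms.\<close>

lemma level_inv_final:
  assumes inv: "level_inv D n \<sigma> s" and v: "var s 3 = 1" "var s 4 = 1" and n: "n \<ge> 1"
  shows "\<exists>Ts X Y. heap (2 * D) s Ts \<and> ref Ts (arr s 16 0) X \<and> ref Ts (arr s 20 0) Y \<and>
    wft X \<and> cx D X \<and> dm X = {0} \<and> wft Y \<and> cx D Y \<and> dm Y = {0} \<and> ps X 0 = ps Y 0 \<and>
    ord X = [1..<Suc n] \<and> ord Y = map (inv \<sigma>) [1..<Suc n]"
proof -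
  from inv obtain Ts X Y \<gamma> \<rho> where I0: "heap (2 * D) s Ts \<and>
     matrix (var s 3) (var s 4) (var s 5) (arr s 10) (arr s 11) (arr s 12) (arr s 13) (arr s 15) (arr s 19) X Y \<and>
     side D (var s 3) (arr s 15) X \<and> side D (var s 4) (arr s 19) Y \<and>
     (\<forall>g<var s 3. ref Ts (arr s 16 g) (X g)) \<and> (\<forall>h<var s 4. ref Ts (arr s 20 h) (Y h)) \<and>
     covering n \<sigma> (var s 3) (var s 4) \<gamma> \<rho> ((\<lambda>i. (arr s 10 i, arr s 11 i)) ` {..<var s 5}) \<and>
     concat (map (\<lambda>g. ord (X g)) [0..<var s 3]) = [1..<Suc n] \<and>
     concat (map (\<lambda>g. ord (Y g)) [0..<var s 4]) = map (inv \<sigma>) [1..<Suc n]"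
    unfolding level_inv_def by (elim exE)
  have upt_one: "[0..<Suc 0] = [0]" by simp
  from I0 have I: "heap (2 * D) s Ts"
     "matrix 1 1 (var s 5) (arr s 10) (arr s 11) (arr s 12) (arr s 13) (arr s 15) (arr s 19) X Y"
     "side D 1 (arr s 15) X" "side D 1 (arr s 19) Y" "ref Ts (arr s 16 0) (X 0)" "ref Ts (arr s 20 0) (Y 0)"
     "covering n \<sigma> 1 1 \<gamma> \<rho> ((\<lambda>i. (arr s 10 i, arr s 11 i)) ` {..<var s 5})"
     "ord (X 0) = [1..<Suc n]" "ord (Y 0) = map (inv \<sigma>) [1..<Suc n]"
    unfolding v One_nat_def upt_one by (simp_all del: upt_Suc)
  note m = matrixD[OF I(2)]
  have "(\<lambda>x. (\<gamma> x, \<rho> (\<sigma> x))) ` {1..n} \<noteq> {}" using n by simp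
  then have N0: "0 < var s 5" using I(7) unfolding covering_def by fastforce
  have z: "arr s 10 i = 0 \<and> arr s 11 i = 0" if "i < var s 5" for i using m(1,2)[OF that] by simp
  have N: "i = 0" if "i < var s 5" for i
    using inj_onD[OF m(6), of i 0] z[OF that] z[OF N0] that N0 by simp
  have c: "arr s 12 0 < arr s 15 0" "arr s 13 0 < arr s 19 0" using m(3,4)[OF N0] z[OF N0] by simp_all
  have "k = 0" if "k < arr s 15 0" for k using m(10)[of 0 k] m(10)[of 0 0] that N by auto
  then have c1: "arr s 15 0 = 1" using c(1) by (metis One_nat_def less_Suc0 linorder_neqE_nat not_less0 zero_less_one)
  have "k = 0" if "k < arr s 19 0" for k using m(11)[of 0 k] m(11)[of 0 0] that N by auto
  then have c2: "arr s 19 0 = 1" using c(2) by (metis One_nat_def less_Suc0 linorder_neqE_nat not_less0 zero_less_one)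
  have d: "dm (X 0) = {0}" "dm (Y 0) = {0}" "wft (X 0)" "cx D (X 0)" "wft (Y 0)" "cx D (Y 0)"
    using I(3,4) c1 c2 unfolding side_def by (auto simp: lessThan_Suc)
  have "ps (X 0) 0 = ps (Y 0) 0" using m(5)[OF N0] z[OF N0] c c1 c2 by simp
  then show ?thesis using I d by blast
qed

text \<open>Up to \<open>D - 2\<close> the steps are reductions of \<open>X\<close>; the middle step
  compares two embeddings of one tree; the remaining steps are reductions of \<open>Y\<close> read
  backwards, \<open>sep\<close> being symmetric.\<close>

lemma order_chain:
  assumes X: "wft X" "cx D X" "dm X = {0}" and Y: "wft Y" "cx D Y" "dm Y = {0}" and e: "ps X 0 = ps Y 0"
    and D: "3 \<le> D"
  defines "Ls \<equiv> \<lambda>j. if j \<le> D - 2 then ord ((red ^^ j) X) else ord ((red ^^ (2 * D - 3 - j)) Y)"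
  shows "\<And>j. j < 2 * D - 3 \<Longrightarrow> sep (Ls j) (Ls (Suc j))"
proof -
  fix j assume j: "j < 2 * D - 3"
  consider "j < D - 2" | "j = D - 2" | "D - 2 < j" by linarith
  then show "sep (Ls j) (Ls (Suc j))"
  proof cases
    case 1
    then show ?thesis using sep_red_iterate[OF X 1] by (simp add: Ls_def)
  next
    case 2
    then have "2 * D - 3 - Suc j = D - 2" using D by simp
    then show ?thesis using 2 sep_red_final[OF X Y e] D by (simp add: Ls_def)
  next
    case 3
    have "2 * D - 3 - j = Suc (2 * D - 3 - Suc j)" using j by simp
    moreover have "2 * D - 3 - Suc j < D - 2" using 3 D by simp
    ultimately show ?thesis using 3 sep_sym[OF sep_red_iterate[OF Y, of "2 * D - 3 - Suc j"]] by (simp add: Ls_def)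
  qed
qed

lemma red_iterate_length:
  assumes X: "wft X" "cx D X" "dm X = {0}" and j: "j \<le> D - 2"
  shows "length (ord ((red ^^ j) X)) = length (ord X)"
  using j
proof (induction j)
  case (Suc j)
  then show ?case using sep_length[OF sep_red_iterate[OF X, of j]] by simp
qed simp

lemma finish_spec:
  assumes inv: "level_inv D n \<sigma> s" and v: "var s 3 = 1" "var s 4 = 1" "var s 0 = n" and n: "n \<ge> 1"
    and perm: "\<sigma> permutes {1..n}" and D: "3 \<le> D" and lim: "lim s = Suc (2 * D - 3) * n + 1"
  defines "s' \<equiv> run (finish D) s"
  shows "\<exists>\<tau>s. length \<tau>s = 2 * D - 3 \<and> separable_factorisation n \<sigma> \<tau>s \<and> var s' 0 = n \<and>
    (\<forall>j<length \<tau>s. \<forall>i\<in>{1..n}. io s' (n + j * n + i) = (\<tau>s ! j) i)"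
proof -
  let ?k = "2 * D - 3"
  obtain Ts X Y where I: "heap (2 * D) s Ts" "ref Ts (arr s 16 0) X" "ref Ts (arr s 20 0) Y"
    and X: "wft X" "cx D X" "dm X = {0}" and Y: "wft Y" "cx D Y" "dm Y = {0}" and e: "ps X 0 = ps Y 0"
    and o: "ord X = [1..<Suc n]" "ord Y = map (inv \<sigma>) [1..<Suc n]"
    using level_inv_final[OF inv v(1,2) n] by blast
  define Ls where "Ls = (\<lambda>j. if j \<le> D - 2 then ord ((red ^^ j) X) else ord ((red ^^ (?k - j)) Y))"
  have chain: "sep (Ls j) (Ls (Suc j))" if "j < ?k" for j
    using order_chain[OF X Y e D that] unfolding Ls_def .
  have L0: "Ls 0 = [1..<Suc n]" using o by (simp add: Ls_def)
  have Lk: "Ls ?k = map (inv \<sigma>) [1..<Suc n]" using o D by (auto simp: Ls_def simp del: upt_Suc)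
  have Lj: "set (Ls j) = {1..n} \<and> distinct (Ls j)" if "j \<le> ?k" for j
    using that
  proof (induction j)
    case 0
    then show ?case unfolding L0 by (auto simp del: upt_Suc)
  next
    case (Suc j)
    then show ?case using sep_set[OF chain[of j]] sep_distinct[OF chain[of j]] by simp
  qed
  define \<tau>s where "\<tau>s = rev (map (\<lambda>j. perm_between (Ls j) (Ls (Suc j))) [0..<?k])"
  have fac: "separable_factorisation n \<sigma> \<tau>s"
    unfolding \<tau>s_def using separable_factorisation_chain[OF perm n _ L0 Lk chain] D by simp
  define s1 where "s1 = setv 28 (arr s 20 0) (setv 27 (arr s 16 0) (setv 8 0 s))"
  define s2 where "s2 = run (reductions D) s1"
  define s3 where "s3 = run (positions ?k) s2"
  have s': "s' = run (output_all ?k) s3"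
    unfolding s'_def finish_def s3_def s2_def s1_def by simp
  have h1: "heap (2 * D) s1 Ts" "ref Ts (var s1 27) X" "ref Ts (var s1 28) Y" "var s1 0 = n" "lim s1 = lim s"
    using I v by (simp_all add: s1_def heap_setv)
  have ln: "length (ord ((red ^^ j) X)) = n" "length (ord ((red ^^ j) Y)) = n" if "j \<le> D - 2" for j
    using red_iterate_length[OF X that] red_iterate_length[OF Y that] o by (simp_all del: upt_Suc)
  note R = reductions_spec[OF D h1(1-3) ln h1(4), folded s2_def]
  have L2: "map (arr s2 (lst j)) [1..<Suc n] = Ls j" if "j \<le> ?k" for j
  proof (cases "j \<le> D - 2")
    case True
    then show ?thesis using R(2) by (simp add: Ls_def)
  next
    case False
    then have "?k - j \<le> D - 2" "?k - (?k - j) = j" using that D by auto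
    then show ?thesis using R(3)[of "?k - j"] False by (simp add: Ls_def)
  qed
  note Q = positions_spec[where k = ?k and Ls = Ls, OF R(1) L2 conjunct2[OF Lj], folded s3_def]
  have l3: "lim s3 = Suc ?k * n + 1" using lim h1(5) by (simp add: s3_def s2_def)
  have L3: "map (arr s3 (lst j)) [1..<Suc n] = Ls j" if "j \<le> ?k" for j using L2[OF that] Q(2) by simp
  have P3: "arr s3 (pos_table j) p = position (Ls j) p" if "j \<le> ?k" "p \<in> {1..n}" for j p
    using Q(4)[of j p] Lj[OF that(1)] that by simp
  note O = output_spec[OF Q(1) l3 L3 P3 conjunct1[OF Lj], folded s']
  have "\<tau>s ! j = perm_between (Ls (?k - 1 - j)) (Ls (?k - j))" if "j < ?k" for j
  proof -
    have S: "Suc (?k - 1 - j) = ?k - j" using that by simp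
    have "rev (map f [0..<k]) ! j = f (k - 1 - j)" if "j < k" for f :: "nat \<Rightarrow> nat \<Rightarrow> nat" and k
      using that by (simp add: rev_nth)
    from this[OF that] show ?thesis unfolding \<tau>s_def S[symmetric] by (rule trans) (rule refl)
  qed
  then have "\<forall>j<length \<tau>s. \<forall>i\<in>{1..n}. io s' (n + j * n + i) = (\<tau>s ! j) i"
    using O(2) by (simp add: \<tau>s_def)
  then show ?thesis using fac O(1) by (intro exI[of _ \<tau>s]) (simp add: \<tau>s_def)
qed

theorem mainTheorem2:
  fixes p :: nat and \<pi> :: "nat \<Rightarrow> nat"
  assumes "\<pi> permutes {1..p}"
  shows "\<exists>k :: nat. \<exists>P :: instr list. \<exists>c d :: nat.
    \<forall>n\<ge>1. \<forall>\<sigma>. \<sigma> permutes {1..n} \<longrightarrow> avoids n \<sigma> p \<pi> \<longrightarrow>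
      (\<exists>s \<tau>s. runs_to P (input_config n \<sigma>) (c * n) (c * n ^ d) s \<and>
        outputs s n \<tau>s \<and> length \<tau>s \<le> k \<and> separable_factorisation n \<sigma> \<tau>s)"
proof -
  obtain C0 where C0: "\<And>m S. S \<subseteq> {..<m} \<times> {..<m} \<Longrightarrow> \<not> contains_pattern p \<pi> S \<Longrightarrow> card S \<le> C0 * m"
    using marcus_tardos[OF assms] by blast
  \<comment> \<open>The successor makes \<open>C\<close> positive, so \<open>D \<ge> 4\<close>, and
    the chain has the length at least 3 that the numbering of its lists presupposes.\<close>
  define C where "C = Suc C0"
  have MT: "card S \<le> C * m" if "S \<subseteq> {..<m} \<times> {..<m}" "\<not> contains_pattern p \<pi> S" for m S
    using C0[OF that] by (simp add: C_def)
  define D where "D = 4 * C"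
  have D: "3 \<le> D" "1 \<le> D" by (simp_all add: D_def C_def)
  define k where "k = 2 * D - 3"
  obtain K0 where K0: "consts_le K0 (main D)" using consts_le_exists by blast
  define K where "K = Suc K0"
  have K: "consts_le K (main D)" "K > 0" using K0 consts_le_mono by (auto simp: K_def)
  obtain A where A: "\<And>s. cost (level D) s \<le> A * (var s 3 + var s 4 + var s 5 + 1)" using level_cost by blast
  obtain A1 where A1: "\<And>M s. bnd M s \<Longrightarrow> consts_le M initialise \<Longrightarrow> cost initialise s \<le> A1 * (M + 1)"
    using unnested_cost[OF unnested_initialise] by blast
  obtain A2 where A2: "\<And>M s. bnd M s \<Longrightarrow> consts_le M (finish D) \<Longrightarrow> cost (finish D) s \<le> A2 * (M + 1)"
    using unnested_cost[OF unnested_finish] by blast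
  define B where "B = 8 + 4 * A * (C + 3)"
  define B1 where "B1 = A1 * (K + 2)"
  define B2 where "B2 = A2 * (K + 2 + B1 + B)"
  have main: "cost (main D) (init_st k n \<sigma>) \<le> (B1 + B + B2) * n \<and> var (run (main D) (init_st k n \<sigma>)) 0 = n \<and>
      (\<exists>\<tau>s. length \<tau>s = k \<and> separable_factorisation n \<sigma> \<tau>s \<and>
        (\<forall>j<k. \<forall>i\<in>{1..n}. io (run (main D) (init_st k n \<sigma>)) (n + j * n + i) = (\<tau>s ! j) i))"
    if n: "n \<ge> 1" and perm: "\<sigma> permutes {1..n}" and av: "avoids n \<sigma> p \<pi>" for n \<sigma>
  proof -
    let ?s0 = "init_st k n \<sigma>"
    define s1 where "s1 = run initialise ?s0"
    define s2 where "s2 = run (phases D) s1"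
    note i1 = initialise_spec[OF n perm D(2), of k, folded s1_def]
    note i2 = phases_spec[OF n perm assms av MT, folded D_def, OF _ _ i1 A, folded s2_def B_def]
    have fin: "run (main D) ?s0 = run (finish D) s2" unfolding main_def s2_def s1_def by simp
    have "lim s2 = Suc (2 * D - 3) * n + 1" unfolding s2_def s1_def by (simp add: init_st_def k_def)
    note f = finish_spec[OF i2(1-4) n perm D(1) this, folded fin]
    have "\<sigma> i \<le> n" if "i \<in> {1..n}" for i using perm that by (metis atLeastAtMost_iff permutes_in_image)
    then have b0: "bnd (n + K) ?s0" by (auto simp: bnd_def init_st_def intro: trans_le_add1)
    have cs: "consts_le (n + K) initialise" "consts_le (n + K) (phases D)" "consts_le (n + K) (finish D)"
      using consts_le_mono[OF K(1), of "n + K"] by (simp_all add: main_def)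
    \<comment> \<open>For \<open>n \<ge> 1\<close> additive constants are absorbed into multiples of
      \<open>n\<close>.\<close>
    have "K * 1 \<le> K * n" using n by (intro mult_le_mono2)
    then have Kn: "Suc K \<le> n + K * n" using n by linarith
    have "cost initialise ?s0 \<le> A1 * (n + K + 1)" using A1[OF b0 cs(1)] .
    also have "\<dots> \<le> A1 * ((K + 2) * n)" using n Kn by (intro mult_le_mono2) (simp add: algebra_simps)
    finally have c1: "cost initialise ?s0 \<le> B1 * n" by (simp add: B1_def algebra_simps)
    have c2: "cost (phases D) s1 \<le> B * n" using i2(5) .
    have b1: "bnd (n + K + cost initialise ?s0) s1" unfolding s1_def using bnd_run[OF b0 cs(1)] .
    then have "bnd (n + K + cost initialise ?s0 + cost (phases D) s1) s2"
      unfolding s2_def using cs(2) consts_le_mono by (intro bnd_run) auto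
    then have b2: "bnd (n + K + B1 * n + B * n) s2" using c1 c2 by (elim bnd_mono) simp
    have "cost (finish D) s2 \<le> A2 * (n + K + B1 * n + B * n + 1)"
      using cs(3) consts_le_mono by (intro A2[OF b2]) auto
    also have "\<dots> \<le> A2 * ((K + 2 + B1 + B) * n)" using n Kn by (intro mult_le_mono2) (simp add: algebra_simps)
    finally have c3: "cost (finish D) s2 \<le> B2 * n" by (simp add: B2_def algebra_simps)
    have "cost (main D) ?s0 = cost initialise ?s0 + (cost (phases D) s1 + cost (finish D) s2)"
      unfolding main_def s2_def s1_def by simp
    also have "\<dots> \<le> (B1 + B + B2) * n" using c1 c2 c3 by (simp add: algebra_simps)
    finally show ?thesis using f by (auto simp: k_def)
  qed
  obtain C' where C': "\<And>n \<sigma>. n \<ge> 1 \<Longrightarrow> \<sigma> permutes {1..n} \<Longrightarrow> cost (main D) (init_st k n \<sigma>) \<le> (B1 + B + B2) * n \<Longrightarrow>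
    var (run (main D) (init_st k n \<sigma>)) 0 = n \<Longrightarrow>
    \<exists>z. runs_to (program k K (main D)) (input_config n \<sigma>) (C' * n) (C' * n) z \<and> reg z 0 = k \<and> reg z 1 = n \<and>
      (\<forall>i \<le> Suc k * n. mem z i = io (run (main D) (init_st k n \<sigma>)) i)"
    using program_runs[OF K] by blast
  \<comment> \<open>The word bound obtained is linear as well, so the exponent 1 serves.\<close>
  have "\<exists>s \<tau>s. runs_to (program k K (main D)) (input_config n \<sigma>) (C' * n) (C' * n ^ 1) s \<and>
        outputs s n \<tau>s \<and> length \<tau>s \<le> k \<and> separable_factorisation n \<sigma> \<tau>s"
    if n: "n \<ge> 1" and perm: "\<sigma> permutes {1..n}" and av: "avoids n \<sigma> p \<pi>" for n \<sigma>
  proof -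
    note m = main[OF n perm av]
    obtain \<tau>s where t: "length \<tau>s = k" "separable_factorisation n \<sigma> \<tau>s"
      "\<And>j i. j < k \<Longrightarrow> i \<in> {1..n} \<Longrightarrow> io (run (main D) (init_st k n \<sigma>)) (n + j * n + i) = (\<tau>s ! j) i"
      using m by blast
    obtain z where z: "runs_to (program k K (main D)) (input_config n \<sigma>) (C' * n) (C' * n) z" "reg z 0 = k" "reg z 1 = n"
      "\<And>i. i \<le> Suc k * n \<Longrightarrow> mem z i = io (run (main D) (init_st k n \<sigma>)) i"
      using C'[OF n perm] m by blast
    have "mem z (n + j * n + i) = (\<tau>s ! j) i" if ji: "j < k" "i \<in> {1..n}" for j i
    proof -
      have "Suc j * n \<le> k * n" using ji(1) by (intro mult_le_mono1) simp
      then have "n + j * n + i \<le> Suc k * n" using ji(2) by simp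
      then show ?thesis using z(4) t(3)[OF ji] by simp
    qed
    then have "outputs z n \<tau>s" using z(2,3) t(1) by (simp add: outputs_def)
    then show ?thesis using z(1) t by (intro exI[of _ z] exI[of _ \<tau>s]) simp
  qed
  then show ?thesis by blast
qed

end
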